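(* Let $X$ be a 4-manifold with a pseudocomplex structure $E\subset\widetilde{\mathrm{Gr}}_2(TX)$, and let $Y$ be a smooth 4-parameter family (a 4-manifold) of $E$ curves in $X$. Let $Z$ be the 6-manifold of pairs $(x,C)$ with $C\in Y$ and $x\in C$, with the maps $\lambda:Z\to X$, $\lambda(x,C)=x$, and $\rho:Z\to Y$, $\rho(x,C)=C$. Suppose that the map $\tau: Z\to E$, $\tau(x,C)=T_xC$, is a local diffeomorphism. Let $\Theta$ be the 4-plane field on $Z$ given by $\Theta_z=\lambda'(z)^{-1}(\tau(z))$. Then the map $$Z\to \widetilde{\mathrm{Gr}}_2(TY),\qquad z\mapsto \rho'(z)\Theta_z\subset T_{\rho(z)}Y$$ (with the orientation described in the context) is, locally on $Z$, a pseudocomplex structure on $Y$ (that is, every point of $Z$ has a neighborhood mapped diffeomorphically onto a pseudocomplex structure on an open subset of $Y$). Moreover the $E$ curves for $Z\to Y$ are the same, as surfaces in $Z$, as the $E$ curves for $Z\to X$.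
   Context: $\widetilde{\mathrm{Gr}}_2(V)$ is the Grassmannian of oriented real 2-planes in a 4-dimensional real vector space $V$, with $T_P\widetilde{\mathrm{Gr}}_2(V)=\mathrm{Lin}(P,V/P)$. An immersed surface in $\widetilde{\mathrm{Gr}}_2(V)$ is an elliptic line congruence if each of its tangent planes, as a 2-plane in $\mathrm{Lin}(P,V/P)$, contains no linear map of rank 1 (equivalently the conformal quadratic form $\det$ is definite on it). A pseudocomplex structure on a 4-manifold $M$ is a six-dimensional submanifold $E\subset\widetilde{\mathrm{Gr}}_2(TM)$ which is a fiber subbundle over $M$ (locally: submersing to an open subset of $M$), each of whose fibers $E_m\subset\widetilde{\mathrm{Gr}}_2(T_mM)$ is an elliptic line congruence. An $E$ curve in $M$ is an oriented surface in $M$ all of whose tangent planes belong to $E$. If $p:E\to M$ is the projection, then $E$ carries the 4-plane field $\Theta_e=p'(e)^{-1}(e)$ and the 2-plane field $V_e=\ker p'(e)\subset\Theta_e$. The prolongation of an $E$ curve is the surface in $E$ consisting of its tangent planes. The $E$ curves of a pseudocomplex structure, viewed as surfaces in the total space $E$, are the surfaces tangent to $\Theta$ (those transverse to the fibers of $E\to M$ being locally the prolongations of $E$ curves in $M$). The same is applied to $Z\to X$ (via the local diffeomorphism $\tau$) and to $Z\to Y$. Orientation of the dual planes: $\Theta_z=\ker\lambda'(z)\oplus\ker\rho'(z)$, so $\rho'(z)\Theta_z\cong\ker\lambda'(z)$. At $z$ with $P=\tau(z)$ and $x=\lambda(z)$, $\tau$ identifies $\ker\lambda'(z)$ with $T_PE_x\subset\mathrm{Lin}(P,T_xX/P)$.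 There are unique complex structures on $P$ (compatible with its orientation) and on $T_xX/P$ for which $T_PE_x$ is the set of complex linear maps $P\to T_xX/P$; this makes $T_PE_x$ a complex line, and $\rho'(z)\Theta_z$ is given the resulting orientation. *)

theory Defs
  imports "HOL-Analysis.Analysis" "HOL-Library.Function_Algebras"
begin

section \<open>Functions as a real vector space\<close>

instantiation "fun" :: (type, real_vector) real_vector
begin

definition scaleR_fun_def: "r *\<^sub>R f = (\<lambda>x. r *\<^sub>R f x)"

instance
  by standard (auto simp: scaleR_fun_def fun_eq_iff scaleR_add_right scaleR_add_left)

end

section \<open>Smooth manifolds\<close>

primrec Ck_on :: "nat \<Rightarrow> 'a::euclidean_space set \<Rightarrow> ('a \<Rightarrow> 'b::real_normed_vector) \<Rightarrow> bool" where
  "Ck_on 0 S f \<longleftrightarrow> continuous_on S f"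
| "Ck_on (Suc k) S f \<longleftrightarrow> (\<forall>x\<in>S. f differentiable (at x)) \<and>
     (\<forall>v. Ck_on k S (\<lambda>x. frechet_derivative f (at x) v))"

text \<open>Used for open sets only.\<close>
definition smooth_on :: "'a::euclidean_space set \<Rightarrow> ('a \<Rightarrow> 'b::real_normed_vector) \<Rightarrow> bool" where
  "smooth_on S f \<longleftrightarrow> (\<forall>k. Ck_on k S f)"

type_synonym ('p, 'v) chart = "'p set \<times> ('p \<Rightarrow> 'v)"

text \<open>A manifold is given by its maximal atlas, so that a smooth structure is a single object and
  equality of manifolds is the right one. For the same reason chart maps are required to be
  \<^const>\<open>undefined\<close> outside their domain.\<close>
type_synonym ('p, 'v) manifold = "('p, 'v) chart set"

definition carrier_of :: "('p, 'v) manifold \<Rightarrow> 'p set" where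
  "carrier_of M = \<Union> (fst ` M)"

definition chart_inv :: "('p, 'v) chart \<Rightarrow> 'v \<Rightarrow> 'p" where
  "chart_inv c = inv_into (fst c) (snd c)"

definition valid_chart :: "('p, 'v::euclidean_space) chart \<Rightarrow> bool" where
  "valid_chart c \<longleftrightarrow> snd c \<in> extensional (fst c) \<and> inj_on (snd c) (fst c) \<and> open (snd c ` fst c)"

definition compatible :: "('p, 'v::euclidean_space) chart \<Rightarrow> ('p, 'v) chart \<Rightarrow> bool" where
  "compatible c d \<longleftrightarrow>
     open (snd c ` (fst c \<inter> fst d)) \<and> open (snd d ` (fst c \<inter> fst d)) \<and>
     smooth_on (snd c ` (fst c \<inter> fst d)) (snd d \<circ> chart_inv c) \<and>
     smooth_on (snd d ` (fst c \<inter> fst d)) (snd c \<circ> chart_inv d)"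

definition atlas :: "('p, 'v::euclidean_space) chart set \<Rightarrow> bool" where
  "atlas A \<longleftrightarrow> (\<forall>c\<in>A. valid_chart c) \<and> (\<forall>c\<in>A. \<forall>d\<in>A. compatible c d)"

definition max_atlas :: "('p, 'v::euclidean_space) chart set \<Rightarrow> ('p, 'v) manifold" where
  "max_atlas A = {c. valid_chart c \<and> fst c \<subseteq> \<Union> (fst ` A) \<and> (\<forall>d\<in>A. compatible c d)}"

definition mtop :: "('p, 'v::euclidean_space) manifold \<Rightarrow> 'p topology" where
  "mtop M = topology_generated_by {fst c \<inter> snd c -` B | c B. c \<in> M \<and> open B}"

definition smooth_manifold :: "('p, 'v::euclidean_space) manifold \<Rightarrow> bool" where
  "smooth_manifold M \<longleftrightarrow> atlas M \<and> max_atlas M \<subseteq> M \<and>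
     Hausdorff_space (mtop M) \<and> second_countable (mtop M)"

definition open_sub :: "('p, 'v) manifold \<Rightarrow> 'p set \<Rightarrow> ('p, 'v) manifold" where
  "open_sub M W = {c \<in> M. fst c \<subseteq> W}"

definition prod_manifold ::
  "('p, 'v::euclidean_space) manifold \<Rightarrow> ('q, 'w::euclidean_space) manifold
     \<Rightarrow> ('p \<times> 'q, 'v \<times> 'w) manifold" where
  "prod_manifold M N = max_atlas
     {(fst c \<times> fst d, restrict (map_prod (snd c) (snd d)) (fst c \<times> fst d)) | c d. c \<in> M \<and> d \<in> N}"

definition smooth_map ::
  "('p, 'v::euclidean_space) manifold \<Rightarrow> ('q, 'w::euclidean_space) manifold
     \<Rightarrow> ('p \<Rightarrow> 'q) \<Rightarrow> bool" where
  "smooth_map M N f \<longleftrightarrow> f ` carrier_of M \<subseteq> carrier_of N \<and>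
     (\<forall>p\<in>carrier_of M. \<exists>c\<in>M. \<exists>d\<in>N. p \<in> fst c \<and> f ` fst c \<subseteq> fst d \<and>
        smooth_on (snd c ` fst c) (snd d \<circ> f \<circ> chart_inv c))"

definition diffeo ::
  "('p, 'v::euclidean_space) manifold \<Rightarrow> ('q, 'w::euclidean_space) manifold
     \<Rightarrow> ('p \<Rightarrow> 'q) \<Rightarrow> bool" where
  "diffeo M N f \<longleftrightarrow> bij_betw f (carrier_of M) (carrier_of N) \<and> smooth_map M N f \<and>
     smooth_map N M (inv_into (carrier_of M) f)"

definition local_diffeo ::
  "('p, 'v::euclidean_space) manifold \<Rightarrow> ('q, 'w::euclidean_space) manifold
     \<Rightarrow> ('p \<Rightarrow> 'q) \<Rightarrow> bool" where
  "local_diffeo M N f \<longleftrightarrow> (\<forall>p\<in>carrier_of M. \<exists>W. openin (mtop M) W \<and> p \<in> W \<and>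
     openin (mtop N) (f ` W) \<and> diffeo (open_sub M W) (open_sub N (f ` W)) f)"

section \<open>Tangent vectors\<close>

text \<open>A tangent vector at \<open>p\<close> assigns to every chart around \<open>p\<close> a coordinate vector, subject to the
  usual transformation law.\<close>
type_synonym ('p, 'v) tvec = "('p, 'v) chart \<Rightarrow> 'v"

definition charts_at :: "('p, 'v) manifold \<Rightarrow> 'p \<Rightarrow> ('p, 'v) chart set" where
  "charts_at M p = {c \<in> M. p \<in> fst c}"

definition tangent_space :: "('p, 'v::euclidean_space) manifold \<Rightarrow> 'p \<Rightarrow> ('p, 'v) tvec set" where
  "tangent_space M p = {v. (\<forall>c. c \<notin> charts_at M p \<longrightarrow> v c = 0) \<and>
     (\<forall>c\<in>charts_at M p. \<forall>d\<in>charts_at M p.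
        v d = frechet_derivative (snd d \<circ> chart_inv c) (at (snd c p)) (v c))}"

text \<open>The tangent vector at \<open>p\<close> with coordinates \<open>w\<close> in the chart \<open>c\<close>.\<close>
definition coord_vec ::
  "('p, 'v::euclidean_space) manifold \<Rightarrow> ('p, 'v) chart \<Rightarrow> 'p \<Rightarrow> 'v \<Rightarrow> ('p, 'v) tvec" where
  "coord_vec M c p w = (\<lambda>d. if d \<in> charts_at M p
     then frechet_derivative (snd d \<circ> chart_inv c) (at (snd c p)) w else 0)"

text \<open>The differential of \<open>f : M \<rightarrow> N\<close> at \<open>p\<close>; for \<open>v\<close> in the tangent space at \<open>p\<close> it does not depend on
  the chart \<open>c\<close> chosen.\<close>
definition tmap ::
  "('p, 'v::euclidean_space) manifold \<Rightarrow> ('q, 'w::euclidean_space) manifold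
     \<Rightarrow> ('p \<Rightarrow> 'q) \<Rightarrow> 'p \<Rightarrow> ('p, 'v) tvec \<Rightarrow> ('q, 'w) tvec" where
  "tmap M N f p v = (let c = (SOME c. c \<in> charts_at M p) in
     (\<lambda>d. if d \<in> charts_at N (f p)
        then frechet_derivative (snd d \<circ> f \<circ> chart_inv c) (at (snd c p)) (v c) else 0))"

definition ker_tmap ::
  "('p, 'v::euclidean_space) manifold \<Rightarrow> ('q, 'w::euclidean_space) manifold
     \<Rightarrow> ('p \<Rightarrow> 'q) \<Rightarrow> 'p \<Rightarrow> ('p, 'v) tvec set" where
  "ker_tmap M N f p = {v \<in> tangent_space M p. tmap M N f p v = 0}"

definition immersion ::
  "('p, 'v::euclidean_space) manifold \<Rightarrow> ('q, 'w::euclidean_space) manifold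
     \<Rightarrow> ('p \<Rightarrow> 'q) \<Rightarrow> bool" where
  "immersion M N f \<longleftrightarrow> smooth_map M N f \<and>
     (\<forall>p\<in>carrier_of M. inj_on (tmap M N f p) (tangent_space M p))"

definition submersion ::
  "('p, 'v::euclidean_space) manifold \<Rightarrow> ('q, 'w::euclidean_space) manifold
     \<Rightarrow> ('p \<Rightarrow> 'q) \<Rightarrow> bool" where
  "submersion M N f \<longleftrightarrow> smooth_map M N f \<and>
     (\<forall>p\<in>carrier_of M. tmap M N f p ` tangent_space M p = tangent_space N (f p))"

section \<open>Submanifolds and surfaces\<close>

definition slice_chart ::
  "('p, 'v::euclidean_space) manifold \<Rightarrow> 'p set \<Rightarrow> ('p, 'v) chart \<Rightarrow> 'v set \<Rightarrow> bool" where
  "slice_chart N S c W \<longleftrightarrow> c \<in> N \<and> subspace W \<and> snd c ` (fst c \<inter> S) = snd c ` fst c \<inter> W"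

text \<open>Embedded submanifolds, as subsets.\<close>
definition submanifold ::
  "nat \<Rightarrow> ('p, 'v::euclidean_space) manifold \<Rightarrow> 'p set \<Rightarrow> bool" where
  "submanifold k N S \<longleftrightarrow> S \<subseteq> carrier_of N \<and>
     (\<forall>p\<in>S. \<exists>c W. p \<in> fst c \<and> slice_chart N S c W \<and> dim W = k)"

text \<open>The induced smooth structure; the type \<open>'w\<close> has to have the dimension of the submanifold.\<close>
definition sub_structure ::
  "('p, 'v::euclidean_space) manifold \<Rightarrow> 'p set \<Rightarrow> ('p, 'w::euclidean_space) manifold" where
  "sub_structure N S = max_atlas
     {(fst c \<inter> S, restrict (L \<circ> snd c) (fst c \<inter> S)) | c W L.
        slice_chart N S c W \<and> linear L \<and> bij_betw L W UNIV}"

text \<open>A surface in \<open>N\<close> is a subset with its own structure of a 2-manifold which makes the inclusion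
  an immersion. This includes embedded surfaces.\<close>
definition surface_in ::
  "('p, real^2) manifold \<Rightarrow> ('p, 'v::euclidean_space) manifold \<Rightarrow> bool" where
  "surface_in S N \<longleftrightarrow> smooth_manifold S \<and> immersion S N id"

section \<open>Oriented planes\<close>

text \<open>An oriented plane is represented by the set of its positively oriented bases.\<close>
type_synonym 'a oplane = "('a \<times> 'a) set"

definition oplane :: "'a::real_vector \<Rightarrow> 'a \<Rightarrow> 'a oplane" where
  "oplane u v = {(a *\<^sub>R u + b *\<^sub>R v, c *\<^sub>R u + d *\<^sub>R v) | a b c d. a * d - b * c > 0}"

definition plane :: "'a::real_vector oplane \<Rightarrow> 'a set" where
  "plane P = span (fst ` P)"

definition oplanes :: "'a::real_vector set \<Rightarrow> 'a oplane set" where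
  "oplanes V = {oplane u v | u v. u \<in> V \<and> v \<in> V \<and> u \<noteq> v \<and> independent {u, v}}"

definition frame :: "'a::real_vector set \<Rightarrow> (4 \<Rightarrow> 'a) \<Rightarrow> bool" where
  "frame V b \<longleftrightarrow> inj b \<and> independent (range b) \<and> span (range b) = V"

text \<open>The graph of the linear map with matrix \<open>A\<close> from the span of \<open>b 1, b 2\<close> to that of
  \<open>b 3, b 4\<close>.\<close>
definition graph_plane :: "(4 \<Rightarrow> 'a::real_vector) \<Rightarrow> real^2^2 \<Rightarrow> 'a oplane" where
  "graph_plane b A = oplane (b 1 + (A$1$1) *\<^sub>R b 3 + (A$1$2) *\<^sub>R b 4)
                            (b 2 + (A$2$1) *\<^sub>R b 3 + (A$2$2) *\<^sub>R b 4)"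

definition graph_chart :: "(4 \<Rightarrow> 'a::real_vector) \<Rightarrow> ('a oplane, real^2^2) chart" where
  "graph_chart b = (range (graph_plane b), restrict (inv (graph_plane b)) (range (graph_plane b)))"

text \<open>The oriented Grassmannian of a 4-dimensional subspace \<open>V\<close>; its carrier is \<open>oplanes V\<close>.\<close>
definition Gr2 :: "'a::real_vector set \<Rightarrow> ('a oplane, real^2^2) manifold" where
  "Gr2 V = max_atlas {graph_chart b | b. frame V b}"

definition graph_param ::
  "('p, real^4) manifold \<Rightarrow> ('p, real^4) chart \<Rightarrow> (4 \<Rightarrow> real^4) \<Rightarrow> (real^4) \<times> (real^2^2)
     \<Rightarrow> 'p \<times> ('p, real^4) tvec oplane" where
  "graph_param M c b = (\<lambda>(y, A). let m = chart_inv c y in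
     (m, graph_plane (\<lambda>i. coord_vec M c m (b i)) A))"

definition graph_bundle_chart ::
  "('p, real^4) manifold \<Rightarrow> ('p, real^4) chart \<Rightarrow> (4 \<Rightarrow> real^4)
     \<Rightarrow> ('p \<times> ('p, real^4) tvec oplane, (real^4) \<times> (real^2^2)) chart" where
  "graph_bundle_chart M c b = (let D = (snd c ` fst c) \<times> UNIV; U = graph_param M c b ` D in
     (U, restrict (inv_into D (graph_param M c b)) U))"

text \<open>The bundle of oriented 2-planes of the tangent spaces of a 4-manifold; its carrier is the set
  of pairs \<open>(m, P)\<close> with \<open>P \<in> oplanes (tangent_space M m)\<close>.\<close>
definition Gr2T ::
  "('p, real^4) manifold \<Rightarrow> ('p \<times> ('p, real^4) tvec oplane, (real^4) \<times> (real^2^2)) manifold" where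
  "Gr2T M = max_atlas {graph_bundle_chart M c b | c b. c \<in> M \<and> frame UNIV b}"

section \<open>The tangent spaces of the Grassmannian\<close>

text \<open>\<open>V/P\<close> consists of cosets. An element of \<open>Lin(P, V/P)\<close> is a coset valued function on \<open>P\<close>,
  extended by the empty set (which is not a coset) outside \<open>P\<close>.\<close>

definition qcoset :: "'a::real_vector oplane \<Rightarrow> 'a \<Rightarrow> 'a set" where
  "qcoset P w = (\<lambda>p. w + p) ` plane P"

definition Lin_quot :: "'a::real_vector set \<Rightarrow> 'a oplane \<Rightarrow> ('a \<Rightarrow> 'a set) set" where
  "Lin_quot V P = {A. (\<forall>p. p \<notin> plane P \<longrightarrow> A p = {}) \<and>
     (\<exists>L. linear L \<and> L ` plane P \<subseteq> V \<and> (\<forall>p\<in>plane P. A p = qcoset P (L p)))}"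

text \<open>The union of the image of \<open>A\<close> is the preimage in \<open>V\<close> of the image of \<open>A\<close> in \<open>V/P\<close>.\<close>
definition quot_rank :: "'a::real_vector oplane \<Rightarrow> ('a \<Rightarrow> 'a set) \<Rightarrow> nat" where
  "quot_rank P A = dim (\<Union>p\<in>plane P. A p) - dim (plane P)"

text \<open>The identification of the tangent space of the Grassmannian at \<open>P\<close> with \<open>Lin(P, V/P)\<close>: if
  \<open>b 1, b 2\<close> is a basis of \<open>P\<close>, then near \<open>P\<close> planes are spanned by vectors
  \<open>b i + A$i$1 b 3 + A$i$2 b 4\<close>, and a tangent vector maps \<open>b i\<close> to the derivative of this vector
  modulo \<open>P\<close>. The coset does not depend on \<open>b\<close>.\<close>
definition Gr2_hom ::
  "'a::real_vector set \<Rightarrow> 'a oplane \<Rightarrow> ('a oplane, real^2^2) tvec \<Rightarrow> 'a \<Rightarrow> 'a set" where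
  "Gr2_hom V P \<xi> p = {w. \<exists>b s t q. frame V b \<and> graph_plane b 0 = P \<and> q \<in> plane P \<and>
     p = s *\<^sub>R b 1 + t *\<^sub>R b 2 \<and>
     w = s *\<^sub>R ((\<xi> (graph_chart b)$1$1) *\<^sub>R b 3 + (\<xi> (graph_chart b)$1$2) *\<^sub>R b 4)
       + t *\<^sub>R ((\<xi> (graph_chart b)$2$1) *\<^sub>R b 3 + (\<xi> (graph_chart b)$2$2) *\<^sub>R b 4) + q}"

definition surface_hom ::
  "'a::real_vector set \<Rightarrow> ('a oplane, real^2) manifold \<Rightarrow> 'a oplane
     \<Rightarrow> ('a oplane, real^2) tvec \<Rightarrow> 'a \<Rightarrow> 'a set" where
  "surface_hom V S P \<zeta> = Gr2_hom V P (tmap S (Gr2 V) id P \<zeta>)"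

definition elliptic_line_congruence ::
  "'a::real_vector set \<Rightarrow> ('a oplane, real^2) manifold \<Rightarrow> bool" where
  "elliptic_line_congruence V S \<longleftrightarrow> surface_in S (Gr2 V) \<and>
     (\<forall>P\<in>carrier_of S. \<forall>A\<in>surface_hom V S P ` tangent_space S P. quot_rank P A \<noteq> 1)"

section \<open>Pseudocomplex structures\<close>

definition fibre_set :: "('p \<times> 'b) set \<Rightarrow> 'p \<Rightarrow> 'b set" where
  "fibre_set E m = {P. (m, P) \<in> E}"

definition fibre ::
  "('p, real^4) manifold \<Rightarrow> ('p \<times> ('p, real^4) tvec oplane) set \<Rightarrow> 'p
     \<Rightarrow> (('p, real^4) tvec oplane, real^2) manifold" where
  "fibre M E m = sub_structure (Gr2 (tangent_space M m)) (fibre_set E m)"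

definition total_space ::
  "('p, real^4) manifold \<Rightarrow> ('p \<times> ('p, real^4) tvec oplane) set
     \<Rightarrow> ('p \<times> ('p, real^4) tvec oplane, real^6) manifold" where
  "total_space M E = sub_structure (Gr2T M) E"

definition trivialized_over ::
  "('e, 'v::euclidean_space) manifold \<Rightarrow> ('m, 'w::euclidean_space) manifold \<Rightarrow> ('e \<Rightarrow> 'm)
     \<Rightarrow> 'm set \<Rightarrow> ('f, 'u::euclidean_space) manifold \<Rightarrow> bool" where
  "trivialized_over E M p W F \<longleftrightarrow> (\<exists>\<Psi>.
     diffeo (open_sub E {e \<in> carrier_of E. p e \<in> W}) (prod_manifold (open_sub M W) F) \<Psi> \<and>
     (\<forall>e\<in>carrier_of E. p e \<in> W \<longrightarrow> fst (\<Psi> e) = p e))"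

text \<open>\<open>E\<close> is a pseudocomplex structure on the open subset \<open>U\<close> of the 4-manifold \<open>M\<close>.\<close>
definition pseudocomplex ::
  "('p, real^4) manifold \<Rightarrow> 'p set \<Rightarrow> ('p \<times> ('p, real^4) tvec oplane) set \<Rightarrow> bool" where
  "pseudocomplex M U E \<longleftrightarrow> smooth_manifold M \<and> openin (mtop M) U \<and>
     submanifold 6 (Gr2T M) E \<and> fst ` E = U \<and>
     (\<forall>m\<in>U. \<exists>W. openin (mtop M) W \<and> m \<in> W \<and> W \<subseteq> U \<and>
        (\<exists>F :: (('p, real^4) tvec oplane, real^2) manifold.
           smooth_manifold F \<and> trivialized_over (total_space M E) M fst W F)) \<and>
     (\<forall>m\<in>U. submanifold 2 (Gr2 (tangent_space M m)) (fibre_set E m) \<and>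
        elliptic_line_congruence (tangent_space M m) (fibre M E m))"

section \<open>\<open>E\<close> curves\<close>

text \<open>An oriented surface: a 2-manifold with a choice of orientation of each tangent space, which
  is locally the one given by some chart.\<close>
type_synonym 'p osurface = "('p, real^2) manifold \<times> ('p \<Rightarrow> ('p, real^2) tvec oplane)"

definition orientation ::
  "('p, real^2) manifold \<Rightarrow> ('p \<Rightarrow> ('p, real^2) tvec oplane) \<Rightarrow> bool" where
  "orientation S ori \<longleftrightarrow> ori \<in> extensional (carrier_of S) \<and>
     (\<forall>p\<in>carrier_of S. ori p \<in> oplanes (tangent_space S p)) \<and>
     (\<forall>p\<in>carrier_of S. \<exists>c\<in>charts_at S p. \<forall>q\<in>fst c.
        (coord_vec S c q (axis 1 1), coord_vec S c q (axis 2 1)) \<in> ori q)"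

definition points :: "'p osurface \<Rightarrow> 'p set" where
  "points C = carrier_of (fst C)"

definition tangent_oplane ::
  "('p, 'v::euclidean_space) manifold \<Rightarrow> 'p osurface \<Rightarrow> 'p \<Rightarrow> ('p, 'v) tvec oplane" where
  "tangent_oplane M C x =
     map_prod (tmap (fst C) M id x) (tmap (fst C) M id x) ` (snd C x)"

definition E_curve ::
  "('p, real^4) manifold \<Rightarrow> ('p \<times> ('p, real^4) tvec oplane) set \<Rightarrow> 'p osurface \<Rightarrow> bool" where
  "E_curve M E C \<longleftrightarrow> surface_in (fst C) M \<and> orientation (fst C) (snd C) \<and>
     (\<forall>x\<in>points C. (x, tangent_oplane M C x) \<in> E)"

text \<open>For \<open>s\<close> from \<open>Z\<close> to the oriented 2-planes of \<open>M\<close>, the plane field on \<open>Z\<close> which \<open>s\<close> pulls back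
  from the canonical one. When \<open>Z\<close> is the total space itself, \<open>s\<close> is the inclusion.\<close>
definition plane_field ::
  "('z, real^6) manifold \<Rightarrow> ('p, real^4) manifold \<Rightarrow> ('z \<Rightarrow> 'p \<times> ('p, real^4) tvec oplane)
     \<Rightarrow> 'z \<Rightarrow> ('z, real^6) tvec set" where
  "plane_field Z M s z = {v \<in> tangent_space Z z. tmap Z M (fst \<circ> s) z v \<in> plane (snd (s z))}"

text \<open>\<open>E\<close> curves viewed as surfaces in the total space \<open>Z\<close>.\<close>
definition E_curves_in ::
  "('z, real^6) manifold \<Rightarrow> ('p, real^4) manifold \<Rightarrow> ('z \<Rightarrow> 'p \<times> ('p, real^4) tvec oplane)
     \<Rightarrow> ('z, real^2) manifold set" where
  "E_curves_in Z M s = {S. surface_in S Z \<and>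
     (\<forall>z\<in>carrier_of S. tmap S Z id z ` tangent_space S z \<subseteq> plane_field Z M s z)}"

text \<open>\<open>Y\<close> is a smooth family of \<open>E\<close> curves with incidence manifold \<open>Z\<close>. Since \<open>Z \<rightarrow> Y\<close> is a
  submersion with fibres of dimension 2, smoothness of the maps \<open>x \<mapsto> (x, C)\<close> says that the curve
  \<open>C\<close> is the fibre over \<open>C\<close> as a manifold, and not only as a set.\<close>
definition smooth_family ::
  "('x, real^4) manifold \<Rightarrow> ('x \<times> ('x, real^4) tvec oplane) set
     \<Rightarrow> ('x osurface, real^4) manifold \<Rightarrow> ('x \<times> 'x osurface, real^6) manifold \<Rightarrow> bool" where
  "smooth_family X E Y Z \<longleftrightarrow> smooth_manifold Y \<and> smooth_manifold Z \<and>
     (\<forall>C\<in>carrier_of Y. E_curve X E C) \<and>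
     carrier_of Z = {(x, C). C \<in> carrier_of Y \<and> x \<in> points C} \<and>
     smooth_map Z X fst \<and> submersion Z Y snd \<and>
     (\<forall>C\<in>carrier_of Y. smooth_map (fst C) Z (\<lambda>x. (x, C)))"

definition tau ::
  "('x, real^4) manifold \<Rightarrow> 'x \<times> 'x osurface \<Rightarrow> 'x \<times> ('x, real^4) tvec oplane" where
  "tau X = (\<lambda>(x, C). (x, tangent_oplane X C x))"

section \<open>The dual planes\<close>

text \<open>\<open>J\<close> is a complex structure on \<open>P\<close> compatible with the orientation, \<open>K\<close> is one on \<open>V/P\<close>, and
  \<open>T\<close> is the set of complex linear maps.\<close>
definition complex_structures ::
  "'a::real_vector set \<Rightarrow> 'a oplane \<Rightarrow> ('a \<Rightarrow> 'a set) set \<Rightarrow> ('a \<Rightarrow> 'a) \<Rightarrow> ('a set \<Rightarrow> 'a set)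
     \<Rightarrow> bool" where
  "complex_structures V P T J K \<longleftrightarrow>
     linear J \<and> J ` plane P \<subseteq> plane P \<and>
     (\<forall>p\<in>plane P. J (J p) = - p) \<and> (\<forall>p\<in>plane P. p \<noteq> 0 \<longrightarrow> (p, J p) \<in> P) \<and>
     (\<exists>k. linear k \<and> k ` V \<subseteq> V \<and> (\<forall>w\<in>V. K (qcoset P w) = qcoset P (k w))) \<and>
     (\<forall>w\<in>V. K (K (qcoset P w)) = qcoset P (- w)) \<and>
     T = {A \<in> Lin_quot V P. \<forall>p\<in>plane P. A (J p) = K (A p)}"

text \<open>\<open>(A, B)\<close> is a positive basis of the complex line \<open>T\<close>, that is \<open>B = (a + b i) A\<close> with \<open>b > 0\<close>,
  where \<open>i A = A \<circ> J\<close>.\<close>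
definition positive_basis ::
  "'a::real_vector set \<Rightarrow> 'a oplane \<Rightarrow> ('a \<Rightarrow> 'a set) set \<Rightarrow> ('a \<Rightarrow> 'a set) \<Rightarrow> ('a \<Rightarrow> 'a set)
     \<Rightarrow> bool" where
  "positive_basis V P T A B \<longleftrightarrow> A \<in> T \<and> B \<in> T \<and> (\<exists>p\<in>plane P. A p \<noteq> qcoset P 0) \<and>
     (\<exists>J K. complex_structures V P T J K \<and>
        (\<exists>a b. b > 0 \<and> (\<forall>p\<in>plane P. B p = A (a *\<^sub>R p + b *\<^sub>R J p))))"

text \<open>The orientation of the kernel of the differential of \<open>Z \<rightarrow> X\<close> obtained by identifying it
  with the tangent plane of a fibre of \<open>E\<close>.\<close>
definition positive_kernel_basis ::
  "('x, real^4) manifold \<Rightarrow> ('x \<times> ('x, real^4) tvec oplane) set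
     \<Rightarrow> ('x \<times> 'x osurface, real^6) manifold \<Rightarrow> 'x \<times> 'x osurface
     \<Rightarrow> ('x \<times> 'x osurface, real^6) tvec \<Rightarrow> ('x \<times> 'x osurface, real^6) tvec \<Rightarrow> bool" where
  "positive_kernel_basis X E Z z v w \<longleftrightarrow>
     (let x = fst (tau X z); P = snd (tau X z); V = tangent_space X x; F = fibre X E x in
      v \<in> ker_tmap Z X fst z \<and> w \<in> ker_tmap Z X fst z \<and>
      (\<exists>\<zeta>\<in>tangent_space F P. \<exists>\<eta>\<in>tangent_space F P.
         tmap F (total_space X E) (Pair x) P \<zeta> = tmap Z (total_space X E) (tau X) z v \<and>
         tmap F (total_space X E) (Pair x) P \<eta> = tmap Z (total_space X E) (tau X) z w \<and>
         positive_basis V P (surface_hom V F P ` tangent_space F P)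
           (surface_hom V F P \<zeta>) (surface_hom V F P \<eta>)))"

definition dual_map ::
  "('x, real^4) manifold \<Rightarrow> ('x \<times> ('x, real^4) tvec oplane) set
     \<Rightarrow> ('x osurface, real^4) manifold \<Rightarrow> ('x \<times> 'x osurface, real^6) manifold
     \<Rightarrow> 'x \<times> 'x osurface \<Rightarrow> 'x osurface \<times> ('x osurface, real^4) tvec oplane" where
  "dual_map X E Y Z z = (snd z,
     {(tmap Z Y snd z v, tmap Z Y snd z w) | v w. positive_kernel_basis X E Z z v w})"

end

theory Submission
  imports Defs
begin

text \<open>Near a point of \<open>Z\<close> choose coordinates \<open>(y, t) \<in> \<real>\<^sup>4 \<times> \<real>\<^sup>2\<close> in which \<open>\<rho>\<close> is \<open>(y, t) \<mapsto> y\<close>, let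
  \<open>l\<close> represent \<open>\<lambda>\<close>, and let \<open>A\<close> be the matrix of the plane \<open>\<tau>\<close>, which is the image of \<open>0 \<times> \<real>\<^sup>2\<close>
  under \<open>D l\<close>. Differentiating this incidence along \<open>w \<in> ker \<lambda>'\<close> shows that the homomorphism \<open>D A w\<close>
  from the plane to its quotient is \<open>D l (0, u) \<mapsto> D\<^sup>2 l ((0, u), w)\<close>, so ellipticity of \<open>E\<close> says
  that the symmetric pairing \<open>D\<^sup>2 l\<close> modulo the plane has no zeros \<open>(u, w)\<close> with \<open>u \<noteq> 0\<close> and \<open>w \<noteq> 0\<close>. The
  dual planes are \<open>\<rho>' ker \<lambda>'\<close>. Differentiating \<open>D l w = 0\<close> in the direction \<open>(0, u)\<close> shows that the same
  pairing describes their variation along the fibres of \<open>\<rho>\<close>, which are therefore immersed as elliptic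
  line congruences. Since the plane field of the dual planes is \<open>ker \<lambda>' \<oplus> ker \<rho>'\<close> again, the two
  families have the same curves.\<close>

section \<open>Calculus of C^k and smooth maps on open subsets of Euclidean spaces\<close>

section \<open>Smooth functions\<close>

text \<open>Two obstacles shape the work around the second derivative. The orientation of the dual
  planes is defined by the mere existence of complex structures, which says nothing about smooth
  dependence on the point. In graph coordinates it becomes a strict polynomial inequality: for the
  matrices N1, N2 of two homomorphisms, \<open>posdet N1 N2\<close> is the determinant formed by
  their first rows times det N1, and its positivity characterizes positive bases. This is an open
  condition, so a smooth basis of ker \<lambda>' that is positive at one point stays positive
  nearby, and the dual planes are graphs of a smooth matrix function B(y, t). Secondly, a
  pseudocomplex structure is an embedded, locally trivial bundle, whereas the family of dual planes
  is only immersed along the fibres of \<rho>. A matrix of nonzero determinant is nonzero, so t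
  \<mapsto> B(y, t) is an immersion. Completing it by a complement of the image of its derivative
  straightens the whole family at once, fibrewise over y; a product box as domain gives all fibres
  the same parameters t, and the trivialization becomes the identity in coordinates.\<close>

lemma Ck_on_subset: "Ck_on k S f \<Longrightarrow> T \<subseteq> S \<Longrightarrow> Ck_on k T f"
  by (induction k arbitrary: f) (auto intro: continuous_on_subset)

lemma Ck_on_cong:
  assumes "open S" "\<And>x. x \<in> S \<Longrightarrow> f x = g x" "Ck_on k S f"
  shows "Ck_on k S g"
  using assms
proof (induction k arbitrary: f g)
  case 0
  then show ?case by (metis Ck_on.simps(1) continuous_on_cong)
next
  case (Suc k)
  have d: "(g has_derivative frechet_derivative f (at x)) (at x)" if "x \<in> S" for x
    using Suc.prems that
    by (meson Ck_on.simps(2) frechet_derivative_works has_derivative_transform_within_open)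
  have "frechet_derivative g (at x) = frechet_derivative f (at x)" if "x \<in> S" for x
    using frechet_derivative_at[OF d[OF that]] by simp
  then have "Ck_on k S (\<lambda>x. frechet_derivative g (at x) v)" for v
    using Suc.IH[of "\<lambda>x. frechet_derivative f (at x) v"] Suc.prems(1,3) by simp
  then show ?case using d by (auto simp: differentiable_def)
qed

text \<open>The definition of \<open>Ck_on\<close> names \<open>frechet_derivative\<close>; here any
  explicit formula \<open>D\<close> may stand in for it, which is what the inductions on
  \<open>k\<close> produce.\<close>

lemma Ck_on_SucI:
  assumes "open S" "\<And>x. x \<in> S \<Longrightarrow> (f has_derivative D x) (at x)" "\<And>v. Ck_on k S (\<lambda>x. D x v)"
  shows "Ck_on (Suc k) S f"
proof -
  have "frechet_derivative f (at x) = D x" if "x \<in> S" for x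
    using frechet_derivative_at[OF assms(2)[OF that]] by simp
  then have "Ck_on k S (\<lambda>x. frechet_derivative f (at x) v)" for v
    using Ck_on_cong[OF assms(1) _ assms(3)[of v]] by simp
  then show ?thesis using assms(2) by (auto simp: differentiable_def)
qed

lemma Ck_on_SucD: "Ck_on (Suc k) S f \<Longrightarrow> Ck_on k S f"
proof (induction k arbitrary: f)
  case 0
  then show ?case
    by (auto intro!: continuous_at_imp_continuous_on differentiable_imp_continuous_within)
qed auto

lemma Ck_on_has_derivative:
  "Ck_on (Suc k) S f \<Longrightarrow> x \<in> S \<Longrightarrow> (f has_derivative frechet_derivative f (at x)) (at x)"
  by (auto simp: frechet_derivative_works)

lemma Ck_on_const: "Ck_on k S (\<lambda>x. c)"
  by (induction k arbitrary: c) auto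

lemma Ck_on_bounded_linear: "bounded_linear f \<Longrightarrow> Ck_on k S f"
proof (cases k)
  case 0
  assume "bounded_linear f"
  then show ?thesis by (simp add: 0 linear_continuous_on)
next
  case (Suc j)
  assume "bounded_linear f"
  then have "(f has_derivative f) (at x)" for x
    by (rule bounded_linear_imp_has_derivative)
  then have "f differentiable at x" "frechet_derivative f (at x) = f" for x
    by (auto simp: differentiable_def frechet_derivative_at[symmetric])
  then show ?thesis by (simp add: Suc Ck_on_const)
qed

lemma Ck_on_add:
  "open S \<Longrightarrow> Ck_on k S f \<Longrightarrow> Ck_on k S g \<Longrightarrow> Ck_on k S (\<lambda>x. f x + g x)"
proof (induction k arbitrary: f g)
  case (Suc k)
  show ?case
    by (rule Ck_on_SucI[OF Suc.prems(1)],
        rule has_derivative_add[OF Ck_on_has_derivative[OF Suc.prems(2)] Ck_on_has_derivative[OF Suc.prems(3)]])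
      (use Suc in auto)
qed (auto intro: continuous_on_add)

lemma Ck_on_bilinear:
  assumes "bounded_bilinear h"
  shows "open S \<Longrightarrow> Ck_on k S f \<Longrightarrow> Ck_on k S g \<Longrightarrow> Ck_on k S (\<lambda>x. h (f x) (g x))"
proof (induction k arbitrary: f g)
  case 0
  then show ?case using bounded_bilinear.continuous_on[OF assms] by auto
next
  case (Suc k)
  note f = Ck_on_SucD[OF Suc.prems(2)] and g = Ck_on_SucD[OF Suc.prems(3)]
  show ?case
    by (rule Ck_on_SucI[OF Suc.prems(1)],
        rule bounded_bilinear.FDERIV[OF assms Ck_on_has_derivative[OF Suc.prems(2)] Ck_on_has_derivative[OF Suc.prems(3)]])
      (use Suc f g in \<open>auto intro!: Ck_on_add\<close>)
qed

lemma Ck_on_sum: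
  assumes "open S"
  shows "(\<And>i. i \<in> I \<Longrightarrow> Ck_on k S (f i)) \<Longrightarrow> Ck_on k S (\<lambda>x. \<Sum>i\<in>I. f i x)"
  by (induction I rule: infinite_finite_induct) (auto intro: Ck_on_add[OF assms] Ck_on_const)

lemma Ck_on_linear_compose:
  assumes "bounded_linear h" "open S" "Ck_on k S f"
  shows "Ck_on k S (\<lambda>x. h (f x))"
  using assms(3)
proof (induction k arbitrary: f)
  case 0
  then show ?case using bounded_linear.continuous_on[OF assms(1)] by auto
next
  case (Suc k)
  show ?case
    by (rule Ck_on_SucI[OF assms(2)],
        rule bounded_linear.has_derivative[OF assms(1) Ck_on_has_derivative[OF Suc.prems]])
      (use Suc in auto)
qed

lemma linear_euclidean_expand:
  fixes f :: "'a::euclidean_space \<Rightarrow> 'b::real_vector"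
  assumes "linear f"
  shows "f v = (\<Sum>i\<in>Basis. (v \<bullet> i) *\<^sub>R f i)"
proof -
  have "f v = f (\<Sum>i\<in>Basis. (v \<bullet> i) *\<^sub>R i)" by (simp add: euclidean_representation)
  then show ?thesis by (simp add: linear_sum[OF assms] linear_scale[OF assms])
qed

text \<open>\<open>Ck_on\<close> controls derivatives in fixed directions, whereas the chain rule
  evaluates the derivative of \<open>g\<close> in a direction that moves with \<open>x\<close>.
  Expanding this direction over \<open>Basis\<close> leaves a sum of products of functions already
  known to be regular.\<close>

lemma Ck_on_compose:
  fixes f :: "'a::euclidean_space \<Rightarrow> 'b::euclidean_space" and g :: "'b \<Rightarrow> 'c::real_normed_vector"
  assumes "open S" "open T" "f ` S \<subseteq> T"
  shows "Ck_on k S f \<Longrightarrow> Ck_on k T g \<Longrightarrow> Ck_on k S (\<lambda>x. g (f x))"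
proof (induction k arbitrary: g)
  case 0
  then show ?case using assms by (auto intro: continuous_on_compose2)
next
  case (Suc k)
  let ?D = "\<lambda>x v. \<Sum>i\<in>Basis. (frechet_derivative f (at x) v \<bullet> i) *\<^sub>R frechet_derivative g (at (f x)) i"
  show ?case
  proof (rule Ck_on_SucI[OF assms(1)])
    fix x assume x: "x \<in> S"
    then have dg: "(g has_derivative frechet_derivative g (at (f x))) (at (f x))"
      using Ck_on_has_derivative[OF Suc.prems(2)] assms(3) by auto
    have "linear (frechet_derivative g (at (f x)))"
      using dg has_derivative_linear by blast
    then have eq: "?D x = (\<lambda>v. frechet_derivative g (at (f x)) (frechet_derivative f (at x) v))"
      by (intro ext linear_euclidean_expand[symmetric])
    show "((\<lambda>x. g (f x)) has_derivative ?D x) (at x)"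
      unfolding eq by (rule has_derivative_compose[OF Ck_on_has_derivative[OF Suc.prems(1) x] dg])
  next
    fix v
    have "Ck_on k S (\<lambda>x. frechet_derivative g (at (f x)) i)" for i
      using Suc.IH[OF Ck_on_SucD[OF Suc.prems(1)], of "\<lambda>y. frechet_derivative g (at y) i"] Suc.prems(2) by auto
    moreover have "Ck_on k S (\<lambda>x. frechet_derivative f (at x) v \<bullet> i)" for i
      by (rule Ck_on_linear_compose[OF bounded_linear_inner_left assms(1)]) (use Suc.prems in auto)
    ultimately show "Ck_on k S (\<lambda>x. ?D x v)"
      by (intro Ck_on_sum assms Ck_on_bilinear[OF bounded_bilinear_scaleR])
  qed
qed

lemma Ck_on_local:
  assumes "\<And>x. x \<in> S \<Longrightarrow> \<exists>T. open T \<and> x \<in> T \<and> Ck_on k (S \<inter> T) f" "open S"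
  shows "Ck_on k S f"
  using assms(1)
proof (induction k arbitrary: f)
  case 0
  have "continuous (at x) f" if "x \<in> S" for x
    using 0[OF that] that assms(2)
    by (metis Ck_on.simps(1) IntI continuous_on_eq_continuous_at open_Int)
  then show ?case by (auto intro: continuous_at_imp_continuous_on)
next
  case (Suc k)
  have "f differentiable at x" if "x \<in> S" for x
    using Suc.prems[OF that] that by (metis Ck_on.simps(2) IntI)
  moreover have "Ck_on k S (\<lambda>x. frechet_derivative f (at x) v)" for v
  proof (rule Suc.IH)
    fix x assume "x \<in> S"
    from Suc.prems[OF this] obtain T where "open T" "x \<in> T" "Ck_on (Suc k) (S \<inter> T) f" by blast
    then show "\<exists>T. open T \<and> x \<in> T \<and> Ck_on k (S \<inter> T) (\<lambda>x. frechet_derivative f (at x) v)"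
      by auto
  qed
  ultimately show ?case by auto
qed

text \<open>The derivative of \<open>1/f\<close> is a polynomial in \<open>1/f\<close> and the
  derivative of \<open>f\<close>, so each order of regularity gives the next.\<close>

lemma Ck_on_inverse:
  fixes f :: "'a::euclidean_space \<Rightarrow> real"
  assumes "open S" "\<And>x. x \<in> S \<Longrightarrow> f x \<noteq> 0"
  shows "Ck_on k S f \<Longrightarrow> Ck_on k S (\<lambda>x. inverse (f x))"
proof (induction k)
  case 0
  then show ?case using assms by (auto intro: continuous_on_inverse)
next
  case (Suc k)
  note IH = Suc.IH[OF Ck_on_SucD[OF Suc.prems]]
  show ?case
  proof (rule Ck_on_SucI[OF assms(1)])
    fix x assume x: "x \<in> S"
    show "((\<lambda>x. inverse (f x)) has_derivative
        (\<lambda>v. (- 1) * (inverse (f x) * (frechet_derivative f (at x) v * inverse (f x))))) (at x)"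
      using has_derivative_inverse'[OF assms(2)[OF x], THEN diff_chain_at[OF Ck_on_has_derivative[OF Suc.prems x]]]
      by (simp add: o_def algebra_simps)
  next
    fix v
    show "Ck_on k S (\<lambda>x. (- 1) * (inverse (f x) * (frechet_derivative f (at x) v * inverse (f x))))"
      by (intro Ck_on_bilinear[OF bounded_bilinear_mult assms(1)] Ck_on_const IH) (use Suc.prems in auto)
  qed
qed

section \<open>Closure rules for smoothness\<close>

named_theorems smooth_intros

lemma smooth_on_subset: "smooth_on S f \<Longrightarrow> T \<subseteq> S \<Longrightarrow> smooth_on T f"
  by (auto simp: smooth_on_def intro: Ck_on_subset)

lemma smooth_on_cong: "open S \<Longrightarrow> (\<And>x. x \<in> S \<Longrightarrow> f x = g x) \<Longrightarrow> smooth_on S f \<Longrightarrow> smooth_on S g"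
  unfolding smooth_on_def by (metis Ck_on_cong)

lemma smooth_on_const [smooth_intros]: "smooth_on S (\<lambda>x. c)"
  by (auto simp: smooth_on_def Ck_on_const)

lemma smooth_on_bounded_linear: "bounded_linear f \<Longrightarrow> smooth_on S f"
  by (auto simp: smooth_on_def Ck_on_bounded_linear)

lemma smooth_on_linear:
  fixes f :: "'a::euclidean_space \<Rightarrow> 'b::real_normed_vector"
  shows "linear f \<Longrightarrow> smooth_on S f"
  by (simp add: smooth_on_bounded_linear linear_linear)

lemma smooth_on_ident [smooth_intros]: "smooth_on S (\<lambda>x. x)"
  by (rule smooth_on_bounded_linear) (rule bounded_linear_ident)

lemma smooth_on_bilinear:
  "bounded_bilinear h \<Longrightarrow> open S \<Longrightarrow> smooth_on S f \<Longrightarrow> smooth_on S g \<Longrightarrow> smooth_on S (\<lambda>x. h (f x) (g x))"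
  by (auto simp: smooth_on_def intro: Ck_on_bilinear)

lemmas smooth_on_mult [smooth_intros] = smooth_on_bilinear[OF bounded_bilinear_mult]
lemmas smooth_on_scaleR [smooth_intros] = smooth_on_bilinear[OF bounded_bilinear_scaleR]

lemma smooth_on_add [smooth_intros]:
  "open S \<Longrightarrow> smooth_on S f \<Longrightarrow> smooth_on S g \<Longrightarrow> smooth_on S (\<lambda>x. f x + g x)"
  by (auto simp: smooth_on_def intro: Ck_on_add)

lemma smooth_on_sum [smooth_intros]:
  "open S \<Longrightarrow> (\<And>i. i \<in> I \<Longrightarrow> smooth_on S (f i)) \<Longrightarrow> smooth_on S (\<lambda>x. \<Sum>i\<in>I. f i x)"
  by (auto simp: smooth_on_def intro: Ck_on_sum)

lemma smooth_on_linear_compose: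
  fixes f :: "'a::euclidean_space \<Rightarrow> 'b::euclidean_space"
  shows "linear h \<Longrightarrow> open S \<Longrightarrow> smooth_on S f \<Longrightarrow> smooth_on S (\<lambda>x. h (f x))"
  by (auto simp: smooth_on_def linear_linear intro: Ck_on_linear_compose)

lemma smooth_on_minus [smooth_intros]:
  assumes "open S" "smooth_on S f" "smooth_on S g"
  shows "smooth_on S (\<lambda>x. f x - g x)"
  using smooth_on_add[OF assms(1,2) smooth_on_scaleR[OF assms(1) smooth_on_const assms(3)], of "-1"] by simp

lemma smooth_on_inverse [smooth_intros]:
  fixes f :: "'a::euclidean_space \<Rightarrow> real"
  shows "open S \<Longrightarrow> (\<And>x. x \<in> S \<Longrightarrow> f x \<noteq> 0) \<Longrightarrow> smooth_on S f \<Longrightarrow> smooth_on S (\<lambda>x. inverse (f x))"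
  by (auto simp: smooth_on_def intro: Ck_on_inverse)

lemma smooth_on_compose:
  fixes f :: "'a::euclidean_space \<Rightarrow> 'b::euclidean_space" and g :: "'b \<Rightarrow> 'c::real_normed_vector"
  shows "open S \<Longrightarrow> open T \<Longrightarrow> f ` S \<subseteq> T \<Longrightarrow> smooth_on S f \<Longrightarrow> smooth_on T g \<Longrightarrow> smooth_on S (\<lambda>x. g (f x))"
  by (auto simp: smooth_on_def intro: Ck_on_compose)

lemma smooth_on_local:
  assumes "\<And>x. x \<in> S \<Longrightarrow> \<exists>T. open T \<and> x \<in> T \<and> smooth_on (S \<inter> T) f" "open S"
  shows "smooth_on S f"
  unfolding smooth_on_def
  by (intro allI Ck_on_local[OF _ assms(2)]) (use assms(1) in \<open>auto simp: smooth_on_def\<close>)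

lemma smooth_on_has_derivative:
  "smooth_on S f \<Longrightarrow> x \<in> S \<Longrightarrow> (f has_derivative frechet_derivative f (at x)) (at x)"
  unfolding smooth_on_def by (metis Ck_on_has_derivative)

lemma smooth_on_frechet_derivative_const:
  "smooth_on S f \<Longrightarrow> smooth_on S (\<lambda>x. frechet_derivative f (at x) v)"
  unfolding smooth_on_def by (metis Ck_on.simps(2))

lemma smooth_on_linear_derivative: "smooth_on S f \<Longrightarrow> x \<in> S \<Longrightarrow> linear (frechet_derivative f (at x))"
  using smooth_on_has_derivative has_derivative_linear by blast

lemma smooth_on_continuous: "smooth_on S f \<Longrightarrow> continuous_on S f"
  unfolding smooth_on_def by (metis Ck_on.simps(1))

lemma smooth_on_fst [smooth_intros]:
  fixes f :: "'a::euclidean_space \<Rightarrow> 'b::euclidean_space \<times> 'c::euclidean_space"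
  shows "open S \<Longrightarrow> smooth_on S f \<Longrightarrow> smooth_on S (\<lambda>x. fst (f x))"
  by (rule smooth_on_linear_compose[OF linear_fst])

lemma smooth_on_snd [smooth_intros]:
  fixes f :: "'a::euclidean_space \<Rightarrow> 'b::euclidean_space \<times> 'c::euclidean_space"
  shows "open S \<Longrightarrow> smooth_on S f \<Longrightarrow> smooth_on S (\<lambda>x. snd (f x))"
  by (rule smooth_on_linear_compose[OF linear_snd])

lemma smooth_on_Pair [smooth_intros]:
  fixes f :: "'a::euclidean_space \<Rightarrow> 'b::euclidean_space" and g :: "'a \<Rightarrow> 'c::euclidean_space"
  assumes "open S" "smooth_on S f" "smooth_on S g"
  shows "smooth_on S (\<lambda>x. (f x, g x))"
proof -
  have l: "linear (\<lambda>u::'b. (u, 0::'c))" "linear (\<lambda>u::'c. (0::'b, u))"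
    by (auto intro!: linearI)
  show ?thesis
    using smooth_on_add[OF assms(1) smooth_on_linear_compose[OF l(1) assms(1,2)] smooth_on_linear_compose[OF l(2) assms(1,3)]]
    by simp
qed

lemma smooth_on_nth [smooth_intros]:
  fixes f :: "'a::euclidean_space \<Rightarrow> 'b::euclidean_space ^ 'n::finite"
  shows "open S \<Longrightarrow> smooth_on S f \<Longrightarrow> smooth_on S (\<lambda>x. f x $ i)"
  by (rule smooth_on_linear_compose[of "\<lambda>x. x $ i"]) (auto intro!: linearI)

lemma smooth_on_vec:
  fixes f :: "'a::euclidean_space \<Rightarrow> 'b::euclidean_space ^ 'n::finite"
  assumes "open S" "\<And>i. smooth_on S (\<lambda>x. f x $ i)"
  shows "smooth_on S f"
proof -
  have l: "linear (axis i :: 'b \<Rightarrow> 'b ^ 'n)" for i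
    by (auto intro!: linearI simp: axis_def vec_eq_iff)
  have "f x = (\<Sum>i\<in>UNIV. axis i (f x $ i))" for x
    by (simp add: vec_eq_iff axis_def sum_component)
  then show ?thesis
    using smooth_on_sum[OF assms(1), of UNIV "\<lambda>i x. axis i (f x $ i)"] smooth_on_linear_compose[OF l assms(1) assms(2)]
    by simp
qed

text \<open>Again the direction moves; the basis expansion reduces it to the fixed directions of
  \<open>smooth_on_frechet_derivative_const\<close>.\<close>

lemma smooth_on_frechet_derivative:
  fixes f :: "'a::euclidean_space \<Rightarrow> 'b::euclidean_space" and g :: "'a \<Rightarrow> 'a"
  assumes "open S" "smooth_on S f" "smooth_on S g"
  shows "smooth_on S (\<lambda>x. frechet_derivative f (at x) (g x))"
proof (rule smooth_on_cong[OF assms(1)])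
  show "(\<Sum>i\<in>Basis. (g x \<bullet> i) *\<^sub>R frechet_derivative f (at x) i) = frechet_derivative f (at x) (g x)"
    if "x \<in> S" for x
    using linear_euclidean_expand[OF smooth_on_linear_derivative[OF assms(2) that]] by metis
  have "smooth_on S (\<lambda>x. g x \<bullet> i)" for i
    by (rule smooth_on_linear_compose[of "\<lambda>x. x \<bullet> i"]) (auto intro!: linearI assms simp: inner_add_left)
  then show "smooth_on S (\<lambda>x. \<Sum>i\<in>Basis. (g x \<bullet> i) *\<^sub>R frechet_derivative f (at x) i)"
    by (intro smooth_intros assms smooth_on_frechet_derivative_const)
qed

section \<open>Smooth dependence of inverses, and the smooth inverse function theorem\<close>

lemma inv_linear_apply:
  fixes L :: "'a::euclidean_space \<Rightarrow> 'a"
  assumes "linear L" "inj L"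
  shows "L (inv L w) = w" "inv L (L w) = w" "linear (inv L)"
proof -
  have s: "surj L" using assms linear_injective_imp_surjective by blast
  show "L (inv L w) = w" "inv L (L w) = w" using s assms by (auto simp: surj_f_inv_f)
  show "linear (inv L)"
    using assms s inj_linear_imp_inv_linear by (auto simp: linear_linear)
qed

text \<open>The map \<open>(y, u) \<mapsto> (y, L y u)\<close> is differentiable with invertible derivative, so its inverse
  is differentiable without any further estimate.\<close>
lemma inv_has_derivative:
  fixes L :: "'a::euclidean_space \<Rightarrow> 'b::euclidean_space \<Rightarrow> 'b"
  assumes S: "open S" "y \<in> S" and sm: "\<And>w. smooth_on S (\<lambda>y. L y w)"
    and lin: "\<And>y. y \<in> S \<Longrightarrow> linear (L y)" and inj: "\<And>y. y \<in> S \<Longrightarrow> inj (L y)"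
  shows "((\<lambda>y. inv (L y) v) has_derivative
     (\<lambda>h. \<Sum>j\<in>Basis. (\<Sum>i\<in>Basis. (- (inv (L y) v \<bullet> i)) * (frechet_derivative (\<lambda>y. L y i) (at y) h \<bullet> j)) *\<^sub>R inv (L y) j)) (at y)"
proof -
  define u where "u = inv (L y) v"
  \<comment> \<open>Writing \<open>L y u\<close> as a basis sum makes \<open>F\<close>
    differentiable termwise in both variables; over \<open>S\<close> it is still
    \<open>(y, L y u)\<close>.\<close>
  define F where "F = (\<lambda>(y, u). (y, \<Sum>i\<in>Basis. (u \<bullet> i) *\<^sub>R L y i))"
  define G where "G = (\<lambda>(y, w). (y, inv (L y) w))"
  define Q where "Q = (\<lambda>h. \<Sum>i\<in>Basis. (u \<bullet> i) *\<^sub>R frechet_derivative (\<lambda>y. L y i) (at y) h)"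
  have F: "F (y, u) = (y, L y u)" if "y \<in> S" for y u
    using linear_euclidean_expand[OF lin[OF that], of u] by (simp add: F_def)
  have op: "open (S \<times> (UNIV :: 'b set))" using S by (simp add: open_Times)
  have lin0: "linear (inv (L y))" and i1: "\<And>w. L y (inv (L y) w) = w" and i2: "\<And>w. inv (L y) (L y w) = w"
    using inv_linear_apply[OF lin inj] S by blast+
  have dL: "((\<lambda>y. L y i) has_derivative frechet_derivative (\<lambda>y. L y i) (at y)) (at y)" if "y \<in> S" for y i
    by (rule smooth_on_has_derivative[OF sm that])
  have dF: "(F has_derivative (\<lambda>(h, k). (h, (\<Sum>i\<in>Basis. (u \<bullet> i) *\<^sub>R frechet_derivative (\<lambda>y. L y i) (at y) h + (k \<bullet> i) *\<^sub>R L y i))))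
      (at (y, u))" if "y \<in> S" for y u
  proof -
    have a: "((\<lambda>p. L (fst p) i) has_derivative (\<lambda>p. frechet_derivative (\<lambda>y. L y i) (at y) (fst p))) (at (y, u))" for i
      using has_derivative_compose[OF has_derivative_fst[OF has_derivative_ident], of "(\<lambda>y. L y i)" _ "(y,u)" UNIV] dL[OF that, of i] by simp
    show ?thesis
      unfolding F_def case_prod_unfold
      by (auto intro!: derivative_eq_intros a)
  qed
  have Qlin: "linear Q"
    unfolding Q_def using has_derivative_linear[OF dL[OF S(2)]]
    by (auto intro!: linear_compose_sum linear_compose_scale_right)
  have dG: "(G has_derivative (\<lambda>(h, k). (h, inv (L y) (k - Q h)))) (at (F (y, u)))"
  proof (rule has_derivative_inverse_strong[OF op _ _ _ dF])
    show "continuous_on (S \<times> UNIV) F"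
      using dF by (auto intro!: continuous_at_imp_continuous_on has_derivative_continuous)
    show "G (F x) = x" if "x \<in> S \<times> UNIV" for x
      using that F inv_linear_apply(2)[OF lin inj] by (auto simp: G_def)
    have "(\<Sum>i\<in>Basis. (u \<bullet> i) *\<^sub>R frechet_derivative (\<lambda>y. L y i) (at y) h + (inv (L y) (k - Q h) \<bullet> i) *\<^sub>R L y i) = k" for h k
      using linear_euclidean_expand[OF lin[OF S(2)], of "inv (L y) (k - Q h)"] i1[of "k - Q h"]
      by (simp add: sum.distrib Q_def)
    then show "(\<lambda>(h, k). (h, \<Sum>i\<in>Basis. (u \<bullet> i) *\<^sub>R frechet_derivative (\<lambda>y. L y i) (at y) h + (k \<bullet> i) *\<^sub>R L y i)) \<circ>
      (\<lambda>(h, k). (h, inv (L y) (k - Q h))) = id"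
      by (auto simp: fun_eq_iff)
  qed (use S in auto)
  have Fyu: "F (y, u) = (y, v)" using F[OF S(2)] by (simp add: u_def i1)
  have "((\<lambda>y. (y, v)) has_derivative (\<lambda>h. (h, 0))) (at y)"
    by (auto intro!: derivative_eq_intros)
  then have "((\<lambda>y. G (y, v)) has_derivative (\<lambda>h. (h, inv (L y) (0 - Q h)))) (at y)"
    using has_derivative_compose[of "\<lambda>y. (y, v)" "\<lambda>h. (h, 0)" y UNIV G
        "\<lambda>(h, k). (h, inv (L y) (k - Q h))"] dG Fyu by simp
  then have "((\<lambda>y. snd (G (y, v))) has_derivative (\<lambda>h. snd (h, inv (L y) (0 - Q h)))) (at y)"
    by (rule has_derivative_snd)
  \<comment> \<open>Expanded so that \<open>inv (L y)\<close> occurs only at the fixed vectors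
    \<open>v\<close> and \<open>j\<close>: in this shape regularity of the inverse can be fed back
    into its own derivative.\<close>
  moreover have "inv (L y) (0 - Q h) = (\<Sum>j\<in>Basis. (\<Sum>i\<in>Basis. (- (u \<bullet> i)) * (frechet_derivative (\<lambda>y. L y i) (at y) h \<bullet> j)) *\<^sub>R inv (L y) j)" for h
    by (subst linear_euclidean_expand[OF lin0]) (simp add: Q_def inner_sum_left sum_negf)
  ultimately show ?thesis by (simp add: G_def u_def)
qed

text \<open>The derivative of the inverse is polynomial in the inverse itself and in the derivatives
  of \<open>L\<close>, so regularity climbs from differentiability to all orders.\<close>

lemma smooth_on_inv_linear:
  fixes L :: "'a::euclidean_space \<Rightarrow> 'b::euclidean_space \<Rightarrow> 'b"
  assumes S: "open S" and sm: "\<And>w. smooth_on S (\<lambda>y. L y w)"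
    and lin: "\<And>y. y \<in> S \<Longrightarrow> linear (L y)" and inj: "\<And>y. y \<in> S \<Longrightarrow> inj (L y)"
  shows "smooth_on S (\<lambda>y. inv (L y) v)"
proof -
  note D = inv_has_derivative[OF S _ sm lin inj]
  have "Ck_on k S (\<lambda>y. inv (L y) v)" for k v
  proof (induction k arbitrary: v)
    case 0
    show ?case using D
      by (auto intro!: continuous_at_imp_continuous_on has_derivative_continuous)
  next
    case (Suc k)
    have 1: "Ck_on k S (\<lambda>y. frechet_derivative (\<lambda>y. L y i) (at y) h)" for i h
      using smooth_on_frechet_derivative_const[OF sm] by (auto simp: smooth_on_def)
    have 2: "Ck_on k S (\<lambda>y. (- 1) * (inv (L y) v \<bullet> i))" for i
      by (intro Ck_on_bilinear[OF bounded_bilinear_mult] Ck_on_bilinear[OF bounded_bilinear_inner] Ck_on_const Suc S)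
    show ?case
    proof (rule Ck_on_SucI[OF S D])
      show "Ck_on k S (\<lambda>x. \<Sum>j\<in>Basis. (\<Sum>i\<in>Basis. - (inv (L x) v \<bullet> i) * (frechet_derivative (\<lambda>y. L y i) (at x) h \<bullet> j)) *\<^sub>R inv (L x) j)" for h
        by (intro Ck_on_sum S Ck_on_bilinear[OF bounded_bilinear_scaleR] Ck_on_bilinear[OF bounded_bilinear_mult]
            Ck_on_bilinear[OF bounded_bilinear_inner] Suc 1 2[simplified] Ck_on_const)
    qed
  qed
  then show ?thesis by (simp add: smooth_on_def)
qed

text \<open>The derivative of the inverse \<open>g\<close> is \<open>inv (D (g y))\<close>, a smooth
  function composed with \<open>g\<close>, so \<open>Ck\<close> regularity of \<open>g\<close>
  yields the next order. The last conclusion, injectivity of nearby derivatives, is what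
  \<open>inj_linear_family_open\<close> extracts.\<close>

theorem smooth_inverse_function:
  fixes f :: "'a::euclidean_space \<Rightarrow> 'a"
  assumes U: "open U" "x0 \<in> U" and sm: "smooth_on U f" and inj: "inj (frechet_derivative f (at x0))"
  obtains U' V g where "open U'" "U' \<subseteq> U" "x0 \<in> U'" "open V" "f ` U' = V" "g ` V = U'"
    "\<And>x. x \<in> U' \<Longrightarrow> g (f x) = x" "\<And>y. y \<in> V \<Longrightarrow> f (g y) = y" "smooth_on V g"
    "\<And>x. x \<in> U' \<Longrightarrow> inj (frechet_derivative f (at x))"
proof -
  define D where "D = (\<lambda>x. frechet_derivative f (at x))"
  define f' where "f' = (\<lambda>x. Blinfun (D x))"
  have der: "(f has_derivative D x) (at x)" if "x \<in> U" for x
    using smooth_on_has_derivative[OF sm that] by (simp add: D_def)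
  have f': "blinfun_apply (f' x) = D x" if "x \<in> U" for x
    using der[OF that] by (simp add: f'_def bounded_linear_Blinfun_apply has_derivative_bounded_linear)
  have "continuous_on U (\<lambda>x. D x i)" for i
    unfolding D_def using smooth_on_continuous[OF smooth_on_frechet_derivative_const[OF sm]] .
  then have "continuous_on U (\<lambda>x. blinfun_apply (f' x) i)" for i
    by (rule continuous_on_eq) (simp add: f')
  \<comment> \<open>In finite dimension, continuity at each fixed vector is continuity in the
    operator norm.\<close>
  then have contf: "continuous_on U f'"
    by (rule continuous_on_blinfun_componentwise)
  define invf where "invf = Blinfun (inv (D x0))"
  have linD: "linear (D x)" if "x \<in> U" for x using der[OF that] has_derivative_linear by blast
  have injD: "inj (D x0)" using inj by (simp add: D_def)
  have "blinfun_apply invf = inv (D x0)"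
    unfolding invf_def using inv_linear_apply(3)[OF linD[OF U(2)] injD]
    by (simp add: bounded_linear_Blinfun_apply linear_linear)
  then have "invf o\<^sub>L f' x0 = id_blinfun"
    using f'[OF U(2)] inv_linear_apply(2)[OF linD[OF U(2)] injD] by (auto intro!: blinfun_eqI)
  have der': "(f has_derivative blinfun_apply (f' x)) (at x)" if "x \<in> U" for x
    using der[OF that] f'[OF that] by simp
  from inverse_function_theorem[OF U(1) der' contf U(2) \<open>invf o\<^sub>L f' x0 = id_blinfun\<close>]
  obtain U' V g g' where A: "open U'" "U' \<subseteq> U" "x0 \<in> U'" "open V" "homeomorphism U' V f g"
    and dg: "\<And>y. y \<in> V \<Longrightarrow> (g has_derivative (g' y)) (at y)"
    and g': "\<And>y. y \<in> V \<Longrightarrow> g' y = inv (blinfun_apply (f'(g y)))"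
    and bij: "\<And>y. y \<in> V \<Longrightarrow> bij (blinfun_apply (f'(g y)))" by metis
  have gV: "g ` V = U'" "f ` U' = V" and gf: "\<And>x. x \<in> U' \<Longrightarrow> g (f x) = x" and fg: "\<And>y. y \<in> V \<Longrightarrow> f (g y) = y"
    using A(5) by (auto simp: homeomorphism_def)
  have bijD: "inj (D x)" if "x \<in> U'" for x
    using bij gV that f' A(2) by (metis bij_betw_def imageE subsetD)
  have smD: "smooth_on U' (\<lambda>x. inv (D x) v)" for v
    by (rule smooth_on_inv_linear) (use A linD bijD smooth_on_subset[OF smooth_on_frechet_derivative_const[OF sm]] in \<open>auto simp: D_def\<close>)
  have "Ck_on k V g" for k
  proof (induction k)
    case 0
    show ?case using A(5) by (simp add: homeomorphism_def)
  next
    case (Suc k)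
    show ?case
    proof (rule Ck_on_SucI[OF A(4)])
      show "(g has_derivative inv (D (g x))) (at x)" if "x \<in> V" for x
        using dg[OF that] g'[OF that] f' gV A(2) that by (metis imageI subsetD)
      show "Ck_on k V (\<lambda>x. inv (D (g x)) v)" for v
        by (rule Ck_on_compose[OF A(4) A(1) _ Suc]) (use gV smD in \<open>auto simp: smooth_on_def\<close>)
    qed
  qed
  then have "smooth_on V g" by (simp add: smooth_on_def)
  then show thesis
    using that[of U' V g] A gV gf fg bijD by (auto simp: D_def)
qed

section \<open>Compatibility of charts and completion of atlases\<close>

section \<open>Charts and maximal atlases\<close>

declare split_paired_All [simp del] split_paired_Ex [simp del]

text \<open>Atlas and maximality alone, which is what every \<open>max_atlas\<close> of an atlas
  has; arguments in charts are carried out at this level.\<close>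

definition mfd :: "('p, 'v::euclidean_space) manifold \<Rightarrow> bool" where
  "mfd M \<longleftrightarrow> atlas M \<and> max_atlas M \<subseteq> M"

lemma smooth_manifold_mfd: "smooth_manifold M \<Longrightarrow> mfd M"
  by (simp add: smooth_manifold_def mfd_def)

lemma mfd_atlas: "mfd M \<Longrightarrow> atlas M"
  by (simp add: mfd_def)

lemma atlas_valid: "atlas M \<Longrightarrow> c \<in> M \<Longrightarrow> valid_chart c"
  by (simp add: atlas_def)

lemma atlas_compatible: "atlas M \<Longrightarrow> c \<in> M \<Longrightarrow> d \<in> M \<Longrightarrow> compatible c d"
  by (simp add: atlas_def)

lemma chart_inv_left: "valid_chart c \<Longrightarrow> p \<in> fst c \<Longrightarrow> chart_inv c (snd c p) = p"
  by (simp add: chart_inv_def valid_chart_def)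

lemma chart_inv_right: "y \<in> snd c ` fst c \<Longrightarrow> snd c (chart_inv c y) = y"
  by (simp add: chart_inv_def f_inv_into_f)

lemma chart_inv_mem: "y \<in> snd c ` fst c \<Longrightarrow> chart_inv c y \<in> fst c"
  by (simp add: chart_inv_def inv_into_into)

lemma chart_inj: "valid_chart c \<Longrightarrow> p \<in> fst c \<Longrightarrow> q \<in> fst c \<Longrightarrow> snd c p = snd c q \<Longrightarrow> p = q"
  unfolding valid_chart_def by (meson inj_onD)

lemma chart_image_Int:
  "valid_chart c \<Longrightarrow> A \<subseteq> fst c \<Longrightarrow> B \<subseteq> fst c \<Longrightarrow> snd c ` (A \<inter> B) = snd c ` A \<inter> snd c ` B"
  unfolding valid_chart_def by (metis inj_on_image_Int)

lemma valid_chart_open: "valid_chart c \<Longrightarrow> open (snd c ` fst c)"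
  by (simp add: valid_chart_def)

lemma compatible_sym: "compatible c d \<Longrightarrow> compatible d c"
  by (auto simp: compatible_def Int_commute)

text \<open>The image under \<open>c\<close> is the preimage, under the transition to
  \<open>a\<close>, of the image under \<open>a\<close>.\<close>

lemma chart_image_open:
  assumes "valid_chart c" "valid_chart a" "compatible c a" "T \<subseteq> fst c" "T \<subseteq> fst a" "open (snd a ` T)"
  shows "open (snd c ` T)"
proof -
  let ?S = "snd c ` (fst c \<inter> fst a)"
  have "open ?S" and sm: "smooth_on ?S (snd a \<circ> chart_inv c)"
    using assms(3) by (auto simp: compatible_def)
  then have "open (?S \<inter> (snd a \<circ> chart_inv c) -` (snd a ` T))"
    using smooth_on_continuous[OF sm] assms(6) by (auto intro: continuous_open_preimage)
  also have "?S \<inter> (snd a \<circ> chart_inv c) -` (snd a ` T) = snd c ` T"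
    using assms(1,2,4,5) by (auto simp: chart_inv_left dest: chart_inj)
  finally show ?thesis .
qed

text \<open>Near each point the transition factors through an intermediate chart \<open>a\<close>,
  and openness and smoothness are local. With \<open>a\<close> taken from an atlas, charts
  compatible with the atlas become compatible with each other.\<close>

lemma compatible_chain:
  assumes val: "valid_chart c" "valid_chart d"
    and A: "\<And>p. p \<in> fst c \<inter> fst d \<Longrightarrow> \<exists>a. valid_chart a \<and> p \<in> fst a \<and> compatible c a \<and> compatible d a"
  shows "open (snd c ` (fst c \<inter> fst d))" "smooth_on (snd c ` (fst c \<inter> fst d)) (snd d \<circ> chart_inv c)"
proof -
  let ?I = "fst c \<inter> fst d"
  have *: "\<exists>T. open T \<and> snd c p \<in> T \<and> T \<subseteq> snd c ` ?I \<and> smooth_on T (snd d \<circ> chart_inv c)" if p: "p \<in> ?I" for p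
  proof -
    from A[OF p] obtain a where a: "valid_chart a" "p \<in> fst a" and ca: "compatible c a" and da: "compatible d a" by blast
    let ?T = "fst c \<inter> fst d \<inter> fst a"
    have "snd a ` ?T = snd a ` (fst c \<inter> fst a) \<inter> snd a ` (fst d \<inter> fst a)"
      by (subst chart_image_Int[OF a(1), symmetric]) (auto intro: arg_cong[of _ _ "(`) (snd a)"])
    then have oa: "open (snd a ` ?T)" using ca da by (auto simp: compatible_def)
    have oc: "open (snd c ` ?T)" by (rule chart_image_open[OF val(1) a(1) ca _ _ oa]) auto
    have sa: "smooth_on (snd c ` ?T) (snd a \<circ> chart_inv c)"
      using ca by (auto simp: compatible_def intro: smooth_on_subset)
    have sd: "smooth_on (snd a ` ?T) (snd d \<circ> chart_inv a)"
      using da by (auto simp: compatible_def intro: smooth_on_subset)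
    have "smooth_on (snd c ` ?T) (\<lambda>x. (snd d \<circ> chart_inv a) ((snd a \<circ> chart_inv c) x))"
      by (rule smooth_on_compose[OF oc oa _ sa sd]) (use val in \<open>auto simp: chart_inv_left\<close>)
    then have "smooth_on (snd c ` ?T) (snd d \<circ> chart_inv c)"
      by (rule smooth_on_cong[OF oc, rotated]) (use val a in \<open>auto simp: chart_inv_left\<close>)
    then show ?thesis using oc p a(2) by (intro exI[of _ "snd c ` ?T"]) auto
  qed
  show o: "open (snd c ` ?I)"
  proof (subst open_subopen, rule ballI)
    fix y assume "y \<in> snd c ` ?I"
    then show "\<exists>T. open T \<and> y \<in> T \<and> T \<subseteq> snd c ` ?I" using * by blast
  qed
  show "smooth_on (snd c ` ?I) (snd d \<circ> chart_inv c)"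
  proof (rule smooth_on_local[OF _ o])
    fix x assume "x \<in> snd c ` ?I"
    then obtain T where "open T" "x \<in> T" "smooth_on T (snd d \<circ> chart_inv c)" using * by blast
    then show "\<exists>T. open T \<and> x \<in> T \<and> smooth_on (snd c ` ?I \<inter> T) (snd d \<circ> chart_inv c)"
      by (meson inf_le2 smooth_on_subset)
  qed
qed

lemma max_atlas_compatible:
  assumes "atlas A" "c \<in> max_atlas A" "d \<in> max_atlas A"
  shows "compatible c d"
proof -
  have v: "valid_chart c" "valid_chart d" using assms by (auto simp: max_atlas_def)
  have 1: "\<exists>a. valid_chart a \<and> p \<in> fst a \<and> compatible c a \<and> compatible d a" if p: "p \<in> fst c \<inter> fst d" for p
  proof -
    obtain a where "a \<in> A" "p \<in> fst a" using p assms(2) by (auto simp: max_atlas_def)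
    then show ?thesis using assms by (auto simp: max_atlas_def atlas_def)
  qed
  have 2: "\<exists>a. valid_chart a \<and> p \<in> fst a \<and> compatible d a \<and> compatible c a" if "p \<in> fst d \<inter> fst c" for p
    using 1[of p] that by blast
  show ?thesis
    unfolding compatible_def
    using compatible_chain[OF v 1] compatible_chain[OF v(2,1) 2] Int_commute[of "fst d" "fst c"] by simp
qed

lemma atlas_subset_max_atlas: "atlas A \<Longrightarrow> A \<subseteq> max_atlas A"
  by (auto simp: atlas_def max_atlas_def)

lemma carrier_max_atlas: "atlas A \<Longrightarrow> carrier_of (max_atlas A) = \<Union> (fst ` A)"
  using atlas_subset_max_atlas[of A] by (auto simp: carrier_of_def max_atlas_def)

lemma mfd_max_atlas: "atlas A \<Longrightarrow> mfd (max_atlas A)"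
proof -
  assume A: "atlas A"
  have 1: "atlas (max_atlas A)"
    unfolding atlas_def using max_atlas_compatible[OF A] by (auto simp: max_atlas_def)
  have "max_atlas (max_atlas A) \<subseteq> max_atlas A"
    using atlas_subset_max_atlas[OF A] carrier_max_atlas[OF A]
    by (auto simp: max_atlas_def[of "max_atlas A"] carrier_of_def) (auto simp: max_atlas_def)
  with 1 show ?thesis by (simp add: mfd_def)
qed

text \<open>By maximality a coordinate change \<open>\<phi>\<close> with smooth inverse
  \<open>\<psi>\<close> turns a chart into a chart. Restrictions, slice charts of straightened
  graphs and normal forms of submersions are all obtained from this.\<close>

lemma new_chart:
  fixes M :: "('p, 'v::euclidean_space) manifold"
  assumes M: "mfd M" and c: "c \<in> M" and D: "D \<subseteq> fst c" and oD: "open (snd c ` D)"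
    and sm: "smooth_on (snd c ` D) \<phi>" and oi: "open (\<phi> ` snd c ` D)"
    and sm': "smooth_on (\<phi> ` snd c ` D) \<psi>" and inv: "\<And>x. x \<in> snd c ` D \<Longrightarrow> \<psi> (\<phi> x) = x"
  shows "(D, restrict (\<phi> \<circ> snd c) D) \<in> M"
proof -
  let ?n = "(D, restrict (\<phi> \<circ> snd c) D)"
  note at = mfd_atlas[OF M]
  have vc: "valid_chart c" using at c atlas_valid by blast
  have injn: "inj_on (\<phi> \<circ> snd c) D"
  proof (rule inj_onI)
    fix x y assume "x \<in> D" "y \<in> D" "(\<phi> \<circ> snd c) x = (\<phi> \<circ> snd c) y"
    then show "x = y" using inv D vc by (metis chart_inj comp_apply image_eqI subsetD)
  qed
  have vn: "valid_chart ?n"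
    using injn oi by (auto simp: valid_chart_def image_comp inj_on_def)
  have invn: "chart_inv ?n (\<phi> (snd c p)) = p" if "p \<in> D" for p
    using chart_inv_left[OF vn, of p] that by simp
  have "compatible ?n d" if d: "d \<in> M" for d
  proof -
    have vd: "valid_chart d" using at d atlas_valid by blast
    have cd: "compatible c d" using atlas_compatible[OF at c d] .
    let ?T = "D \<inter> fst d"
    have "snd c ` ?T = snd c ` D \<inter> snd c ` (fst c \<inter> fst d)"
      using D by (subst chart_image_Int[OF vc, symmetric]) (auto intro: arg_cong[of _ _ "(`) (snd c)"])
    then have oc: "open (snd c ` ?T)" using cd oD by (auto simp: compatible_def)
    have od: "open (snd d ` ?T)" by (rule chart_image_open[OF vd vc compatible_sym[OF cd] _ _ oc]) (use D in auto)
    have "\<phi> ` snd c ` ?T = \<phi> ` snd c ` D \<inter> \<psi> -` (snd c ` ?T)"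
    proof (intro equalityI subsetI)
      fix y assume "y \<in> \<phi> ` snd c ` D \<inter> \<psi> -` (snd c ` ?T)"
      then obtain x where x: "x \<in> snd c ` D" "y = \<phi> x" "\<psi> y \<in> snd c ` ?T" by blast
      then show "y \<in> \<phi> ` snd c ` ?T" using inv[OF x(1)] by auto
    next
      fix y assume "y \<in> \<phi> ` snd c ` ?T"
      then obtain x where x: "x \<in> snd c ` ?T" "y = \<phi> x" by blast
      then show "y \<in> \<phi> ` snd c ` D \<inter> \<psi> -` (snd c ` ?T)" using inv[of x] by auto
    qed
    then have on: "open (\<phi> ` snd c ` ?T)"
      using continuous_open_preimage[OF smooth_on_continuous[OF sm'] oi oc] by simp
    have s1: "smooth_on (snd c ` ?T) (snd d \<circ> chart_inv c)"
      using cd D by (auto simp: compatible_def intro: smooth_on_subset)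
    have s2: "smooth_on (snd d ` ?T) (snd c \<circ> chart_inv d)"
      using cd D by (auto simp: compatible_def intro: smooth_on_subset)
    have s3: "smooth_on (snd c ` ?T) \<phi>" "smooth_on (\<phi> ` snd c ` ?T) \<psi>"
      using sm sm' by (auto intro: smooth_on_subset)
    have "smooth_on (\<phi> ` snd c ` ?T) (\<lambda>x. (snd d \<circ> chart_inv c) (\<psi> x))"
      by (rule smooth_on_compose[OF on oc _ s3(2) s1]) (use inv in auto)
    then have t1: "smooth_on (\<phi> ` snd c ` ?T) (snd d \<circ> chart_inv ?n)"
      by (rule smooth_on_cong[OF on, rotated]) (use inv invn D vc in \<open>auto simp: chart_inv_left subset_iff\<close>)
    have "smooth_on (snd d ` ?T) (\<lambda>x. \<phi> ((snd c \<circ> chart_inv d) x))"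
      by (rule smooth_on_compose[OF od oc _ s2 s3(1)]) (use vd in \<open>auto simp: chart_inv_left\<close>)
    then have t2: "smooth_on (snd d ` ?T) (snd ?n \<circ> chart_inv d)"
      by (rule smooth_on_cong[OF od, rotated]) (use vd in \<open>auto simp: chart_inv_left\<close>)
    have im: "snd ?n ` (fst ?n \<inter> fst d) = \<phi> ` snd c ` ?T" by (auto simp: image_comp)
    show ?thesis
      unfolding compatible_def im using on od t1 t2 by simp
  qed
  then have "?n \<in> max_atlas M"
    using vn D c by (auto simp: max_atlas_def)
  then show ?thesis using M by (auto simp: mfd_def)
qed

lemma restrict_chart:
  assumes "mfd M" "c \<in> M" "D \<subseteq> fst c" "open (snd c ` D)"
  shows "(D, restrict (snd c) D) \<in> M"
  using new_chart[OF assms, of "\<lambda>x. x" "\<lambda>x. x"] assms(4)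
  by (simp add: smooth_on_ident o_def)

lemma chart_inv_restrict:
  "valid_chart c \<Longrightarrow> D \<subseteq> fst c \<Longrightarrow> y \<in> snd c ` D \<Longrightarrow> chart_inv (D, restrict (snd c) D) y = chart_inv c y"
proof -
  assume a: "valid_chart c" "D \<subseteq> fst c" "y \<in> snd c ` D"
  then obtain p where p: "p \<in> D" "y = snd c p" by blast
  have "inj_on (restrict (snd c) D) D"
    using a by (auto simp: valid_chart_def inj_on_def subset_iff)
  from inv_into_f_f[OF this p(1)] have "chart_inv (D, restrict (snd c) D) y = p"
    using p by (simp add: chart_inv_def)
  moreover have "chart_inv c y = p" using chart_inv_left[OF a(1)] a(2) p by auto
  ultimately show ?thesis by simp
qed

section \<open>Description in charts of the topology generated by chart preimages\<close>

section \<open>The topology of a manifold\<close>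

text \<open>The sets on the right are closed under intersection because charts are injective, and
  contain the generators because charts are compatible. Each is a union of generators, since
  \<open>fst c \<inter> W\<close> is the preimage of its own image.\<close>

lemma openin_mtop_iff:
  assumes M: "atlas M"
  shows "openin (mtop M) W \<longleftrightarrow> W \<subseteq> carrier_of M \<and> (\<forall>c\<in>M. open (snd c ` (fst c \<inter> W)))"
proof -
  let ?B = "{fst c \<inter> snd c -` B | c B. c \<in> M \<and> open B}"
  have eq: "openin (mtop M) W \<longleftrightarrow> generate_topology_on ?B W"
    by (simp add: mtop_def openin_topology_generated_by_iff)
  have *: "W \<subseteq> carrier_of M \<and> (\<forall>c\<in>M. open (snd c ` (fst c \<inter> W)))" if "generate_topology_on ?B W" for W
    using that
  proof (induction rule: generate_topology_on.induct)
    case (Int a b)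
    have "snd c ` (fst c \<inter> (a \<inter> b)) = snd c ` (fst c \<inter> a) \<inter> snd c ` (fst c \<inter> b)" if "c \<in> M" for c
      using atlas_valid[OF M that]
      by (subst chart_image_Int[symmetric]) (auto intro: arg_cong[of _ _ "(`) (snd c)"])
    then show ?case using Int by auto
  next
    case (UN K)
    have eqU: "snd c ` (fst c \<inter> \<Union>K) = (\<Union>k\<in>K. snd c ` (fst c \<inter> k))" for c by auto
    have "open (snd c ` (fst c \<inter> \<Union>K))" if "c \<in> M" for c unfolding eqU by (intro open_UN) (use UN that in blast)
    moreover have "\<Union>K \<subseteq> carrier_of M" using UN by blast
    ultimately show ?case by blast
  next
    case (Basis s)
    then obtain c' B where s: "s = fst c' \<inter> snd c' -` B" "c' \<in> M" "open B" by auto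
    have "open (snd c ` (fst c \<inter> s))" if c: "c \<in> M" for c
    proof (rule chart_image_open[OF atlas_valid[OF M c] atlas_valid[OF M s(2)] atlas_compatible[OF M c s(2)]])
      have "snd c' ` (fst c \<inter> s) = snd c' ` (fst c \<inter> fst c') \<inter> B" using s by auto
      then show "open (snd c' ` (fst c \<inter> s))"
        using atlas_compatible[OF M c s(2)] s by (auto simp: compatible_def)
    qed (use s in auto)
    then show ?case using s by (auto simp: carrier_of_def)
  qed auto
  have "generate_topology_on ?B W" if W: "W \<subseteq> carrier_of M" "\<forall>c\<in>M. open (snd c ` (fst c \<inter> W))"
  proof -
    have eqc: "fst c \<inter> snd c -` (snd c ` (fst c \<inter> W)) = fst c \<inter> W" if "c \<in> M" for c
      using chart_inj[OF atlas_valid[OF M that]] by auto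
    let ?U = "(\<lambda>c. fst c \<inter> snd c -` (snd c ` (fst c \<inter> W))) ` M"
    have "\<Union>?U = (\<Union>c\<in>M. fst c \<inter> W)" using eqc by blast
    also have "\<dots> = W" using W(1) unfolding carrier_of_def by blast
    finally have Weq: "\<Union>?U = W" .
    have "generate_topology_on ?B (fst c \<inter> snd c -` (snd c ` (fst c \<inter> W)))" if "c \<in> M" for c
      using that W by (intro generate_topology_on.Basis) blast
    then have "generate_topology_on ?B (\<Union>?U)"
      by (intro generate_topology_on.UN) blast
    then show ?thesis by (simp only: Weq)
  qed
  then show ?thesis using eq * by blast
qed

lemma openin_mtop_preimage:
  "atlas M \<Longrightarrow> c \<in> M \<Longrightarrow> open B \<Longrightarrow> openin (mtop M) (fst c \<inter> snd c -` B)"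
  unfolding mtop_def openin_topology_generated_by_iff by (rule generate_topology_on.Basis) blast

lemma openin_chart_dom: "atlas M \<Longrightarrow> c \<in> M \<Longrightarrow> openin (mtop M) (fst c)"
  using openin_mtop_preimage[of M c UNIV] by simp

lemma restrict_chart_openin:
  assumes "mfd M" "c \<in> M" "openin (mtop M) W"
  shows "(fst c \<inter> W, restrict (snd c) (fst c \<inter> W)) \<in> M"
  by (rule restrict_chart[OF assms(1,2)])
    (use assms openin_mtop_iff[OF mfd_atlas[OF assms(1)]] in auto)

lemma topspace_mtop: "atlas M \<Longrightarrow> topspace (mtop M) = carrier_of M"
proof
  assume M: "atlas M"
  show "topspace (mtop M) \<subseteq> carrier_of M" using openin_mtop_iff[OF M] by blast
  have "fst c \<subseteq> topspace (mtop M)" if "c \<in> M" for c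
    using openin_chart_dom[OF M that] openin_subset by blast
  then show "carrier_of M \<subseteq> topspace (mtop M)" by (auto simp: carrier_of_def)
qed

text \<open>Separation and a countable base are pulled back from the Euclidean space along the
  global chart. This makes the model fibre of the trivialization a
  \<open>smooth_manifold\<close>.\<close>

lemma single_chart_smooth_manifold:
  fixes M :: "('p, 'v::euclidean_space) manifold"
  assumes M: "mfd M" and c: "c \<in> M" "fst c = carrier_of M"
  shows "smooth_manifold M"
proof -
  note at = mfd_atlas[OF M]
  have vc: "valid_chart c" using at c atlas_valid by blast
  have "Hausdorff_space (mtop M)"
    unfolding Hausdorff_space_def topspace_mtop[OF at]
  proof (intro allI impI)
    fix x y assume xy: "x \<in> carrier_of M \<and> y \<in> carrier_of M \<and> x \<noteq> y"
    then have "snd c x \<noteq> snd c y" using c vc chart_inj by metis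
    then obtain U V where UV: "open U" "open V" "snd c x \<in> U" "snd c y \<in> V" "U \<inter> V = {}"
      using hausdorff by metis
    show "\<exists>U V. openin (mtop M) U \<and> openin (mtop M) V \<and> x \<in> U \<and> y \<in> V \<and> disjnt U V"
      using openin_mtop_preimage[OF at c(1) UV(1)] openin_mtop_preimage[OF at c(1) UV(2)] UV xy c(2)
      by (intro exI[of _ "fst c \<inter> snd c -` U"] exI[of _ "fst c \<inter> snd c -` V"]) (auto simp: disjnt_iff)
  qed
  moreover have "second_countable (mtop M)"
  proof -
    obtain \<B> :: "'v set set" where B: "countable \<B>" "\<And>V. V \<in> \<B> \<Longrightarrow> open V" "\<And>U. open U \<Longrightarrow> \<exists>\<U>\<subseteq>\<B>. U = \<Union>\<U>"
      using univ_second_countable by metis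
    let ?C = "(\<lambda>V. fst c \<inter> snd c -` V) ` \<B>"
    have "\<exists>U\<in>?C. x \<in> U \<and> U \<subseteq> W" if "openin (mtop M) W" "x \<in> W" for W x
    proof -
      have o: "open (snd c ` (fst c \<inter> W))" and W: "W \<subseteq> fst c"
        using that openin_mtop_iff[OF at] c by auto
      obtain \<U> where U: "\<U> \<subseteq> \<B>" "snd c ` (fst c \<inter> W) = \<Union>\<U>" using B(3)[OF o] by blast
      moreover have "snd c x \<in> snd c ` (fst c \<inter> W)" using that W by blast
      ultimately obtain V where V: "V \<in> \<U>" "snd c x \<in> V" by auto
      have "fst c \<inter> snd c -` V \<subseteq> W"
      proof
        fix q assume q: "q \<in> fst c \<inter> snd c -` V"
        then have "snd c q \<in> snd c ` (fst c \<inter> W)" using U V by blast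
        then show "q \<in> W" using q chart_inj[OF vc] by auto
      qed
      then show ?thesis using V U(1) that W by (intro bexI[of _ "fst c \<inter> snd c -` V"]) auto
    qed
    then show ?thesis
      unfolding second_countable_def
      using B openin_mtop_preimage[OF at c(1)] by (intro exI[of _ ?C]) auto
  qed
  ultimately show ?thesis using M by (simp add: smooth_manifold_def mfd_def)
qed

section \<open>Smooth maps read in arbitrary pairs of charts\<close>

section \<open>Smooth maps\<close>

text \<open>\<open>smooth_map\<close> provides one suitable pair of charts per point; transitions on
  both sides carry smoothness to any pair, on the part of \<open>c\<close> that \<open>f\<close>
  sends into \<open>d\<close>.\<close>

lemma smooth_map_rep:
  assumes M: "atlas M" and N: "atlas N" and f: "smooth_map M N f" and c: "c \<in> M" and d: "d \<in> N"
  shows "open (snd c ` (fst c \<inter> f -` fst d))"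
    and "smooth_on (snd c ` (fst c \<inter> f -` fst d)) (snd d \<circ> f \<circ> chart_inv c)"
proof -
  let ?I = "fst c \<inter> f -` fst d"
  note vc = atlas_valid[OF M c] and vd = atlas_valid[OF N d]
  have *: "\<exists>T. open T \<and> snd c p \<in> T \<and> T \<subseteq> snd c ` ?I \<and> smooth_on T (snd d \<circ> f \<circ> chart_inv c)" if p: "p \<in> ?I" for p
  proof -
    have "p \<in> carrier_of M" using p c by (auto simp: carrier_of_def)
    then obtain c0 d0 where 0: "c0 \<in> M" "d0 \<in> N" "p \<in> fst c0" "f ` fst c0 \<subseteq> fst d0"
      and s0: "smooth_on (snd c0 ` fst c0) (snd d0 \<circ> f \<circ> chart_inv c0)"
      using f unfolding smooth_map_def by blast
    note v0 = atlas_valid[OF M 0(1)] and w0 = atlas_valid[OF N 0(2)]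
    note cc = atlas_compatible[OF M c 0(1)] and dd = atlas_compatible[OF N 0(2) d]
    have "open (snd c0 ` fst c0 \<inter> (snd d0 \<circ> f \<circ> chart_inv c0) -` (snd d0 ` (fst d0 \<inter> fst d)))"
      using smooth_on_continuous[OF s0] valid_chart_open[OF v0] dd
      by (intro continuous_open_preimage) (auto simp: compatible_def)
    also have "snd c0 ` fst c0 \<inter> (snd d0 \<circ> f \<circ> chart_inv c0) -` (snd d0 ` (fst d0 \<inter> fst d)) = snd c0 ` (fst c0 \<inter> f -` fst d)"
    proof (intro equalityI subsetI)
      fix y assume "y \<in> snd c0 ` fst c0 \<inter> (snd d0 \<circ> f \<circ> chart_inv c0) -` (snd d0 ` (fst d0 \<inter> fst d))"
      then obtain q r where qr: "q \<in> fst c0" "y = snd c0 q" "snd d0 (f q) = snd d0 r" "r \<in> fst d0" "r \<in> fst d"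
        by (auto simp: chart_inv_left[OF v0])
      then have "f q = r" using chart_inj[OF w0] 0(4) by auto
      then show "y \<in> snd c0 ` (fst c0 \<inter> f -` fst d)" using qr by auto
    next
      fix y assume "y \<in> snd c0 ` (fst c0 \<inter> f -` fst d)"
      then show "y \<in> snd c0 ` fst c0 \<inter> (snd d0 \<circ> f \<circ> chart_inv c0) -` (snd d0 ` (fst d0 \<inter> fst d))"
        using 0(4) by (auto simp: chart_inv_left[OF v0])
    qed
    finally have o1: "open (snd c0 ` (fst c0 \<inter> f -` fst d))" .
    let ?T = "fst c \<inter> fst c0 \<inter> f -` fst d"
    have "snd c0 ` ?T = snd c0 ` (fst c0 \<inter> f -` fst d) \<inter> snd c0 ` (fst c \<inter> fst c0)"
      by (subst chart_image_Int[OF v0, symmetric]) (auto intro: arg_cong[of _ _ "(`) (snd c0)"])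
    then have oc0: "open (snd c0 ` ?T)" using o1 cc by (auto simp: compatible_def)
    have oc: "open (snd c ` ?T)" by (rule chart_image_open[OF vc v0 cc _ _ oc0]) auto
    have s1: "smooth_on (snd c ` ?T) (snd c0 \<circ> chart_inv c)"
      using cc by (auto simp: compatible_def intro: smooth_on_subset)
    have s2: "smooth_on (snd c0 ` ?T) (snd d0 \<circ> f \<circ> chart_inv c0)"
      by (rule smooth_on_subset[OF s0]) auto
    have s3: "smooth_on (snd d0 ` (fst d0 \<inter> fst d)) (snd d \<circ> chart_inv d0)" and od: "open (snd d0 ` (fst d0 \<inter> fst d))"
      using dd by (auto simp: compatible_def)
    have "smooth_on (snd c ` ?T) (\<lambda>x. (snd d0 \<circ> f \<circ> chart_inv c0) ((snd c0 \<circ> chart_inv c) x))"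
      by (rule smooth_on_compose[OF oc oc0 _ s1 s2]) (auto simp: chart_inv_left[OF vc])
    from smooth_on_compose[OF oc od _ this s3]
    have "smooth_on (snd c ` ?T) (\<lambda>x. (snd d \<circ> chart_inv d0) ((snd d0 \<circ> f \<circ> chart_inv c0) ((snd c0 \<circ> chart_inv c) x)))"
      using 0(4) by (fastforce simp: chart_inv_left[OF vc] chart_inv_left[OF v0])
    then have "smooth_on (snd c ` ?T) (snd d \<circ> f \<circ> chart_inv c)"
    proof (rule smooth_on_cong[OF oc, rotated])
      fix x assume "x \<in> snd c ` ?T"
      then show "(snd d \<circ> chart_inv d0) ((snd d0 \<circ> f \<circ> chart_inv c0) ((snd c0 \<circ> chart_inv c) x)) = (snd d \<circ> f \<circ> chart_inv c) x"
        using 0(4) by (auto simp: chart_inv_left[OF vc] chart_inv_left[OF v0] chart_inv_left[OF w0] image_subset_iff)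
    qed
    then show ?thesis using oc p 0(3) by (intro exI[of _ "snd c ` ?T"]) auto
  qed
  show o: "open (snd c ` ?I)"
  proof (subst open_subopen, rule ballI)
    fix y assume "y \<in> snd c ` ?I"
    then show "\<exists>T. open T \<and> y \<in> T \<and> T \<subseteq> snd c ` ?I" using * by blast
  qed
  show "smooth_on (snd c ` ?I) (snd d \<circ> f \<circ> chart_inv c)"
  proof (rule smooth_on_local[OF _ o])
    fix x assume "x \<in> snd c ` ?I"
    then obtain T where "open T" "x \<in> T" "smooth_on T (snd d \<circ> f \<circ> chart_inv c)" using * by blast
    then show "\<exists>T. open T \<and> x \<in> T \<and> smooth_on (snd c ` ?I \<inter> T) (snd d \<circ> f \<circ> chart_inv c)"
      by (meson inf_le2 smooth_on_subset)
  qed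
qed

lemma smooth_mapI:
  assumes M: "mfd M"
    and *: "\<And>p. p \<in> carrier_of M \<Longrightarrow> \<exists>c\<in>M. \<exists>d\<in>N. \<exists>T. p \<in> T \<and> T \<subseteq> fst c \<and> open (snd c ` T) \<and>
       f ` T \<subseteq> fst d \<and> smooth_on (snd c ` T) (snd d \<circ> f \<circ> chart_inv c)"
  shows "smooth_map M N f"
  unfolding smooth_map_def
proof (intro conjI ballI)
  show "f ` carrier_of M \<subseteq> carrier_of N"
    using * by (fastforce simp: carrier_of_def)
  fix p assume "p \<in> carrier_of M"
  from *[OF this] obtain c d T where 1: "c \<in> M" "d \<in> N" "p \<in> T" "T \<subseteq> fst c" "open (snd c ` T)"
      "f ` T \<subseteq> fst d" "smooth_on (snd c ` T) (snd d \<circ> f \<circ> chart_inv c)" by blast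
  let ?c = "(T, restrict (snd c) T)"
  have "?c \<in> M" using restrict_chart[OF M 1(1,4,5)] .
  moreover have "smooth_on (snd ?c ` fst ?c) (snd d \<circ> f \<circ> chart_inv ?c)"
    using smooth_on_cong[OF 1(5) _ 1(7), of "snd d \<circ> f \<circ> chart_inv ?c"]
      chart_inv_restrict[OF atlas_valid[OF mfd_atlas[OF M] 1(1)] 1(4)] by simp
  ultimately show "\<exists>c\<in>M. \<exists>d\<in>N. p \<in> fst c \<and> f ` fst c \<subseteq> fst d \<and> smooth_on (snd c ` fst c) (snd d \<circ> f \<circ> chart_inv c)"
    using 1 by (intro bexI[of _ ?c] bexI[of _ d]) auto
qed

lemma smooth_map_carrier: "smooth_map M N f \<Longrightarrow> p \<in> carrier_of M \<Longrightarrow> f p \<in> carrier_of N"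
  by (auto simp: smooth_map_def)

lemma smooth_map_comp:
  assumes M: "mfd M" and N: "mfd N" and P: "mfd P" and f: "smooth_map M N f" and g: "smooth_map N P g"
  shows "smooth_map M P (g \<circ> f)"
proof (rule smooth_mapI[OF M])
  fix p assume p: "p \<in> carrier_of M"
  then obtain c d e where c: "c \<in> M" "p \<in> fst c" and d: "d \<in> N" "f p \<in> fst d" and e: "e \<in> P" "g (f p) \<in> fst e"
    using smooth_map_carrier[OF f] smooth_map_carrier[OF g] by (fastforce simp: carrier_of_def)
  note fr = smooth_map_rep[OF mfd_atlas[OF M] mfd_atlas[OF N] f c(1) d(1)]
  note gr = smooth_map_rep[OF mfd_atlas[OF N] mfd_atlas[OF P] g d(1) e(1)]
  have vc: "valid_chart c" and vd: "valid_chart d" using atlas_valid M N c d mfd_atlas by blast+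
  let ?T = "fst c \<inter> f -` (fst d \<inter> g -` fst e)"
  have "open (snd c ` (fst c \<inter> f -` fst d) \<inter> (snd d \<circ> f \<circ> chart_inv c) -` (snd d ` (fst d \<inter> g -` fst e)))"
    using smooth_on_continuous[OF fr(2)] fr(1) gr(1) by (intro continuous_open_preimage)
  also have "snd c ` (fst c \<inter> f -` fst d) \<inter> (snd d \<circ> f \<circ> chart_inv c) -` (snd d ` (fst d \<inter> g -` fst e)) = snd c ` ?T"
    by (auto simp: chart_inv_left[OF vc] dest!: chart_inj[OF vd, rotated 2])
  finally have o: "open (snd c ` ?T)" .
  have "smooth_on (snd c ` ?T) (\<lambda>x. (snd e \<circ> g \<circ> chart_inv d) ((snd d \<circ> f \<circ> chart_inv c) x))"
    by (rule smooth_on_compose[OF o gr(1) _ smooth_on_subset[OF fr(2)] gr(2)]) (auto simp: chart_inv_left[OF vc])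
  then have "smooth_on (snd c ` ?T) (snd e \<circ> (g \<circ> f) \<circ> chart_inv c)"
    by (rule smooth_on_cong[OF o, rotated]) (auto simp: chart_inv_left[OF vc] chart_inv_left[OF vd])
  then show "\<exists>c\<in>M. \<exists>d\<in>P. \<exists>T. p \<in> T \<and> T \<subseteq> fst c \<and> open (snd c ` T) \<and> (g \<circ> f) ` T \<subseteq> fst d \<and>
      smooth_on (snd c ` T) (snd d \<circ> (g \<circ> f) \<circ> chart_inv c)"
    using c d e o by (intro bexI[of _ c] bexI[of _ e] exI[of _ ?T]) auto
qed

lemma smooth_map_cong:
  assumes M: "mfd M" and f: "smooth_map M N f" and eq: "\<And>p. p \<in> carrier_of M \<Longrightarrow> f p = g p"
  shows "smooth_map M N g"
  unfolding smooth_map_def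
proof (intro conjI ballI)
  show "g ` carrier_of M \<subseteq> carrier_of N" using f eq by (auto simp: smooth_map_def image_subset_iff)
  fix p assume "p \<in> carrier_of M"
  then obtain c d where 1: "c \<in> M" "d \<in> N" "p \<in> fst c" "f ` fst c \<subseteq> fst d" "smooth_on (snd c ` fst c) (snd d \<circ> f \<circ> chart_inv c)"
    using f by (auto simp: smooth_map_def)
  have vc: "valid_chart c" using atlas_valid[OF mfd_atlas[OF M] 1(1)] .
  have eqc: "f q = g q" if "q \<in> fst c" for q using eq that 1(1) by (auto simp: carrier_of_def)
  have "smooth_on (snd c ` fst c) (snd d \<circ> g \<circ> chart_inv c)"
    by (rule smooth_on_cong[OF valid_chart_open[OF vc] _ 1(5)]) (auto simp: chart_inv_left[OF vc] eqc)
  then show "\<exists>c\<in>M. \<exists>d\<in>N. p \<in> fst c \<and> g ` fst c \<subseteq> fst d \<and> smooth_on (snd c ` fst c) (snd d \<circ> g \<circ> chart_inv c)"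
    using 1 eqc by (intro bexI[of _ c] bexI[of _ d]) auto
qed

section \<open>Tangent vectors in coordinates and the chain rule for differentials\<close>

section \<open>Tangent spaces\<close>

lemma charts_at_carrier: "c \<in> charts_at M p \<Longrightarrow> p \<in> carrier_of M"
  by (auto simp: charts_at_def carrier_of_def)

lemma carrier_charts_at: "p \<in> carrier_of M \<Longrightarrow> \<exists>c. c \<in> charts_at M p"
  by (auto simp: charts_at_def carrier_of_def)

lemma transition_has_derivative:
  assumes M: "atlas M" and c: "c \<in> charts_at M p" and d: "d \<in> charts_at M p"
  shows "((snd d \<circ> chart_inv c) has_derivative frechet_derivative (snd d \<circ> chart_inv c) (at (snd c p))) (at (snd c p))"
  using atlas_compatible[OF M, of c d] c d
  by (intro smooth_on_has_derivative[of "snd c ` (fst c \<inter> fst d)"]) (auto simp: charts_at_def compatible_def)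

lemma rep_has_derivative:
  assumes M: "atlas M" and N: "atlas N" and f: "smooth_map M N f" and c: "c \<in> charts_at M p" and d: "d \<in> charts_at N (f p)"
  shows "((snd d \<circ> f \<circ> chart_inv c) has_derivative frechet_derivative (snd d \<circ> f \<circ> chart_inv c) (at (snd c p))) (at (snd c p))"
  using smooth_map_rep[OF M N f, of c d] c d
  by (intro smooth_on_has_derivative[of "snd c ` (fst c \<inter> f -` fst d)"]) (auto simp: charts_at_def)

lemma smooth_map_id: "mfd M \<Longrightarrow> smooth_map M M id"
proof (rule smooth_mapI)
  fix p assume M: "mfd M" and "p \<in> carrier_of M"
  then obtain c where c: "c \<in> M" "p \<in> fst c" by (auto simp: carrier_of_def)
  have v: "valid_chart c" using M c atlas_valid mfd_atlas by blast
  have "smooth_on (snd c ` fst c) (snd c \<circ> id \<circ> chart_inv c)"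
    by (rule smooth_on_cong[OF valid_chart_open[OF v] _ smooth_on_ident]) (auto simp: chart_inv_left[OF v])
  then show "\<exists>c\<in>M. \<exists>d\<in>M. \<exists>T. p \<in> T \<and> T \<subseteq> fst c \<and> open (snd c ` T) \<and> id ` T \<subseteq> fst d \<and> smooth_on (snd c ` T) (snd d \<circ> id \<circ> chart_inv c)"
    using c valid_chart_open[OF v] by (intro bexI[of _ c] exI[of _ "fst c"]) auto
qed

text \<open>Chain rule for coordinate representatives. With identity maps in place of
  \<open>f\<close> or \<open>g\<close> it becomes the cocycle rule for transitions and the chart
  independence of \<open>tmap\<close>.\<close>

lemma rep_derivative_comp:
  assumes M: "atlas M" and N: "atlas N" and P: "atlas P" and f: "smooth_map M N f" and g: "smooth_map N P g"
    and c: "c \<in> charts_at M p" and d: "d \<in> charts_at N (f p)" and e: "e \<in> charts_at P (g (f p))"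
  shows "frechet_derivative (snd e \<circ> g \<circ> chart_inv d) (at (snd d (f p))) (frechet_derivative (snd d \<circ> f \<circ> chart_inv c) (at (snd c p)) w)
     = frechet_derivative (snd e \<circ> (g \<circ> f) \<circ> chart_inv c) (at (snd c p)) w"
proof -
  have vc: "valid_chart c" "valid_chart d" using c d M N by (auto simp: charts_at_def atlas_valid)
  have pc: "p \<in> fst c" using c by (simp add: charts_at_def)
  let ?F = "snd d \<circ> f \<circ> chart_inv c" and ?G = "snd e \<circ> g \<circ> chart_inv d"
  note fr = rep_has_derivative[OF M N f c d]
  have gr: "(?G has_derivative frechet_derivative ?G (at (snd d (f p)))) (at (?F (snd c p)))"
    using rep_has_derivative[OF N P g d e] by (simp add: chart_inv_left[OF vc(1) pc])
  have h: "(?G \<circ> ?F has_derivative frechet_derivative ?G (at (snd d (f p))) \<circ> frechet_derivative ?F (at (snd c p))) (at (snd c p))"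
    by (rule diff_chain_at[OF fr gr])
  have c1: "c \<in> M" "d \<in> N" using c d by (auto simp: charts_at_def)
  have "(snd e \<circ> (g \<circ> f) \<circ> chart_inv c has_derivative frechet_derivative ?G (at (snd d (f p))) \<circ> frechet_derivative ?F (at (snd c p))) (at (snd c p))"
  proof (rule has_derivative_transform_within_open[OF h smooth_map_rep(1)[OF M N f c1]])
    show "snd c p \<in> snd c ` (fst c \<inter> f -` fst d)" using pc d by (auto simp: charts_at_def)
    show "(?G \<circ> ?F) x = (snd e \<circ> (g \<circ> f) \<circ> chart_inv c) x" if "x \<in> snd c ` (fst c \<inter> f -` fst d)" for x
      using that by (auto simp: chart_inv_left[OF vc(1)] chart_inv_left[OF vc(2)])
  qed
  then show ?thesis by (metis comp_apply frechet_derivative_at)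
qed

lemma transition_comp:
  assumes M: "mfd M" and c: "c \<in> charts_at M p" and d: "d \<in> charts_at M p" and e: "e \<in> charts_at M p"
  shows "frechet_derivative (snd e \<circ> chart_inv d) (at (snd d p)) (frechet_derivative (snd d \<circ> chart_inv c) (at (snd c p)) w)
     = frechet_derivative (snd e \<circ> chart_inv c) (at (snd c p)) w"
  using rep_derivative_comp[OF mfd_atlas[OF M] mfd_atlas[OF M] mfd_atlas[OF M] smooth_map_id[OF M] smooth_map_id[OF M] c, of d e w] d e
  by simp

lemma transition_self:
  assumes M: "atlas M" and c: "c \<in> charts_at M p"
  shows "frechet_derivative (snd c \<circ> chart_inv c) (at (snd c p)) w = w"
proof -
  have v: "valid_chart c" and p: "p \<in> fst c" using M c by (auto simp: charts_at_def atlas_valid)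
  have "(snd c \<circ> chart_inv c has_derivative (\<lambda>x. x)) (at (snd c p))"
    by (rule has_derivative_transform_within_open[OF has_derivative_ident valid_chart_open[OF v]])
      (use p v in \<open>auto simp: chart_inv_left\<close>)
  then show ?thesis by (metis frechet_derivative_at)
qed

lemma coord_vec_apply:
  "d \<in> charts_at M p \<Longrightarrow> coord_vec M c p w d = frechet_derivative (snd d \<circ> chart_inv c) (at (snd c p)) w"
  by (simp add: coord_vec_def)

lemma coord_vec_same: "atlas M \<Longrightarrow> c \<in> charts_at M p \<Longrightarrow> coord_vec M c p w c = w"
  by (simp add: coord_vec_apply transition_self)

lemma coord_vec_tangent: "mfd M \<Longrightarrow> c \<in> charts_at M p \<Longrightarrow> coord_vec M c p w \<in> tangent_space M p"
  by (auto simp: tangent_space_def coord_vec_def transition_comp)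

lemma tangent_law:
  "v \<in> tangent_space M p \<Longrightarrow> c \<in> charts_at M p \<Longrightarrow> d \<in> charts_at M p \<Longrightarrow>
     v d = frechet_derivative (snd d \<circ> chart_inv c) (at (snd c p)) (v c)"
  "v \<in> tangent_space M p \<Longrightarrow> d \<notin> charts_at M p \<Longrightarrow> v d = 0"
  unfolding tangent_space_def by blast+

lemma tangent_coord:
  assumes "c \<in> charts_at M p" "v \<in> tangent_space M p"
  shows "coord_vec M c p (v c) = v"
proof
  fix d show "coord_vec M c p (v c) d = v d"
  proof (cases "d \<in> charts_at M p")
    case True
    show ?thesis unfolding coord_vec_apply[OF True] by (rule tangent_law(1)[OF assms(2,1) True, symmetric])
  next
    case False
    then show ?thesis using tangent_law(2)[OF assms(2) False] by (simp only: coord_vec_def if_False)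
  qed
qed

lemma tangent_eqI:
  "c \<in> charts_at M p \<Longrightarrow> v \<in> tangent_space M p \<Longrightarrow> w \<in> tangent_space M p \<Longrightarrow> v c = w c \<Longrightarrow> v = w"
  by (metis tangent_coord)

lemma linear_coord_vec:
  assumes "atlas M" "c \<in> charts_at M p"
  shows "linear (coord_vec M c p)"
proof -
  have l: "linear (frechet_derivative (snd d \<circ> chart_inv c) (at (snd c p)))" if "d \<in> charts_at M p" for d
    using transition_has_derivative[OF assms that] has_derivative_linear by blast
  have "coord_vec M c p (x + y) d = (coord_vec M c p x + coord_vec M c p y) d" for x y d
    by (cases "d \<in> charts_at M p") (simp_all add: coord_vec_def linear_add[OF l])
  moreover have "coord_vec M c p (r *\<^sub>R x) d = (r *\<^sub>R coord_vec M c p x) d" for r x d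
    by (cases "d \<in> charts_at M p") (simp_all add: coord_vec_def scaleR_fun_def linear_scale[OF l])
  ultimately show ?thesis by (intro linearI ext)
qed

lemma linear_fun_apply: "linear (\<lambda>v. v c)"
  by (rule linearI) (auto simp: scaleR_fun_def)

lemma subspace_tangent_space:
  assumes "mfd M" "p \<in> carrier_of M"
  shows "subspace (tangent_space M p)"
proof -
  obtain c where c: "c \<in> charts_at M p" using carrier_charts_at[OF assms(2)] by blast
  have "tangent_space M p = range (coord_vec M c p)"
    using coord_vec_tangent[OF assms(1) c] by (auto simp: image_iff intro!: exI[of _ "_ c"] dest: tangent_coord[OF c, symmetric])
  then show ?thesis
    using linear_subspace_image[OF linear_coord_vec[OF mfd_atlas[OF assms(1)] c] subspace_UNIV] by simp
qed

text \<open>The transformation law of \<open>v\<close> absorbs the arbitrary chart chosen in the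
  definition of \<open>tmap\<close>.\<close>

lemma tmap_apply:
  assumes M: "mfd M" and N: "mfd N" and f: "smooth_map M N f" and v: "v \<in> tangent_space M p"
    and c: "c \<in> charts_at M p" and d: "d \<in> charts_at N (f p)"
  shows "tmap M N f p v d = frechet_derivative (snd d \<circ> f \<circ> chart_inv c) (at (snd c p)) (v c)"
proof -
  define c0 where "c0 = (SOME c. c \<in> charts_at M p)"
  have c0: "c0 \<in> charts_at M p" unfolding c0_def using c by (rule someI)
  have "v c0 = frechet_derivative (snd c0 \<circ> id \<circ> chart_inv c) (at (snd c p)) (v c)"
    unfolding comp_id using tangent_law(1)[OF v c c0] .
  then have "frechet_derivative (snd d \<circ> f \<circ> chart_inv c0) (at (snd c0 p)) (v c0) = frechet_derivative (snd d \<circ> f \<circ> chart_inv c) (at (snd c p)) (v c)"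
    using rep_derivative_comp[OF mfd_atlas[OF M] mfd_atlas[OF M] mfd_atlas[OF N] smooth_map_id[OF M] f c, of c0 d] c0 d by simp
  then show ?thesis using d by (simp add: tmap_def c0_def[symmetric])
qed

lemma linear_tmap:
  assumes M: "mfd M" and N: "mfd N" and f: "smooth_map M N f" and p: "p \<in> carrier_of M"
  shows "linear (tmap M N f p)"
proof -
  define c0 where "c0 = (SOME c. c \<in> charts_at M p)"
  have c0: "c0 \<in> charts_at M p" unfolding c0_def using carrier_charts_at[OF p] by (metis someI)
  have l: "linear (frechet_derivative (snd d \<circ> f \<circ> chart_inv c0) (at (snd c0 p)))" if "d \<in> charts_at N (f p)" for d
    using rep_has_derivative[OF mfd_atlas[OF M] mfd_atlas[OF N] f c0 that] has_derivative_linear by blast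
  have "tmap M N f p (x + y) d = (tmap M N f p x + tmap M N f p y) d" for x y d
    by (cases "d \<in> charts_at N (f p)") (simp_all add: tmap_def c0_def[symmetric] linear_add[OF l])
  moreover have "tmap M N f p (r *\<^sub>R x) d = (r *\<^sub>R tmap M N f p x) d" for r x d
    by (cases "d \<in> charts_at N (f p)") (simp_all add: tmap_def c0_def[symmetric] scaleR_fun_def linear_scale[OF l])
  ultimately show ?thesis by (intro linearI ext)
qed

lemma tmap_coord_vec:
  assumes M: "mfd M" and N: "mfd N" and f: "smooth_map M N f"
    and c: "c \<in> charts_at M p" and d: "d \<in> charts_at N (f p)"
  shows "tmap M N f p (coord_vec M c p w) = coord_vec N d (f p) (frechet_derivative (snd d \<circ> f \<circ> chart_inv c) (at (snd c p)) w)"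
proof
  fix e
  show "tmap M N f p (coord_vec M c p w) e = coord_vec N d (f p) (frechet_derivative (snd d \<circ> f \<circ> chart_inv c) (at (snd c p)) w) e"
  proof (cases "e \<in> charts_at N (f p)")
    case True
    have "tmap M N f p (coord_vec M c p w) e = frechet_derivative (snd e \<circ> f \<circ> chart_inv c) (at (snd c p)) w"
      using tmap_apply[OF M N f coord_vec_tangent[OF M c] c True] by (simp add: coord_vec_same[OF mfd_atlas[OF M] c])
    then show ?thesis
      using rep_derivative_comp[OF mfd_atlas[OF M] mfd_atlas[OF N] mfd_atlas[OF N] f smooth_map_id[OF N] c d, of e w] True
      by (simp add: coord_vec_apply)
  qed (simp add: tmap_def coord_vec_def Let_def)
qed

lemma tmap_tangent:
  assumes M: "mfd M" and N: "mfd N" and f: "smooth_map M N f" and v: "v \<in> tangent_space M p" and p: "p \<in> carrier_of M"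
  shows "tmap M N f p v \<in> tangent_space N (f p)"
proof -
  obtain c d where c: "c \<in> charts_at M p" and d: "d \<in> charts_at N (f p)"
    using carrier_charts_at[OF p] carrier_charts_at[OF smooth_map_carrier[OF f p]] by blast
  show ?thesis
    using tmap_coord_vec[OF M N f c d, of "v c"] coord_vec_tangent[OF N d] tangent_coord[OF c v] by simp
qed

lemma tmap_comp:
  assumes M: "mfd M" and N: "mfd N" and P: "mfd P" and f: "smooth_map M N f" and g: "smooth_map N P g"
    and v: "v \<in> tangent_space M p" and p: "p \<in> carrier_of M"
  shows "tmap M P (g \<circ> f) p v = tmap N P g (f p) (tmap M N f p v)"
proof -
  obtain c d where c: "c \<in> charts_at M p" and d: "d \<in> charts_at N (f p)"
    using carrier_charts_at[OF p] carrier_charts_at[OF smooth_map_carrier[OF f p]] by blast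
  obtain e where e: "e \<in> charts_at P (g (f p))"
    using carrier_charts_at[OF smooth_map_carrier[OF g smooth_map_carrier[OF f p]]] by blast
  have e': "e \<in> charts_at P ((g \<circ> f) p)" using e by simp
  have "tmap M P (g \<circ> f) p (coord_vec M c p (v c)) = tmap N P g (f p) (tmap M N f p (coord_vec M c p (v c)))"
    unfolding tmap_coord_vec[OF M P smooth_map_comp[OF M N P f g] c e'] tmap_coord_vec[OF M N f c d] tmap_coord_vec[OF N P g d e]
    using rep_derivative_comp[OF mfd_atlas[OF M] mfd_atlas[OF N] mfd_atlas[OF P] f g c d e] by simp
  then show ?thesis using tangent_coord[OF c v] by simp
qed

lemma tmap_cong:
  assumes M: "mfd M" and N: "mfd N" and f: "smooth_map M N f" and eq: "\<And>p. p \<in> carrier_of M \<Longrightarrow> f p = g p"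
    and v: "v \<in> tangent_space M p" and p: "p \<in> carrier_of M"
  shows "tmap M N g p v = tmap M N f p v"
proof -
  note g = smooth_map_cong[OF M f eq]
  obtain c d where c: "c \<in> charts_at M p" and d: "d \<in> charts_at N (f p)"
    using carrier_charts_at[OF p] carrier_charts_at[OF smooth_map_carrier[OF f p]] by blast
  have d': "d \<in> charts_at N (g p)" using d eq[OF p] by simp
  have cM: "c \<in> M" "p \<in> fst c" using c by (auto simp: charts_at_def)
  have vc: "valid_chart c" using atlas_valid[OF mfd_atlas[OF M] cM(1)] .
  have "frechet_derivative (snd d \<circ> g \<circ> chart_inv c) (at (snd c p)) = frechet_derivative (snd d \<circ> f \<circ> chart_inv c) (at (snd c p))"
  proof (rule frechet_derivative_at[symmetric])
    have fg: "f q = g q" if "q \<in> fst c" for q using eq[of q] that cM(1) unfolding carrier_of_def by blast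
    show "(snd d \<circ> g \<circ> chart_inv c has_derivative frechet_derivative (snd d \<circ> f \<circ> chart_inv c) (at (snd c p))) (at (snd c p))"
      by (rule has_derivative_transform_within_open[OF rep_has_derivative[OF mfd_atlas[OF M] mfd_atlas[OF N] f c d] valid_chart_open[OF vc]])
        (use cM fg in \<open>auto simp: chart_inv_left[OF vc]\<close>)
  qed
  then show ?thesis
    using tmap_coord_vec[OF M N f c d, of "v c"] tmap_coord_vec[OF M N g c d', of "v c"] eq[OF p] tangent_coord[OF c v] by simp
qed

section \<open>Open submanifolds, and differentials of local diffeomorphisms\<close>

section \<open>Open submanifolds and local diffeomorphisms\<close>

lemma open_sub_subset: "open_sub M W \<subseteq> M"
  by (auto simp: open_sub_def)

lemma carrier_open_sub:
  assumes M: "mfd M" and W: "openin (mtop M) W"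
  shows "carrier_of (open_sub M W) = W"
proof
  show "carrier_of (open_sub M W) \<subseteq> W" by (auto simp: carrier_of_def open_sub_def)
  show "W \<subseteq> carrier_of (open_sub M W)"
  proof
    fix p assume p: "p \<in> W"
    then have "p \<in> carrier_of M" using openin_mtop_iff[OF mfd_atlas[OF M]] W by blast
    then obtain c where c: "c \<in> M" "p \<in> fst c" by (auto simp: carrier_of_def)
    have *: "(fst c \<inter> W, restrict (snd c) (fst c \<inter> W)) \<in> open_sub M W"
      using restrict_chart_openin[OF M c(1) W] by (auto simp: open_sub_def)
    show "p \<in> carrier_of (open_sub M W)"
      unfolding carrier_of_def by (rule UnionI[OF imageI[OF *]]) (use c p in simp)
  qed
qed

text \<open>The point is maximality: a chart inside \<open>W\<close> that is compatible with the
  charts lying in \<open>W\<close> is compatible with every chart of \<open>M\<close>, because it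
  meets only the part of the latter over \<open>W\<close>.\<close>

lemma mfd_open_sub:
  assumes M: "mfd M" and W: "openin (mtop M) W"
  shows "mfd (open_sub M W)"
proof -
  have at: "atlas (open_sub M W)"
    using mfd_atlas[OF M] open_sub_subset[of M W] by (auto simp: atlas_def subset_iff)
  have "c \<in> open_sub M W" if c: "c \<in> max_atlas (open_sub M W)" for c
  proof -
    have vc: "valid_chart c" and cW: "fst c \<subseteq> W"
      using c by (auto simp: max_atlas_def open_sub_def)
    have "compatible c d" if d: "d \<in> M" for d
    proof -
      let ?d = "(fst d \<inter> W, restrict (snd d) (fst d \<inter> W))"
      have vd: "valid_chart d" using atlas_valid[OF mfd_atlas[OF M] d] .
      have "?d \<in> open_sub M W"
        using restrict_chart_openin[OF M d W] by (auto simp: open_sub_def)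
      then have comp: "compatible c ?d" using c by (auto simp: max_atlas_def)
      have eq: "fst c \<inter> fst ?d = fst c \<inter> fst d" using cW by auto
      have im: "snd ?d ` (fst c \<inter> fst d) = snd d ` (fst c \<inter> fst d)" using cW by auto
      have o: "open (snd c ` (fst c \<inter> fst d))" "open (snd d ` (fst c \<inter> fst d))"
        using comp im unfolding compatible_def eq by auto
      have "smooth_on (snd c ` (fst c \<inter> fst d)) (snd d \<circ> chart_inv c)"
        by (rule smooth_on_cong[OF o(1), of "snd ?d \<circ> chart_inv c"])
          (use comp cW in \<open>auto simp: compatible_def eq[simplified] chart_inv_left[OF vc]\<close>)
      moreover have "smooth_on (snd d ` (fst c \<inter> fst d)) (snd c \<circ> chart_inv d)"
      proof (rule smooth_on_cong[OF o(2), of "snd c \<circ> chart_inv ?d"])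
        show "smooth_on (snd d ` (fst c \<inter> fst d)) (snd c \<circ> chart_inv ?d)"
          using comp im unfolding compatible_def eq by auto
        show "(snd c \<circ> chart_inv ?d) x = (snd c \<circ> chart_inv d) x" if "x \<in> snd d ` (fst c \<inter> fst d)" for x
          using chart_inv_restrict[OF vd, of "fst d \<inter> W" x] that cW by auto
      qed
      ultimately show ?thesis using o by (simp add: compatible_def)
    qed
    moreover have "fst c \<subseteq> \<Union> (fst ` M)" using c open_sub_subset[of M W] unfolding max_atlas_def by blast
    ultimately have "c \<in> max_atlas M" using vc by (auto simp: max_atlas_def)
    then show ?thesis using M cW by (auto simp: mfd_def open_sub_def)
  qed
  then show ?thesis using at by (auto simp: mfd_def)
qed

lemma smooth_map_open_sub_incl:
  assumes M: "mfd M" and W: "openin (mtop M) W"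
  shows "smooth_map (open_sub M W) M id"
  unfolding smooth_map_def
proof (intro conjI ballI)
  show "id ` carrier_of (open_sub M W) \<subseteq> carrier_of M"
    using open_sub_subset[of M W] by (auto simp: carrier_of_def)
  fix p assume "p \<in> carrier_of (open_sub M W)"
  then obtain c where c: "c \<in> open_sub M W" "p \<in> fst c" by (auto simp: carrier_of_def)
  have cM: "c \<in> M" using c open_sub_subset by blast
  have v: "valid_chart c" using atlas_valid[OF mfd_atlas[OF M] cM] .
  have "smooth_on (snd c ` fst c) (snd c \<circ> id \<circ> chart_inv c)"
    by (rule smooth_on_cong[OF valid_chart_open[OF v] _ smooth_on_ident]) (auto simp: chart_inv_left[OF v])
  then show "\<exists>c\<in>open_sub M W. \<exists>d\<in>M. p \<in> fst c \<and> id ` fst c \<subseteq> fst d \<and> smooth_on (snd c ` fst c) (snd d \<circ> id \<circ> chart_inv c)"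
    using c cM by (intro bexI[of _ c]) auto
qed

text \<open>A tangent vector is a function on all charts at the point, nonzero at most on those of
  the manifold in question. Fewer charts give a different set of vectors, so the identification has
  to be made by the differential of the inclusion.\<close>

lemma tmap_open_sub_incl_bij:
  assumes M: "mfd M" and W: "openin (mtop M) W" and p: "p \<in> W"
  shows "bij_betw (tmap (open_sub M W) M id p) (tangent_space (open_sub M W) p) (tangent_space M p)"
proof -
  note M' = mfd_open_sub[OF M W]
  have p': "p \<in> carrier_of (open_sub M W)" using carrier_open_sub[OF M W] p by simp
  obtain c where c: "c \<in> charts_at (open_sub M W) p" using carrier_charts_at[OF p'] by blast
  then have cM': "c \<in> charts_at M p" using open_sub_subset[of M W] unfolding charts_at_def by blast
  then have cM: "c \<in> charts_at M (id p)" unfolding id_apply .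
  have eq: "tmap (open_sub M W) M id p (coord_vec (open_sub M W) c p w) = coord_vec M c p w" for w
    using tmap_coord_vec[where f=id, OF M' M smooth_map_open_sub_incl[OF M W] c cM, of w]
    unfolding comp_id id_apply transition_self[OF mfd_atlas[OF M] cM'] .
  show ?thesis
  proof (rule bij_betwI')
    fix v w assume vw: "v \<in> tangent_space (open_sub M W) p" "w \<in> tangent_space (open_sub M W) p"
    show "(tmap (open_sub M W) M id p v = tmap (open_sub M W) M id p w) = (v = w)"
    proof
      assume "tmap (open_sub M W) M id p v = tmap (open_sub M W) M id p w"
      then have "coord_vec M c p (v c) = coord_vec M c p (w c)"
        using eq[of "v c"] eq[of "w c"] tangent_coord[OF c] vw by simp
      then show "v = w" using coord_vec_same[OF mfd_atlas[OF M], of c p] cM tangent_eqI[OF c vw] by (metis id_apply)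
    qed simp
  next
    fix v assume "v \<in> tangent_space (open_sub M W) p"
    then show "tmap (open_sub M W) M id p v \<in> tangent_space M p"
      using tmap_tangent[OF M' M smooth_map_open_sub_incl[OF M W] _ p'] by simp
  next
    fix v assume "v \<in> tangent_space M p"
    then have "v = tmap (open_sub M W) M id p (coord_vec (open_sub M W) c p (v c))"
      using eq tangent_coord[of c M p v] cM by simp
    then show "\<exists>x\<in>tangent_space (open_sub M W) p. v = tmap (open_sub M W) M id p x"
      using coord_vec_tangent[OF M' c] by blast
  qed
qed

lemma smooth_map_into_open_sub:
  assumes M: "mfd M" and N: "mfd N" and V: "openin (mtop N) V" and f: "smooth_map M (open_sub N V) f"
  shows "smooth_map M N f"
  using smooth_map_comp[OF M mfd_open_sub[OF N V] N f smooth_map_open_sub_incl[OF N V]] by simp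

lemma diffeo_open_sub_inverse:
  assumes M: "mfd M" and N: "mfd N" and W: "openin (mtop M) W" and V: "openin (mtop N) (f ` W)"
    and d: "diffeo (open_sub M W) (open_sub N (f ` W)) f"
  obtains g where "smooth_map (open_sub N (f ` W)) (open_sub M W) g"
    "\<And>p. p \<in> W \<Longrightarrow> g (f p) = p" "\<And>q. q \<in> f ` W \<Longrightarrow> f (g q) = q"
proof -
  have c: "carrier_of (open_sub M W) = W" using carrier_open_sub[OF M W] .
  have inj: "inj_on f W" using d by (simp add: diffeo_def c bij_betw_def)
  show thesis
  proof (rule that[of "inv_into W f"])
    show "smooth_map (open_sub N (f ` W)) (open_sub M W) (inv_into W f)" using d by (simp add: diffeo_def c)
    show "inv_into W f (f p) = p" if "p \<in> W" for p using inj that by simp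
    show "f (inv_into W f q) = q" if "q \<in> f ` W" for q using that by (simp add: f_inv_into_f)
  qed
qed

lemma local_diffeo_smooth_map:
  assumes M: "mfd M" and N: "mfd N" and f: "local_diffeo M N f"
  shows "smooth_map M N f"
proof (rule smooth_mapI[OF M])
  fix p assume "p \<in> carrier_of M"
  then obtain W where W: "openin (mtop M) W" "p \<in> W" "openin (mtop N) (f ` W)" "diffeo (open_sub M W) (open_sub N (f ` W)) f"
    using f unfolding local_diffeo_def by blast
  then have "smooth_map (open_sub M W) (open_sub N (f ` W)) f" by (simp add: diffeo_def)
  moreover have "p \<in> carrier_of (open_sub M W)" using carrier_open_sub[OF M W(1)] W by simp
  ultimately obtain c d where "c \<in> open_sub M W" "d \<in> open_sub N (f ` W)" "p \<in> fst c" "f ` fst c \<subseteq> fst d"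
      "smooth_on (snd c ` fst c) (snd d \<circ> f \<circ> chart_inv c)"
    unfolding smooth_map_def by blast
  moreover from this have "c \<in> M" "d \<in> N" "open (snd c ` fst c)"
    using open_sub_subset[of M W] open_sub_subset[of N "f ` W"] valid_chart_open[OF atlas_valid[OF mfd_atlas[OF M], of c]] by blast+
  ultimately show "\<exists>c\<in>M. \<exists>d\<in>N. \<exists>T. p \<in> T \<and> T \<subseteq> fst c \<and> open (snd c ` T) \<and> f ` T \<subseteq> fst d \<and> smooth_on (snd c ` T) (snd d \<circ> f \<circ> chart_inv c)"
    by (intro bexI[of _ c] bexI[of _ d] exI[of _ "fst c"]) auto
qed

text \<open>The chain rule for \<open>f\<close> and its local inverse \<open>g\<close>, with the
  tangent spaces of the open submanifolds as intermediate stations.\<close>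

lemma local_diffeo_tmap_bij:
  assumes M: "mfd M" and N: "mfd N" and f: "local_diffeo M N f" and p: "p \<in> carrier_of M"
  shows "bij_betw (tmap M N f p) (tangent_space M p) (tangent_space N (f p))"
proof -
  note sf = local_diffeo_smooth_map[OF M N f]
  obtain W where W: "openin (mtop M) W" "p \<in> W" "openin (mtop N) (f ` W)" and di: "diffeo (open_sub M W) (open_sub N (f ` W)) f"
    using f p unfolding local_diffeo_def by blast
  define M' N' where "M' = open_sub M W" and "N' = open_sub N (f ` W)"
  obtain g where g: "smooth_map N' M' g" and gf: "\<And>p. p \<in> W \<Longrightarrow> g (f p) = p" and fg: "\<And>q. q \<in> f ` W \<Longrightarrow> f (g q) = q"
    using diffeo_open_sub_inverse[OF M N W(1,3) di] unfolding M'_def N'_def by metis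
  have f': "smooth_map M' N' f" using di by (simp add: diffeo_def M'_def N'_def)
  have mM': "mfd M'" and mN': "mfd N'" using mfd_open_sub M N W by (auto simp: M'_def N'_def)
  have cM: "carrier_of M' = W" and cN: "carrier_of N' = f ` W"
    using carrier_open_sub M N W by (auto simp: M'_def N'_def)
  have iM: "smooth_map M' M id" and iN: "smooth_map N' N id"
    using smooth_map_open_sub_incl M N W by (auto simp: M'_def N'_def)
  have bM: "bij_betw (tmap M' M id p) (tangent_space M' p) (tangent_space M p)"
    using tmap_open_sub_incl_bij[OF M W(1,2)] by (simp add: M'_def)
  have bN: "bij_betw (tmap N' N id (f p)) (tangent_space N' (f p)) (tangent_space N (f p))"
    using tmap_open_sub_incl_bij[OF N W(3)] W by (simp add: N'_def)
  have g1: "smooth_map N' M g" using smooth_map_comp[OF mN' mM' M g iM] by simp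
  have pM': "p \<in> carrier_of M'" and pN': "f p \<in> carrier_of N'" using W cM cN by auto
  note gp = gf[OF W(2)]
  have surj: "tangent_space N (f p) \<subseteq> tmap M N f p ` tangent_space M p"
  proof
    fix w assume "w \<in> tangent_space N (f p)"
    then obtain w' where w': "w' \<in> tangent_space N' (f p)" "w = tmap N' N id (f p) w'"
      using bN by (auto simp: bij_betw_def)
    have "tmap N' N (f \<circ> g) (f p) w' = tmap N' N id (f p) w'"
      by (rule tmap_cong[OF mN' N iN _ w'(1) pN']) (use cN fg in auto)
    moreover have "tmap N' N (f \<circ> g) (f p) w' = tmap M N f p (tmap N' M g (f p) w')"
      using tmap_comp[OF mN' M N g1 sf w'(1) pN'] gp by simp
    moreover have "tmap N' M g (f p) w' \<in> tangent_space M p"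
      using tmap_tangent[OF mN' M g1 w'(1) pN'] gp by simp
    ultimately show "w \<in> tmap M N f p ` tangent_space M p" using w'(2) by (metis imageI)
  qed
  have key: "tmap N' M g (f p) (tmap M' N' f p v') = tmap M' M id p v'"
    and key2: "tmap M N f p (tmap M' M id p v') = tmap N' N id (f p) (tmap M' N' f p v')" if v': "v' \<in> tangent_space M' p" for v'
  proof -
    have "tmap M' M (g \<circ> f) p v' = tmap M' M id p v'"
      by (rule tmap_cong[OF mM' M iM _ v' pM']) (use cM gf in auto)
    then show "tmap N' M g (f p) (tmap M' N' f p v') = tmap M' M id p v'"
      using tmap_comp[OF mM' mN' M f' g1 v' pM'] by simp
    show "tmap M N f p (tmap M' M id p v') = tmap N' N id (f p) (tmap M' N' f p v')"
      using tmap_comp[OF mM' mN' N f' iN v' pM'] tmap_comp[OF mM' M N iM sf v' pM'] by simp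
  qed
  have "inj_on (tmap M N f p) (tangent_space M p)"
  proof (rule inj_onI)
    fix v w assume vw: "v \<in> tangent_space M p" "w \<in> tangent_space M p" "tmap M N f p v = tmap M N f p w"
    obtain v' w' where v': "v' \<in> tangent_space M' p" "v = tmap M' M id p v'" and w': "w' \<in> tangent_space M' p" "w = tmap M' M id p w'"
      using bM vw unfolding bij_betw_def by blast
    have "tmap M' N' f p v' = tmap M' N' f p w'"
      using vw(3) key2 v' w' bN tmap_tangent[OF mM' mN' f' _ pM'] unfolding bij_betw_def by (metis inj_onD)
    then show "v = w" using key v' w' by metis
  qed
  moreover have "tmap M N f p ` tangent_space M p \<subseteq> tangent_space N (f p)"
    using tmap_tangent[OF M N sf _ p] by blast
  ultimately show ?thesis using surj by (auto simp: bij_betw_def)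
qed

section \<open>Product manifolds, the models of trivial bundles\<close>

section \<open>Products\<close>

definition prod_chart :: "('p, 'v) chart \<Rightarrow> ('q, 'w) chart \<Rightarrow> ('p \<times> 'q, 'v \<times> 'w) chart" where
  "prod_chart c d = (fst c \<times> fst d, restrict (map_prod (snd c) (snd d)) (fst c \<times> fst d))"

lemma prod_manifold_eq: "prod_manifold M N = max_atlas {prod_chart c d | c d. c \<in> M \<and> d \<in> N}"
  by (simp add: prod_manifold_def prod_chart_def)

lemma prod_chart_image:
  "A \<subseteq> fst c \<Longrightarrow> B \<subseteq> fst d \<Longrightarrow> snd (prod_chart c d) ` (A \<times> B) = snd c ` A \<times> snd d ` B"
  by (auto simp: prod_chart_def image_iff map_prod_def subset_iff)

lemma valid_prod_chart:
  assumes "valid_chart c" "valid_chart d"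
  shows "valid_chart (prod_chart c d)"
  using assms prod_chart_image[of "fst c" c "fst d" d]
  by (auto simp: valid_chart_def prod_chart_def inj_on_def intro!: open_Times)

lemma prod_chart_inv:
  assumes "valid_chart c" "valid_chart d" "p \<in> fst c" "q \<in> fst d"
  shows "chart_inv (prod_chart c d) (snd c p, snd d q) = (p, q)"
  using chart_inv_left[OF valid_prod_chart[OF assms(1,2)], of "(p, q)"] assms(3,4) by (simp add: prod_chart_def)

lemma compatible_prod_chart:
  assumes v: "valid_chart c" "valid_chart d" "valid_chart c'" "valid_chart d'" and cc: "compatible c c'" and dd: "compatible d d'"
  shows "compatible (prod_chart c d) (prod_chart c' d')"
proof -
  have *: "open (snd (prod_chart c d) ` (fst (prod_chart c d) \<inter> fst (prod_chart c' d'))) \<and>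
     smooth_on (snd (prod_chart c d) ` (fst (prod_chart c d) \<inter> fst (prod_chart c' d'))) (snd (prod_chart c' d') \<circ> chart_inv (prod_chart c d))"
    if v: "valid_chart c" "valid_chart d" "valid_chart c'" "valid_chart d'" and cc: "compatible c c'" and dd: "compatible d d'"
    for c c' :: "('a, 'b) chart" and d d' :: "('c, 'd) chart"
  proof -
    let ?A = "fst c \<inter> fst c'" and ?B = "fst d \<inter> fst d'"
    have I: "fst (prod_chart c d) \<inter> fst (prod_chart c' d') = ?A \<times> ?B" by (auto simp: prod_chart_def)
    have im: "snd (prod_chart c d) ` (?A \<times> ?B) = snd c ` ?A \<times> snd d ` ?B" by (rule prod_chart_image) auto
    have oA: "open (snd c ` ?A)" "smooth_on (snd c ` ?A) (snd c' \<circ> chart_inv c)"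
      and oB: "open (snd d ` ?B)" "smooth_on (snd d ` ?B) (snd d' \<circ> chart_inv d)"
      using cc dd by (auto simp: compatible_def)
    have o: "open (snd c ` ?A \<times> snd d ` ?B)" using oA oB by (simp add: open_Times)
    have "smooth_on (snd c ` ?A \<times> snd d ` ?B) (\<lambda>x. ((snd c' \<circ> chart_inv c) (fst x), (snd d' \<circ> chart_inv d) (snd x)))"
      by (intro smooth_on_Pair[OF o] smooth_on_compose[OF o oA(1) _ _ oA(2)] smooth_on_compose[OF o oB(1) _ _ oB(2)]
          smooth_on_fst[OF o] smooth_on_snd[OF o] smooth_on_ident) auto
    then have "smooth_on (snd c ` ?A \<times> snd d ` ?B) (snd (prod_chart c' d') \<circ> chart_inv (prod_chart c d))"
    proof (rule smooth_on_cong[OF o, rotated])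
      fix x assume "x \<in> snd c ` ?A \<times> snd d ` ?B"
      then obtain p q where "p \<in> ?A" "q \<in> ?B" "x = (snd c p, snd d q)" by auto
      then show "((snd c' \<circ> chart_inv c) (fst x), (snd d' \<circ> chart_inv d) (snd x)) = (snd (prod_chart c' d') \<circ> chart_inv (prod_chart c d)) x"
        using prod_chart_inv[OF v(1,2)] by (auto simp: chart_inv_left[OF v(1)] chart_inv_left[OF v(2)]) (auto simp: prod_chart_def)
    qed
    then show ?thesis using o by (simp add: I im)
  qed
  show ?thesis
    unfolding compatible_def
    using *[OF v cc dd] *[OF v(3,4,1,2) compatible_sym[OF cc] compatible_sym[OF dd]]
    by (simp add: Int_commute)
qed

lemma atlas_prod_charts:
  assumes M: "atlas M" and N: "atlas N"
  shows "atlas {prod_chart c d | c d. c \<in> M \<and> d \<in> N}"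
  unfolding atlas_def
  using atlas_valid[OF M] atlas_valid[OF N] atlas_compatible[OF M] atlas_compatible[OF N]
  by (auto intro!: valid_prod_chart compatible_prod_chart)

lemma mfd_prod_manifold: "atlas M \<Longrightarrow> atlas N \<Longrightarrow> mfd (prod_manifold M N)"
  unfolding prod_manifold_eq by (intro mfd_max_atlas atlas_prod_charts)

lemma prod_chart_mem: "atlas M \<Longrightarrow> atlas N \<Longrightarrow> c \<in> M \<Longrightarrow> d \<in> N \<Longrightarrow> prod_chart c d \<in> prod_manifold M N"
  unfolding prod_manifold_eq using atlas_subset_max_atlas[OF atlas_prod_charts] by blast

lemma carrier_prod_manifold:
  assumes "atlas M" "atlas N"
  shows "carrier_of (prod_manifold M N) = carrier_of M \<times> carrier_of N"
proof -
  have "carrier_of (prod_manifold M N) = \<Union> (fst ` {prod_chart c d | c d. c \<in> M \<and> d \<in> N})"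
    unfolding prod_manifold_eq by (rule carrier_max_atlas[OF atlas_prod_charts[OF assms]])
  also have "\<dots> = carrier_of M \<times> carrier_of N"
  proof (intro equalityI subsetI)
    fix x assume "x \<in> \<Union> (fst ` {prod_chart c d | c d. c \<in> M \<and> d \<in> N})"
    then obtain c d where "c \<in> M" "d \<in> N" "x \<in> fst c \<times> fst d" by (auto simp: prod_chart_def)
    then show "x \<in> carrier_of M \<times> carrier_of N" unfolding carrier_of_def mem_Times_iff by blast
  next
    fix x assume "x \<in> carrier_of M \<times> carrier_of N"
    then obtain c d where cd: "c \<in> M" "d \<in> N" "x \<in> fst c \<times> fst d" unfolding carrier_of_def mem_Times_iff by blast
    then have "prod_chart c d \<in> {prod_chart c d | c d. c \<in> M \<and> d \<in> N}" by blast
    then show "x \<in> \<Union> (fst ` {prod_chart c d | c d. c \<in> M \<and> d \<in> N})"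
      by (rule UnionI[OF imageI]) (use cd in \<open>simp add: prod_chart_def\<close>)
  qed
  finally show ?thesis .
qed

lemma smooth_map_Pair_const:
  assumes M: "mfd M" and N: "mfd N" and q: "q \<in> carrier_of N"
  shows "smooth_map M (prod_manifold M N) (\<lambda>x. (x, q))"
proof (rule smooth_mapI[OF M])
  fix p assume "p \<in> carrier_of M"
  then obtain c where c: "c \<in> M" "p \<in> fst c" by (auto simp: carrier_of_def)
  obtain d where d: "d \<in> N" "q \<in> fst d" using q by (auto simp: carrier_of_def)
  have v: "valid_chart c" using atlas_valid[OF mfd_atlas[OF M] c(1)] .
  note o = valid_chart_open[OF v]
  have "smooth_on (snd c ` fst c) (snd (prod_chart c d) \<circ> (\<lambda>x. (x, q)) \<circ> chart_inv c)"
    by (rule smooth_on_cong[OF o, of "\<lambda>x. (x, snd d q)"])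
      (use d in \<open>auto simp: chart_inv_left[OF v] prod_chart_def intro!: smooth_intros o\<close>)
  then show "\<exists>c\<in>M. \<exists>d\<in>prod_manifold M N. \<exists>T. p \<in> T \<and> T \<subseteq> fst c \<and> open (snd c ` T) \<and> (\<lambda>x. (x, q)) ` T \<subseteq> fst d \<and>
      smooth_on (snd c ` T) (snd d \<circ> (\<lambda>x. (x, q)) \<circ> chart_inv c)"
    using c d o prod_chart_mem[OF mfd_atlas[OF M] mfd_atlas[OF N] c(1) d(1)]
    by (intro bexI[of _ c] bexI[of _ "prod_chart c d"] exI[of _ "fst c"]) (auto simp: prod_chart_def)
qed

section \<open>Slice charts and the induced structure of embedded submanifolds\<close>

section \<open>Submanifolds\<close>

definition slice_restr :: "('p, 'v) chart \<Rightarrow> 'p set \<Rightarrow> ('v \<Rightarrow> 'w) \<Rightarrow> ('p, 'w) chart" where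
  "slice_restr c S L = (fst c \<inter> S, restrict (L \<circ> snd c) (fst c \<inter> S))"

definition slice_restrs :: "('p, 'v::euclidean_space) manifold \<Rightarrow> 'p set \<Rightarrow> ('p, 'w::euclidean_space) chart set" where
  "slice_restrs N S = {slice_restr c S L | c W L. slice_chart N S c W \<and> linear L \<and> bij_betw L W UNIV}"

lemma sub_structure_eq: "sub_structure N S = max_atlas (slice_restrs N S)"
  by (simp add: sub_structure_def slice_restrs_def slice_restr_def)

text \<open>\<open>R\<close> inverts \<open>L\<close> on \<open>W\<close> as a linear map defined on
  the model space; in slice charts it represents the inclusion of the submanifold.\<close>

lemma linear_section:
  assumes "linear L" "subspace W" "bij_betw L W UNIV"
  obtains R where "linear R" "range R = W" "\<And>w. L (R w) = w" "\<And>x. x \<in> W \<Longrightarrow> R (L x) = x"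
proof -
  define R where "R = inv_into W L"
  have inj: "inj_on L W" and im: "L ` W = UNIV" using assms(3) by (auto simp: bij_betw_def)
  have RW: "R w \<in> W" and LR: "L (R w) = w" for w
    using im by (auto simp: R_def inv_into_into f_inv_into_f)
  have RL: "R (L x) = x" if "x \<in> W" for x using inj that by (simp add: R_def)
  have "linear R"
  proof (rule linearI)
    fix a b and r :: real
    have "L (R a + R b) = a + b" "L (r *\<^sub>R R a) = r *\<^sub>R a"
      using LR assms(1) by (auto simp: linear_add linear_scale)
    moreover have "R a + R b \<in> W" "r *\<^sub>R R a \<in> W" using RW assms(2) by (auto simp: subspace_add subspace_scale)
    ultimately show "R (a + b) = R a + R b" "R (r *\<^sub>R a) = r *\<^sub>R R a" using RL by metis+
  qed
  moreover have "range R = W" using RW RL by (metis image_subset_iff rangeI subsetI subset_antisym UNIV_I)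
  ultimately show thesis using that LR RL by blast
qed

text \<open>Since \<open>R\<close> takes values in \<open>W\<close>, the coordinates of slice points
  are those that \<open>R\<close> sends into the ambient chart image. As a preimage under a linear
  map the result is open whenever the image of \<open>T\<close> is.\<close>

lemma slice_image:
  assumes sl: "slice_chart N S c W" and v: "valid_chart c" and R: "range R = W" "\<And>w. L (R w) = w" "\<And>x. x \<in> W \<Longrightarrow> R (L x) = x"
    and T: "T \<subseteq> fst c"
  shows "snd (slice_restr c S L) ` (T \<inter> S) = R -` (snd c ` T)"
proof (intro equalityI subsetI)
  have im: "snd c ` (fst c \<inter> S) = snd c ` fst c \<inter> W" using sl by (simp add: slice_chart_def)
  fix y assume "y \<in> snd (slice_restr c S L) ` (T \<inter> S)"
  then obtain p where p: "p \<in> T" "p \<in> S" "y = L (snd c p)" using T by (auto simp: slice_restr_def)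
  then have "snd c p \<in> W" using im T by blast
  then show "y \<in> R -` (snd c ` T)" using p R(3) by simp
next
  have im: "snd c ` (fst c \<inter> S) = snd c ` fst c \<inter> W" using sl by (simp add: slice_chart_def)
  fix y assume "y \<in> R -` (snd c ` T)"
  then obtain p where p: "p \<in> T" "R y = snd c p" by auto
  then have "snd c p \<in> snd c ` fst c \<inter> W" using R(1) T by (auto, metis rangeI)
  then obtain q where "q \<in> fst c \<inter> S" "snd c p = snd c q" using im by (metis imageE)
  then have "p \<in> S" using chart_inj[OF v] p T by auto
  moreover have "y = snd (slice_restr c S L) p" using p R(2)[of y] T \<open>p \<in> S\<close> by (auto simp: slice_restr_def)
  ultimately show "y \<in> snd (slice_restr c S L) ` (T \<inter> S)" using p by blast
qed

lemma valid_slice_restr: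
  fixes L :: "'v::euclidean_space \<Rightarrow> 'w::euclidean_space"
  assumes sl: "slice_chart N S c W" and v: "valid_chart c" and L: "linear L" "bij_betw L W UNIV"
  shows "valid_chart (slice_restr c S L)"
proof -
  have sub: "subspace W" and im: "snd c ` (fst c \<inter> S) = snd c ` fst c \<inter> W" using sl by (auto simp: slice_chart_def)
  obtain R where R: "linear R" "range R = W" "\<And>w. L (R w) = w" "\<And>x. x \<in> W \<Longrightarrow> R (L x) = x"
    using linear_section[OF L(1) sub L(2)] by blast
  have "snd (slice_restr c S L) ` fst (slice_restr c S L) = R -` (snd c ` fst c)"
    using slice_image[OF sl v R(2-4) order_refl] by (simp add: slice_restr_def)
  moreover have "open (R -` (snd c ` fst c))"
    using valid_chart_open[OF v] R(1) by (intro open_vimage linear_continuous_on) (auto simp: linear_linear)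
  moreover have "inj_on (restrict (L \<circ> snd c) (fst c \<inter> S)) (fst c \<inter> S)"
  proof (rule inj_onI)
    fix p q assume pq: "p \<in> fst c \<inter> S" "q \<in> fst c \<inter> S" "restrict (L \<circ> snd c) (fst c \<inter> S) p = restrict (L \<circ> snd c) (fst c \<inter> S) q"
    then have "snd c p \<in> W" "snd c q \<in> W" using im by blast+
    moreover have "L (snd c p) = L (snd c q)" using pq by simp
    ultimately have "snd c p = snd c q" using R(4) by metis
    then show "p = q" using chart_inj[OF v] pq by auto
  qed
  ultimately show ?thesis by (simp add: valid_chart_def slice_restr_def)
qed

lemma slice_restr_inv:
  fixes L :: "'v::euclidean_space \<Rightarrow> 'w::euclidean_space"
  assumes sl: "slice_chart N S c W" and v: "valid_chart c" and L: "linear L" "bij_betw L W UNIV"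
    and R: "range R = W" "\<And>w. L (R w) = w" "\<And>x. x \<in> W \<Longrightarrow> R (L x) = x"
    and y: "y \<in> snd (slice_restr c S L) ` (fst c \<inter> S)"
  shows "chart_inv (slice_restr c S L) y = chart_inv c (R y)"
proof -
  obtain p where p: "p \<in> fst c \<inter> S" "y = snd (slice_restr c S L) p" using y by blast
  then have "snd c p \<in> W" using sl by (auto simp: slice_chart_def)
  then have "R y = snd c p" using p R(3) by (simp add: slice_restr_def)
  moreover have "chart_inv (slice_restr c S L) y = p"
    using chart_inv_left[OF valid_slice_restr[OF sl v L]] p by (simp add: slice_restr_def)
  ultimately show ?thesis using chart_inv_left[OF v] p by simp
qed

lemma atlas_slice_restrs:
  fixes N :: "('p, 'v::euclidean_space) manifold"
  assumes N: "atlas N"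
  shows "atlas (slice_restrs N S :: ('p, 'w::euclidean_space) chart set)"
proof -
  have main: "open (snd s ` (fst s \<inter> fst s')) \<and> smooth_on (snd s ` (fst s \<inter> fst s')) (snd s' \<circ> chart_inv s)"
    if s: "s \<in> slice_restrs N S" "s' \<in> slice_restrs N S" for s s' :: "('p, 'w) chart"
  proof -
    obtain c W L where s1: "s = slice_restr c S L" and sl: "slice_chart N S c W" and L: "linear L" "bij_betw L W (UNIV :: 'w set)"
      using s by (auto simp: slice_restrs_def)
    obtain c' W' L' where s2: "s' = slice_restr c' S L'" and sl': "slice_chart N S c' W'" and L': "linear L'" "bij_betw L' W' (UNIV :: 'w set)"
      using s by (auto simp: slice_restrs_def)
    have c: "c \<in> N" "c' \<in> N" "subspace W" using sl sl' by (auto simp: slice_chart_def)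
    have v: "valid_chart c" and v': "valid_chart c'" and comp: "compatible c c'"
      using c N by (auto simp: atlas_def)
    obtain R where R: "linear R" "range R = W" "\<And>w. L (R w) = w" "\<And>x. x \<in> W \<Longrightarrow> R (L x) = x"
      using linear_section[OF L(1) c(3) L(2)] by blast
    let ?T = "fst c \<inter> fst c'"
    have I: "fst s \<inter> fst s' = ?T \<inter> S" by (auto simp: s1 s2 slice_restr_def)
    have im: "snd s ` (?T \<inter> S) = R -` (snd c ` ?T)"
      unfolding s1 by (rule slice_image[OF sl v R(2-4)]) auto
    have oT: "open (snd c ` ?T)" and sT: "smooth_on (snd c ` ?T) (snd c' \<circ> chart_inv c)" using comp by (auto simp: compatible_def)
    have o: "open (R -` (snd c ` ?T))"
      using oT R(1) by (intro open_vimage linear_continuous_on) (auto simp: linear_linear)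
    have o': "open (snd c' ` ?T)" using comp by (auto simp: compatible_def)
    have "smooth_on (R -` (snd c ` ?T)) (\<lambda>x. L' ((snd c' \<circ> chart_inv c) (R x)))"
      by (intro smooth_on_linear_compose[OF L'(1) o] smooth_on_compose[OF o oT _ _ sT] smooth_on_linear R(1)) auto
    then have "smooth_on (R -` (snd c ` ?T)) (snd s' \<circ> chart_inv s)"
    proof (rule smooth_on_cong[OF o, rotated])
      fix x assume x: "x \<in> R -` (snd c ` ?T)"
      then have "x \<in> snd s ` (?T \<inter> S)" using im by simp
      then have x': "x \<in> snd (slice_restr c S L) ` (fst c \<inter> S)" by (auto simp: s1)
      have "chart_inv s x = chart_inv c (R x)"
        unfolding s1 by (rule slice_restr_inv[OF sl v L R(2-4) x'])
      moreover have "chart_inv s x \<in> ?T \<inter> S"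
        using \<open>x \<in> snd s ` (?T \<inter> S)\<close> chart_inv_left[OF valid_slice_restr[OF sl v L]] by (auto simp: s1) (auto simp: slice_restr_def)
      ultimately show "L' ((snd c' \<circ> chart_inv c) (R x)) = (snd s' \<circ> chart_inv s) x"
        by (simp add: s2 slice_restr_def)
    qed
    then show ?thesis using o by (simp add: I im)
  qed
  have "valid_chart s" if s: "s \<in> slice_restrs N S" for s :: "('p, 'w) chart"
  proof -
    obtain c W L where "s = slice_restr c S L" "slice_chart N S c W" "linear L" "bij_betw L W (UNIV :: 'w set)"
      using s unfolding slice_restrs_def by blast
    then show ?thesis using valid_slice_restr[of N S c W L] atlas_valid[OF N, of c] by (simp add: slice_chart_def)
  qed
  moreover have "compatible s s'" if "s \<in> slice_restrs N S" "s' \<in> slice_restrs N S" for s s' :: "('p, 'w) chart"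
    using main[OF that] main[OF that(2,1)] by (simp add: compatible_def Int_commute)
  ultimately show ?thesis by (simp add: atlas_def)
qed

lemma mfd_sub_structure: "atlas N \<Longrightarrow> mfd (sub_structure N S :: ('p, 'w::euclidean_space) manifold)"
  unfolding sub_structure_eq by (intro mfd_max_atlas atlas_slice_restrs)

lemma slice_restr_mem:
  assumes "atlas N" "slice_chart N S c W" "linear L" "bij_betw L W UNIV"
  shows "slice_restr c S L \<in> sub_structure N S"
proof -
  have "slice_restr c S L \<in> slice_restrs N S" unfolding slice_restrs_def using assms(2-4) by blast
  then show ?thesis unfolding sub_structure_eq using atlas_subset_max_atlas[OF atlas_slice_restrs[OF assms(1)]] by blast
qed

lemma exists_slice_linear:
  fixes W :: "'v::euclidean_space set"
  assumes "subspace W" "dim W = DIM('w::euclidean_space)"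
  obtains L :: "'v \<Rightarrow> 'w::euclidean_space" where "linear L" "bij_betw L W UNIV"
proof -
  obtain L :: "'v \<Rightarrow> 'w" where "linear L" "L ` W = UNIV" "inj_on L W"
    using subspace_isomorphism[OF assms(1) subspace_UNIV, where 'b='w] assms(2) by (metis dim_UNIV)
  then show thesis using that by (auto simp: bij_betw_def)
qed

lemma sub_structure_chart_at:
  fixes N :: "('p, 'v::euclidean_space) manifold"
  assumes N: "atlas N" and S: "submanifold DIM('w::euclidean_space) N S" and p: "p \<in> S"
  obtains c W and L :: "'v \<Rightarrow> 'w::euclidean_space" where "slice_chart N S c W" "p \<in> fst c" "linear L" "bij_betw L W UNIV"
    "slice_restr c S L \<in> charts_at (sub_structure N S) p"
proof -
  obtain c W where c: "p \<in> fst c" "slice_chart N S c W" "dim W = DIM('w)" using S p by (auto simp: submanifold_def)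
  have "subspace W" using c by (simp add: slice_chart_def)
  then obtain L :: "'v \<Rightarrow> 'w" where L: "linear L" "bij_betw L W UNIV" using exists_slice_linear c by metis
  then show thesis using that[OF c(2,1) L] slice_restr_mem[OF N c(2) L] c p by (auto simp: charts_at_def slice_restr_def)
qed

lemma carrier_sub_structure:
  fixes N :: "('p, 'v::euclidean_space) manifold"
  assumes N: "atlas N" and S: "submanifold DIM('w::euclidean_space) N S"
  shows "carrier_of (sub_structure N S :: ('p, 'w) manifold) = S"
proof
  have "carrier_of (sub_structure N S :: ('p, 'w) manifold) = \<Union> (fst ` (slice_restrs N S :: ('p, 'w) chart set))"
    unfolding sub_structure_eq by (rule carrier_max_atlas[OF atlas_slice_restrs[OF N]])
  then show "carrier_of (sub_structure N S :: ('p, 'w) manifold) \<subseteq> S" by (auto simp: slice_restrs_def slice_restr_def)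
  show "S \<subseteq> carrier_of (sub_structure N S :: ('p, 'w) manifold)"
  proof
    fix p assume "p \<in> S"
    then obtain s :: "('p, 'w) chart" where "s \<in> charts_at (sub_structure N S) p"
      using sub_structure_chart_at[OF N S] by metis
    then show "p \<in> carrier_of (sub_structure N S :: ('p, 'w) manifold)" by (rule charts_at_carrier)
  qed
qed

lemma sub_incl_rep:
  fixes N :: "('p, 'v::euclidean_space) manifold" and L :: "'v \<Rightarrow> 'w::euclidean_space"
  assumes N: "atlas N" and sl: "slice_chart N S c W" and L: "linear L" "bij_betw L W UNIV"
  obtains R where "linear R" "inj R" "open (snd (slice_restr c S L) ` fst (slice_restr c S L))"
    "\<And>x. x \<in> snd (slice_restr c S L) ` fst (slice_restr c S L) \<Longrightarrow> (snd c \<circ> id \<circ> chart_inv (slice_restr c S L)) x = R x"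
proof -
  have c: "c \<in> N" "subspace W" using sl by (auto simp: slice_chart_def)
  have v: "valid_chart c" using N c atlas_valid by blast
  obtain R where R: "linear R" "range R = W" "\<And>w. L (R w) = w" "\<And>x. x \<in> W \<Longrightarrow> R (L x) = x"
    using linear_section[OF L(1) c(2) L(2)] by blast
  note vs = valid_slice_restr[OF sl v L]
  show thesis
  proof (rule that[OF R(1)])
    show "inj R" using R(3) by (metis injI)
    show "open (snd (slice_restr c S L) ` fst (slice_restr c S L))" by (rule valid_chart_open[OF vs])
    fix x assume "x \<in> snd (slice_restr c S L) ` fst (slice_restr c S L)"
    then have x: "x \<in> snd (slice_restr c S L) ` (fst c \<inter> S)" by (simp add: slice_restr_def)
    then have "x \<in> R -` (snd c ` fst c)" using slice_image[OF sl v R(2-4) order_refl] by simp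
    then show "(snd c \<circ> id \<circ> chart_inv (slice_restr c S L)) x = R x"
      using slice_restr_inv[OF sl v L R(2-4) x] chart_inv_right by simp
  qed
qed

lemma smooth_map_sub_incl:
  fixes N :: "('p, 'v::euclidean_space) manifold"
  assumes N: "mfd N" and S: "submanifold DIM('w::euclidean_space) N S"
  shows "smooth_map (sub_structure N S :: ('p, 'w) manifold) N id"
proof (rule smooth_mapI[OF mfd_sub_structure[OF mfd_atlas[OF N]]])
  note at = mfd_atlas[OF N]
  fix p assume "p \<in> carrier_of (sub_structure N S :: ('p, 'w) manifold)"
  then have "p \<in> S" using carrier_sub_structure[OF at S] by simp
  then obtain c W and L :: "'v \<Rightarrow> 'w" where sl: "slice_chart N S c W" and pc: "p \<in> fst c" and L: "linear L" "bij_betw L W UNIV"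
      and ch: "slice_restr c S L \<in> charts_at (sub_structure N S) p" using sub_structure_chart_at[OF at S] by metis
  let ?s = "slice_restr c S L"
  obtain R where R: "linear R" "open (snd ?s ` fst ?s)" "\<And>x. x \<in> snd ?s ` fst ?s \<Longrightarrow> (snd c \<circ> id \<circ> chart_inv ?s) x = R x"
    using sub_incl_rep[OF at sl L] by metis
  have "smooth_on (snd ?s ` fst ?s) (snd c \<circ> id \<circ> chart_inv ?s)"
    by (rule smooth_on_cong[OF R(2) _ smooth_on_linear[OF R(1)]]) (simp add: R(3)[symmetric])
  then show "\<exists>c\<in>sub_structure N S :: ('p, 'w) manifold. \<exists>d\<in>N. \<exists>T. p \<in> T \<and> T \<subseteq> fst c \<and> open (snd c ` T) \<and> id ` T \<subseteq> fst d \<and>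
      smooth_on (snd c ` T) (snd d \<circ> id \<circ> chart_inv c)"
    using ch sl R(2) by (intro bexI[of _ ?s] bexI[of _ c] exI[of _ "fst ?s"])
      (auto simp: charts_at_def slice_chart_def, auto simp: slice_restr_def)
qed

lemma immersion_sub_incl:
  fixes N :: "('p, 'v::euclidean_space) manifold"
  assumes N: "mfd N" and S: "submanifold DIM('w::euclidean_space) N S"
  shows "immersion (sub_structure N S :: ('p, 'w) manifold) N id"
  unfolding immersion_def
proof (intro conjI ballI smooth_map_sub_incl[OF N S])
  note at = mfd_atlas[OF N]
  let ?M = "sub_structure N S :: ('p, 'w) manifold"
  have M: "mfd ?M" by (rule mfd_sub_structure[OF at])
  fix p assume p: "p \<in> carrier_of ?M"
  then have "p \<in> S" using carrier_sub_structure[OF at S] by simp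
  then obtain c W and L :: "'v \<Rightarrow> 'w" where sl: "slice_chart N S c W" and pc: "p \<in> fst c" and L: "linear L" "bij_betw L W UNIV"
      and ch: "slice_restr c S L \<in> charts_at (sub_structure N S) p" using sub_structure_chart_at[OF at S] by metis
  let ?s = "slice_restr c S L"
  obtain R where R: "linear R" "inj R" "open (snd ?s ` fst ?s)" "\<And>x. x \<in> snd ?s ` fst ?s \<Longrightarrow> (snd c \<circ> id \<circ> chart_inv ?s) x = R x"
    using sub_incl_rep[OF at sl L] by metis
  have cN: "c \<in> charts_at N (id p)" using sl pc by (simp add: charts_at_def slice_chart_def)
  have "(snd c \<circ> id \<circ> chart_inv ?s has_derivative R) (at (snd ?s p))"
    by (rule has_derivative_transform_within_open[OF linear_imp_has_derivative[OF R(1)] R(3)])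
      (use ch R(4) in \<open>auto simp: charts_at_def\<close>)
  then have "frechet_derivative (snd c \<circ> id \<circ> chart_inv ?s) (at (snd ?s p)) = R"
    by (metis frechet_derivative_at)
  then have eq: "tmap ?M N id p v c = R (v ?s)" if "v \<in> tangent_space ?M p" for v
    using tmap_apply[where f=id, OF M N smooth_map_sub_incl[OF N S] that ch cN] by simp
  show "inj_on (tmap ?M N id p) (tangent_space ?M p)"
  proof (rule inj_onI)
    fix v w assume "v \<in> tangent_space ?M p" "w \<in> tangent_space ?M p" "tmap ?M N id p v = tmap ?M N id p w"
    then show "v = w" using eq R(2) tangent_eqI[OF ch] by (metis injD)
  qed
qed

lemma smooth_map_into_sub:
  fixes N :: "('p, 'v::euclidean_space) manifold"
  assumes M: "mfd M" and N: "mfd N" and S: "submanifold DIM('w::euclidean_space) N S"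
    and f: "smooth_map M N f" and im: "f ` carrier_of M \<subseteq> S"
  shows "smooth_map M (sub_structure N S :: ('p, 'w) manifold) f"
proof (rule smooth_mapI[OF M])
  note at = mfd_atlas[OF N]
  fix p assume p: "p \<in> carrier_of M"
  then obtain a where a: "a \<in> M" "p \<in> fst a" by (auto simp: carrier_of_def)
  obtain c W and L :: "'v \<Rightarrow> 'w" where sl: "slice_chart N S c W" and pc: "f p \<in> fst c" and L: "linear L" "bij_betw L W UNIV"
      and ch: "slice_restr c S L \<in> charts_at (sub_structure N S) (f p)" using sub_structure_chart_at[OF at S, of "f p"] im p by blast
  let ?s = "slice_restr c S L" and ?T = "fst a \<inter> f -` fst c"
  have cN: "c \<in> N" using sl by (simp add: slice_chart_def)
  have va: "valid_chart a" using atlas_valid[OF mfd_atlas[OF M] a(1)] .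
  note r = smooth_map_rep[OF mfd_atlas[OF M] at f a(1) cN]
  have TS': "f q \<in> S" if "q \<in> fst a" for q using im a that unfolding carrier_of_def by blast
  then have TS: "f ` ?T \<subseteq> fst c \<inter> S" by auto
  have "smooth_on (snd a ` ?T) (\<lambda>x. L ((snd c \<circ> f \<circ> chart_inv a) x))"
    by (rule smooth_on_linear_compose[OF L(1) r])
  then have "smooth_on (snd a ` ?T) (snd ?s \<circ> f \<circ> chart_inv a)"
    by (rule smooth_on_cong[OF r(1), rotated]) (use TS' in \<open>auto simp: slice_restr_def chart_inv_left[OF va]\<close>)
  then show "\<exists>c\<in>M. \<exists>d\<in>sub_structure N S :: ('p, 'w) manifold. \<exists>T. p \<in> T \<and> T \<subseteq> fst c \<and> open (snd c ` T) \<and> f ` T \<subseteq> fst d \<and>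
      smooth_on (snd c ` T) (snd d \<circ> f \<circ> chart_inv c)"
    using ch a pc TS r(1) by (intro bexI[of _ a] bexI[of _ ?s] exI[of _ ?T])
      (auto simp: charts_at_def, auto simp: slice_restr_def)
qed

section \<open>Linear algebra of frames and of positively oriented bases\<close>

section \<open>Frames and oriented planes\<close>

definition lc :: "(4 \<Rightarrow> 'a::real_vector) \<Rightarrow> real^4 \<Rightarrow> 'a" where
  "lc b x = (\<Sum>i\<in>UNIV. (x $ i) *\<^sub>R b i)"

lemma linear_lc: "linear (lc b)"
  by (rule linearI) (simp_all add: lc_def scaleR_add_left sum.distrib scaleR_sum_right)

lemma lc_expand: "lc b x = x $ 1 *\<^sub>R b 1 + x $ 2 *\<^sub>R b 2 + x $ 3 *\<^sub>R b 3 + x $ 4 *\<^sub>R b 4"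
  by (simp add: lc_def sum_4)

lemma lc_axis: "lc b (axis i 1) = b i"
  by (simp add: lc_def axis_def if_distrib[of "\<lambda>r. r *\<^sub>R _"] cong: if_cong)

lemma linear_lc_comp: "linear f \<Longrightarrow> f (lc b x) = lc (\<lambda>i. f (b i)) x"
  by (simp add: lc_def linear_sum linear_scale)

text \<open>A frame is handled as the linear isomorphism \<open>lc b\<close> from
  \<open>real^4\<close> onto \<open>V\<close>, so that questions about planes in \<open>V\<close>
  become questions about coordinate vectors.\<close>

lemma frame_iff: "frame V b \<longleftrightarrow> inj (lc b) \<and> range (lc b) = V"
proof
  assume f: "frame V b"
  then have inj: "inj b" and ind: "independent (range b)" and V: "span (range b) = V" by (auto simp: frame_def)
  have rei: "(\<Sum>v\<in>range b. u v *\<^sub>R v) = lc b (\<chi> i. u (b i))" for u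
    using inj by (simp add: lc_def sum.reindex)
  have "x = 0" if "lc b x = 0" for x
  proof -
    have "(\<chi> i. (\<lambda>v. x $ (inv b v)) (b i)) = x" using inj by (simp add: vec_eq_iff)
    then have "(\<Sum>v\<in>range b. (x $ (inv b v)) *\<^sub>R v) = 0" using rei[of "\<lambda>v. x $ (inv b v)"] that by simp
    then have "\<forall>v\<in>range b. x $ (inv b v) = 0" using ind dependent_finite[of "range b"] by auto
    then show "x = 0" using inj by (simp add: vec_eq_iff)
  qed
  then have "inj (lc b)" using linear_injective_0[OF linear_lc] by blast
  moreover have "range (lc b) = V"
  proof -
    have "span (range b) = range (\<lambda>u. \<Sum>v\<in>range b. u v *\<^sub>R v)" by (rule span_finite) simp
    also have "\<dots> = range (lc b)"
    proof (intro equalityI subsetI)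
      fix y assume "y \<in> range (lc b)"
      then obtain x where "y = lc b x" by blast
      moreover have "(\<chi> i. (\<lambda>v. x $ (inv b v)) (b i)) = x" using inj by (simp add: vec_eq_iff)
      ultimately have "y = (\<Sum>v\<in>range b. (x $ (inv b v)) *\<^sub>R v)" using rei[of "\<lambda>v. x $ (inv b v)"] by simp
      then show "y \<in> range (\<lambda>u. \<Sum>v\<in>range b. u v *\<^sub>R v)"
        by (intro image_eqI[where x="\<lambda>v. x $ inv b v"] UNIV_I) simp
    qed (auto simp: rei)
    finally show ?thesis using V by simp
  qed
  ultimately show "inj (lc b) \<and> range (lc b) = V" by blast
next
  assume a: "inj (lc b) \<and> range (lc b) = V"
  have r: "range b = lc b ` (range (\<lambda>i. axis i 1))" by (auto simp: lc_axis image_image)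
  have B: "range (\<lambda>i. axis i 1) = (Basis :: (real^4) set)" by (auto simp: Basis_vec_def)
  have "inj b"
  proof (rule injI)
    fix i j assume "b i = b j"
    then have "axis i (1::real) = axis j 1" using a lc_axis[of b] by (metis injD)
    then show "i = j" by (simp add: axis_eq_axis)
  qed
  moreover have "independent (range b)"
    unfolding r B by (rule linear_independent_injective_image[OF linear_lc independent_Basis]) (use a in simp)
  moreover have "span (range b) = V"
    unfolding r B linear_span_image[OF linear_lc] using a by simp
  ultimately show "frame V b" by (simp add: frame_def)
qed

lemma frame_lc_eq: "frame V b \<Longrightarrow> lc b x = lc b y \<longleftrightarrow> x = y"
  by (auto simp: frame_iff inj_eq)

lemma frame_mem: "frame V b \<Longrightarrow> lc b x \<in> V"
  by (auto simp: frame_iff)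

lemma frame_obtain: "frame V b \<Longrightarrow> v \<in> V \<Longrightarrow> \<exists>x. v = lc b x"
  by (auto simp: frame_iff)

lemma frame_change:
  assumes b: "frame V b" and b': "frame V b'"
  obtains m where "linear m" "inj m" "\<And>x. lc b x = lc b' (m x)"
proof -
  define m where "m = (\<lambda>x. inv (lc b') (lc b x))"
  have m: "lc b' (m x) = lc b x" for x
    using frame_mem[OF b, of x] b' by (auto simp: m_def frame_iff f_inv_into_f)
  have "linear m"
  proof (rule linearI)
    fix x y and r :: real
    have "lc b' (m (x + y)) = lc b' (m x + m y)" "lc b' (m (r *\<^sub>R x)) = lc b' (r *\<^sub>R m x)"
      by (simp_all add: m linear_add[OF linear_lc] linear_scale[OF linear_lc])
    then show "m (x + y) = m x + m y" "m (r *\<^sub>R x) = r *\<^sub>R m x" using frame_lc_eq[OF b'] by auto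
  qed
  moreover have "inj m" using m frame_lc_eq[OF b] by (metis injI)
  ultimately show thesis using that m by metis
qed

lemma oplane_self: "(u, v) \<in> oplane u v"
  unfolding oplane_def by (intro CollectI exI[of _ 1] exI[of _ 0]) auto

lemma oplane_memI: "a * d - b * c > 0 \<Longrightarrow> (a *\<^sub>R u + b *\<^sub>R v, c *\<^sub>R u + d *\<^sub>R v) \<in> oplane u v"
  unfolding oplane_def by blast

text \<open>Matrices of base changes multiply, and so do their determinants.\<close>

lemma oplane_subset:
  assumes "(u', v') \<in> oplane u v"
  shows "oplane u' v' \<subseteq> oplane u v"
proof
  obtain a b c d where e: "u' = a *\<^sub>R u + b *\<^sub>R v" "v' = c *\<^sub>R u + d *\<^sub>R v" "a * d - b * c > 0"
    using assms by (auto simp: oplane_def)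
  fix w assume "w \<in> oplane u' v'"
  then obtain a' b' c' d' where w: "w = (a' *\<^sub>R u' + b' *\<^sub>R v', c' *\<^sub>R u' + d' *\<^sub>R v')" "a' * d' - b' * c' > 0"
    by (auto simp: oplane_def)
  have "w = ((a' * a + b' * c) *\<^sub>R u + (a' * b + b' * d) *\<^sub>R v, (c' * a + d' * c) *\<^sub>R u + (c' * b + d' * d) *\<^sub>R v)"
    by (simp add: w e algebra_simps)
  moreover have "(a' * a + b' * c) * (c' * b + d' * d) - (a' * b + b' * d) * (c' * a + d' * c) = (a' * d' - b' * c') * (a * d - b * c)"
    by (simp add: algebra_simps)
  ultimately show "w \<in> oplane u v" using e w by (metis oplane_memI mult_pos_pos)
qed

text \<open>The inverse matrix, by Cramer's rule, has determinant \<open>1 / D\<close>, again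
  positive.\<close>

lemma oplane_sym:
  assumes "(u', v') \<in> oplane u v"
  shows "(u, v) \<in> oplane u' v'"
proof -
  obtain a b c d where e: "u' = a *\<^sub>R u + b *\<^sub>R v" "v' = c *\<^sub>R u + d *\<^sub>R v" "a * d - b * c > 0"
    using assms by (auto simp: oplane_def)
  define D where "D = a * d - b * c"
  have D: "D > 0" using e by (simp add: D_def)
  have "(d / D) *\<^sub>R u' + (- b / D) *\<^sub>R v' = ((d * a - b * c) / D) *\<^sub>R u + ((d * b - b * d) / D) *\<^sub>R v"
    by (simp add: e algebra_simps diff_divide_distrib scaleR_diff_left)
  then have 1: "(d / D) *\<^sub>R u' + (- b / D) *\<^sub>R v' = u" using D by (simp add: D_def mult.commute)
  have "(- c / D) *\<^sub>R u' + (a / D) *\<^sub>R v' = ((a * c - c * a) / D) *\<^sub>R u + ((a * d - c * b) / D) *\<^sub>R v"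
    by (simp add: e algebra_simps diff_divide_distrib scaleR_diff_left)
  then have 2: "(- c / D) *\<^sub>R u' + (a / D) *\<^sub>R v' = v" using D by (simp add: D_def mult.commute)
  have "(d / D) * (a / D) - (- b / D) * (- c / D) = D / (D * D)"
    by (simp add: D_def diff_divide_distrib mult.commute)
  then have "(d / D) * (a / D) - (- b / D) * (- c / D) > 0" using D by simp
  from oplane_memI[OF this, of u' v'] show ?thesis by (simp only: 1 2)
qed

lemma oplane_eqI: "(u', v') \<in> oplane u v \<Longrightarrow> oplane u' v' = oplane u v"
  using oplane_subset oplane_sym by blast

lemma oplane_linear_image: "linear f \<Longrightarrow> map_prod f f ` oplane u v = oplane (f u) (f v)"
proof -
  assume f: "linear f"
  have "map_prod f f (a *\<^sub>R u + b *\<^sub>R v, c *\<^sub>R u + d *\<^sub>R v) = (a *\<^sub>R f u + b *\<^sub>R f v, c *\<^sub>R f u + d *\<^sub>R f v)" for a b c d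
    by (simp add: linear_add[OF f] linear_scale[OF f])
  then show ?thesis
    unfolding oplane_def image_Collect by (intro Collect_cong) metis
qed

lemma plane_oplane: "plane (oplane u v) = span {u, v}"
proof
  have "fst ` oplane u v \<subseteq> span {u, v}"
    unfolding oplane_def by (auto intro!: span_add[OF span_scale[OF span_base] span_scale[OF span_base]])
  then show "plane (oplane u v) \<subseteq> span {u, v}" unfolding plane_def by (metis span_minimal subspace_span)
  \<comment> \<open>\<open>plane\<close> sees only first vectors of positive bases; rotating the
    basis shows that \<open>v\<close> is one of them too.\<close>
  have "(v, - u) \<in> oplane u v" using oplane_memI[of 0 0 1 "-1" u v] by simp
  then have "{u, v} \<subseteq> fst ` oplane u v" using oplane_self[of u v] by force
  then show "span {u, v} \<subseteq> plane (oplane u v)" unfolding plane_def by (rule span_mono)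
qed

lemma span_pair: "span {u, v} = {s *\<^sub>R u + t *\<^sub>R v | s t. True}"
  by (auto simp: span_insert algebra_simps)

section \<open>Graph coordinates on one Grassmannian, with rational transitions\<close>

section \<open>Charts of the Grassmannian\<close>

text \<open>Read: graph rows. They are the coordinates, in a frame, of the two vectors that span the
  graph of \<open>A\<close>.\<close>

definition grow1 :: "real^2^2 \<Rightarrow> real^4" where "grow1 A = vector [1, 0, A$1$1, A$1$2]"
definition grow2 :: "real^2^2 \<Rightarrow> real^4" where "grow2 A = vector [0, 1, A$2$1, A$2$2]"

lemma vector_4 [simp]:
  "(vector [a, b, c, d] :: real^4) $ 1 = a" "(vector [a, b, c, d] :: real^4) $ 2 = b"
  "(vector [a, b, c, d] :: real^4) $ 3 = c" "(vector [a, b, c, d] :: real^4) $ 4 = d"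
  by (simp_all add: vector_def)

lemma grow_nth [simp]:
  "grow1 A $ 1 = 1" "grow1 A $ 2 = 0" "grow1 A $ 3 = A$1$1" "grow1 A $ 4 = A$1$2"
  "grow2 A $ 1 = 0" "grow2 A $ 2 = 1" "grow2 A $ 3 = A$2$1" "grow2 A $ 4 = A$2$2"
  by (simp_all add: grow1_def grow2_def)

lemma graph_plane_lc: "graph_plane b A = oplane (lc b (grow1 A)) (lc b (grow2 A))"
  by (simp add: graph_plane_def lc_expand algebra_simps)

text \<open>The first Pluecker coordinate of the pair. Its sign decides whether the oriented plane
  is an oriented graph over the span of the first two frame vectors.\<close>

definition qdet :: "real^4 \<Rightarrow> real^4 \<Rightarrow> real" where
  "qdet x y = x$1 * y$2 - x$2 * y$1"

text \<open>The matrix of the graph spanned by \<open>x\<close> and \<open>y\<close>, by Cramer's rule.\<close>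
definition qmat :: "real^4 \<Rightarrow> real^4 \<Rightarrow> real^2^2" where
  "qmat x y = vector [vector [(y$2 * x$3 - x$2 * y$3) * inverse (qdet x y), (y$2 * x$4 - x$2 * y$4) * inverse (qdet x y)],
                      vector [(x$1 * y$3 - y$1 * x$3) * inverse (qdet x y), (x$1 * y$4 - y$1 * x$4) * inverse (qdet x y)]]"

lemma qmat_nth:
  "qmat x y $ 1 $ 1 = (y$2 * x$3 - x$2 * y$3) * inverse (qdet x y)"
  "qmat x y $ 1 $ 2 = (y$2 * x$4 - x$2 * y$4) * inverse (qdet x y)"
  "qmat x y $ 2 $ 1 = (x$1 * y$3 - y$1 * x$3) * inverse (qdet x y)"
  "qmat x y $ 2 $ 2 = (x$1 * y$4 - y$1 * x$4) * inverse (qdet x y)"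
  by (simp_all add: qmat_def)

lemma vec4_eqI: "(x::real^4) $ 1 = y $ 1 \<Longrightarrow> x $ 2 = y $ 2 \<Longrightarrow> x $ 3 = y $ 3 \<Longrightarrow> x $ 4 = y $ 4 \<Longrightarrow> x = y"
  by (simp add: vec_eq_iff forall_4)

lemma mat2_eqI: "(A::real^2^2) $ 1 $ 1 = B $ 1 $ 1 \<Longrightarrow> A $ 1 $ 2 = B $ 1 $ 2 \<Longrightarrow> A $ 2 $ 1 = B $ 2 $ 1 \<Longrightarrow> A $ 2 $ 2 = B $ 2 $ 2 \<Longrightarrow> A = B"
  by (simp add: vec_eq_iff forall_2)

lemma qmat_row:
  assumes "qdet x y \<noteq> 0"
  shows "x = x$1 *\<^sub>R grow1 (qmat x y) + x$2 *\<^sub>R grow2 (qmat x y)"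
    and "y = y$1 *\<^sub>R grow1 (qmat x y) + y$2 *\<^sub>R grow2 (qmat x y)"
proof -
  have a: "z * (x$1 * y$2 - x$2 * y$1) * inverse (qdet x y) = z" for z
    unfolding qdet_def[symmetric] using assms by simp
  show "x = x$1 *\<^sub>R grow1 (qmat x y) + x$2 *\<^sub>R grow2 (qmat x y)"
    by (rule vec4_eqI) (simp_all add: qmat_nth, (subst (1) a[symmetric], simp add: algebra_simps)+)
  show "y = y$1 *\<^sub>R grow1 (qmat x y) + y$2 *\<^sub>R grow2 (qmat x y)"
    by (rule vec4_eqI) (simp_all add: qmat_nth, (subst (1) a[symmetric], simp add: algebra_simps)+)
qed

lemma oplane_lc_graph:
  assumes "qdet x y > 0"
  shows "oplane (lc b x) (lc b y) = graph_plane b (qmat x y)"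
proof -
  let ?g = "lc b (grow1 (qmat x y))" and ?h = "lc b (grow2 (qmat x y))"
  have nz: "qdet x y \<noteq> 0" using assms by simp
  have l: "lc b (s *\<^sub>R grow1 (qmat x y) + t *\<^sub>R grow2 (qmat x y)) = s *\<^sub>R ?g + t *\<^sub>R ?h" for s t
    by (simp add: linear_add[OF linear_lc] linear_scale[OF linear_lc])
  have "lc b x = x$1 *\<^sub>R ?g + x$2 *\<^sub>R ?h" "lc b y = y$1 *\<^sub>R ?g + y$2 *\<^sub>R ?h"
    using l[of "x$1" "x$2"] l[of "y$1" "y$2"] by (simp_all only: qmat_row[OF nz, symmetric])
  then have "(lc b x, lc b y) \<in> oplane ?g ?h"
    using oplane_memI[of "x$1" "y$2" "x$2" "y$1" ?g ?h] assms by (simp add: qdet_def)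
  then show ?thesis unfolding graph_plane_lc by (rule oplane_eqI)
qed

text \<open>The first two entries of a combination of graph rows are its coefficients, so the base
  change, its determinant and then \<open>A\<close> can be read off from \<open>x\<close> and
  \<open>y\<close>.\<close>

lemma oplane_lc_eq_graph:
  assumes b: "frame V b" and eq: "oplane (lc b x) (lc b y) = graph_plane b A"
  shows "qdet x y > 0" "qmat x y = A"
proof -
  have "(lc b x, lc b y) \<in> oplane (lc b (grow1 A)) (lc b (grow2 A))"
    using eq oplane_self by (metis graph_plane_lc)
  then obtain p q r s where 1: "lc b x = p *\<^sub>R lc b (grow1 A) + q *\<^sub>R lc b (grow2 A)" "lc b y = r *\<^sub>R lc b (grow1 A) + s *\<^sub>R lc b (grow2 A)"
      and pos: "p * s - q * r > 0" by (auto simp: oplane_def)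
  have "lc b x = lc b (p *\<^sub>R grow1 A + q *\<^sub>R grow2 A)" "lc b y = lc b (r *\<^sub>R grow1 A + s *\<^sub>R grow2 A)"
    using 1 by (simp_all add: linear_add[OF linear_lc] linear_scale[OF linear_lc])
  then have xy: "x = p *\<^sub>R grow1 A + q *\<^sub>R grow2 A" "y = r *\<^sub>R grow1 A + s *\<^sub>R grow2 A"
    using frame_lc_eq[OF b] by auto
  then have x: "x$1 = p" "x$2 = q" "y$1 = r" "y$2 = s" by simp_all
  then have D: "qdet x y = p * s - q * r" by (simp add: qdet_def)
  then show "qdet x y > 0" using pos by simp
  have nz: "inverse (p * s - q * r) * (p * s - q * r) = 1" using pos by simp
  have a: "z * (p * s - q * r) * inverse (p * s - q * r) = z" for z
    using nz by (simp add: mult.assoc mult.commute)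
  show "qmat x y = A"
    by (rule mat2_eqI; (subst a[symmetric])?; simp add: qmat_nth D; simp add: xy; simp add: algebra_simps)
qed

lemma graph_plane_inj: "frame V b \<Longrightarrow> graph_plane b A = graph_plane b B \<longleftrightarrow> A = B"
proof
  assume b: "frame V b" and eq: "graph_plane b A = graph_plane b B"
  have q: "qdet (grow1 A) (grow2 A) > 0" by (simp add: qdet_def)
  have "qmat (grow1 A) (grow2 A) = A" by (rule oplane_lc_eq_graph(2)[OF b]) (simp add: graph_plane_lc)
  moreover have "qmat (grow1 A) (grow2 A) = B" by (rule oplane_lc_eq_graph(2)[OF b]) (simp add: graph_plane_lc[symmetric] eq)
  ultimately show "A = B" by simp
qed simp

lemma range_graph_plane_iff:
  "frame V b \<Longrightarrow> oplane (lc b x) (lc b y) \<in> range (graph_plane b) \<longleftrightarrow> qdet x y > 0"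
  using oplane_lc_graph[of x y b] oplane_lc_eq_graph(1)[of V b x y] by auto

lemma smooth_on_qdet [smooth_intros]:
  fixes f g :: "'a::euclidean_space \<Rightarrow> real^4"
  shows "open S \<Longrightarrow> smooth_on S f \<Longrightarrow> smooth_on S g \<Longrightarrow> smooth_on S (\<lambda>p. qdet (f p) (g p))"
  unfolding qdet_def by (intro smooth_intros)

lemma smooth_on_qmat:
  fixes f g :: "'a::euclidean_space \<Rightarrow> real^4"
  assumes S: "open S" and f: "smooth_on S f" and g: "smooth_on S g" and nz: "\<And>p. p \<in> S \<Longrightarrow> qdet (f p) (g p) \<noteq> 0"
  shows "smooth_on S (\<lambda>p. qmat (f p) (g p))"
proof (intro smooth_on_vec S)
  fix i j :: 2
  have "(i = 1 \<or> i = 2) \<and> (j = 1 \<or> j = 2)" using exhaust_2 by blast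
  then show "smooth_on S (\<lambda>p. qmat (f p) (g p) $ i $ j)"
    by (elim conjE disjE; simp only: qmat_nth; intro smooth_intros S f g nz; assumption?)
qed

lemma smooth_on_grow [smooth_intros]:
  fixes f :: "'a::euclidean_space \<Rightarrow> real^2^2"
  assumes S: "open S" and f: "smooth_on S f"
  shows "smooth_on S (\<lambda>p. grow1 (f p))" "smooth_on S (\<lambda>p. grow2 (f p))"
proof -
  have *: "smooth_on S (\<lambda>p. grow1 (f p) $ i) \<and> smooth_on S (\<lambda>p. grow2 (f p) $ i)" for i
    using exhaust_4[of i] by (elim disjE; simp; intro conjI smooth_intros S f)
  show "smooth_on S (\<lambda>p. grow1 (f p))" by (rule smooth_on_vec[OF S]) (simp only: *)
  show "smooth_on S (\<lambda>p. grow2 (f p))" by (rule smooth_on_vec[OF S]) (simp only: *)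
qed

lemma graph_chart_apply: "frame V b \<Longrightarrow> snd (graph_chart b) (graph_plane b A) = A"
  unfolding graph_chart_def using graph_plane_inj[of V b] by (auto simp: inj_def intro!: inv_f_f)

lemma graph_chart_dom: "fst (graph_chart b) = range (graph_plane b)"
  by (simp add: graph_chart_def)

lemma valid_graph_chart: "frame V b \<Longrightarrow> valid_chart (graph_chart b)"
proof -
  assume b: "frame V b"
  have "snd (graph_chart b) ` fst (graph_chart b) = UNIV"
    by (simp add: graph_chart_dom image_image graph_chart_apply[OF b])
  moreover have "inj_on (snd (graph_chart b)) (fst (graph_chart b))"
    by (auto simp: inj_on_def graph_chart_dom graph_chart_apply[OF b])
  ultimately show ?thesis by (auto simp: valid_chart_def) (simp add: graph_chart_def)
qed

lemma graph_chart_inv: "frame V b \<Longrightarrow> chart_inv (graph_chart b) A = graph_plane b A"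
  using chart_inv_left[OF valid_graph_chart, of V b "graph_plane b A"]
  by (simp add: graph_chart_apply) (simp add: graph_chart_def)

text \<open>In coordinates the transition applies the frame change \<open>m\<close> to the graph
  rows and renormalizes by Cramer's rule. It is rational with denominator \<open>qdet\<close>, and
  its domain is where \<open>qdet\<close> is positive.\<close>

lemma graph_chart_transition:
  assumes b: "frame V b" and b': "frame V b'" and m: "linear m" "\<And>x. lc b x = lc b' (m x)"
  shows "snd (graph_chart b) ` (fst (graph_chart b) \<inter> fst (graph_chart b')) = {A. qdet (m (grow1 A)) (m (grow2 A)) > 0}"
    and "qdet (m (grow1 A)) (m (grow2 A)) > 0 \<Longrightarrow>
      snd (graph_chart b') (chart_inv (graph_chart b) A) = qmat (m (grow1 A)) (m (grow2 A))"
    and "open {A. qdet (m (grow1 A)) (m (grow2 A)) > 0}"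
    and "smooth_on {A. qdet (m (grow1 A)) (m (grow2 A)) > 0} (snd (graph_chart b') \<circ> chart_inv (graph_chart b))"
proof -
  have gp: "graph_plane b A = oplane (lc b' (m (grow1 A))) (lc b' (m (grow2 A)))" for A
    by (simp add: graph_plane_lc m)
  have "graph_plane b A \<in> range (graph_plane b') \<longleftrightarrow> qdet (m (grow1 A)) (m (grow2 A)) > 0" for A
    unfolding gp by (rule range_graph_plane_iff[OF b'])
  then have "range (graph_plane b) \<inter> range (graph_plane b') = graph_plane b ` {A. qdet (m (grow1 A)) (m (grow2 A)) > 0}"
    by blast
  then show "snd (graph_chart b) ` (fst (graph_chart b) \<inter> fst (graph_chart b')) = {A. qdet (m (grow1 A)) (m (grow2 A)) > 0}"
    unfolding graph_chart_dom by (simp add: image_image graph_chart_apply[OF b])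
  show *: "snd (graph_chart b') (chart_inv (graph_chart b) A) = qmat (m (grow1 A)) (m (grow2 A))"
    if "qdet (m (grow1 A)) (m (grow2 A)) > 0" for A
    using oplane_lc_graph[OF that, of b'] graph_chart_apply[OF b'] by (simp add: graph_chart_inv[OF b] gp)
  have sm: "smooth_on UNIV (\<lambda>A. m (grow1 A))" "smooth_on UNIV (\<lambda>A. m (grow2 A))"
    by (intro smooth_on_linear_compose[OF m(1)] smooth_intros open_UNIV)+
  have "continuous_on UNIV (\<lambda>A. qdet (m (grow1 A)) (m (grow2 A)))"
    by (intro smooth_on_continuous smooth_intros sm open_UNIV)
  then show o: "open {A. qdet (m (grow1 A)) (m (grow2 A)) > 0}"
    by (intro open_Collect_less) auto
  show "smooth_on {A. qdet (m (grow1 A)) (m (grow2 A)) > 0} (snd (graph_chart b') \<circ> chart_inv (graph_chart b))"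
    by (rule smooth_on_cong[OF o _ smooth_on_qmat[OF o]]) (use * sm in \<open>auto intro: smooth_on_subset\<close>)
qed

lemma atlas_graph_charts: "atlas {graph_chart b | b. frame V b}"
proof -
  have main: "open (snd (graph_chart b) ` (fst (graph_chart b) \<inter> fst (graph_chart b'))) \<and>
      smooth_on (snd (graph_chart b) ` (fst (graph_chart b) \<inter> fst (graph_chart b'))) (snd (graph_chart b') \<circ> chart_inv (graph_chart b))"
    if b: "frame V b" and b': "frame V b'" for b b' :: "4 \<Rightarrow> 'a"
  proof -
    obtain m where "linear m" "\<And>x. lc b x = lc b' (m x)" using frame_change[OF b b'] by metis
    from graph_chart_transition[OF b b' this] show ?thesis by simp
  qed
  have "compatible (graph_chart b) (graph_chart b')" if "frame V b" "frame V b'" for b b' :: "4 \<Rightarrow> 'a"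
    unfolding compatible_def using main[OF that] main[OF that(2,1)] by (simp add: Int_commute)
  then show ?thesis unfolding atlas_def using valid_graph_chart by auto
qed

lemma mfd_Gr2: "mfd (Gr2 V)"
  unfolding Gr2_def by (rule mfd_max_atlas[OF atlas_graph_charts])

lemma graph_chart_mem: "frame V b \<Longrightarrow> graph_chart b \<in> Gr2 V"
  unfolding Gr2_def using atlas_subset_max_atlas[OF atlas_graph_charts] by blast

lemma carrier_Gr2: "carrier_of (Gr2 V) = {graph_plane b A | b A. frame V b}"
  unfolding Gr2_def carrier_max_atlas[OF atlas_graph_charts] by (auto simp: graph_chart_dom) (auto simp: graph_chart_dom[symmetric])

section \<open>Graph coordinates on the Grassmann bundle, with moving frames\<close>

section \<open>Charts of the Grassmann bundle\<close>

definition coord_frame :: "('p, real^4) manifold \<Rightarrow> ('p, real^4) chart \<Rightarrow> (4 \<Rightarrow> real^4) \<Rightarrow> 'p \<Rightarrow> 4 \<Rightarrow> ('p, real^4) tvec" where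
  "coord_frame M c b m = (\<lambda>i. coord_vec M c m (b i))"

lemma lc_coord_frame:
  "atlas M \<Longrightarrow> c \<in> charts_at M m \<Longrightarrow> lc (coord_frame M c b m) x = coord_vec M c m (lc b x)"
  unfolding coord_frame_def by (simp add: linear_lc_comp[OF linear_coord_vec])

lemma inj_coord_vec: "atlas M \<Longrightarrow> c \<in> charts_at M m \<Longrightarrow> coord_vec M c m x = coord_vec M c m y \<longleftrightarrow> x = y"
  using coord_vec_same by metis

lemma frame_coord_frame:
  assumes M: "mfd M" and c: "c \<in> charts_at M m" and b: "frame UNIV b"
  shows "frame (tangent_space M m) (coord_frame M c b m)"
proof -
  note l = lc_coord_frame[OF mfd_atlas[OF M] c, of b]
  have "inj (lc (coord_frame M c b m))"
    using l inj_coord_vec[OF mfd_atlas[OF M] c] frame_lc_eq[OF b] by (auto intro!: injI)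
  moreover have "range (lc (coord_frame M c b m)) = tangent_space M m"
  proof (intro equalityI subsetI)
    fix v assume "v \<in> range (lc (coord_frame M c b m))"
    then show "v \<in> tangent_space M m" using l coord_vec_tangent[OF M c] by auto
  next
    fix v assume v: "v \<in> tangent_space M m"
    obtain x where "v c = lc b x" using frame_obtain[OF b] by blast
    then have "v = lc (coord_frame M c b m) x" using tangent_coord[OF c v] l by simp
    then show "v \<in> range (lc (coord_frame M c b m))" by blast
  qed
  ultimately show ?thesis by (simp add: frame_iff)
qed

lemma graph_param_eq: "graph_param M c b (y, A) = (chart_inv c y, graph_plane (coord_frame M c b (chart_inv c y)) A)"
  by (simp add: graph_param_def coord_frame_def Let_def)

lemma graph_bundle_dom:
  assumes "valid_chart c"
  shows "fst (graph_bundle_chart M c b) = {(m, graph_plane (coord_frame M c b m) A) | m A. m \<in> fst c}"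
proof -
  have "fst (graph_bundle_chart M c b) = graph_param M c b ` (snd c ` fst c \<times> UNIV)"
    by (simp add: graph_bundle_chart_def Let_def)
  also have "\<dots> = {(m, graph_plane (coord_frame M c b m) A) | m A. m \<in> fst c}"
    using chart_inv_left[OF assms] by (force simp: graph_param_eq image_iff)
  finally show ?thesis .
qed

lemma graph_bundle_apply:
  assumes M: "mfd M" and c: "c \<in> charts_at M m" and b: "frame UNIV b"
  shows "snd (graph_bundle_chart M c b) (m, graph_plane (coord_frame M c b m) A) = (snd c m, A)"
    and "(m, graph_plane (coord_frame M c b m) A) \<in> fst (graph_bundle_chart M c b)"
proof -
  have cM: "c \<in> M" "m \<in> fst c" using c by (auto simp: charts_at_def)
  have v: "valid_chart c" using atlas_valid[OF mfd_atlas[OF M] cM(1)] .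
  let ?D = "snd c ` fst c \<times> (UNIV :: (real^2^2) set)"
  have "inj_on (graph_param M c b) ?D"
  proof (rule inj_onI)
    fix x y assume xy: "x \<in> ?D" "y \<in> ?D" "graph_param M c b x = graph_param M c b y"
    obtain p q A B where pq: "p \<in> fst c" "x = (snd c p, A)" "q \<in> fst c" "y = (snd c q, B)"
      using xy(1,2) by auto
    then have e: "p = q" "graph_plane (coord_frame M c b p) A = graph_plane (coord_frame M c b q) B"
      using xy(3) by (auto simp: graph_param_eq chart_inv_left[OF v])
    have "c \<in> charts_at M p" using cM pq by (simp add: charts_at_def)
    from graph_plane_inj[OF frame_coord_frame[OF M this b]] show "x = y" using pq e by auto
  qed
  moreover have "(snd c m, A) \<in> ?D" using cM by simp
  moreover have e: "graph_param M c b (snd c m, A) = (m, graph_plane (coord_frame M c b m) A)"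
    using cM by (simp add: graph_param_eq chart_inv_left[OF v])
  ultimately have "inv_into ?D (graph_param M c b) (m, graph_plane (coord_frame M c b m) A) = (snd c m, A)"
    by (metis inv_into_f_f)
  moreover show m: "(m, graph_plane (coord_frame M c b m) A) \<in> fst (graph_bundle_chart M c b)"
    unfolding graph_bundle_dom[OF v] using cM by blast
  ultimately show "snd (graph_bundle_chart M c b) (m, graph_plane (coord_frame M c b m) A) = (snd c m, A)"
    by (simp add: graph_bundle_chart_def Let_def)
qed

lemma graph_bundle_image:
  assumes M: "mfd M" and c: "c \<in> M" and b: "frame UNIV b"
  shows "snd (graph_bundle_chart M c b) ` fst (graph_bundle_chart M c b) = snd c ` fst c \<times> UNIV"
proof -
  have v: "valid_chart c" using atlas_valid[OF mfd_atlas[OF M] c] .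
  have cm: "c \<in> charts_at M m" if "m \<in> fst c" for m using c that by (simp add: charts_at_def)
  show ?thesis
  proof (intro equalityI subsetI)
    fix y assume "y \<in> snd (graph_bundle_chart M c b) ` fst (graph_bundle_chart M c b)"
    then show "y \<in> snd c ` fst c \<times> UNIV" unfolding graph_bundle_dom[OF v] using graph_bundle_apply(1)[OF M cm b] by auto
  next
    fix y assume "y \<in> snd c ` fst c \<times> (UNIV :: (real^2^2) set)"
    then obtain m A where "m \<in> fst c" "y = (snd c m, A)" by auto
    then show "y \<in> snd (graph_bundle_chart M c b) ` fst (graph_bundle_chart M c b)"
      using graph_bundle_apply[OF M cm b] by (metis imageI)
  qed
qed

lemma valid_graph_bundle_chart:
  assumes M: "mfd M" and c: "c \<in> M" and b: "frame UNIV b"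
  shows "valid_chart (graph_bundle_chart M c b)"
proof -
  have v: "valid_chart c" using atlas_valid[OF mfd_atlas[OF M] c] .
  have cm: "c \<in> charts_at M m" if "m \<in> fst c" for m using c that by (simp add: charts_at_def)
  have "inj_on (snd (graph_bundle_chart M c b)) (fst (graph_bundle_chart M c b))"
  proof (rule inj_onI)
    fix x y assume xy: "x \<in> fst (graph_bundle_chart M c b)" "y \<in> fst (graph_bundle_chart M c b)"
      "snd (graph_bundle_chart M c b) x = snd (graph_bundle_chart M c b) y"
    obtain m A n B where m: "m \<in> fst c" "x = (m, graph_plane (coord_frame M c b m) A)" "n \<in> fst c" "y = (n, graph_plane (coord_frame M c b n) B)"
      using xy(1,2) unfolding graph_bundle_dom[OF v] by auto
    then show "x = y" using xy(3) graph_bundle_apply(1)[OF M cm b] chart_inj[OF v] by auto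
  qed
  moreover have "snd (graph_bundle_chart M c b) \<in> extensional (fst (graph_bundle_chart M c b))"
    by (simp add: graph_bundle_chart_def Let_def)
  ultimately show ?thesis
    using graph_bundle_image[OF assms] valid_chart_open[OF v] by (simp add: valid_chart_def open_Times)
qed

lemma graph_bundle_inv:
  assumes M: "mfd M" and c: "c \<in> charts_at M m" and b: "frame UNIV b"
  shows "chart_inv (graph_bundle_chart M c b) (snd c m, A) = (m, graph_plane (coord_frame M c b m) A)"
  using chart_inv_left[OF valid_graph_bundle_chart[OF M _ b] graph_bundle_apply(2)[OF assms], of A] c
  by (simp add: graph_bundle_apply(1)[OF assms] charts_at_def)

lemma smooth_on_linear_family:
  fixes L :: "'a::euclidean_space \<Rightarrow> 'b::euclidean_space \<Rightarrow> 'c::euclidean_space"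
  assumes S: "open S" and L: "\<And>w. smooth_on S (\<lambda>p. L p w)" "\<And>p. p \<in> S \<Longrightarrow> linear (L p)" and h: "smooth_on S h"
  shows "smooth_on S (\<lambda>p. L p (h p))"
proof (rule smooth_on_cong[OF S])
  show "(\<Sum>i\<in>Basis. (h p \<bullet> i) *\<^sub>R L p i) = L p (h p)" if "p \<in> S" for p
    using linear_euclidean_expand[OF L(2)[OF that]] by metis
  have "smooth_on S (\<lambda>p. h p \<bullet> i)" for i
    by (rule smooth_on_linear_compose[of "\<lambda>x. x \<bullet> i"]) (auto intro!: linearI S h simp: inner_add_left)
  then show "smooth_on S (\<lambda>p. \<Sum>i\<in>Basis. (h p \<bullet> i) *\<^sub>R L p i)" by (intro smooth_intros S L(1))
qed

lemma coord_vec_change: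
  assumes M: "mfd M" and c: "c \<in> charts_at M m" and c': "c' \<in> charts_at M m"
  shows "coord_vec M c m w = coord_vec M c' m (frechet_derivative (snd c' \<circ> chart_inv c) (at (snd c m)) w)"
  using tangent_coord[OF c' coord_vec_tangent[OF M c], of w] by (simp add: coord_vec_apply[OF c'])

text \<open>The rational transition of a single Grassmannian again, but the frame change
  \<open>m p\<close> now moves with the base point, through the derivative of the transition from
  \<open>c\<close> to \<open>c'\<close>. Smoothness of that derivative makes the bundle charts
  compatible.\<close>

lemma graph_bundle_transition:
  assumes M: "mfd M" and c: "c \<in> M" and b: "frame UNIV b" and c': "c' \<in> M" and b': "frame UNIV b'"
  defines "G \<equiv> graph_bundle_chart M c b" and "G' \<equiv> graph_bundle_chart M c' b'"
  shows "open (snd G ` (fst G \<inter> fst G'))" "smooth_on (snd G ` (fst G \<inter> fst G')) (snd G' \<circ> chart_inv G)"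
proof -
  have v: "valid_chart c" and v': "valid_chart c'" using atlas_valid[OF mfd_atlas[OF M]] c c' by auto
  have cc: "compatible c c'" using atlas_compatible[OF mfd_atlas[OF M] c c'] .
  let ?U = "snd c ` (fst c \<inter> fst c')"
  define D where "D = (\<lambda>y. frechet_derivative (snd c' \<circ> chart_inv c) (at y))"
  have oU: "open ?U" and sU: "smooth_on ?U (snd c' \<circ> chart_inv c)" using cc by (auto simp: compatible_def)
  have il: "linear (inv (lc b'))" "\<And>w. lc b' (inv (lc b') w) = w"
    using inv_linear_apply[OF linear_lc, of b'] b' by (auto simp: frame_iff)
  define m where "m = (\<lambda>(p :: (real^4) \<times> (real^2^2)) x. inv (lc b') (D (fst p) (lc b x)))"
  define x1 where "x1 = (\<lambda>p. m p (grow1 (snd p)))"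
  define x2 where "x2 = (\<lambda>p. m p (grow2 (snd p)))"
  let ?UU = "?U \<times> (UNIV :: (real^2^2) set)"
  have oUU: "open ?UU" using oU by (simp add: open_Times)
  have linD: "linear (D y)" if "y \<in> ?U" for y
    unfolding D_def by (rule smooth_on_linear_derivative[OF sU that])
  have linm: "linear (m p)" if "p \<in> ?UU" for p
  proof -
    have "linear (inv (lc b') \<circ> D (fst p) \<circ> lc b)"
      using that by (intro linear_compose linear_lc il linD) auto
    then show ?thesis by (simp add: m_def o_def)
  qed
  have smD: "smooth_on ?UU (\<lambda>p. D (fst p) w)" for w
    unfolding D_def
    by (rule smooth_on_compose[OF oUU oU _ smooth_on_fst[OF oUU smooth_on_ident] smooth_on_frechet_derivative_const[OF sU]]) auto
  have smm: "smooth_on ?UU (\<lambda>p. m p w)" for w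
    unfolding m_def by (rule smooth_on_linear_compose[OF il(1) oUU smD])
  have smx: "smooth_on ?UU x1" "smooth_on ?UU x2"
    unfolding x1_def x2_def by (intro smooth_on_linear_family[OF oUU smm linm] smooth_intros oUU; assumption)+
  let ?O = "?UU \<inter> {p. qdet (x1 p) (x2 p) > 0}"
  have oO: "open ?O"
  proof -
    have "continuous_on ?UU (\<lambda>p. qdet (x1 p) (x2 p))"
      by (intro smooth_on_continuous smooth_intros smx oUU)
    from continuous_open_preimage[OF this oUU open_greaterThan[of 0]]
    show ?thesis by (simp add: vimage_def)
  qed
  have gp: "graph_plane (coord_frame M c b q) A = oplane (lc (coord_frame M c' b' q) (x1 (snd c q, A))) (lc (coord_frame M c' b' q) (x2 (snd c q, A)))"
    if q: "q \<in> fst c" "q \<in> fst c'" for q A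
  proof -
    have cq: "c \<in> charts_at M q" and cq': "c' \<in> charts_at M q" using q c c' by (auto simp: charts_at_def)
    have "lc (coord_frame M c b q) x = lc (coord_frame M c' b' q) (m (snd c q, A) x)" for x
      using coord_vec_change[OF M cq cq'] by (simp add: lc_coord_frame[OF mfd_atlas[OF M]] cq cq' m_def D_def il)
    then show ?thesis by (simp add: graph_plane_lc x1_def x2_def)
  qed
  have mem: "(q, graph_plane (coord_frame M c b q) A) \<in> fst G' \<longleftrightarrow> q \<in> fst c' \<and> (snd c q, A) \<in> ?O" if q: "q \<in> fst c" for q A
  proof (cases "q \<in> fst c'")
    case True
    have cq': "c' \<in> charts_at M q" using True c' by (auto simp: charts_at_def)
    have "(q, graph_plane (coord_frame M c b q) A) \<in> fst G' \<longleftrightarrow> graph_plane (coord_frame M c b q) A \<in> range (graph_plane (coord_frame M c' b' q))"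
      unfolding G'_def graph_bundle_dom[OF v'] using True by auto
    also have "\<dots> \<longleftrightarrow> qdet (x1 (snd c q, A)) (x2 (snd c q, A)) > 0"
      unfolding gp[OF q True] by (rule range_graph_plane_iff[OF frame_coord_frame[OF M cq' b']])
    finally show ?thesis using True q by auto
  next
    case False
    then show ?thesis unfolding G'_def graph_bundle_dom[OF v'] by auto
  qed
  have im: "snd G ` (fst G \<inter> fst G') = ?O"
  proof (intro equalityI subsetI)
    fix y assume "y \<in> snd G ` (fst G \<inter> fst G')"
    then obtain q A where q: "q \<in> fst c" "y = snd G (q, graph_plane (coord_frame M c b q) A)" "(q, graph_plane (coord_frame M c b q) A) \<in> fst G'"
      unfolding G_def graph_bundle_dom[OF v] by auto
    have "c \<in> charts_at M q" using q c by (simp add: charts_at_def)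
    then have "y = (snd c q, A)" using q graph_bundle_apply(1)[OF M _ b] by (simp add: G_def)
    then show "y \<in> ?O" using mem[OF q(1)] q(3) by simp
  next
    fix y assume y: "y \<in> ?O"
    then obtain q A where q: "q \<in> fst c" "q \<in> fst c'" "y = (snd c q, A)" by auto
    have cq: "c \<in> charts_at M q" using q c by (simp add: charts_at_def)
    have "(q, graph_plane (coord_frame M c b q) A) \<in> fst G'" using mem[OF q(1), of A] q y by blast
    moreover have "y = snd G (q, graph_plane (coord_frame M c b q) A)" using q graph_bundle_apply(1)[OF M cq b] by (simp add: G_def)
    moreover have "(q, graph_plane (coord_frame M c b q) A) \<in> fst G" using graph_bundle_apply(2)[OF M cq b] by (simp add: G_def)
    ultimately show "y \<in> snd G ` (fst G \<inter> fst G')" by blast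
  qed
  show "open (snd G ` (fst G \<inter> fst G'))" unfolding im by (rule oO)
  have smO: "smooth_on ?O x1" "smooth_on ?O x2" using smx by (auto intro: smooth_on_subset)
  have "smooth_on ?O (\<lambda>p. ((snd c' \<circ> chart_inv c) (fst p), qmat (x1 p) (x2 p)))"
    by (intro smooth_on_Pair[OF oO] smooth_on_qmat[OF oO] smO smooth_on_compose[OF oO oU _ _ sU] smooth_on_fst[OF oO] smooth_on_ident) auto
  then show "smooth_on (snd G ` (fst G \<inter> fst G')) (snd G' \<circ> chart_inv G)"
    unfolding im
  proof (rule smooth_on_cong[OF oO, rotated])
    fix p assume p: "p \<in> ?O"
    then obtain q A where q: "q \<in> fst c" "q \<in> fst c'" "p = (snd c q, A)" by auto
    have cq: "c \<in> charts_at M q" and cq': "c' \<in> charts_at M q" using q c c' by (auto simp: charts_at_def)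
    have "graph_plane (coord_frame M c b q) A = graph_plane (coord_frame M c' b' q) (qmat (x1 p) (x2 p))"
      using gp[OF q(1,2)] oplane_lc_graph[of "x1 p" "x2 p"] p q(3) by auto
    then show "((snd c' \<circ> chart_inv c) (fst p), qmat (x1 p) (x2 p)) = (snd G' \<circ> chart_inv G) p"
      using q graph_bundle_inv[OF M cq b] graph_bundle_apply(1)[OF M cq' b'] by (simp add: G_def G'_def chart_inv_left[OF v])
  qed
qed

lemma atlas_graph_bundle_charts:
  assumes M: "mfd M"
  shows "atlas {graph_bundle_chart M c b | c b. c \<in> M \<and> frame UNIV b}"
proof -
  have "compatible (graph_bundle_chart M c b) (graph_bundle_chart M c' b')"
    if "c \<in> M" "frame UNIV b" "c' \<in> M" "frame UNIV b'" for c b c' b'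
    unfolding compatible_def
    using graph_bundle_transition[OF M that] graph_bundle_transition[OF M that(3,4,1,2)] by (simp add: Int_commute)
  then show ?thesis unfolding atlas_def using valid_graph_bundle_chart[OF M] by blast
qed

lemma mfd_Gr2T: "mfd M \<Longrightarrow> mfd (Gr2T M)"
  unfolding Gr2T_def by (rule mfd_max_atlas[OF atlas_graph_bundle_charts])

lemma graph_bundle_chart_mem: "mfd M \<Longrightarrow> c \<in> M \<Longrightarrow> frame UNIV b \<Longrightarrow> graph_bundle_chart M c b \<in> Gr2T M"
  unfolding Gr2T_def using atlas_subset_max_atlas[OF atlas_graph_bundle_charts] by blast

lemma carrier_Gr2T_obtain:
  assumes M: "mfd M" and e: "(m, P) \<in> carrier_of (Gr2T M)"
  obtains c b A where "c \<in> charts_at M m" "frame UNIV b" "P = graph_plane (coord_frame M c b m) A"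
proof -
  have "(m, P) \<in> \<Union> (fst ` {graph_bundle_chart M c b | c b. c \<in> M \<and> frame UNIV b})"
    using e unfolding Gr2T_def carrier_max_atlas[OF atlas_graph_bundle_charts[OF M]] .
  then obtain c b where c: "c \<in> M" "frame UNIV b" "(m, P) \<in> fst (graph_bundle_chart M c b)" by auto
  then obtain A where "m \<in> fst c" "P = graph_plane (coord_frame M c b m) A"
    using graph_bundle_dom[OF atlas_valid[OF mfd_atlas[OF M] c(1)]] by auto
  then show thesis using that[of c b A] c by (auto simp: charts_at_def)
qed

text \<open>Makes the graph of \<open>A\<close> the zero graph by taking the graph rows as first two
  frame vectors, since \<open>Gr2_hom\<close> uses only frames adapted to the plane. Graph
  coordinates undergo a mere translation, so matrices of tangent vectors do not change.\<close>

definition shift_frame :: "(4 \<Rightarrow> 'a::real_vector) \<Rightarrow> real^2^2 \<Rightarrow> 4 \<Rightarrow> 'a" where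
  "shift_frame b A = (\<lambda>i. if i = 1 then lc b (grow1 A) else if i = 2 then lc b (grow2 A) else b i)"

lemma lc_shift_frame:
  "lc (shift_frame b A) x = lc b (x + x$1 *\<^sub>R (grow1 A - axis 1 1) + x$2 *\<^sub>R (grow2 A - axis 2 1))"
  by (simp add: lc_expand shift_frame_def axis_def algebra_simps)

lemma frame_shift:
  assumes b: "frame V b"
  shows "frame V (shift_frame b A)"
proof -
  let ?m = "\<lambda>x::real^4. x + x$1 *\<^sub>R (grow1 A - axis 1 1) + x$2 *\<^sub>R (grow2 A - axis 2 1)"
  let ?n = "\<lambda>x::real^4. x - x$1 *\<^sub>R (grow1 A - axis 1 1) - x$2 *\<^sub>R (grow2 A - axis 2 1)"
  have mn: "?m (?n x) = x" "?n (?m x) = x" for x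
    by (rule vec4_eqI; simp add: axis_def algebra_simps)+
  have "inj (lc (shift_frame b A))"
  proof (rule injI)
    fix x y assume "lc (shift_frame b A) x = lc (shift_frame b A) y"
    then have "?m x = ?m y" unfolding lc_shift_frame using frame_lc_eq[OF b] by blast
    then show "x = y" using mn(2) by metis
  qed
  moreover have "range (lc (shift_frame b A)) = range (lc b)"
  proof (intro equalityI subsetI)
    fix v assume "v \<in> range (lc b)"
    then obtain x where "v = lc b x" by blast
    then have "v = lc (shift_frame b A) (?n x)" unfolding lc_shift_frame mn(1) .
    then show "v \<in> range (lc (shift_frame b A))" by blast
  qed (auto simp: lc_shift_frame)
  ultimately show ?thesis using b by (simp add: frame_iff)
qed

lemma graph_plane_shift: "graph_plane (shift_frame b A) B = graph_plane b (A + B)"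
proof -
  have "grow1 B + (grow1 B)$1 *\<^sub>R (grow1 A - axis 1 1) + (grow1 B)$2 *\<^sub>R (grow2 A - axis 2 1) = grow1 (A + B)"
    by (rule vec4_eqI) (simp_all add: axis_def)
  moreover have "grow2 B + (grow2 B)$1 *\<^sub>R (grow1 A - axis 1 1) + (grow2 B)$2 *\<^sub>R (grow2 A - axis 2 1) = grow2 (A + B)"
    by (rule vec4_eqI) (simp_all add: axis_def)
  ultimately show ?thesis unfolding graph_plane_lc lc_shift_frame by simp
qed

section \<open>Tangent spaces of the Grassmannian as spaces of 2 by 2 matrices\<close>

section \<open>Tangent vectors of the Grassmannian as homomorphisms\<close>

text \<open>The splitting of \<open>real^4\<close> into the domain (index 1) and the target (index
  2) of the maps whose graphs are the planes.\<close>

definition emb1 :: "real^2 \<Rightarrow> real^4" where "emb1 x = vector [x$1, x$2, 0, 0]"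
definition emb2 :: "real^2 \<Rightarrow> real^4" where "emb2 x = vector [0, 0, x$1, x$2]"
definition proj1 :: "real^4 \<Rightarrow> real^2" where "proj1 z = vector [z$1, z$2]"
definition proj2 :: "real^4 \<Rightarrow> real^2" where "proj2 z = vector [z$3, z$4]"

lemma emb_nth [simp]:
  "emb1 x $ 1 = x$1" "emb1 x $ 2 = x$2" "emb1 x $ 3 = 0" "emb1 x $ 4 = 0"
  "emb2 x $ 1 = 0" "emb2 x $ 2 = 0" "emb2 x $ 3 = x$1" "emb2 x $ 4 = x$2"
  "proj1 z $ 1 = z$1" "proj1 z $ 2 = z$2" "proj2 z $ 1 = z$3" "proj2 z $ 2 = z$4"
  by (simp_all add: emb1_def emb2_def proj1_def proj2_def)

lemma vec2_eqI: "(x::real^2) $ 1 = y $ 1 \<Longrightarrow> x $ 2 = y $ 2 \<Longrightarrow> x = y"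
  by (simp add: vec_eq_iff forall_2)

lemma emb_proj [simp]: "proj1 (emb1 x) = x" "proj2 (emb2 x) = x" "proj1 (emb2 x) = 0" "proj2 (emb1 x) = 0"
  by (rule vec2_eqI; simp)+

lemma emb_proj_sum: "emb1 (proj1 z) + emb2 (proj2 z) = z"
  by (rule vec4_eqI) simp_all

lemma linear_emb: "linear emb1" "linear emb2" "linear proj1" "linear proj2"
  by (auto intro!: linearI vec4_eqI vec2_eqI)

lemma grow_emb: "grow1 A = axis 1 1 + emb2 (A$1)" "grow2 A = axis 2 1 + emb2 (A$2)"
  by (rule vec4_eqI; simp add: axis_def)+

lemma vm_nth: "((x::real^2) v* (N::real^2^2)) $ j = x$1 * N$1$j + x$2 * N$2$j"
  by (simp add: vector_matrix_mult_def sum_2 mult.commute)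

lemma axis_vm: "axis i 1 v* (N::real^2^2) = N $ i"
  using exhaust_2[of i] by (auto intro!: vec2_eqI simp: vm_nth axis_def)

lemma vm_linear_right: "x v* (A + B :: real^2^2) = x v* A + x v* B" "x v* (r *\<^sub>R A) = r *\<^sub>R (x v* (A::real^2^2))"
  by (rule vec2_eqI; simp add: vm_nth algebra_simps)+

lemma vm_linear_left: "(x + y) v* (A :: real^2^2) = x v* A + y v* A" "(r *\<^sub>R x) v* (A::real^2^2) = r *\<^sub>R (x v* A)"
  by (rule vec2_eqI; simp add: vm_nth algebra_simps)+

lemma bounded_bilinear_vm: "bounded_bilinear (\<lambda>(x::real^2) (N::real^2^2). x v* N)"
  unfolding bilinear_conv_bounded_bilinear[symmetric] bilinear_def
  by (auto intro!: linearI simp: vm_linear_left vm_linear_right)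

lemma mat2_eq_vm:
  assumes "\<And>x. x v* A = x v* B"
  shows "(A::real^2^2) = B"
proof -
  have "A $ i = B $ i" for i using assms[of "axis i 1"] by (simp only: axis_vm)
  then show ?thesis by (auto simp: vec_eq_iff)
qed

text \<open>When the plane is \<open>graph_plane b 0\<close>, \<open>rv\<close> parametrizes it and
  \<open>rw\<close> a complement that represents the quotient. The rows of a chart matrix are images
  of basis vectors, hence coordinate vectors act from the left, as in \<open>x v* N\<close>.\<close>

definition rv :: "(4 \<Rightarrow> 'a::real_vector) \<Rightarrow> real^2 \<Rightarrow> 'a" where "rv b x = lc b (emb1 x)"
definition rw :: "(4 \<Rightarrow> 'a::real_vector) \<Rightarrow> real^2 \<Rightarrow> 'a" where "rw b x = lc b (emb2 x)"

lemma rv_expand: "rv b x = x$1 *\<^sub>R b 1 + x$2 *\<^sub>R b 2" and rw_expand: "rw b x = x$1 *\<^sub>R b 3 + x$2 *\<^sub>R b 4"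
  by (simp_all add: rv_def rw_def lc_expand)

lemma linear_rv: "linear (rv b)" "linear (rw b)"
  using linear_compose[OF linear_emb(1) linear_lc, of b] linear_compose[OF linear_emb(2) linear_lc, of b]
  by (simp_all add: rv_def[abs_def] rw_def[abs_def] o_def)

lemma rv_0 [simp]: "rv b 0 = 0" and rw_0 [simp]: "rw b 0 = 0"
  by (simp_all add: linear_0 linear_rv)

lemma lc_rv_rw: "lc b z = rv b (proj1 z) + rw b (proj2 z)"
proof -
  have "lc b z = lc b (emb1 (proj1 z) + emb2 (proj2 z))" by (simp only: emb_proj_sum)
  then show ?thesis by (simp add: linear_add[OF linear_lc] rv_def rw_def)
qed

lemma frame_rv_eq:
  assumes "frame V b"
  shows "rv b x + rw b y = rv b x' + rw b y' \<longleftrightarrow> x = x' \<and> y = y'"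
proof -
  have "rv b x + rw b y = lc b (emb1 x + emb2 y)" "rv b x' + rw b y' = lc b (emb1 x' + emb2 y')"
    by (simp_all add: rv_def rw_def linear_add[OF linear_lc])
  moreover have "emb1 x + emb2 y = emb1 x' + emb2 y' \<longleftrightarrow> x = x' \<and> y = y'"
    by (auto simp: vec_eq_iff forall_4 forall_2)
  ultimately show ?thesis using frame_lc_eq[OF assms] by simp
qed

lemma frame_rv_inj: "frame V b \<Longrightarrow> rv b x = rv b x' \<longleftrightarrow> x = x'"
  using frame_rv_eq[of V b x 0 x' 0] linear_0[OF linear_rv(2)] by simp

lemma plane_graph0: "plane (graph_plane b 0) = range (rv b)"
proof -
  have "plane (graph_plane b 0) = span {b 1, b 2}" by (simp add: graph_plane_def plane_oplane)
  also have "\<dots> = range (rv b)"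
  proof (intro equalityI subsetI)
    fix v assume "v \<in> span {b 1, b 2}"
    then obtain s t where "v = s *\<^sub>R b 1 + t *\<^sub>R b 2" by (auto simp: span_pair)
    then have "v = rv b (vector [s, t])" by (simp add: rv_expand)
    then show "v \<in> range (rv b)" by blast
  qed (auto simp: rv_expand span_pair)
  finally show ?thesis .
qed

lemma graph0_pair_mem: "x$1 * y$2 - x$2 * y$1 > 0 \<Longrightarrow> (rv b x, rv b y) \<in> graph_plane b 0"
  using oplane_memI[of "x$1" "y$2" "x$2" "y$1" "b 1" "b 2"] by (simp add: rv_expand graph_plane_def)

lemma graph0_pair_memD:
  assumes "frame V b" "(rv b x, rv b y) \<in> graph_plane b 0"
  shows "x$1 * y$2 - x$2 * y$1 > 0"
proof -
  obtain p q r s where "rv b x = p *\<^sub>R b 1 + q *\<^sub>R b 2" "rv b y = r *\<^sub>R b 1 + s *\<^sub>R b 2" and pos: "p * s - q * r > 0"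
    using assms(2) by (auto simp: graph_plane_def oplane_def)
  then have "rv b x = rv b (vector [p, q])" "rv b y = rv b (vector [r, s])" by (simp_all add: rv_expand)
  then have "x = vector [p, q]" "y = vector [r, s]" using frame_rv_inj[OF assms(1)] by auto
  then show ?thesis using pos by simp
qed

lemma rw_mem_plane: "frame V b \<Longrightarrow> rw b y \<in> plane (graph_plane b 0) \<longleftrightarrow> y = 0"
proof
  assume b: "frame V b" and "rw b y \<in> plane (graph_plane b 0)"
  then obtain x where "rw b y = rv b x" by (auto simp: plane_graph0)
  then have "rv b 0 + rw b y = rv b x + rw b 0" by simp
  then show "y = 0" using frame_rv_eq[OF b] by blast
next
  show "y = 0 \<Longrightarrow> rw b y \<in> plane (graph_plane b 0)"
    using rangeI[of "rv b" 0] by (simp add: plane_graph0)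
qed

lemma subspace_plane: "subspace (plane P)"
  by (simp add: plane_def)

lemma qcoset_eq: "qcoset P w = qcoset P w' \<longleftrightarrow> w - w' \<in> plane P"
proof
  assume e: "qcoset P w = qcoset P w'"
  have "w + 0 \<in> qcoset P w" unfolding qcoset_def using subspace_0[OF subspace_plane] by blast
  then obtain q where "q \<in> plane P" "w = w' + q" using e by (auto simp: qcoset_def)
  then show "w - w' \<in> plane P" by simp
next
  have *: "qcoset P u \<subseteq> qcoset P u'" if "u - u' \<in> plane P" for u u'
  proof
    fix z assume "z \<in> qcoset P u"
    then obtain q where q: "q \<in> plane P" "z = u + q" by (auto simp: qcoset_def)
    then have "z = u' + ((u - u') + q)" "(u - u') + q \<in> plane P"
      using that subspace_add[OF subspace_plane] by auto
    then show "z \<in> qcoset P u'" unfolding qcoset_def by blast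
  qed
  assume d: "w - w' \<in> plane P"
  then have "w' - w \<in> plane P" using subspace_neg[OF subspace_plane] by fastforce
  then show "qcoset P w = qcoset P w'" using *[OF d] * by blast
qed

text \<open>The homomorphism with matrix \<open>N\<close> relative to \<open>b 1\<close>,
  \<open>b 2\<close> in the plane and the classes of \<open>b 3\<close>, \<open>b 4\<close> in the
  quotient; empty off the plane, in keeping with \<open>Lin_quot\<close>.\<close>

definition frame_hom :: "(4 \<Rightarrow> 'a::real_vector) \<Rightarrow> real^2^2 \<Rightarrow> 'a \<Rightarrow> 'a set" where
  "frame_hom b N p = {w. \<exists>x q. q \<in> plane (graph_plane b 0) \<and> p = rv b x \<and> w = rw b (x v* N) + q}"

lemma frame_hom_apply: "frame V b \<Longrightarrow> frame_hom b N (rv b x) = qcoset (graph_plane b 0) (rw b (x v* N))"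
  unfolding frame_hom_def qcoset_def using frame_rv_inj[of V b] by (auto simp: image_iff)

lemma frame_hom_outside: "p \<notin> plane (graph_plane b 0) \<Longrightarrow> frame_hom b N p = {}"
  by (auto simp: frame_hom_def plane_graph0)

lemma qcoset_rw_eq: "frame V b \<Longrightarrow> qcoset (graph_plane b 0) (rw b y) = qcoset (graph_plane b 0) (rw b y') \<longleftrightarrow> y = y'"
  unfolding qcoset_eq linear_diff[OF linear_rv(2), symmetric] by (simp add: rw_mem_plane)

text \<open>Condition \<open>r\<close> compares the two homomorphisms on the basis
  \<open>b' 1\<close>, \<open>b' 2\<close> of the common plane. Only \<open>proj2\<close> enters on
  its left side, since components in the plane vanish in the quotient.\<close>

lemma frame_hom_eqI:
  assumes b: "frame V b" and b': "frame V b'" and P: "graph_plane b 0 = graph_plane b' 0"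
    and m: "linear m" "\<And>z. lc b' z = lc b (m z)"
    and r: "\<And>i. proj2 (m (emb2 (N' $ i))) = proj1 (m (emb1 (axis i 1))) v* N"
  shows "frame_hom b' N' = frame_hom b N"
proof
  fix p
  show "frame_hom b' N' p = frame_hom b N p"
  proof (cases "p \<in> plane (graph_plane b' 0)")
    case False
    then show ?thesis using frame_hom_outside P by metis
  next
    case True
    then obtain x where x: "p = rv b' x" by (auto simp: plane_graph0)
    define y where "y = proj1 (m (emb1 x))"
    have "p \<in> range (rv b)" using True P by (simp add: plane_graph0[symmetric])
    then obtain y' where y': "p = rv b y'" by blast
    have e: "lc b (m (emb1 x)) = rv b y'" using x y' m by (simp add: rv_def)
    then have "m (emb1 x) = emb1 y'" using frame_lc_eq[OF b] by (simp add: rv_def)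
    then have py: "p = rv b y" using y' by (simp add: y_def)
    have lp: "linear (\<lambda>z. proj2 (m z))" "linear (\<lambda>z. proj1 (m z))"
      using linear_compose[OF m(1) linear_emb(4)] linear_compose[OF m(1) linear_emb(3)] by (simp_all add: o_def)
    have xs: "x = x$1 *\<^sub>R axis 1 1 + x$2 *\<^sub>R axis 2 1" by (rule vec2_eqI) (simp_all add: axis_def)
    have e1: "emb1 x = x$1 *\<^sub>R emb1 (axis 1 1) + x$2 *\<^sub>R emb1 (axis 2 1)"
      by (rule vec4_eqI) (simp_all add: axis_def)
    have e2: "emb2 (x v* N') = x$1 *\<^sub>R emb2 (N'$1) + x$2 *\<^sub>R emb2 (N'$2)"
      by (rule vec4_eqI) (simp_all add: vm_nth)
    have "proj2 (m (emb2 (x v* N'))) = x$1 *\<^sub>R proj2 (m (emb2 (N'$1))) + x$2 *\<^sub>R proj2 (m (emb2 (N'$2)))"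
      unfolding e2 by (simp only: linear_add[OF lp(1)] linear_scale[OF lp(1)])
    also have "\<dots> = y v* N"
      unfolding r y_def e1 by (simp only: linear_add[OF lp(2)] linear_scale[OF lp(2)] vm_linear_left)
    finally have p2: "proj2 (m (emb2 (x v* N'))) = y v* N" .
    have "rw b' (x v* N') = rv b (proj1 (m (emb2 (x v* N')))) + rw b (y v* N)"
      unfolding rw_def[of b'] m(2) lc_rv_rw[of b] p2 ..
    then have "rw b' (x v* N') - rw b (y v* N) \<in> plane (graph_plane b 0)" by (simp add: plane_graph0)
    then have "qcoset (graph_plane b 0) (rw b' (x v* N')) = qcoset (graph_plane b 0) (rw b (y v* N))"
      by (simp add: qcoset_eq)
    then show ?thesis
      using frame_hom_apply[OF b', of N' x] frame_hom_apply[OF b, of N y] x py P by simp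
  qed
qed

lemma graph_chart_at: "frame V b \<Longrightarrow> graph_plane b A = P \<Longrightarrow> graph_chart b \<in> charts_at (Gr2 V) P"
  using graph_chart_mem[of V b] by (auto simp: charts_at_def graph_chart_dom)

text \<open>For each graph row \<open>g A\<close> the transition \<open>T\<close> satisfies
  \<open>proj1 (m (g A)) v* T A = proj2 (m (g A))\<close>. The derivative of this implicit equation
  at 0, where \<open>T\<close> vanishes, is the rule by which the matrices of one homomorphism
  transform.\<close>

lemma frame_hom_change:
  assumes b: "frame V b" and b': "frame V b'" and P: "graph_plane b 0 = P" "graph_plane b' 0 = P"
    and xi: "\<xi> \<in> tangent_space (Gr2 V) P"
  shows "frame_hom b' (\<xi> (graph_chart b')) = frame_hom b (\<xi> (graph_chart b))"
proof -
  obtain m where m: "linear m" "\<And>x. lc b' x = lc b (m x)" using frame_change[OF b' b] by metis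
  define N N' where "N = \<xi> (graph_chart b)" and "N' = \<xi> (graph_chart b')"
  define T where "T = snd (graph_chart b) \<circ> chart_inv (graph_chart b')"
  note tr = graph_chart_transition[OF b' b m]
  let ?O = "{A. qdet (m (grow1 A)) (m (grow2 A)) > 0}"
  have ch: "graph_chart b \<in> charts_at (Gr2 V) P" "graph_chart b' \<in> charts_at (Gr2 V) P"
    using graph_chart_at[OF b P(1)] graph_chart_at[OF b' P(2)] .
  have c0: "snd (graph_chart b') P = 0" using graph_chart_apply[OF b', of 0] P by simp
  have "N = frechet_derivative T (at 0) N'"
    unfolding N_def N'_def T_def using tangent_law(1)[OF xi ch(2,1)] c0 by simp
  moreover have "P \<in> fst (graph_chart b') \<inter> fst (graph_chart b)" using ch by (simp add: charts_at_def)
  then have O0: "0 \<in> ?O" unfolding tr(1)[symmetric] using c0 by (metis imageI)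
  ultimately have dT: "(T has_derivative frechet_derivative T (at 0)) (at 0)" and N: "N = frechet_derivative T (at 0) N'"
    using smooth_on_has_derivative[OF tr(4) O0] by (simp_all add: T_def)
  have T0: "T 0 = 0" using graph_chart_inv[OF b', of 0] graph_chart_apply[OF b, of 0] P by (simp add: T_def)
  have row: "proj2 (m (emb2 (N' $ i))) = proj1 (m (emb1 (axis i 1))) v* N" for i :: 2
  proof -
    define g where "g = (\<lambda>A :: real^2^2. emb1 (axis i 1) + emb2 (A $ i))"
    have g: "g = (if i = 1 then grow1 else grow2)"
      using exhaust_2[of i] by (auto simp: g_def fun_eq_iff intro!: vec4_eqI) (simp_all add: axis_def)
    have lp: "linear (\<lambda>z. proj2 (m z))" "linear (\<lambda>z. proj1 (m z))"
      using linear_compose[OF m(1) linear_emb(4)] linear_compose[OF m(1) linear_emb(3)] by (simp_all add: o_def)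
    have dg: "(g has_derivative (\<lambda>H. emb2 (H $ i))) (at 0)"
    proof -
      have "linear (\<lambda>H :: real^2^2. emb2 (H $ i))" by (auto intro!: linearI vec4_eqI)
      from has_derivative_add[OF has_derivative_const linear_imp_has_derivative[OF this]]
      show ?thesis unfolding g_def by simp
    qed
    have d2: "((\<lambda>A. proj2 (m (g A))) has_derivative (\<lambda>H. proj2 (m (emb2 (H $ i))))) (at 0)"
      by (rule has_derivative_compose[OF dg linear_imp_has_derivative[OF lp(1)]])
    have d1: "((\<lambda>A. proj1 (m (g A))) has_derivative (\<lambda>H. proj1 (m (emb2 (H $ i))))) (at 0)"
      by (rule has_derivative_compose[OF dg linear_imp_has_derivative[OF lp(2)]])
    have dB: "((\<lambda>A. proj1 (m (g A)) v* T A) has_derivative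
        (\<lambda>H. proj1 (m (g 0)) v* frechet_derivative T (at 0) H + proj1 (m (emb2 (H $ i))) v* T 0)) (at 0)"
      by (rule bounded_bilinear.FDERIV[OF bounded_bilinear_vm d1 dT])
    have eq: "proj1 (m (g A)) v* T A = proj2 (m (g A))" if A: "A \<in> ?O" for A
    proof -
      have TA: "T A = qmat (m (grow1 A)) (m (grow2 A))" using tr(2)[of A] A by (simp add: T_def)
      have nz: "qdet (m (grow1 A)) (m (grow2 A)) \<noteq> 0" using A by simp
      have "z = z$1 *\<^sub>R grow1 Q + z$2 *\<^sub>R grow2 Q \<Longrightarrow> proj1 z v* Q = proj2 z" for z and Q :: "real^2^2"
        by (rule vec2_eqI) (simp_all add: vm_nth vec_eq_iff forall_4)
      from this[OF qmat_row(1)[OF nz]] this[OF qmat_row(2)[OF nz]]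
      show ?thesis unfolding g TA by simp
    qed
    have "((\<lambda>A. proj2 (m (g A))) has_derivative
        (\<lambda>H. proj1 (m (g 0)) v* frechet_derivative T (at 0) H + proj1 (m (emb2 (H $ i))) v* T 0)) (at 0)"
      by (rule has_derivative_transform_within_open[OF dB tr(3) O0 eq])
    from has_derivative_unique[OF d2 this]
    have "proj2 (m (emb2 (N' $ i))) = proj1 (m (g 0)) v* N + proj1 (m (emb2 (N' $ i))) v* T 0"
      unfolding N by (rule fun_cong)
    moreover have "g 0 = emb1 (axis i 1)" by (rule vec4_eqI) (simp_all add: g_def)
    ultimately show ?thesis by (simp add: T0)
  qed
  show ?thesis
    unfolding N_def[symmetric] N'_def[symmetric]
    by (rule frame_hom_eqI[OF b b' _ m row]) (simp add: P)
qed

text \<open>\<open>Gr2_hom\<close> is a union over all frames adapted to the plane; by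
  \<open>frame_hom_change\<close> each of them contributes the same coset.\<close>

lemma Gr2_hom_eq:
  assumes b: "frame V b" and P: "graph_plane b 0 = P" and xi: "\<xi> \<in> tangent_space (Gr2 V) P"
  shows "Gr2_hom V P \<xi> = frame_hom b (\<xi> (graph_chart b))"
proof
  fix p
  have *: "frame_hom b' (\<xi> (graph_chart b')) p = {w. \<exists>s t q. q \<in> plane P \<and> p = s *\<^sub>R b' 1 + t *\<^sub>R b' 2 \<and>
     w = s *\<^sub>R ((\<xi> (graph_chart b')$1$1) *\<^sub>R b' 3 + (\<xi> (graph_chart b')$1$2) *\<^sub>R b' 4)
       + t *\<^sub>R ((\<xi> (graph_chart b')$2$1) *\<^sub>R b' 3 + (\<xi> (graph_chart b')$2$2) *\<^sub>R b' 4) + q}" (is "?l = ?r")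
    if P': "graph_plane b' 0 = P" for b'
  proof -
    define N where "N = \<xi> (graph_chart b')"
    have e: "rw b' (x v* N) = x$1 *\<^sub>R (N$1$1 *\<^sub>R b' 3 + N$1$2 *\<^sub>R b' 4) + x$2 *\<^sub>R (N$2$1 *\<^sub>R b' 3 + N$2$2 *\<^sub>R b' 4)" for x
      by (simp add: rw_expand vm_nth algebra_simps)
    show ?thesis
      unfolding N_def[symmetric] frame_hom_def P' e rv_expand
    proof (intro Collect_cong iffI; elim exE)
      fix w x q assume "q \<in> plane P \<and> p = x$1 *\<^sub>R b' 1 + x$2 *\<^sub>R b' 2 \<and>
        w = x$1 *\<^sub>R (N$1$1 *\<^sub>R b' 3 + N$1$2 *\<^sub>R b' 4) + x$2 *\<^sub>R (N$2$1 *\<^sub>R b' 3 + N$2$2 *\<^sub>R b' 4) + q"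
      then show "\<exists>s t q. q \<in> plane P \<and> p = s *\<^sub>R b' 1 + t *\<^sub>R b' 2 \<and>
        w = s *\<^sub>R (N$1$1 *\<^sub>R b' 3 + N$1$2 *\<^sub>R b' 4) + t *\<^sub>R (N$2$1 *\<^sub>R b' 3 + N$2$2 *\<^sub>R b' 4) + q" by blast
    next
      fix w s t q assume "q \<in> plane P \<and> p = s *\<^sub>R b' 1 + t *\<^sub>R b' 2 \<and>
        w = s *\<^sub>R (N$1$1 *\<^sub>R b' 3 + N$1$2 *\<^sub>R b' 4) + t *\<^sub>R (N$2$1 *\<^sub>R b' 3 + N$2$2 *\<^sub>R b' 4) + q"
      then show "\<exists>(x::real^2) q. q \<in> plane P \<and> p = x$1 *\<^sub>R b' 1 + x$2 *\<^sub>R b' 2 \<and>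
        w = x$1 *\<^sub>R (N$1$1 *\<^sub>R b' 3 + N$1$2 *\<^sub>R b' 4) + x$2 *\<^sub>R (N$2$1 *\<^sub>R b' 3 + N$2$2 *\<^sub>R b' 4) + q"
        by (intro exI[of _ "vector [s, t]"] exI[of _ q]) simp
    qed
  qed
  have fc: "frame_hom b' (\<xi> (graph_chart b')) = frame_hom b (\<xi> (graph_chart b))"
    if "frame V b'" "graph_plane b' 0 = P" for b'
    by (rule frame_hom_change[OF b that(1) P that(2) xi])
  have "w \<in> Gr2_hom V P \<xi> p \<longleftrightarrow> (\<exists>b'. frame V b' \<and> graph_plane b' 0 = P \<and> w \<in> frame_hom b' (\<xi> (graph_chart b')) p)" for w
    unfolding Gr2_hom_def mem_Collect_eq
  proof (rule ex_cong1)
    fix b'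
    show "(\<exists>s t q. frame V b' \<and> graph_plane b' 0 = P \<and> q \<in> plane P \<and> p = s *\<^sub>R b' 1 + t *\<^sub>R b' 2 \<and>
       w = s *\<^sub>R ((\<xi> (graph_chart b')$1$1) *\<^sub>R b' 3 + (\<xi> (graph_chart b')$1$2) *\<^sub>R b' 4)
         + t *\<^sub>R ((\<xi> (graph_chart b')$2$1) *\<^sub>R b' 3 + (\<xi> (graph_chart b')$2$2) *\<^sub>R b' 4) + q)
      \<longleftrightarrow> frame V b' \<and> graph_plane b' 0 = P \<and> w \<in> frame_hom b' (\<xi> (graph_chart b')) p"
    proof (cases "graph_plane b' 0 = P")
      case True
      show ?thesis unfolding *[OF True] mem_Collect_eq by blast
    qed blast
  qed
  then have "w \<in> Gr2_hom V P \<xi> p \<longleftrightarrow> w \<in> frame_hom b (\<xi> (graph_chart b)) p" for w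
    using fc b P by metis
  then show "Gr2_hom V P \<xi> p = frame_hom b (\<xi> (graph_chart b)) p" by blast
qed

section \<open>Rank one as nonzero matrix of zero determinant\<close>

section \<open>Rank\<close>

lemma dim_frame_image:
  assumes b: "frame V b" and W: "subspace W"
  shows "dim (lc b ` W) = dim W"
proof -
  obtain B where B: "B \<subseteq> W" "independent B" "span B = W" "card B = dim W"
    using basis_exists[of W] by (metis W span_subspace)
  have inj: "inj (lc b)" using b by (simp add: frame_iff)
  have "independent (lc b ` B)"
    by (rule linear_independent_injective_image[OF linear_lc B(2)]) (use inj in \<open>auto intro: inj_on_subset\<close>)
  moreover have "lc b ` W = span (lc b ` B)" using linear_span_image[OF linear_lc, of b B] B(3) by simp
  ultimately have "dim (lc b ` W) = card (lc b ` B)" by (simp add: dim_eq_card_independent)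
  also have "\<dots> = dim W" using B(4) inj by (metis card_image inj_on_subset subset_UNIV)
  finally show ?thesis .
qed

lemma mat2_det: "det (N::real^2^2) = N$1$1 * N$2$2 - N$1$2 * N$2$1"
  by (rule det_2)

lemma mat2_invertible: "det (N::real^2^2) \<noteq> 0 \<Longrightarrow> \<exists>Ni. N ** Ni = mat 1 \<and> Ni ** N = mat 1"
  using invertible_det_nz[of N] by (auto simp: invertible_def)

lemma frame_hom_Union:
  assumes b: "frame V b"
  shows "(\<Union>p\<in>plane (graph_plane b 0). frame_hom b N p) = lc b ` {z. \<exists>y. proj2 z = y v* N}"
proof (intro equalityI subsetI)
  fix w assume "w \<in> (\<Union>p\<in>plane (graph_plane b 0). frame_hom b N p)"
  then obtain x y where "w = rw b (x v* N) + rv b y" by (auto simp: frame_hom_def plane_graph0)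
  then have "w = lc b (emb1 y + emb2 (x v* N))" by (simp add: rv_def rw_def linear_add[OF linear_lc])
  moreover have "proj2 (emb1 y + emb2 (x v* N)) = x v* N" by (rule vec2_eqI) simp_all
  ultimately show "w \<in> lc b ` {z. \<exists>y. proj2 z = y v* N}" by blast
next
  fix w assume "w \<in> lc b ` {z. \<exists>y. proj2 z = y v* N}"
  then obtain z y where "w = lc b z" "proj2 z = y v* N" by blast
  then have "w = rw b (y v* N) + rv b (proj1 z)" by (simp add: lc_rv_rw add.commute)
  then have "w \<in> frame_hom b N (rv b y)" unfolding frame_hom_def plane_graph0 by blast
  then show "w \<in> (\<Union>p\<in>plane (graph_plane b 0). frame_hom b N p)" by (auto simp: plane_graph0)
qed

lemma dim_axis_pair: "dim {z :: real^4. proj2 z = 0} = 2"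
proof -
  have "{z :: real^4. proj2 z = 0} = span {axis 1 1, axis 2 1}"
  proof (intro equalityI subsetI)
    fix z :: "real^4" assume "z \<in> {z. proj2 z = 0}"
    then have "z$3 = 0" "z$4 = 0" by (auto simp: vec_eq_iff forall_2)
    then have "z = z$1 *\<^sub>R axis 1 1 + z$2 *\<^sub>R axis 2 1" by (intro vec4_eqI) (simp_all add: axis_def)
    then show "z \<in> span {axis 1 1, axis 2 1}" unfolding span_pair by blast
  next
    fix z :: "real^4" assume "z \<in> span {axis 1 1, axis 2 1}"
    then show "z \<in> {z. proj2 z = 0}" unfolding span_pair by (auto intro!: vec2_eqI simp: axis_def)
  qed
  moreover have "independent {axis 1 1, axis 2 (1::real) :: real^4}"
    by (rule independent_mono[OF independent_Basis]) (auto simp: Basis_vec_def)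
  moreover have "axis 1 1 \<noteq> (axis 2 1 :: real^4)" by (simp add: axis_eq_axis)
  ultimately show ?thesis by (simp add: dim_eq_card_independent)
qed

lemma subspace_row: "subspace {z. \<exists>y. proj2 z = y v* (N :: real^2^2)}"
proof (rule subspaceI)
  show "0 \<in> {z. \<exists>y. proj2 z = y v* N}" by (auto intro!: exI[of _ 0] vec2_eqI)
next
  fix z z' assume "z \<in> {z. \<exists>y. proj2 z = y v* N}" "z' \<in> {z. \<exists>y. proj2 z = y v* N}"
  then obtain y y' where "proj2 z = y v* N" "proj2 z' = y' v* N" by blast
  then have "proj2 (z + z') = (y + y') v* N" by (simp add: linear_add[OF linear_emb(4)] vm_linear_left)
  then show "z + z' \<in> {z. \<exists>y. proj2 z = y v* N}" by blast
next
  fix r z assume "z \<in> {z. \<exists>y. proj2 z = y v* N}"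
  then obtain y where "proj2 z = y v* N" by blast
  then have "proj2 (r *\<^sub>R z) = (r *\<^sub>R y) v* N" by (simp add: linear_scale[OF linear_emb(4)] vm_linear_left)
  then show "r *\<^sub>R z \<in> {z. \<exists>y. proj2 z = y v* N}" by blast
qed

text \<open>A nonzero singular matrix has proportional rows, hence a row space spanned by a single
  \<open>u\<close>; its preimage under \<open>proj2\<close> adds the two dimensions of the
  kernel.\<close>

lemma dim_row_singular:
  assumes "N \<noteq> 0" "det N = 0"
  shows "dim {z. \<exists>y. proj2 z = y v* N} = 3"
proof -
  have d: "N$1$1 * N$2$2 = N$1$2 * N$2$1" using assms(2) by (simp add: mat2_det)
  obtain u i j where u: "u = N $ i" "u \<noteq> 0" "i \<noteq> j" "\<exists>k. N $ j = k *\<^sub>R u"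
  proof (cases "N $ 1 = 0")
    case True
    then have "N $ 2 \<noteq> 0" using assms(1) by (auto simp: vec_eq_iff forall_2)
    then show thesis using that[of "N $ 2" 2 1] True by (auto intro!: exI[of _ 0])
  next
    case False
    have "\<exists>k. N $ 2 = k *\<^sub>R N $ 1"
    proof (cases "N$1$1 = 0")
      case True
      then have nz: "N$1$2 \<noteq> 0" using False by (auto simp: vec_eq_iff forall_2)
      then have "N$2$1 = 0" using d True by simp
      then show ?thesis using nz True by (intro exI[of _ "N$2$2 / N$1$2"] vec2_eqI) simp_all
    next
      case False
      then show ?thesis using d by (intro exI[of _ "N$2$1 / N$1$1"] vec2_eqI) (simp_all add: field_simps)
    qed
    then show thesis using that[of "N $ 1" 1 2] False by simp
  qed
  obtain k where k: "N $ j = k *\<^sub>R u" using u by blast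
  have "\<exists>t. y v* N = t *\<^sub>R u" for y
  proof -
    have "i = 1 \<and> j = 2 \<or> i = 2 \<and> j = 1" using u(3) exhaust_2[of i] exhaust_2[of j] by auto
    then have "y v* N = (y $ i + y $ j * k) *\<^sub>R u"
      using u(1) k by (auto intro!: vec2_eqI simp: vm_nth algebra_simps)
    then show ?thesis by blast
  qed
  moreover have "(t *\<^sub>R axis i 1) v* N = t *\<^sub>R u" for t by (simp add: vm_linear_left axis_vm u(1))
  ultimately have W: "{z. \<exists>y. proj2 z = y v* N} = {z. \<exists>t. proj2 z = t *\<^sub>R u}" by metis
  have S: "{z. \<exists>t. proj2 z = t *\<^sub>R u} = span {axis 1 1, axis 2 1, emb2 u}"
  proof (intro equalityI subsetI)
    fix z assume "z \<in> {z. \<exists>t. proj2 z = t *\<^sub>R u}"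
    then obtain t where t: "proj2 z = t *\<^sub>R u" by blast
    have z: "z = z$1 *\<^sub>R axis 1 1 + z$2 *\<^sub>R axis 2 1 + t *\<^sub>R emb2 u"
      using arg_cong[OF t, of "\<lambda>x. x$1"] arg_cong[OF t, of "\<lambda>x. x$2"]
      by (intro vec4_eqI) (simp_all add: axis_def)
    show "z \<in> span {axis 1 1, axis 2 1, emb2 u}"
      by (subst z) (intro span_add span_scale span_base; simp)
  next
    fix z assume "z \<in> span {axis 1 1, axis 2 1, emb2 u}"
    then show "z \<in> {z. \<exists>t. proj2 z = t *\<^sub>R u}"
    proof (induction rule: span_induct_alt)
      case base
      show ?case by (auto intro!: exI[of _ 0] vec2_eqI)
    next
      case (step c x y)
      then obtain t where t: "proj2 y = t *\<^sub>R u" by blast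
      have "\<exists>s. proj2 x = s *\<^sub>R u"
      proof -
        have "proj2 (axis 1 1) = 0 *\<^sub>R u" "proj2 (axis 2 1) = 0 *\<^sub>R u" "proj2 (emb2 u) = 1 *\<^sub>R u"
          by (auto intro!: vec2_eqI simp: axis_def)
        then show ?thesis using step(1) by (metis insertE singletonD)
      qed
      then obtain s where "proj2 x = s *\<^sub>R u" by blast
      then have "proj2 (c *\<^sub>R x + y) = (c * s + t) *\<^sub>R u"
        using t by (simp add: linear_add[OF linear_emb(4)] linear_scale[OF linear_emb(4)] scaleR_add_left)
      then show ?case by blast
    qed
  qed
  have e: "emb2 u \<noteq> 0" using u(2) by (auto simp: vec_eq_iff forall_4 forall_2)
  have ne: "axis 1 1 \<noteq> (axis 2 1 :: real^4)" by (simp add: axis_eq_axis)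
  have ne2: "axis 1 1 \<noteq> emb2 u" "axis 2 1 \<noteq> emb2 u"
    by (metis axis_nth emb_nth(5) zero_neq_one) (metis axis_nth emb_nth(6) zero_neq_one)
  have "independent {axis 1 1, axis 2 1, emb2 u}"
  proof (rule pairwise_orthogonal_independent)
    have "axis 1 1 \<bullet> (axis 2 1 :: real^4) = 0" "axis 1 1 \<bullet> emb2 u = 0" "axis 2 1 \<bullet> emb2 u = 0"
      by (simp_all add: inner_axis_axis inner_axis') (simp add: axis_def)
    then show "pairwise orthogonal {axis 1 1, axis 2 1, emb2 u}"
      by (auto simp: pairwise_def orthogonal_def inner_commute)
    show "0 \<notin> {axis 1 1, axis 2 1, emb2 u}" using e by (auto simp: axis_eq_0_iff)
  qed
  then have "dim (span {axis 1 1, axis 2 1, emb2 u}) = card {axis 1 1, axis 2 1, emb2 u}"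
    by (rule dim_span_eq_card_independent)
  then show ?thesis using ne ne2 unfolding W S by simp
qed

text \<open>The cosets in the image fill the preimage of the row space of \<open>N\<close>, so
  \<open>quot_rank\<close> is the rank of \<open>N\<close>. Ellipticity thereby becomes a statement
  about determinants.\<close>

lemma quot_rank_frame_hom:
  assumes b: "frame V b"
  shows "quot_rank (graph_plane b 0) (frame_hom b N) = 1 \<longleftrightarrow> N \<noteq> 0 \<and> det N = 0"
proof -
  have p: "plane (graph_plane b 0) = lc b ` {z. proj2 z = 0}"
  proof (intro equalityI subsetI)
    fix v assume "v \<in> lc b ` {z. proj2 z = 0}"
    then show "v \<in> plane (graph_plane b 0)" by (auto simp: plane_graph0 lc_rv_rw)
  qed (auto simp: plane_graph0 rv_def)
  have s0: "subspace {z :: real^4. proj2 z = 0}"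
    using linear_subspace_vimage[OF linear_emb(4) subspace_single_0] by (simp add: vimage_def)
  have q: "quot_rank (graph_plane b 0) (frame_hom b N) = dim {z. \<exists>y. proj2 z = y v* N} - 2"
  proof -
    have "dim (plane (graph_plane b 0)) = 2" unfolding p dim_frame_image[OF b s0] dim_axis_pair ..
    then show ?thesis unfolding quot_rank_def frame_hom_Union[OF b] dim_frame_image[OF b subspace_row] by simp
  qed
  show ?thesis
  proof (cases "det N = 0")
    case False
    then obtain Ni where "Ni ** N = mat 1" using mat2_invertible by blast
    then have "y = (y v* Ni) v* N" for y by (simp add: vector_matrix_mul_assoc)
    then have "{z. \<exists>y. proj2 z = y v* N} = UNIV" by blast
    then have "dim {z. \<exists>y. proj2 z = y v* N} = 4" by simp
    then show ?thesis using q False by simp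
  next
    case True
    show ?thesis
    proof (cases "N = 0")
      case True
      then have "{z. \<exists>y. proj2 z = y v* N} = {z. proj2 z = 0}" by auto
      then show ?thesis using q True dim_axis_pair by simp
    next
      case False
      then show ?thesis using q dim_row_singular[OF False True] True by simp
    qed
  qed
qed

section \<open>The orientation by complex structures as the sign of a polynomial\<close>

section \<open>Complex structures and positive bases\<close>

text \<open>For \<open>N2 = a *\<^sub>R N1 + c *\<^sub>R (j ** N1)\<close> the determinant of the
  first rows is c times \<open>j$1$2\<close> times \<open>det N1\<close>. The extra factor
  \<open>det N1\<close> completes a square, so the sign is that of \<open>c\<close> if the complex
  structure \<open>j\<close> turns the first basis vector in the positive direction, that is if
  \<open>j$1$2 > 0\<close>.\<close>

definition posdet :: "real^2^2 \<Rightarrow> real^2^2 \<Rightarrow> real" where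
  "posdet N1 N2 = (N1$1$1 * N2$1$2 - N1$1$2 * N2$1$1) * det N1"

lemma mm_nth: "((A::real^2^2) ** B) $ i $ j = A$i$1 * B$1$j + A$i$2 * B$2$j"
  by (simp add: matrix_matrix_mult_def sum_2)

lemma mm_linear:
  "(A + B) ** (C::real^2^2) = A ** C + B ** C" "(r *\<^sub>R A) ** (C::real^2^2) = r *\<^sub>R (A ** C)"
  "C ** (A + B :: real^2^2) = C ** A + C ** B" "C ** (r *\<^sub>R A) = r *\<^sub>R (C ** (A::real^2^2))"
  by (rule mat2_eqI; simp add: mm_nth algebra_simps)+

lemma mat1_nth: "(mat 1 :: real^2^2) $ 1 $ 1 = 1" "(mat 1 :: real^2^2) $ 1 $ 2 = 0"
  "(mat 1 :: real^2^2) $ 2 $ 1 = 0" "(mat 1 :: real^2^2) $ 2 $ 2 = 1"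
  by (simp_all add: mat_def)

text \<open>\<open>N\<^sub>2 N\<^sub>1\<^sup>-\<^sup>1\<close> has no real eigenvalue, so it is \<open>a + \<beta> j\<close> for a complex structure \<open>j\<close>.\<close>
lemma complex_decomposition:
  fixes N1 N2 :: "real^2^2"
  assumes d: "det N1 \<noteq> 0" and nr: "\<And>s. det (N2 - s *\<^sub>R N1) \<noteq> 0" and pos: "posdet N1 N2 > 0"
  obtains a \<beta> j where "\<beta> > 0" "N2 = a *\<^sub>R N1 + \<beta> *\<^sub>R (j ** N1)" "j ** j = - mat 1" "j$1$2 > 0" "j$2$2 = - (j$1$1)"
    "(j$1$1)^2 + j$1$2 * j$2$1 = -1"
proof -
  obtain Ni where Ni: "N1 ** Ni = mat 1" "Ni ** N1 = mat 1" using mat2_invertible[OF d] by blast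
  define M where "M = N2 ** Ni"
  have N2: "N2 = M ** N1" by (simp add: M_def matrix_mul_assoc[symmetric] Ni)
  \<comment> \<open>The discriminant of the characteristic polynomial of \<open>M\<close>. If it
    were nonnegative, \<open>s\<close> below would be a real eigenvalue.\<close>
  define ds where "ds = (M$1$1 - M$2$2)^2 + 4 * (M$1$2 * M$2$1)"
  have ev: "(M$1$1 - s) * (M$2$2 - s) - M$1$2 * M$2$1 \<noteq> 0" for s
  proof -
    have "N2 - s *\<^sub>R N1 = (M - s *\<^sub>R mat 1) ** N1"
      by (rule mat2_eqI) (simp_all add: N2 mm_nth mat1_nth algebra_simps)
    then have "det (M - s *\<^sub>R mat 1) * det N1 \<noteq> 0" using nr[of s] by (simp add: det_mul)
    then show ?thesis by (simp add: mat2_det mat1_nth)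
  qed
  have ds: "ds < 0"
  proof (rule ccontr)
    assume "\<not> ds < 0"
    then have sq: "sqrt ds * sqrt ds = ds" by simp
    define s where "s = (M$1$1 + M$2$2 + sqrt ds) / 2"
    have "4 * ((M$1$1 - s) * (M$2$2 - s) - M$1$2 * M$2$1) = sqrt ds * sqrt ds - ds"
      by (simp add: s_def ds_def power2_eq_square field_simps)
    then show False using ev[of s] sq by simp
  qed
  \<comment> \<open>\<open>a\<close> and \<open>\<beta>\<close> are the real and imaginary parts of
    the eigenvalues of \<open>M\<close>, so \<open>j\<close> has eigenvalues i and -i and squares to
    -1.\<close>
  define \<beta> where "\<beta> = sqrt (- ds) / 2"
  have b: "\<beta> > 0" and b2: "\<beta> * \<beta> = - ds / 4" using ds by (simp_all add: \<beta>_def)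
  define a where "a = (M$1$1 + M$2$2) / 2"
  define j where "j = (1 / \<beta>) *\<^sub>R (M - a *\<^sub>R mat 1)"
  have Mj: "M = a *\<^sub>R mat 1 + \<beta> *\<^sub>R j" using b by (simp add: j_def)
  have N2e: "N2 = a *\<^sub>R N1 + \<beta> *\<^sub>R (j ** N1)"
    unfolding N2 by (subst Mj) (simp add: mm_linear)
  \<comment> \<open>As \<open>N2 = M ** N1\<close>, \<open>posdet N1 N2\<close> is
    \<open>M$1$2\<close> times a square; with \<open>\<beta>\<close> taken positive, its sign passes
    to \<open>j$1$2\<close>.\<close>
  have "N1$1$1 * N2$1$2 - N1$1$2 * N2$1$1 = M$1$2 * det N1"
    by (simp add: N2 mm_nth mat2_det algebra_simps)
  then have "M$1$2 * (det N1)^2 > 0" using pos by (simp add: posdet_def power2_eq_square mult.assoc)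
  then have "M$1$2 > 0" using d by (simp add: zero_less_mult_iff)
  then have j12: "j$1$2 > 0" using b by (simp add: j_def mat1_nth)
  have "M$2$2 - a = - (M$1$1 - a)" by (simp add: a_def field_simps)
  moreover have "j$2$2 = (M$2$2 - a) / \<beta>" "j$1$1 = (M$1$1 - a) / \<beta>" by (simp_all add: j_def mat1_nth)
  ultimately have tr: "j$2$2 = - (j$1$1)" by (metis minus_divide_left)
  have "\<beta> * \<beta> * ((j$1$1)^2 + j$1$2 * j$2$1) = (\<beta> * j$1$1)^2 + (\<beta> * j$1$2) * (\<beta> * j$2$1)"
    by (simp add: power2_eq_square algebra_simps)
  also have "\<dots> = ds / 4"
    using b by (simp add: j_def a_def mat1_nth ds_def power2_eq_square field_simps)
  finally have "\<beta> * \<beta> * ((j$1$1)^2 + j$1$2 * j$2$1) = \<beta> * \<beta> * (-1)" using b2 by simp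
  then have dj: "(j$1$1)^2 + j$1$2 * j$2$1 = -1" using b by (metis mult_cancel_left less_irrefl mult_eq_0_iff)
  have "j ** j = - mat 1"
    using dj by (intro mat2_eqI) (simp_all add: mm_nth mat1_nth tr power2_eq_square mult.commute)
  then show thesis using that[OF b N2e _ j12 tr dj] by blast
qed

text \<open>The endomorphism \<open>h\<close> of coordinates is transported to \<open>V\<close> and
  extended to the whole ambient type, because \<open>complex_structures\<close> asks for linearity
  there.\<close>

lemma frame_linear_extend:
  assumes b: "frame V b" and h: "linear h"
  obtains J where "linear J" "\<And>z. J (lc b z) = lc b (h z)"
proof -
  have inj: "inj b" and ind: "independent (range b)" using b by (auto simp: frame_def)
  obtain J where J: "linear J" "\<forall>v\<in>range b. J v = lc b (h (axis (inv b v) 1))"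
    using linear_independent_extend[OF ind, of "\<lambda>v. lc b (h (axis (inv b v) 1))"] by blast
  have l: "linear (\<lambda>z. lc b (h z))" using linear_compose[OF h linear_lc] by (simp add: o_def)
  have "J (lc b z) = lc b (h z)" for z
  proof -
    have "lc b (h (axis i 1)) = J (b i)" for i using J(2) inj by simp
    then have "J (lc b z) = lc (\<lambda>i. lc b (h (axis i 1))) z" using linear_lc_comp[OF J(1), of b z] by simp
    also have "\<dots> = lc b (h (lc (\<lambda>i. axis i 1) z))" using linear_lc_comp[OF l, of "\<lambda>i. axis i 1" z] by simp
    also have "lc (\<lambda>i. axis i 1) z = z" by (rule vec4_eqI) (simp_all add: lc_expand axis_def)
    finally show ?thesis .
  qed
  then show thesis using that J by blast
qed

text \<open>A homomorphism is fixed by the classes of the images of the two basis vectors, and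
  \<open>proj2\<close> of their coordinates reads these classes off.\<close>

lemma Lin_quot_frame_hom:
  assumes b: "frame V b"
  shows "Lin_quot V (graph_plane b 0) = range (frame_hom b)"
proof (intro equalityI subsetI)
  let ?P = "graph_plane b 0"
  fix A assume "A \<in> Lin_quot V ?P"
  then obtain L where L: "linear L" "L ` plane ?P \<subseteq> V" "\<And>p. p \<in> plane ?P \<Longrightarrow> A p = qcoset ?P (L p)"
    and out: "\<And>p. p \<notin> plane ?P \<Longrightarrow> A p = {}" by (auto simp: Lin_quot_def)
  have "L (rv b (axis i 1)) \<in> V" for i using L(2) unfolding plane_graph0 by blast
  then have "\<exists>z. L (rv b (axis i 1)) = lc b z" for i using frame_obtain[OF b] by blast
  then obtain z where z: "\<And>i. L (rv b (axis i 1)) = lc b (z i)" by metis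
  define N where "N = (\<chi> i. proj2 (z i))"
  have "A p = frame_hom b N p" for p
  proof (cases "p \<in> plane ?P")
    case True
    then obtain x where x: "p = rv b x" by (auto simp: plane_graph0)
    have xs: "x = x$1 *\<^sub>R axis 1 1 + x$2 *\<^sub>R axis 2 1" by (rule vec2_eqI) (simp_all add: axis_def)
    have "L (rv b x) = x$1 *\<^sub>R lc b (z 1) + x$2 *\<^sub>R lc b (z 2)"
      by (subst xs) (simp only: linear_add[OF linear_rv(1)] linear_scale[OF linear_rv(1)] linear_add[OF L(1)] linear_scale[OF L(1)] z)
    also have "\<dots> = lc b (x$1 *\<^sub>R z 1 + x$2 *\<^sub>R z 2)" by (simp add: linear_add[OF linear_lc] linear_scale[OF linear_lc])
    also have "\<dots> = rv b (proj1 (x$1 *\<^sub>R z 1 + x$2 *\<^sub>R z 2)) + rw b (x v* N)"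
    proof -
      have "proj2 (x$1 *\<^sub>R z 1 + x$2 *\<^sub>R z 2) = x v* N" by (rule vec2_eqI) (simp_all add: vm_nth N_def)
      then show ?thesis by (simp add: lc_rv_rw)
    qed
    finally have "L p - rw b (x v* N) \<in> plane ?P" by (simp add: x plane_graph0)
    then have "qcoset ?P (L p) = qcoset ?P (rw b (x v* N))" by (simp add: qcoset_eq)
    then show ?thesis using L(3)[OF True] frame_hom_apply[OF b, of N x] x by simp
  next
    case False
    then show ?thesis using out frame_hom_outside by metis
  qed
  then show "A \<in> range (frame_hom b)" by blast
next
  let ?P = "graph_plane b 0"
  fix A assume "A \<in> range (frame_hom b)"
  then obtain N where A: "A = frame_hom b N" by blast
  have "linear (\<lambda>z. emb2 (proj1 z v* N))"
    by (rule linearI) (simp_all add: linear_add[OF linear_emb(2)] linear_scale[OF linear_emb(2)] linear_add[OF linear_emb(3)] linear_scale[OF linear_emb(3)] vm_linear_left)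
  then obtain L where L: "linear L" "\<And>z. L (lc b z) = lc b (emb2 (proj1 z v* N))" using frame_linear_extend[OF b] by metis
  have Lr: "L (rv b x) = rw b (x v* N)" for x by (simp add: rv_def L rw_def)
  have "L ` plane ?P \<subseteq> V" using frame_mem[OF b] by (auto simp: plane_graph0 Lr rw_def)
  moreover have "A p = qcoset ?P (L p)" if "p \<in> plane ?P" for p
    using that frame_hom_apply[OF b] by (auto simp: plane_graph0 A Lr)
  ultimately show "A \<in> Lin_quot V ?P" using L(1) frame_hom_outside A unfolding Lin_quot_def by blast
qed

text \<open>Evaluate the relation between the two homomorphisms at the first basis vector. If
  \<open>x\<close> are the coordinates of its image under \<open>J\<close>, then
  \<open>posdet N1 N2\<close> is c times \<open>x$2\<close> times the square of
  \<open>det N1\<close>, and compatibility of \<open>J\<close> with the orientation says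
  \<open>x$2 > 0\<close>.\<close>

lemma positive_basis_posdet:
  assumes b: "frame V b" and d: "\<And>N. N \<in> T0 \<Longrightarrow> N \<noteq> 0 \<Longrightarrow> det N \<noteq> 0" and N: "N1 \<in> T0" "N2 \<in> T0"
    and pb: "positive_basis V (graph_plane b 0) (frame_hom b ` T0) (frame_hom b N1) (frame_hom b N2)"
  shows "posdet N1 N2 > 0"
proof -
  let ?P = "graph_plane b 0"
  obtain p where p: "p \<in> plane ?P" "frame_hom b N1 p \<noteq> qcoset ?P 0"
    using pb unfolding positive_basis_def by blast
  have "N1 \<noteq> 0"
  proof
    assume "N1 = 0"
    obtain x where "p = rv b x" using p by (auto simp: plane_graph0)
    then show False using p(2) \<open>N1 = 0\<close> frame_hom_apply[OF b, of N1 x] by simp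
  qed
  then have dN: "det N1 \<noteq> 0" using d N by blast
  obtain J K a c where cs: "complex_structures V ?P (frame_hom b ` T0) J K" and c: "c > 0"
    and B: "\<And>p. p \<in> plane ?P \<Longrightarrow> frame_hom b N2 p = frame_hom b N1 (a *\<^sub>R p + c *\<^sub>R J p)"
    using pb unfolding positive_basis_def by blast
  let ?e = "axis 1 1 :: real^2"
  have e: "rv b ?e \<in> plane ?P" by (simp add: plane_graph0)
  have "rv b ?e \<noteq> 0"
    using frame_rv_inj[OF b, of ?e 0] by (simp add: axis_eq_0_iff)
  then have or: "(rv b ?e, J (rv b ?e)) \<in> ?P" using cs e by (auto simp: complex_structures_def)
  have "J (rv b ?e) \<in> plane ?P" using cs e by (auto simp: complex_structures_def)
  then obtain x where x: "J (rv b ?e) = rv b x" by (auto simp: plane_graph0)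
  have x2: "x$2 > 0" using graph0_pair_memD[OF b or[unfolded x]] by (simp add: axis_def)
  have "qcoset ?P (rw b (?e v* N2)) = frame_hom b N1 (rv b (a *\<^sub>R ?e + c *\<^sub>R x))"
    using B[OF e] frame_hom_apply[OF b, of N2 ?e] x
    by (simp add: linear_add[OF linear_rv(1)] linear_scale[OF linear_rv(1)])
  also have "\<dots> = qcoset ?P (rw b ((a *\<^sub>R ?e + c *\<^sub>R x) v* N1))" by (rule frame_hom_apply[OF b])
  finally have "?e v* N2 = (a *\<^sub>R ?e + c *\<^sub>R x) v* N1" by (simp only: qcoset_rw_eq[OF b])
  then have r: "N2$1 = (a *\<^sub>R ?e + c *\<^sub>R x) v* N1" by (simp only: axis_vm)
  then have "N2$1$1 = (a + c * x$1) * N1$1$1 + c * x$2 * N1$2$1" "N2$1$2 = (a + c * x$1) * N1$1$2 + c * x$2 * N1$2$2"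
    by (simp_all add: vm_nth axis_def)
  then have "posdet N1 N2 = c * x$2 * (det N1 * det N1)"
    by (simp add: posdet_def mat2_det algebra_simps)
  then show ?thesis using c x2 dN by (simp add: zero_less_mult_iff) (metis linorder_neqE_linordered_idom)
qed

text \<open>The complex structures are recovered from the pair: \<open>complex_decomposition\<close>
  yields the one on the plane, conjugation by \<open>N1\<close> the one on the quotient. The complex
  linear maps are then spanned by \<open>N1\<close> and \<open>j ** N1\<close>, and so is
  \<open>T0\<close> by its dimension.\<close>

lemma posdet_positive_basis:
  assumes b: "frame V b" and d: "\<And>N. N \<in> T0 \<Longrightarrow> N \<noteq> 0 \<Longrightarrow> det N \<noteq> 0" and T0: "subspace T0" "dim T0 = 2"
    and N: "N1 \<in> T0" "N2 \<in> T0" and pos: "posdet N1 N2 > 0"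
  shows "positive_basis V (graph_plane b 0) (frame_hom b ` T0) (frame_hom b N1) (frame_hom b N2)"
proof -
  define P where "P = graph_plane b 0"
  have nz: "N1 \<noteq> 0" using pos by (auto simp: posdet_def)
  have dN: "det N1 \<noteq> 0" using d[OF N(1) nz] .
  have w: "N1$1$1 * N2$1$2 - N1$1$2 * N2$1$1 \<noteq> 0" using pos by (auto simp: posdet_def)
  have ns: "N2 - s *\<^sub>R N1 \<noteq> 0" for s using w by (auto simp: eq_iff_diff_eq_0[symmetric])
  have "det (N2 - s *\<^sub>R N1) \<noteq> 0" for s
    using d[OF subspace_diff[OF T0(1) N(2) subspace_scale[OF T0(1) N(1)]] ns] .
  then obtain a \<beta> j where j: "\<beta> > 0" "N2 = a *\<^sub>R N1 + \<beta> *\<^sub>R (j ** N1)" "j ** j = - mat 1" "j$1$2 > 0" "j$2$2 = - (j$1$1)"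
    "(j$1$1)^2 + j$1$2 * j$2$1 = -1" using complex_decomposition[OF dN _ pos] by metis
  have jN1: "j ** N1 = (1 / \<beta>) *\<^sub>R (N2 - a *\<^sub>R N1)" using j(1,2) by simp
  have jN1T: "j ** N1 \<in> T0" unfolding jN1 by (intro subspace_scale subspace_diff T0 N)
  have spanT: "\<exists>x y. M = x *\<^sub>R N1 + y *\<^sub>R (j ** N1)" if "M \<in> T0" for M
  proof -
    have "N2 \<noteq> N1" using ns[of 1] by auto
    have "N2 \<notin> span {N1}" using ns by (auto simp: span_singleton)
    moreover have "independent {N1}" using nz by simp
    ultimately have ind: "independent {N1, N2}"
      using independent_insertI[of N2 "{N1}"] by (simp add: insert_commute)
    have "T0 \<subseteq> span {N1, N2}"
      by (rule card_ge_dim_independent[OF _ ind]) (use N T0 \<open>N2 \<noteq> N1\<close> in auto)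
    then have "M \<in> {s *\<^sub>R N1 + t *\<^sub>R N2 | s t. True}" using that unfolding span_pair by blast
    then obtain x y where "M = x *\<^sub>R N1 + y *\<^sub>R N2" by blast
    then have "M = (x + y * a) *\<^sub>R N1 + (y * \<beta>) *\<^sub>R (j ** N1)" by (simp add: j(2) algebra_simps)
    then show ?thesis by blast
  qed
  obtain Ni where Ni: "N1 ** Ni = mat 1" "Ni ** N1 = mat 1" using mat2_invertible[OF dN] by blast
  \<comment> \<open>On row vectors \<open>j\<close> acts as J and \<open>\<kappa>\<close> as K;
    conjugation is forced by the wish that \<open>N1\<close> be complex linear.\<close>
  define \<kappa> where "\<kappa> = Ni ** j ** N1"
  have N1k: "N1 ** \<kappa> = j ** N1" by (simp add: \<kappa>_def matrix_mul_assoc Ni)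
  have kk: "\<kappa> ** \<kappa> = - mat 1"
  proof -
    have "\<kappa> ** \<kappa> = Ni ** j ** (N1 ** \<kappa>)" by (simp add: \<kappa>_def matrix_mul_assoc)
    also have "\<dots> = Ni ** (j ** j) ** N1" by (simp add: N1k matrix_mul_assoc)
    also have "\<dots> = - (Ni ** N1)" unfolding j(3) by (rule mat2_eqI) (simp_all add: mm_nth mat1_nth)
    finally show ?thesis by (simp add: Ni)
  qed
  have lin: "linear (\<lambda>z. emb1 (proj1 z v* j))" "linear (\<lambda>z. emb2 (proj2 z v* \<kappa>))"
    by (rule linearI; simp add: linear_add[OF linear_emb(1)] linear_scale[OF linear_emb(1)] linear_add[OF linear_emb(2)] linear_scale[OF linear_emb(2)]
      linear_add[OF linear_emb(3)] linear_scale[OF linear_emb(3)] linear_add[OF linear_emb(4)] linear_scale[OF linear_emb(4)] vm_linear_left)+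
  \<comment> \<open>\<open>J\<close> acts by \<open>j\<close> on the plane and kills the complement;
    \<open>k\<close> acts by \<open>\<kappa>\<close> on the complement and kills the plane, so it
    descends to the quotient.\<close>
  obtain J where J: "linear J" "\<And>z. J (lc b z) = lc b (emb1 (proj1 z v* j))" using frame_linear_extend[OF b lin(1)] by metis
  obtain k where k: "linear k" "\<And>z. k (lc b z) = lc b (emb2 (proj2 z v* \<kappa>))" using frame_linear_extend[OF b lin(2)] by metis
  have Jr: "J (rv b x) = rv b (x v* j)" for x by (simp add: rv_def J)
  have kr: "k (rv b x) = 0" for x using rw_0[of b] by (simp add: rv_def k rw_def)
  have kw: "k (rw b x) = rw b (x v* \<kappa>)" for x by (simp add: rw_def k)
  \<comment> \<open>K has to act on cosets, so a representative is chosen; the choice is harmless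
    because \<open>k\<close> vanishes on the plane.\<close>
  define K where "K = (\<lambda>S. qcoset P (k (SOME w. w \<in> V \<and> S = qcoset P w)))"
  have K: "K (qcoset P w) = qcoset P (k w)" if "w \<in> V" for w
  proof -
    define w' where "w' = (SOME w'. w' \<in> V \<and> qcoset P w = qcoset P w')"
    have w': "w' \<in> V \<and> qcoset P w = qcoset P w'" unfolding w'_def by (rule someI[of _ w]) (use that in simp)
    then have "w - w' \<in> plane P" by (simp add: qcoset_eq)
    then have "k (w - w') = 0" using kr by (auto simp: P_def plane_graph0)
    then have "k w = k w'" by (simp add: linear_diff[OF k(1)])
    then show ?thesis by (simp add: K_def w'_def)
  qed
  have rwV: "rw b y \<in> V" for y using frame_mem[OF b] by (simp add: rw_def)
  have vmneg: "x v* (- mat 1 :: real^2^2) = - x" for x by (rule vec2_eqI) (simp_all add: vm_nth mat1_nth)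
  have linJ: "(\<forall>p\<in>plane P. frame_hom b M (J p) = K (frame_hom b M p)) \<longleftrightarrow> j ** M = M ** \<kappa>" for M
  proof -
    have "frame_hom b M (J (rv b x)) = K (frame_hom b M (rv b x)) \<longleftrightarrow> x v* (j ** M) = x v* (M ** \<kappa>)" for x
      using frame_hom_apply[OF b, of M "x v* j"] frame_hom_apply[OF b, of M x] K[OF rwV, of "x v* M"] qcoset_rw_eq[OF b]
      by (simp add: Jr kw P_def vector_matrix_mul_assoc)
    then have "(\<forall>p\<in>plane P. frame_hom b M (J p) = K (frame_hom b M p)) \<longleftrightarrow> (\<forall>x. x v* (j ** M) = x v* (M ** \<kappa>))"
      unfolding P_def plane_graph0 by blast
    then show ?thesis using mat2_eq_vm by metis
  qed
  have comm: "j ** M = M ** \<kappa> \<longleftrightarrow> M \<in> T0" for M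
  proof
    assume "M \<in> T0"
    then obtain x y where M: "M = x *\<^sub>R N1 + y *\<^sub>R (j ** N1)" using spanT by blast
    show "j ** M = M ** \<kappa>"
      by (simp add: M mm_linear N1k matrix_mul_assoc[symmetric])
  next
    assume e: "j ** M = M ** \<kappa>"
    \<comment> \<open>Dividing by \<open>N1\<close> turns the relation into commuting with
      \<open>j\<close>. Comparing entries, with \<open>j$1$2\<close> nonzero, shows that only the
      combinations of 1 and \<open>j\<close> commute with \<open>j\<close>.\<close>
    define Q where "Q = M ** Ni"
    have "j ** Q = (M ** \<kappa>) ** Ni" by (simp add: Q_def matrix_mul_assoc e[symmetric])
    also have "\<dots> = Q ** (j ** (N1 ** Ni))" by (simp add: Q_def \<kappa>_def matrix_mul_assoc)
    finally have c: "j ** Q = Q ** j" by (simp add: Ni)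
    define y where "y = Q$1$2 / j$1$2"
    define x where "x = Q$1$1 - y * j$1$1"
    have y: "Q$1$2 = y * j$1$2" using j(4) by (simp add: y_def)
    have c1: "j$1$2 * Q$2$1 = Q$1$2 * j$2$1"
      using arg_cong[OF c, of "\<lambda>A. A$1$1"] by (simp add: mm_nth)
    have c2: "j$1$1 * Q$1$2 + j$1$2 * Q$2$2 = Q$1$1 * j$1$2 + Q$1$2 * j$2$2"
      using arg_cong[OF c, of "\<lambda>A. A$1$2"] by (simp add: mm_nth)
    have "j$1$2 * Q$2$1 = j$1$2 * (y * j$2$1)" using c1 y by simp
    then have q21: "Q$2$1 = y * j$2$1" using j(4) by simp
    have "j$1$2 * Q$2$2 = j$1$2 * (x + y * j$2$2)" using c2 y j(5) by (simp add: x_def algebra_simps)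
    then have q22: "Q$2$2 = x + y * j$2$2" using j(4) by simp
    have "Q = x *\<^sub>R mat 1 + y *\<^sub>R j"
      by (rule mat2_eqI) (simp_all add: mat1_nth y q21 q22 x_def)
    moreover have "M = Q ** N1" by (simp add: Q_def matrix_mul_assoc[symmetric] Ni)
    ultimately have "M = x *\<^sub>R N1 + y *\<^sub>R (j ** N1)" by (simp add: mm_linear)
    then show "M \<in> T0" using subspace_add[OF T0(1) subspace_scale[OF T0(1) N(1)] subspace_scale[OF T0(1) jN1T]] by simp
  qed
  have "complex_structures V P (frame_hom b ` T0) J K"
    unfolding complex_structures_def
  proof (intro conjI)
    show "linear J" by (rule J(1))
    show "J ` plane P \<subseteq> plane P" by (auto simp: P_def plane_graph0 Jr)
    show "\<forall>p\<in>plane P. J (J p) = - p"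
      by (auto simp: P_def plane_graph0 Jr vector_matrix_mul_assoc j(3) vmneg linear_neg[OF linear_rv(1)])
    show "\<forall>p\<in>plane P. p \<noteq> 0 \<longrightarrow> (p, J p) \<in> P"
    proof (intro ballI impI)
      fix p assume p: "p \<in> plane P" "p \<noteq> 0"
      then obtain x where x: "p = rv b x" by (auto simp: P_def plane_graph0)
      have x0: "x \<noteq> 0" using p x linear_0[OF linear_rv(1)] by auto
      \<comment> \<open>Completing the square with the relation \<open>j(6)\<close> shows that the
        orientation form of \<open>x\<close> and \<open>x v* j\<close> is definite, with the sign of
        \<open>j$1$2\<close>.\<close>
      have "j$1$2 * (x$1 * (x v* j)$2 - x$2 * (x v* j)$1) = (j$1$2 * x$1 - j$1$1 * x$2)^2 - ((j$1$1)^2 + j$1$2 * j$2$1) * (x$2)^2"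
        by (simp add: vm_nth j(5) power2_eq_square algebra_simps)
      also have "\<dots> = (j$1$2 * x$1 - j$1$1 * x$2)^2 + (x$2)^2" by (simp add: j(6))
      also have "\<dots> > 0"
      proof (cases "x$2 = 0")
        case True
        then have "x$1 \<noteq> 0" using x0 by (auto simp: vec_eq_iff forall_2)
        then show ?thesis using True j(4) by simp
      next
        case False
        then show ?thesis by (simp add: add_nonneg_pos)
      qed
      finally have "x$1 * (x v* j)$2 - x$2 * (x v* j)$1 > 0" using j(4) by (simp add: zero_less_mult_iff)
      then show "(p, J p) \<in> P" unfolding P_def x Jr by (rule graph0_pair_mem)
    qed
    show "\<exists>k. linear k \<and> k ` V \<subseteq> V \<and> (\<forall>w\<in>V. K (qcoset P w) = qcoset P (k w))"
    proof (intro exI[of _ k] conjI k(1) ballI K)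
      show "k ` V \<subseteq> V"
      proof
        fix v assume "v \<in> k ` V"
        then obtain w where "w \<in> V" "v = k w" by blast
        moreover from this obtain z where "w = lc b z" using frame_obtain[OF b] by blast
        ultimately show "v \<in> V" using frame_mem[OF b] by (simp add: k(2))
      qed
    qed
    show "\<forall>w\<in>V. K (K (qcoset P w)) = qcoset P (- w)"
    proof
      fix w assume w: "w \<in> V"
      then obtain z where z: "w = rv b (proj1 z) + rw b (proj2 z)" using frame_obtain[OF b] lc_rv_rw by metis
      have kw1: "k w = rw b (proj2 z v* \<kappa>)" by (simp add: z linear_add[OF k(1)] kr kw)
      have "k (k w) = - rw b (proj2 z)"
        by (simp add: kw1 kw vector_matrix_mul_assoc kk vmneg linear_neg[OF linear_rv(2)])
      then have "k (k w) - (- w) \<in> plane P" by (simp add: z P_def plane_graph0)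
      then show "K (K (qcoset P w)) = qcoset P (- w)"
        using K[OF w] K[OF rwV, of "proj2 z v* \<kappa>"] kw1 by (simp add: qcoset_eq)
    qed
    show "frame_hom b ` T0 = {A \<in> Lin_quot V P. \<forall>p\<in>plane P. A (J p) = K (A p)}"
    proof (intro equalityI subsetI)
      fix A assume "A \<in> frame_hom b ` T0"
      then obtain M where M: "M \<in> T0" "A = frame_hom b M" by blast
      then show "A \<in> {A \<in> Lin_quot V P. \<forall>p\<in>plane P. A (J p) = K (A p)}"
        using linJ[of M] comm[of M] Lin_quot_frame_hom[OF b] by (simp add: P_def)
    next
      fix A assume A: "A \<in> {A \<in> Lin_quot V P. \<forall>p\<in>plane P. A (J p) = K (A p)}"
      then obtain M where M: "A = frame_hom b M" using Lin_quot_frame_hom[OF b] by (auto simp: P_def)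
      have "\<forall>p\<in>plane P. frame_hom b M (J p) = K (frame_hom b M p)" using A M by simp
      then show "A \<in> frame_hom b ` T0" using linJ[of M] comm[of M] M by simp
    qed
  qed
  moreover have "frame_hom b N2 p = frame_hom b N1 (a *\<^sub>R p + \<beta> *\<^sub>R J p)" if p: "p \<in> plane P" for p
  proof -
    obtain x where x: "p = rv b x" using p by (auto simp: P_def plane_graph0)
    have "a *\<^sub>R p + \<beta> *\<^sub>R J p = rv b (a *\<^sub>R x + \<beta> *\<^sub>R (x v* j))"
      by (simp add: x Jr linear_add[OF linear_rv(1)] linear_scale[OF linear_rv(1)])
    moreover have "(a *\<^sub>R x + \<beta> *\<^sub>R (x v* j)) v* N1 = x v* N2"
      by (simp add: j(2) vm_linear_left vm_linear_right vector_matrix_mul_assoc)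
    ultimately show ?thesis using frame_hom_apply[OF b] x by simp
  qed
  moreover have "\<exists>p\<in>plane P. frame_hom b N1 p \<noteq> qcoset P 0"
  proof (rule bexI[of _ "rv b (axis 1 1)"])
    have "N1 $ 1 \<noteq> 0" using dN by (auto simp: mat2_det)
    then show "frame_hom b N1 (rv b (axis 1 1)) \<noteq> qcoset P 0"
      using frame_hom_apply[OF b, of N1 "axis 1 1"] qcoset_rw_eq[OF b, of "N1 $ 1" 0] linear_0[OF linear_rv(2), of b]
      by (simp add: axis_vm P_def)
  qed (simp add: P_def plane_graph0)
  ultimately show ?thesis
    unfolding positive_basis_def P_def[symmetric] using N j(1) by blast
qed

text \<open>The pairs with \<open>posdet\<close> positive are the positively oriented bases for one orientation,
  because \<open>det\<close> has constant sign on the definite plane.\<close>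
lemma posdet_combination:
  assumes d: "\<And>x y. x \<noteq> 0 \<or> y \<noteq> 0 \<Longrightarrow> det (x *\<^sub>R N1 + y *\<^sub>R N2 :: real^2^2) \<noteq> 0" and pos: "posdet N1 N2 > 0"
  shows "posdet (p *\<^sub>R N1 + q *\<^sub>R N2) (r *\<^sub>R N1 + s *\<^sub>R N2) > 0 \<longleftrightarrow> p * s - q * r > 0"
proof -
  have d1: "det N1 \<noteq> 0" using d[of 1 0] by simp
  define g where "g = (\<lambda>t. det ((1 - t) *\<^sub>R N1 + t *\<^sub>R (p *\<^sub>R N1 + q *\<^sub>R N2)))"
  have e: "posdet (p *\<^sub>R N1 + q *\<^sub>R N2) (r *\<^sub>R N1 + s *\<^sub>R N2) =
     (p * s - q * r) * ((N1$1$1 * N2$1$2 - N1$1$2 * N2$1$1) * det (p *\<^sub>R N1 + q *\<^sub>R N2))"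
    by (simp add: posdet_def algebra_simps)
  have quad: "det (x *\<^sub>R N1 + y *\<^sub>R N2) = det N1 * x^2 + m * (x * y) + det N2 * y^2"
    if "m = N1$1$1 * N2$2$2 + N2$1$1 * N1$2$2 - N1$1$2 * N2$2$1 - N2$1$2 * N1$2$1" for x y m
    by (simp add: that mat2_det power2_eq_square algebra_simps)
  define m where "m = N1$1$1 * N2$2$2 + N2$1$1 * N1$2$2 - N1$1$2 * N2$2$1 - N2$1$2 * N1$2$1"
  \<comment> \<open>A nonnegative discriminant would give a real root \<open>x\<close>, that is a
    singular combination of \<open>N1\<close> and \<open>N2\<close>.\<close>
  have disc: "m^2 - 4 * det N1 * det N2 < 0"
  proof (rule ccontr)
    assume "\<not> m^2 - 4 * det N1 * det N2 < 0"
    then have sq: "sqrt (m^2 - 4 * det N1 * det N2) ^ 2 = m^2 - 4 * det N1 * det N2" by simp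
    define x where "x = (- m + sqrt (m^2 - 4 * det N1 * det N2)) / (2 * det N1)"
    have "2 * det N1 * x + m = sqrt (m^2 - 4 * det N1 * det N2)" using d1 by (simp add: x_def)
    then have "(2 * det N1 * x + m)^2 = m^2 - 4 * det N1 * det N2" using sq by simp
    then have "4 * det N1 * (det N1 * x^2 + m * x + det N2) = 0" by (simp add: power2_eq_square algebra_simps)
    then have "det (x *\<^sub>R N1 + 1 *\<^sub>R N2) = 0" using d1 quad[OF m_def, of x 1] by simp
    then show False using d[of x 1] by simp
  qed
  \<comment> \<open>Completing the square: a binary quadratic form of negative discriminant keeps
    the sign of its leading coefficient \<open>det N1\<close>.\<close>
  have sgn: "det N1 * det (x *\<^sub>R N1 + y *\<^sub>R N2) > 0" if "x \<noteq> 0 \<or> y \<noteq> 0" for x y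
  proof -
    have "4 * (det N1 * det (x *\<^sub>R N1 + y *\<^sub>R N2)) = (2 * det N1 * x + m * y)^2 - (m^2 - 4 * det N1 * det N2) * y^2"
      unfolding quad[OF m_def] by (simp add: power2_eq_square algebra_simps)
    moreover have "(m^2 - 4 * det N1 * det N2) * y^2 \<le> 0"
      using disc by (intro mult_nonpos_nonneg) auto
    moreover have "(2 * det N1 * x + m * y)^2 \<ge> 0" by simp
    ultimately have "det N1 * det (x *\<^sub>R N1 + y *\<^sub>R N2) \<ge> 0" by linarith
    then show ?thesis using d[OF that] d1 by (simp add: less_le)
  qed
  show ?thesis
  proof (cases "p \<noteq> 0 \<or> q \<noteq> 0")
    case True
    define w where "w = N1$1$1 * N2$1$2 - N1$1$2 * N2$1$1"
    have "w * det N1 > 0" using pos by (simp add: posdet_def w_def)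
    then have wD: "w * det (p *\<^sub>R N1 + q *\<^sub>R N2) > 0"
      using sgn[OF True] by (auto simp: zero_less_mult_iff)
    then have "(p * s - q * r) * (w * det (p *\<^sub>R N1 + q *\<^sub>R N2)) > 0 \<longleftrightarrow> p * s - q * r > 0"
      by (blast intro: mult_pos_pos dest: zero_less_mult_pos2)
    then show ?thesis unfolding e w_def .
  qed (auto simp: posdet_def)
qed

section \<open>Symmetry of second derivatives and smooth families of linear maps\<close>

section \<open>Calculus in adapted coordinates\<close>

lemma frechet_derivative_eq: "(f has_derivative D) (at x) \<Longrightarrow> frechet_derivative f (at x) = D"
  by (rule frechet_derivative_at[symmetric])

lemma dim_kernel_surj:
  fixes f :: "'a::euclidean_space \<Rightarrow> 'b::euclidean_space"
  assumes f: "linear f" "surj f"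
  shows "dim {x. f x = 0} + DIM('b) = DIM('a)"
proof -
  obtain R where R: "linear R" "f \<circ> R = id" using linear_surjective_right_inverse[OF f] by blast
  have fR: "f (R y) = y" for y using R(2) by (metis comp_apply id_apply)
  let ?K = "{x. f x = 0}"
  let ?g = "\<lambda>(k, y). k + R y"
  have K: "subspace ?K" using linear_subspace_vimage[OF f(1) subspace_single_0] by (simp add: vimage_def)
  have lin: "linear ?g" by (rule linearI) (auto simp: linear_add[OF R(1)] linear_scale[OF R(1)] algebra_simps)
  have "inj_on ?g (?K \<times> UNIV)"
  proof (rule inj_onI, clarsimp)
    fix k y k' y' assume a: "f k = 0" "f k' = 0" "k + R y = k' + R y'"
    have "f (k + R y) = y" "f (k' + R y') = y'" by (simp_all only: linear_add[OF f(1)] fR a(1,2) add_0)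
    then have "y = y'" using a(3) by simp
    then show "k = k' \<and> y = y'" using a by simp
  qed
  then have "dim (?g ` (?K \<times> UNIV)) = dim (?K \<times> (UNIV :: 'b set))"
    by (intro dim_image_eq[OF lin]) (simp add: span_eq_iff[THEN iffD2, OF subspace_Times[OF K subspace_UNIV]])
  moreover have "?g ` (?K \<times> UNIV) = UNIV"
  proof -
    have "x \<in> ?g ` (?K \<times> UNIV)" for x
      by (rule image_eqI[of _ _ "(x - R (f x), f x)"]) (simp_all add: linear_diff[OF f(1)] fR)
    then show ?thesis by blast
  qed
  ultimately show ?thesis using dim_Times[OF K subspace_UNIV, where 'b='b] by simp
qed

lemma affine_line_derivative:
  fixes \<phi> :: "'a::euclidean_space \<Rightarrow> real"
  assumes "smooth_on S \<phi>" "q + s *\<^sub>R a \<in> S"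
  shows "((\<lambda>s. \<phi> (q + s *\<^sub>R a)) has_real_derivative frechet_derivative \<phi> (at (q + s *\<^sub>R a)) a) (at s)"
proof -
  have "((\<lambda>s. q + s *\<^sub>R a) has_derivative (\<lambda>h. h *\<^sub>R a)) (at s)" by (auto intro!: derivative_eq_intros)
  from has_derivative_compose[OF this smooth_on_has_derivative[OF assms]]
  show ?thesis
    using linear_scale[OF smooth_on_linear_derivative[OF assms]]
    by (simp add: has_field_derivative_def mult.commute[of _ "frechet_derivative \<phi> (at (q + s *\<^sub>R a)) a"])
qed

text \<open>The mean value theorem, once in direction \<open>a\<close> and once in direction
  \<open>b\<close>. The left side is symmetric in \<open>a\<close> and \<open>b\<close>, the right
  side is a value of one mixed derivative.\<close>

lemma second_difference:
  fixes \<phi> :: "'a::euclidean_space \<Rightarrow> real"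
  assumes sm: "smooth_on S \<phi>" and h: "h > 0"
    and box: "\<And>s t. 0 \<le> s \<Longrightarrow> s \<le> h \<Longrightarrow> 0 \<le> t \<Longrightarrow> t \<le> h \<Longrightarrow> p + s *\<^sub>R a + t *\<^sub>R b \<in> S"
  shows "\<exists>s t. 0 < s \<and> s < h \<and> 0 < t \<and> t < h \<and>
    \<phi> (p + h *\<^sub>R a + h *\<^sub>R b) - \<phi> (p + h *\<^sub>R a) - \<phi> (p + h *\<^sub>R b) + \<phi> p =
    h * h * frechet_derivative (\<lambda>q. frechet_derivative \<phi> (at q) a) (at (p + s *\<^sub>R a + t *\<^sub>R b)) b"
proof -
  let ?D = "\<lambda>q. frechet_derivative \<phi> (at q) a"
  have "((\<lambda>s. \<phi> (p + h *\<^sub>R b + s *\<^sub>R a) - \<phi> (p + s *\<^sub>R a)) has_real_derivative ?D (p + h *\<^sub>R b + s *\<^sub>R a) - ?D (p + s *\<^sub>R a)) (at s)"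
    if "0 \<le> s" "s \<le> h" for s
    by (intro DERIV_diff affine_line_derivative[OF sm]) (use box[OF that, of h] box[OF that, of 0] h in \<open>simp_all add: algebra_simps\<close>)
  from MVT2[OF h this] obtain s where s: "0 < s" "s < h"
    "\<phi> (p + h *\<^sub>R b + h *\<^sub>R a) - \<phi> (p + h *\<^sub>R a) - (\<phi> (p + h *\<^sub>R b + 0 *\<^sub>R a) - \<phi> (p + 0 *\<^sub>R a)) =
     (h - 0) * (?D (p + h *\<^sub>R b + s *\<^sub>R a) - ?D (p + s *\<^sub>R a))" by blast
  have "((\<lambda>t. ?D (p + s *\<^sub>R a + t *\<^sub>R b)) has_real_derivative frechet_derivative ?D (at (p + s *\<^sub>R a + t *\<^sub>R b)) b) (at t)"
    if "0 \<le> t" "t \<le> h" for t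
    by (intro affine_line_derivative[OF smooth_on_frechet_derivative_const[OF sm]]) (use box that s in auto)
  from MVT2[OF h this] obtain t where t: "0 < t" "t < h"
    "?D (p + s *\<^sub>R a + h *\<^sub>R b) - ?D (p + s *\<^sub>R a + 0 *\<^sub>R b) = (h - 0) * frechet_derivative ?D (at (p + s *\<^sub>R a + t *\<^sub>R b)) b" by blast
  show ?thesis using s t by (intro exI[of _ s] exI[of _ t]) (simp add: algebra_simps)
qed

text \<open>Schwarz's theorem: one and the same second difference is \<open>h * h\<close> times a
  value of either mixed derivative near \<open>p\<close>, and both are continuous at
  \<open>p\<close>.\<close>

lemma second_derivative_symmetric_real:
  fixes \<phi> :: "'a::euclidean_space \<Rightarrow> real"
  assumes S: "open S" "p \<in> S" and sm: "smooth_on S \<phi>"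
  shows "frechet_derivative (\<lambda>q. frechet_derivative \<phi> (at q) a) (at p) b = frechet_derivative (\<lambda>q. frechet_derivative \<phi> (at q) b) (at p) a"
proof -
  define F where "F = (\<lambda>q. frechet_derivative (\<lambda>q. frechet_derivative \<phi> (at q) a) (at q) b)"
  define G where "G = (\<lambda>q. frechet_derivative (\<lambda>q. frechet_derivative \<phi> (at q) b) (at q) a)"
  have "continuous_on S F" "continuous_on S G"
    unfolding F_def G_def
    by (rule smooth_on_continuous[OF smooth_on_frechet_derivative_const[OF smooth_on_frechet_derivative_const[OF sm]]])+
  then have cont: "continuous (at p) F" "continuous (at p) G"
    using S by (simp_all add: continuous_on_eq_continuous_at)
  have "\<bar>F p - G p\<bar> \<le> 2 * e" if e: "e > 0" for e
  proof -
    obtain d1 where d1: "d1 > 0" "\<And>q. dist q p < d1 \<Longrightarrow> dist (F q) (F p) < e" using cont(1) e unfolding continuous_at_eps_delta by blast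
    obtain d2 where d2: "d2 > 0" "\<And>q. dist q p < d2 \<Longrightarrow> dist (G q) (G p) < e" using cont(2) e unfolding continuous_at_eps_delta by blast
    obtain d3 where d3: "d3 > 0" "ball p d3 \<subseteq> S" using S openE by blast
    define d where "d = min d1 (min d2 d3)"
    have d: "d > 0" using d1 d2 d3 by (simp add: d_def)
    \<comment> \<open>Keeps the parallelogram with sides \<open>h *\<^sub>R a\<close> and
      \<open>h *\<^sub>R b\<close> within distance \<open>d\<close> of \<open>p\<close>; the summand
      1 guards against \<open>a\<close> and \<open>b\<close> both being zero.\<close>
    define h where "h = d / (2 * (norm a + norm b + 1))"
    have np: "norm a + norm b + 1 > 0" by (simp add: add_nonneg_pos)
    have h: "h > 0" using d np by (simp add: h_def)
    have near: "dist (p + s *\<^sub>R x + t *\<^sub>R y) p < d" if st: "0 \<le> s" "s \<le> h" "0 \<le> t" "t \<le> h" and xy: "{x, y} = {a, b}" for s t x y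
    proof -
      have nn: "norm x + norm y \<le> norm a + norm b" using xy by (auto simp: doubleton_eq_iff)
      have "dist (p + s *\<^sub>R x + t *\<^sub>R y) p = norm (s *\<^sub>R x + t *\<^sub>R y)" by (simp add: dist_norm)
      also have "\<dots> \<le> s * norm x + t * norm y" using norm_triangle_ineq[of "s *\<^sub>R x" "t *\<^sub>R y"] st by simp
      also have "\<dots> \<le> h * norm x + h * norm y" using st by (intro add_mono mult_right_mono) auto
      also have "\<dots> = h * (norm x + norm y)" by (simp add: algebra_simps)
      also have "\<dots> \<le> h * (norm a + norm b + 1)" using h nn by (intro mult_left_mono) auto
      also have "\<dots> = d / 2" using np by (simp add: h_def field_simps)
      finally show ?thesis using d by simp
    qed
    have inS: "p + s *\<^sub>R x + t *\<^sub>R y \<in> S" if "0 \<le> s" "s \<le> h" "0 \<le> t" "t \<le> h" "{x, y} = {a, b}" for s t x y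
      using near[OF that] d3 by (auto simp: d_def dist_commute)
    obtain s t where st: "0 < s" "s < h" "0 < t" "t < h"
      "\<phi> (p + h *\<^sub>R a + h *\<^sub>R b) - \<phi> (p + h *\<^sub>R a) - \<phi> (p + h *\<^sub>R b) + \<phi> p = h * h * F (p + s *\<^sub>R a + t *\<^sub>R b)"
      using second_difference[OF sm h inS, of a b] unfolding F_def by blast
    obtain s' t' where st': "0 < s'" "s' < h" "0 < t'" "t' < h"
      "\<phi> (p + h *\<^sub>R b + h *\<^sub>R a) - \<phi> (p + h *\<^sub>R b) - \<phi> (p + h *\<^sub>R a) + \<phi> p = h * h * G (p + s' *\<^sub>R b + t' *\<^sub>R a)"
      using second_difference[OF sm h inS, of b a] unfolding G_def by blast
    have "h * h * F (p + s *\<^sub>R a + t *\<^sub>R b) = h * h * G (p + s' *\<^sub>R b + t' *\<^sub>R a)"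
      using st(5) st'(5) by (simp add: algebra_simps)
    then have eq: "F (p + s *\<^sub>R a + t *\<^sub>R b) = G (p + s' *\<^sub>R b + t' *\<^sub>R a)" using h by simp
    have "dist (F (p + s *\<^sub>R a + t *\<^sub>R b)) (F p) < e" using near[of s t a b] st d1(2) by (simp add: d_def)
    moreover have "dist (G (p + s' *\<^sub>R b + t' *\<^sub>R a)) (G p) < e" using near[of s' t' b a] st' d2(2) by (simp add: d_def insert_commute)
    ultimately show ?thesis using eq by (simp add: dist_real_def)
  qed
  note small = this
  have "F p = G p"
  proof (rule ccontr)
    assume "F p \<noteq> G p"
    then show False using small[of "\<bar>F p - G p\<bar> / 4"] by simp
  qed
  then show ?thesis by (simp add: F_def G_def)
qed

lemma frechet_inner:
  fixes f :: "'a::euclidean_space \<Rightarrow> 'b::euclidean_space"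
  assumes "(f has_derivative D) (at x)"
  shows "frechet_derivative (\<lambda>q. f q \<bullet> i) (at x) = (\<lambda>h. D h \<bullet> i)"
  by (rule frechet_derivative_eq[OF has_derivative_inner_left[OF assms]])

lemma second_derivative_symmetric:
  fixes f :: "'a::euclidean_space \<Rightarrow> 'b::euclidean_space"
  assumes S: "open S" "p \<in> S" and sm: "smooth_on S f"
  shows "frechet_derivative (\<lambda>q. frechet_derivative f (at q) a) (at p) b = frechet_derivative (\<lambda>q. frechet_derivative f (at q) b) (at p) a"
proof (rule euclidean_eqI)
  fix i :: 'b assume "i \<in> Basis"
  have smi: "smooth_on S (\<lambda>q. f q \<bullet> i)"
    by (rule smooth_on_linear_compose[of "\<lambda>x. x \<bullet> i"]) (auto intro!: linearI S sm simp: inner_add_left)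
  have *: "frechet_derivative (\<lambda>q. frechet_derivative (\<lambda>q. f q \<bullet> i) (at q) a) (at p) b = frechet_derivative (\<lambda>q. frechet_derivative f (at q) a) (at p) b \<bullet> i" for a b
  proof -
    have d: "((\<lambda>q. frechet_derivative f (at q) a \<bullet> i) has_derivative
        (\<lambda>h. frechet_derivative (\<lambda>q. frechet_derivative f (at q) a) (at p) h \<bullet> i)) (at p)"
      by (rule has_derivative_inner_left[OF smooth_on_has_derivative[OF smooth_on_frechet_derivative_const[OF sm] S(2)]])
    have "((\<lambda>q. frechet_derivative (\<lambda>q. f q \<bullet> i) (at q) a) has_derivative
        (\<lambda>h. frechet_derivative (\<lambda>q. frechet_derivative f (at q) a) (at p) h \<bullet> i)) (at p)"
      by (rule has_derivative_transform_within_open[OF d S]) (simp add: frechet_inner[OF smooth_on_has_derivative[OF sm]])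
    then show ?thesis by (simp add: frechet_derivative_eq)
  qed
  show "frechet_derivative (\<lambda>q. frechet_derivative f (at q) a) (at p) b \<bullet> i = frechet_derivative (\<lambda>q. frechet_derivative f (at q) b) (at p) a \<bullet> i"
    using second_derivative_symmetric_real[OF S smi, of a b] by (simp add: *)
qed

text \<open>Product rule for a moving linear map evaluated at a moving vector; the first summand
  differentiates with the vector frozen at \<open>g p\<close>. It serves to differentiate the
  identity \<open>Dl r (w r) = 0\<close>.\<close>

lemma has_derivative_linear_family:
  fixes L :: "'a::euclidean_space \<Rightarrow> 'b::euclidean_space \<Rightarrow> 'c::euclidean_space"
  assumes S: "open S" "p \<in> S" and L: "\<And>w. smooth_on S (\<lambda>p. L p w)" "\<And>p. p \<in> S \<Longrightarrow> linear (L p)"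
    and g: "(g has_derivative g') (at p)"
  shows "((\<lambda>q. L q (g q)) has_derivative (\<lambda>h. frechet_derivative (\<lambda>q. L q (g p)) (at p) h + L p (g' h))) (at p)"
proof -
  let ?Li = "\<lambda>i. frechet_derivative (\<lambda>q. L q i) (at p)"
  have ex: "L q w = (\<Sum>i\<in>Basis. (w \<bullet> i) *\<^sub>R L q i)" if "q \<in> S" for q w
    by (rule linear_euclidean_expand[OF L(2)[OF that]])
  have dLi: "((\<lambda>q. L q i) has_derivative ?Li i) (at p)" for i
    by (rule smooth_on_has_derivative[OF L(1) S(2)])
  have d1: "((\<lambda>q. \<Sum>i\<in>Basis. (g q \<bullet> i) *\<^sub>R L q i) has_derivative
      (\<lambda>h. \<Sum>i\<in>Basis. (g p \<bullet> i) *\<^sub>R ?Li i h + (g' h \<bullet> i) *\<^sub>R L p i)) (at p)"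
    by (intro has_derivative_sum has_derivative_scaleR has_derivative_inner_left g dLi)
  have d2: "((\<lambda>q. \<Sum>i\<in>Basis. (g p \<bullet> i) *\<^sub>R L q i) has_derivative (\<lambda>h. \<Sum>i\<in>Basis. (g p \<bullet> i) *\<^sub>R ?Li i h)) (at p)"
    by (intro has_derivative_sum has_derivative_scaleR_right dLi)
  have "((\<lambda>q. L q (g p)) has_derivative (\<lambda>h. \<Sum>i\<in>Basis. (g p \<bullet> i) *\<^sub>R ?Li i h)) (at p)"
    by (rule has_derivative_transform_within_open[OF d2 S]) (rule ex[symmetric])
  then have e: "frechet_derivative (\<lambda>q. L q (g p)) (at p) = (\<lambda>h. \<Sum>i\<in>Basis. (g p \<bullet> i) *\<^sub>R ?Li i h)"
    by (rule frechet_derivative_eq)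
  have "((\<lambda>q. L q (g q)) has_derivative (\<lambda>h. \<Sum>i\<in>Basis. (g p \<bullet> i) *\<^sub>R ?Li i h + (g' h \<bullet> i) *\<^sub>R L p i)) (at p)"
    by (rule has_derivative_transform_within_open[OF d1 S]) (rule ex[symmetric])
  moreover have "(\<lambda>h. \<Sum>i\<in>Basis. (g p \<bullet> i) *\<^sub>R ?Li i h + (g' h \<bullet> i) *\<^sub>R L p i) =
      (\<lambda>h. frechet_derivative (\<lambda>q. L q (g p)) (at p) h + L p (g' h))"
    by (rule ext) (simp only: e sum.distrib ex[OF S(2), of "g' _"])
  ultimately show ?thesis by simp
qed

text \<open>Apply the inverse function theorem to \<Phi>(p, u) = (p, L p u) at u = 0. As
  \<open>L p 0 = 0\<close> for all p, the derivative there is (h, k) \<mapsto> (h, L p k), injective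
  exactly when \<open>L p\<close> is.\<close>

lemma inj_linear_family_open:
  fixes L :: "'a::euclidean_space \<Rightarrow> 'b::euclidean_space \<Rightarrow> 'b"
  assumes S: "open S" "p0 \<in> S" and L: "\<And>w. smooth_on S (\<lambda>p. L p w)" "\<And>p. p \<in> S \<Longrightarrow> linear (L p)"
    and inj: "inj (L p0)"
  obtains S' where "open S'" "p0 \<in> S'" "S' \<subseteq> S" "\<And>p. p \<in> S' \<Longrightarrow> inj (L p)"
proof -
  define \<Phi> where "\<Phi> = (\<lambda>x. (fst x, L (fst x) (snd x)))"
  let ?SS = "S \<times> (UNIV :: 'b set)"
  have oSS: "open ?SS" using S by (simp add: open_Times)
  have smL: "smooth_on ?SS (\<lambda>x. L (fst x) w)" for w
    by (rule smooth_on_compose[OF oSS S(1) _ smooth_on_fst[OF oSS smooth_on_ident] L(1)]) auto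
  have linL: "linear (L (fst x))" if "x \<in> ?SS" for x using that L(2) by auto
  have sm: "smooth_on ?SS \<Phi>"
    unfolding \<Phi>_def
    by (intro smooth_on_Pair[OF oSS] smooth_on_linear_family[OF oSS smL linL] smooth_on_fst[OF oSS] smooth_on_snd[OF oSS] smooth_on_ident)
  have dL: "((\<lambda>x. L (fst x) (snd x)) has_derivative (\<lambda>h. L p (snd h))) (at (p, 0))" if p: "p \<in> S" for p
  proof -
    have p': "(p, 0) \<in> ?SS" using p by simp
    have "((\<lambda>x. L (fst x) (snd (p, 0::'b))) has_derivative (\<lambda>h. 0)) (at (p, 0::'b))"
      by (rule has_derivative_transform_within_open[OF has_derivative_const[of 0] oSS p'])
        (use L(2) in \<open>auto simp: linear_0\<close>)
    then have "frechet_derivative (\<lambda>x. L (fst x) (snd (p, 0::'b))) (at (p, 0::'b)) = (\<lambda>h. 0)"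
      by (rule frechet_derivative_eq)
    then show ?thesis
      using has_derivative_linear_family[OF oSS p' smL linL has_derivative_snd[OF has_derivative_ident]] by (simp add: fun_eq_iff)
  qed
  have d\<Phi>: "frechet_derivative \<Phi> (at (p, 0)) = (\<lambda>h. (fst h, L p (snd h)))" if p: "p \<in> S" for p
    unfolding \<Phi>_def by (rule frechet_derivative_eq[OF has_derivative_Pair[OF has_derivative_fst[OF has_derivative_ident] dL[OF p]]])
  have "inj (frechet_derivative \<Phi> (at (p0, 0)))"
    unfolding d\<Phi>[OF S(2)]
  proof (rule injI)
    fix x y assume "(fst x, L p0 (snd x)) = (fst y, L p0 (snd y))"
    then show "x = y" using injD[OF inj, of "snd x" "snd y"] by (simp add: prod_eq_iff)
  qed
  note inj0 = this
  have p0: "(p0, 0) \<in> ?SS" using S by simp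
  show thesis
  proof (rule smooth_inverse_function[OF oSS p0 sm inj0])
  fix U'
  assume U': "open U'" "U' \<subseteq> ?SS" "(p0, 0) \<in> U'" "\<And>x. x \<in> U' \<Longrightarrow> inj (frechet_derivative \<Phi> (at x))"
  show thesis
  proof (rule that[of "(\<lambda>p. (p, 0)) -` U'"])
    show "open ((\<lambda>p. (p, 0::'b)) -` U')" by (intro open_vimage U' continuous_intros)
    show "inj (L p)" if "p \<in> (\<lambda>p. (p, 0)) -` U'" for p
    proof (rule injI)
      fix x y assume "L p x = L p y"
      moreover have "p \<in> S" using that U' by auto
      ultimately have "frechet_derivative \<Phi> (at (p, 0)) (0, x) = frechet_derivative \<Phi> (at (p, 0)) (0, y)" by (simp add: d\<Phi>)
      then show "x = y" using U'(4) that by (metis Pair_inject injD vimageE)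
    qed
  qed (use U' in auto)
  qed
qed

section \<open>Bases of definite planes of matrices, and the local graph form of the dual
  planes\<close>

lemma frame_extend:
  fixes a1 a2 :: "real^4"
  assumes ind: "\<And>x y. x *\<^sub>R a1 + y *\<^sub>R a2 = 0 \<Longrightarrow> x = 0 \<and> y = 0"
  obtains a where "frame UNIV a" "a 1 = a1" "a 2 = a2"
proof -
  have n1: "a1 \<noteq> 0" using ind[of 1 0] by auto
  have ns: "a2 \<notin> span {a1}"
  proof
    assume "a2 \<in> span {a1}"
    then obtain k where "a2 = k *\<^sub>R a1" by (auto simp: span_singleton)
    then show False using ind[of k "-1"] by simp
  qed
  have "independent {a2, a1}" using independent_insertI[OF ns] n1 by simp
  then obtain B where B: "{a2, a1} \<subseteq> B" "B \<subseteq> UNIV" "independent B" "UNIV \<subseteq> span B"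
    by (rule maximal_independent_subset_extend[OF subset_UNIV])
  have ne: "a1 \<noteq> a2" using ns by (auto intro: span_base)
  have sB: "span B = UNIV" using B(4) by blast
  have "card B = 4" using dim_span_eq_card_independent[OF B(3)] unfolding sB by simp
  moreover have fB: "finite B" using independent_imp_finite[OF B(3)] .
  ultimately have "card (B - {a2, a1}) = 2" using B(1) ne by (simp add: card_Diff_subset)
  then obtain a3 a4 where a34: "B - {a2, a1} = {a3, a4}" "a3 \<noteq> a4" by (auto simp: card_2_iff)
  define a where "a = (\<lambda>i::4. if i = 1 then a1 else if i = 2 then a2 else if i = 3 then a3 else a4)"
  have r: "range a = {a1, a2, a3, a4}" unfolding UNIV_4 by (auto simp: a_def)
  then have rB: "range a = B" using a34 B(1) by auto
  have "inj a"
    using ne a34 by (intro eq_card_imp_inj_on) (auto simp: rB \<open>card B = 4\<close>)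
  then have "frame UNIV a" using rB B by (auto simp: frame_def)
  then show thesis using that[of a] by (simp add: a_def)
qed

lemma lc_grow: "lc b (grow1 A) = b 1 + rw b (A $ 1)" "lc b (grow2 A) = b 2 + rw b (A $ 2)"
  by (simp_all add: grow_emb linear_add[OF linear_lc] lc_axis rw_def)

lemma smooth_on_posdet:
  fixes f g :: "'a::euclidean_space \<Rightarrow> real^2^2"
  shows "open S \<Longrightarrow> smooth_on S f \<Longrightarrow> smooth_on S g \<Longrightarrow> smooth_on S (\<lambda>p. posdet (f p) (g p))"
  unfolding posdet_def mat2_det by (intro smooth_intros)

lemma posdet_independent:
  assumes "posdet N1 N2 \<noteq> 0" "x *\<^sub>R N1 + y *\<^sub>R N2 = 0"
  shows "x = 0 \<and> y = 0"
proof -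
  define w where "w = N1$1$1 * N2$1$2 - N1$1$2 * N2$1$1"
  have w: "w \<noteq> 0" using assms(1) by (auto simp: posdet_def w_def)
  have e: "x * N1$1$1 + y * N2$1$1 = 0" "x * N1$1$2 + y * N2$1$2 = 0"
    using arg_cong[OF assms(2), of "\<lambda>A. A$1$1"] arg_cong[OF assms(2), of "\<lambda>A. A$1$2"] by simp_all
  have xw: "x * w = (x * N1$1$1 + y * N2$1$1) * N2$1$2 - (x * N1$1$2 + y * N2$1$2) * N2$1$1"
    "y * w = (x * N1$1$2 + y * N2$1$2) * N1$1$1 - (x * N1$1$1 + y * N2$1$1) * N1$1$2"
    by (simp_all add: w_def algebra_simps)
  show ?thesis using xw(1)[unfolded e] xw(2)[unfolded e] w by simp
qed

text \<open>If \<open>posdet\<close> vanishes, the first rows are proportional, and some nontrivial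
  combination has zero first row and hence zero determinant.\<close>

lemma definite_posdet_nonzero:
  assumes d: "\<And>x y. x \<noteq> 0 \<or> y \<noteq> 0 \<Longrightarrow> det (x *\<^sub>R N1 + y *\<^sub>R N2 :: real^2^2) \<noteq> 0"
  shows "posdet N1 N2 \<noteq> 0"
proof
  assume "posdet N1 N2 = 0"
  moreover have dN: "det N1 \<noteq> 0" using d[of 1 0] by simp
  ultimately have w: "N1$1$1 * N2$1$2 = N1$1$2 * N2$1$1" by (simp add: posdet_def)
  have "N1$1$1 \<noteq> 0 \<or> N1$1$2 \<noteq> 0" using dN by (auto simp: mat2_det)
  then show False
  proof
    assume n: "N1$1$1 \<noteq> 0"
    have "det (N2$1$1 *\<^sub>R N1 + (- (N1$1$1)) *\<^sub>R N2) = 0" using w by (simp add: mat2_det mult.commute)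
    then show False using d[of "N2$1$1" "- (N1$1$1)"] n by auto
  next
    assume n: "N1$1$2 \<noteq> 0"
    have "det (N2$1$2 *\<^sub>R N1 + (- (N1$1$2)) *\<^sub>R N2) = 0" using w by (simp add: mat2_det mult.commute)
    then show False using d[of "N2$1$2" "- (N1$1$2)"] n by auto
  qed
qed

text \<open>\<open>posdet\<close> is nonzero on any basis of a definite plane, and replacing
  \<open>w2\<close> by \<open>- w2\<close> reverses its sign.\<close>

lemma definite_kernel_basis:
  fixes \<alpha> :: "'a::euclidean_space \<Rightarrow> real^2^2"
  assumes K: "subspace K" "dim K = 2" and \<alpha>: "linear \<alpha>" and d: "\<And>w. w \<in> K \<Longrightarrow> w \<noteq> 0 \<Longrightarrow> det (\<alpha> w) \<noteq> 0"
  obtains w1 w2 where "w1 \<in> K" "w2 \<in> K" "posdet (\<alpha> w1) (\<alpha> w2) > 0" "\<And>w. w \<in> K \<Longrightarrow> \<exists>x y. w = x *\<^sub>R w1 + y *\<^sub>R w2"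
proof -
  obtain B where B: "B \<subseteq> K" "independent B" "span B = K" "card B = 2"
    using basis_exists[of K] K by (metis span_subspace)
  then obtain w1 w2 where w: "B = {w1, w2}" "w1 \<noteq> w2" by (auto simp: card_2_iff)
  have wK: "w1 \<in> K" "w2 \<in> K" using B w by auto
  have ind: "x = 0 \<and> y = 0" if "x *\<^sub>R w1 + y *\<^sub>R w2 = 0" for x y
  proof -
    have "(\<Sum>v\<in>B. (if v = w1 then x else y) *\<^sub>R v) = 0" using that w by simp
    moreover have fB: "finite B" using w by simp
    have nd: "\<forall>v\<in>B. u v = 0" if "(\<Sum>v\<in>B. u v *\<^sub>R v) = 0" for u
      using B(2) that unfolding dependent_finite[OF fB] by blast
    ultimately have "\<forall>v\<in>B. (if v = w1 then x else y) = 0"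
      using nd[of "\<lambda>v. if v = w1 then x else y"] by blast
    then show ?thesis using w by auto
  qed
  have "det (x *\<^sub>R \<alpha> w1 + y *\<^sub>R \<alpha> w2) \<noteq> 0" if "x \<noteq> 0 \<or> y \<noteq> 0" for x y
    using d[of "x *\<^sub>R w1 + y *\<^sub>R w2"] ind[of x y] that wK K(1)
    by (auto simp: linear_add[OF \<alpha>] linear_scale[OF \<alpha>] subspace_add subspace_scale)
  then have nz: "posdet (\<alpha> w1) (\<alpha> w2) \<noteq> 0" by (rule definite_posdet_nonzero)
  have sp: "\<exists>x y. w = x *\<^sub>R w1 + y *\<^sub>R w2" if "w \<in> K" for w
  proof -
    have "w \<in> {s *\<^sub>R w1 + t *\<^sub>R w2 | s t. True}" using that B(3) unfolding w span_pair by simp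
    then show ?thesis by blast
  qed
  show thesis
  proof (cases "posdet (\<alpha> w1) (\<alpha> w2) > 0")
    case True
    then show thesis using that wK sp by blast
  next
    case False
    have "posdet (\<alpha> w1) (\<alpha> (- w2)) = - posdet (\<alpha> w1) (\<alpha> w2)"
      by (simp add: linear_neg[OF \<alpha>] posdet_def algebra_simps)
    then have "posdet (\<alpha> w1) (\<alpha> (- w2)) > 0" using False nz by simp
    moreover have "- w2 \<in> K" using wK K by (simp add: subspace_neg)
    moreover have "\<exists>x y. w = x *\<^sub>R w1 + y *\<^sub>R (- w2)" if w: "w \<in> K" for w
    proof -
      obtain x y where "w = x *\<^sub>R w1 + y *\<^sub>R w2" using sp[OF w] by blast
      then show ?thesis by (intro exI[of _ x] exI[of _ "- y"]) simp
    qed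
    ultimately show thesis using that wK by blast
  qed
qed

text \<open>Ellipticity is the condition \<open>D\<^sup>2 l (u, w) \<notin> D l (0 \<times> \<real>\<^sup>2)\<close> for nonzero \<open>u\<close> along the fibres of
  one projection and nonzero \<open>w\<close> along those of the other. It is symmetric in the two projections.\<close>
lemma dual_graph_local:
  fixes l :: "(real^4) \<times> (real^2) \<Rightarrow> real^4" and A :: "(real^4) \<times> (real^2) \<Rightarrow> real^2^2"
  assumes Om: "open Om" "p0 \<in> Om" and sl: "smooth_on Om l" and sA: "smooth_on Om A"
    and surj: "\<And>p. p \<in> Om \<Longrightarrow> surj (frechet_derivative l (at p))"
    and ell: "\<And>p w. p \<in> Om \<Longrightarrow> frechet_derivative l (at p) w = 0 \<Longrightarrow> w \<noteq> 0 \<Longrightarrow> det (frechet_derivative A (at p) w) \<noteq> 0"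
    and pl: "\<And>p u. p \<in> Om \<Longrightarrow> proj2 (frechet_derivative l (at p) (0, u)) = proj1 (frechet_derivative l (at p) (0, u)) v* A p"
    and imm: "\<And>p u. p \<in> Om \<Longrightarrow> frechet_derivative l (at p) (0, u) = 0 \<Longrightarrow> u = 0"
  obtains O' a B where "open O'" "p0 \<in> O'" "O' \<subseteq> Om" "frame UNIV a" "smooth_on O' B"
    "\<And>p. p \<in> O' \<Longrightarrow> \<exists>w1 w2. fst w1 = lc a (grow1 (B p)) \<and> fst w2 = lc a (grow2 (B p)) \<and>
       frechet_derivative l (at p) w1 = 0 \<and> frechet_derivative l (at p) w2 = 0 \<and>
       posdet (frechet_derivative A (at p) w1) (frechet_derivative A (at p) w2) > 0"
    "\<And>p u. p \<in> O' \<Longrightarrow> u \<noteq> 0 \<Longrightarrow> det (frechet_derivative B (at p) (0, u)) \<noteq> 0"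
proof -
  define Dl where "Dl = (\<lambda>p. frechet_derivative l (at p))"
  define DA where "DA = (\<lambda>p. frechet_derivative A (at p))"
  have linDl: "linear (Dl p)" and linDA: "linear (DA p)" if "p \<in> Om" for p
    unfolding Dl_def DA_def using smooth_on_linear_derivative that sl sA by blast+
  have smDl: "smooth_on Om (\<lambda>p. Dl p w)" and smDA: "smooth_on Om (\<lambda>p. DA p w)" for w
    unfolding Dl_def DA_def using smooth_on_frechet_derivative_const sl sA by blast+
  note l0 = linDl[OF Om(2)]
  have subK: "subspace {w. Dl p0 w = 0}" using linear_subspace_vimage[OF l0 subspace_single_0] by (simp add: vimage_def)
  have dimK: "dim {w. Dl p0 w = 0} = 2"
    using dim_kernel_surj[OF l0] surj[OF Om(2)] by (simp add: Dl_def)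
  obtain w1 w2 where w: "Dl p0 w1 = 0" "Dl p0 w2 = 0" "posdet (DA p0 w1) (DA p0 w2) > 0"
    and wsp: "\<And>w. Dl p0 w = 0 \<Longrightarrow> \<exists>x y. w = x *\<^sub>R w1 + y *\<^sub>R w2"
  proof (rule definite_kernel_basis[OF subK dimK linDA[OF Om(2)]])
    show "det (DA p0 w) \<noteq> 0" if "w \<in> {w. Dl p0 w = 0}" "w \<noteq> 0" for w
      using ell[OF Om(2) _ that(2)] that(1) by (simp add: Dl_def DA_def)
  qed blast
  have wind: "x = 0 \<and> y = 0" if "x *\<^sub>R w1 + y *\<^sub>R w2 = 0" for x y
  proof -
    have "x *\<^sub>R DA p0 w1 + y *\<^sub>R DA p0 w2 = 0"
      using arg_cong[OF that, of "DA p0"] linDA[OF Om(2)] by (simp add: linear_add linear_scale linear_0)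
    then show ?thesis using posdet_independent[of "DA p0 w1" "DA p0 w2"] w(3) by simp
  qed
  \<comment> \<open>The projections of \<open>w1\<close> and \<open>w2\<close> to the first factor
    are independent, because a vertical vector in the kernel of \<open>Dl p0\<close> vanishes by
    \<open>imm\<close>.\<close>
  have "x = 0 \<and> y = 0" if e: "x *\<^sub>R fst w1 + y *\<^sub>R fst w2 = 0" for x y
  proof -
    let ?w = "x *\<^sub>R w1 + y *\<^sub>R w2"
    have D: "Dl p0 ?w = 0" using w by (simp add: linear_add[OF l0] linear_scale[OF l0])
    have f: "fst ?w = 0" using e by simp
    have "?w = (0, snd ?w)" using f by (metis prod.collapse)
    then have "snd ?w = 0" using imm[OF Om(2), of "snd ?w"] D by (simp only: Dl_def)
    then have "?w = 0" using f by (metis prod.collapse zero_prod_def)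
    then show ?thesis by (rule wind)
  qed
  then obtain a where a: "frame UNIV a" "a 1 = fst w1" "a 2 = fst w2" using frame_extend by metis
  \<comment> \<open>A kernel vector over a graph row has the form
    \<open>(a i + rw a (proj2 q), proj1 q)\<close>, with four unknowns in \<open>q\<close>: two
    graph entries and the vertical part. The equation for it is
    \<open>Lq p q = - Dl p (a i, 0)\<close>, solved smoothly once \<open>Lq p\<close> is
    invertible.\<close>
  define Lq where "Lq = (\<lambda>p q. Dl p (rw a (proj2 q), proj1 q))"
  have le: "linear (\<lambda>q. (rw a (proj2 q), proj1 q))"
    by (rule linearI) (simp_all add: linear_add[OF linear_rv(2)] linear_scale[OF linear_rv(2)] linear_add[OF linear_emb(3)] linear_scale[OF linear_emb(3)]
        linear_add[OF linear_emb(4)] linear_scale[OF linear_emb(4)])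
  have linL: "linear (Lq p)" if "p \<in> Om" for p
    using linear_compose[OF le linDl[OF that]] by (simp add: Lq_def o_def)
  have smL: "smooth_on Om (\<lambda>p. Lq p q)" for q unfolding Lq_def by (rule smDl)
  \<comment> \<open>First components of kernel vectors at \<open>p0\<close> lie in the span of
    \<open>a 1\<close>, \<open>a 2\<close>, and those of the form used in \<open>Lq\<close> lie in
    the span of \<open>a 3\<close>, \<open>a 4\<close>.\<close>
  have injL: "inj (Lq p0)"
    unfolding linear_injective_0[OF linL[OF Om(2)]]
  proof (intro allI impI)
    fix q assume "Lq p0 q = 0"
    then obtain x y where xy: "(rw a (proj2 q), proj1 q) = x *\<^sub>R w1 + y *\<^sub>R w2" using wsp unfolding Lq_def by blast
    then have "rw a (proj2 q) = x *\<^sub>R a 1 + y *\<^sub>R a 2" unfolding a by (metis fst_add fst_conv fst_scaleR)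
    then have "rv a 0 + rw a (proj2 q) = rv a (vector [x, y]) + rw a 0" by (simp add: rv_expand)
    then have "proj2 q = 0" "vector [x, y] = (0 :: real^2)" unfolding frame_rv_eq[OF a(1)] by auto
    moreover from this(2) have "x = 0" "y = 0" by (simp_all add: vec_eq_iff forall_2)
    ultimately have "proj2 q = 0" "proj1 q = 0" using xy by (auto simp: zero_prod_def)
    then show "q = 0" by (metis emb_proj_sum linear_0 linear_emb(1) linear_emb(2) add_0)
  qed
  obtain O1 where O1: "open O1" "p0 \<in> O1" "O1 \<subseteq> Om" and injO1: "\<And>p. p \<in> O1 \<Longrightarrow> inj (Lq p)"
    using inj_linear_family_open[OF Om smL linL injL] by blast
  have linO1: "linear (Lq p)" if "p \<in> O1" for p using linL that O1 by blast
  define q where "q = (\<lambda>i p. inv (Lq p) (- Dl p (a i, 0)))"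
  define B where "B = (\<lambda>p. vector [proj2 (q 1 p), proj2 (q 2 p)] :: real^2^2)"
  define W1 where "W1 = (\<lambda>p. (lc a (grow1 (B p)), proj1 (q 1 p)))"
  define W2 where "W2 = (\<lambda>p. (lc a (grow2 (B p)), proj1 (q 2 p)))"
  have smq: "smooth_on O1 (q i)" for i
    unfolding q_def
  proof (rule smooth_on_linear_family[OF O1(1), where L="\<lambda>p. inv (Lq p)"])
    show "smooth_on O1 (\<lambda>p. inv (Lq p) v)" for v
      by (rule smooth_on_inv_linear[OF O1(1) smooth_on_subset[OF smL O1(3)] linO1 injO1])
    show "linear (inv (Lq p))" if "p \<in> O1" for p using inv_linear_apply(3)[OF linO1 injO1] that by blast
    show "smooth_on O1 (\<lambda>p. - Dl p (a i, 0))"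
      using smooth_on_minus[OF O1(1) smooth_on_const[of _ 0] smooth_on_subset[OF smDl O1(3)]] by simp
  qed
  have smB: "smooth_on O1 B"
  proof (rule smooth_on_vec[OF O1(1)])
    fix i :: 2
    have "smooth_on O1 (\<lambda>p. proj2 (q j p))" for j
      by (rule smooth_on_linear_compose[OF linear_emb(4) O1(1) smq])
    then show "smooth_on O1 (\<lambda>p. B p $ i)" using exhaust_2[of i] by (auto simp: B_def)
  qed
  have smW: "smooth_on O1 W1" "smooth_on O1 W2"
    unfolding W1_def W2_def
    by (intro smooth_on_Pair[OF O1(1)] smooth_on_linear_compose[OF linear_lc O1(1)] smooth_on_linear_compose[OF linear_emb(3) O1(1)] smq smooth_on_grow[OF O1(1) smB])+
  have Wq: "W1 p = (a 1, 0) + (rw a (proj2 (q 1 p)), proj1 (q 1 p))" "W2 p = (a 2, 0) + (rw a (proj2 (q 2 p)), proj1 (q 2 p))" for p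
    by (simp_all add: W1_def W2_def lc_grow B_def)
  have DlW: "Dl p (W1 p) = 0" "Dl p (W2 p) = 0" if p: "p \<in> O1" for p
  proof -
    have pO: "p \<in> Om" using p O1 by blast
    have "Lq p (q i p) = - Dl p (a i, 0)" for i
      unfolding q_def by (rule inv_linear_apply(1)[OF linO1[OF p] injO1[OF p]])
    then show "Dl p (W1 p) = 0" "Dl p (W2 p) = 0"
      unfolding Wq linear_add[OF linDl[OF pO]] by (simp_all add: Lq_def)
  qed
  \<comment> \<open>At \<open>p0\<close> the solutions give back \<open>w1\<close> and
    \<open>w2\<close>, so \<open>posdet\<close> is positive there and, by continuity, on a
    neighbourhood.\<close>
  have "q 1 p0 = emb1 (snd w1)" "q 2 p0 = emb1 (snd w2)"
  proof -
    have "Lq p0 (emb1 (snd v)) = - Dl p0 (fst v, 0)" if "Dl p0 v = 0" for v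
    proof -
      have "Dl p0 ((fst v, 0) + (0, snd v)) = 0" using that by simp
      then show ?thesis unfolding linear_add[OF l0] by (simp add: Lq_def add_eq_0_iff)
    qed
    then show "q 1 p0 = emb1 (snd w1)" "q 2 p0 = emb1 (snd w2)"
      using w a inv_linear_apply(2)[OF linL[OF Om(2)] injL] unfolding q_def by metis+
  qed
  then have W0: "W1 p0 = w1" "W2 p0 = w2" by (simp_all add: Wq a)
  have smpd: "smooth_on O1 (\<lambda>p. posdet (DA p (W1 p)) (DA p (W2 p)))"
    unfolding DA_def by (intro smooth_on_posdet O1(1) smooth_on_frechet_derivative smooth_on_subset[OF sA O1(3)] smW)
  define O' where "O' = O1 \<inter> {p. posdet (DA p (W1 p)) (DA p (W2 p)) > 0}"
  have oO': "open O'"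
    using continuous_open_preimage[OF smooth_on_continuous[OF smpd] O1(1) open_greaterThan[of 0]]
    by (simp add: O'_def vimage_def)
  have p0O': "p0 \<in> O'" using O1 w W0 by (simp add: O'_def)
  have detB: "det (frechet_derivative B (at p) (0, u)) \<noteq> 0" if p: "p \<in> O'" and u: "u \<noteq> 0" for p u
  proof
    have p1: "p \<in> O1" and pO: "p \<in> Om" using p O1 by (auto simp: O'_def)
    let ?N = "frechet_derivative B (at p) (0, u)"
    assume "det ?N = 0"
    moreover have "(*v) (transpose ?N) = (\<lambda>x. x v* ?N)" by (rule ext) (simp add: transpose_matrix_vector)
    ultimately have "\<not> inj (\<lambda>x. x v* ?N)"
      using invertible_det_nz[of "transpose ?N"] invertible_left_inverse[of "transpose ?N"] matrix_left_invertible_injective[of "transpose ?N"]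
      by (simp add: det_transpose)
    \<comment> \<open>A null combination of the rows of the singular matrix. With these coefficients
      frozen, the kernel field \<open>w\<close> below has a first component that is stationary in
      the fibre direction \<open>u\<close>.\<close>
    then obtain x where x: "x \<noteq> 0" "x v* ?N = 0"
      using linear_injective_0[of "\<lambda>x. x v* ?N"] by (auto simp: linear_iff vm_linear_left)
    define w where "w = (\<lambda>r. x$1 *\<^sub>R W1 r + x$2 *\<^sub>R W2 r)"
    have dB: "(B has_derivative frechet_derivative B (at p)) (at p)" by (rule smooth_on_has_derivative[OF smB p1])
    have smw: "smooth_on O1 w" unfolding w_def by (intro smooth_intros O1(1) smW)
    have dw: "(w has_derivative frechet_derivative w (at p)) (at p)" by (rule smooth_on_has_derivative[OF smw p1])
    have fw: "fst (w r) = rv a x + rw a (x v* B r)" for r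
    proof -
      have "rw a (x v* B r) = x$1 *\<^sub>R rw a (B r $ 1) + x$2 *\<^sub>R rw a (B r $ 2)"
        by (simp add: rw_expand vm_nth algebra_simps)
      then show ?thesis by (simp add: w_def W1_def W2_def lc_grow rv_expand algebra_simps)
    qed
    have "((\<lambda>r. rv a x + rw a (x v* B r)) has_derivative (\<lambda>h. rw a (x v* frechet_derivative B (at p) h))) (at p)"
    proof -
      have lin: "linear (\<lambda>M. rw a (x v* M))"
        by (rule linearI) (simp_all add: vm_linear_right linear_add[OF linear_rv(2)] linear_scale[OF linear_rv(2)])
      show ?thesis
        using has_derivative_add[OF has_derivative_const has_derivative_compose[OF dB linear_imp_has_derivative[OF lin]]] by simp
    qed
    moreover have "((\<lambda>r. fst (w r)) has_derivative (\<lambda>h. fst (frechet_derivative w (at p) h))) (at p)"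
      by (rule has_derivative_fst[OF dw])
    ultimately have "(\<lambda>h. fst (frechet_derivative w (at p) h)) = (\<lambda>h. rw a (x v* frechet_derivative B (at p) h))"
      unfolding fw by (rule has_derivative_unique[rotated])
    then have "fst (frechet_derivative w (at p) (0, u)) = rw a (x v* ?N)" by (rule fun_cong)
    then have w'0: "frechet_derivative w (at p) (0, u) = (0, snd (frechet_derivative w (at p) (0, u)))"
      using x(2) by (metis prod.collapse rw_0)
    have Dlw: "Dl r (w r) = 0" if "r \<in> O1" for r
      using DlW[OF that] linDl[of r] O1(3) that by (auto simp: w_def linear_add linear_scale)
    \<comment> \<open>differentiating \<open>Dl w = 0\<close> along the fibre\<close>
    have "((\<lambda>r. Dl r (w r)) has_derivative (\<lambda>h. frechet_derivative (\<lambda>r. Dl r (w p)) (at p) h + Dl p (frechet_derivative w (at p) h))) (at p)"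
      by (rule has_derivative_linear_family[OF Om(1) pO smDl linDl dw])
    moreover have "((\<lambda>r. Dl r (w r)) has_derivative (\<lambda>h. 0)) (at p)"
      by (rule has_derivative_transform_within_open[OF has_derivative_const[of 0] O1(1) p1]) (simp add: Dlw)
    ultimately have "(\<lambda>h. frechet_derivative (\<lambda>r. Dl r (w p)) (at p) h + Dl p (frechet_derivative w (at p) h)) = (\<lambda>h. 0)"
      by (rule has_derivative_unique)
    then have "frechet_derivative (\<lambda>r. Dl r (w p)) (at p) (0, u) + Dl p (frechet_derivative w (at p) (0, u)) = 0"
      by (rule fun_cong)
    moreover define s where "s = snd (frechet_derivative w (at p) (0, u))"
    ultimately have "frechet_derivative (\<lambda>r. Dl r (w p)) (at p) (0, u) + Dl p (0, s) = 0"
      using w'0 by simp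
    then have "frechet_derivative (\<lambda>r. Dl r (w p)) (at p) (0, u) = - Dl p (0, s)"
      by (simp only: eq_neg_iff_add_eq_0)
    moreover have "Dl p (0, - s) = - Dl p (0, s)"
      using linear_neg[OF linDl[OF pO], of "(0, s)"] by simp
    ultimately have e1: "frechet_derivative (\<lambda>r. Dl r (w p)) (at p) (0, u) = Dl p (0, - s)"
      by (simp only:)
    \<comment> \<open>The second derivative of \<open>l\<close> on the vertical \<open>u\<close> and
      the kernel vector \<open>w p\<close>. By symmetry and \<open>e1\<close> it lies in the plane
      with matrix \<open>A p\<close>.\<close>
    define \<beta> where "\<beta> = frechet_derivative (\<lambda>r. Dl r (0, u)) (at p) (w p)"
    have "\<beta> = frechet_derivative (\<lambda>r. Dl r (w p)) (at p) (0, u)"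
      unfolding \<beta>_def Dl_def by (rule second_derivative_symmetric[OF Om(1) pO sl])
    then have \<beta>: "proj2 \<beta> = proj1 \<beta> v* A p" using pl[OF pO] e1 by (simp add: Dl_def)
    \<comment> \<open>differentiating the incidence of \<open>Dl (0, u)\<close> with the plane along \<open>w\<close>\<close>
    have dh: "((\<lambda>r. Dl r (0, u)) has_derivative frechet_derivative (\<lambda>r. Dl r (0, u)) (at p)) (at p)"
      by (rule smooth_on_has_derivative[OF smDl pO])
    note d2 = has_derivative_compose[OF dh linear_imp_has_derivative[OF linear_emb(4)]]
    note d1 = has_derivative_compose[OF dh linear_imp_has_derivative[OF linear_emb(3)]]
    have dA: "(A has_derivative DA p) (at p)" unfolding DA_def by (rule smooth_on_has_derivative[OF sA pO])
    have "((\<lambda>r. proj2 (Dl r (0, u))) has_derivative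
        (\<lambda>h. proj1 (Dl p (0, u)) v* DA p h + proj1 (frechet_derivative (\<lambda>r. Dl r (0, u)) (at p) h) v* A p)) (at p)"
      by (rule has_derivative_transform_within_open[OF bounded_bilinear.FDERIV[OF bounded_bilinear_vm d1 dA] Om(1) pO])
        (simp add: pl Dl_def)
    from has_derivative_unique[OF d2 this]
    have "proj2 \<beta> = proj1 (Dl p (0, u)) v* DA p (w p) + proj1 \<beta> v* A p"
      unfolding \<beta>_def by (rule fun_cong)
    \<comment> \<open>The homomorphism belonging to \<open>w p\<close> annihilates the vector
      \<open>Dl p (0, u)\<close> of the plane. Ellipticity makes it invertible, so this vector is
      zero, against \<open>imm\<close>.\<close>
    then have z: "proj1 (Dl p (0, u)) v* DA p (w p) = 0" using \<beta> by simp
    have "w p \<noteq> 0"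
    proof
      assume "w p = 0"
      then have "rv a x + rw a (x v* B p) = rv a 0 + rw a 0" using fw[of p] by simp
      then show False using frame_rv_eq[OF a(1)] x by blast
    qed
    then have "det (DA p (w p)) \<noteq> 0" using ell[OF pO] Dlw[OF p1] by (simp add: Dl_def DA_def)
    then obtain Mi where Mi: "DA p (w p) ** Mi = mat 1" using mat2_invertible by blast
    have "proj1 (Dl p (0, u)) = (proj1 (Dl p (0, u)) v* DA p (w p)) v* Mi" by (simp add: vector_matrix_mul_assoc Mi)
    then have p1z: "proj1 (Dl p (0, u)) = 0" unfolding z by simp
    then have "proj2 (Dl p (0, u)) = 0" using pl[OF pO, of u] by (simp add: Dl_def)
    then have "Dl p (0, u) = 0" using p1z emb_proj_sum[of "Dl p (0, u)"] by (simp add: linear_0[OF linear_emb(1)] linear_0[OF linear_emb(2)])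
    then show False using imm[OF pO] u by (simp add: Dl_def)
  qed
  show thesis
  proof (rule that[OF oO' p0O' _ a(1) smooth_on_subset[OF smB]])
    show "O' \<subseteq> Om" using O1 by (auto simp: O'_def)
    show "O' \<subseteq> O1" by (auto simp: O'_def)
    show "\<exists>w1 w2. fst w1 = lc a (grow1 (B p)) \<and> fst w2 = lc a (grow2 (B p)) \<and>
       frechet_derivative l (at p) w1 = 0 \<and> frechet_derivative l (at p) w2 = 0 \<and>
       posdet (frechet_derivative A (at p) w1) (frechet_derivative A (at p) w2) > 0" if "p \<in> O'" for p
      using that DlW[of p] by (intro exI[of _ "W1 p"] exI[of _ "W2 p"]) (auto simp: O'_def W1_def W2_def Dl_def DA_def)
    show "det (frechet_derivative B (at p) (0, u)) \<noteq> 0" if "p \<in> O'" "u \<noteq> 0" for p u by (rule detB[OF that])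
  qed
qed

section \<open>Vertical tangent vectors of the Grassmann bundle\<close>

section \<open>The projection of the Grassmann bundle and its fibres\<close>

lemma smooth_map_openin_preimage:
  assumes M: "mfd M" and N: "mfd N" and f: "smooth_map M N f" and W: "openin (mtop N) W"
  shows "openin (mtop M) {p \<in> carrier_of M. f p \<in> W}"
  unfolding openin_mtop_iff[OF mfd_atlas[OF M]]
proof (intro conjI ballI)
  fix c assume c: "c \<in> M"
  have "fst c \<inter> {p \<in> carrier_of M. f p \<in> W} = (\<Union>d\<in>N. fst c \<inter> f -` (fst d \<inter> W))"
  proof (intro equalityI subsetI)
    fix p assume p: "p \<in> fst c \<inter> {p \<in> carrier_of M. f p \<in> W}"
    then have "f p \<in> carrier_of N" using smooth_map_carrier[OF f] by blast
    then obtain d where "d \<in> N" "f p \<in> fst d" unfolding carrier_of_def by blast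
    then show "p \<in> (\<Union>d\<in>N. fst c \<inter> f -` (fst d \<inter> W))" using p by blast
  next
    fix p assume "p \<in> (\<Union>d\<in>N. fst c \<inter> f -` (fst d \<inter> W))"
    then show "p \<in> fst c \<inter> {p \<in> carrier_of M. f p \<in> W}" using c unfolding carrier_of_def by blast
  qed
  then have eq: "snd c ` (fst c \<inter> {p \<in> carrier_of M. f p \<in> W}) = (\<Union>d\<in>N. snd c ` (fst c \<inter> f -` (fst d \<inter> W)))"
    by (simp only: image_UN)
  have o: "\<forall>d\<in>N. open (snd c ` (fst c \<inter> f -` (fst d \<inter> W)))"
    using smooth_map_rep(1)[OF mfd_atlas[OF M] mfd_atlas[OF N] f c restrict_chart_openin[OF N _ W]] by simp
  show "open (snd c ` (fst c \<inter> {p \<in> carrier_of M. f p \<in> W}))" unfolding eq by (rule open_UN[OF o])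
qed blast

lemma graph_bundle_fst:
  assumes M: "mfd M" and c: "c \<in> M" and b: "frame UNIV b" and e: "e \<in> fst (graph_bundle_chart M c b)"
  shows "fst (snd (graph_bundle_chart M c b) e) = snd c (fst e)" "fst e \<in> fst c"
proof -
  have v: "valid_chart c" using atlas_valid[OF mfd_atlas[OF M] c] .
  obtain m A where m: "e = (m, graph_plane (coord_frame M c b m) A)" "m \<in> fst c"
    using e unfolding graph_bundle_dom[OF v] by blast
  then have "c \<in> charts_at M m" using c by (simp add: charts_at_def)
  then show "fst (snd (graph_bundle_chart M c b) e) = snd c (fst e)" "fst e \<in> fst c"
    using graph_bundle_apply(1)[OF M _ b] m by simp_all
qed

lemma fst_graph_bundle_rep:
  assumes M: "mfd M" and c: "c \<in> M" and b: "frame UNIV b"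
    and y: "y \<in> snd (graph_bundle_chart M c b) ` fst (graph_bundle_chart M c b)"
  shows "(snd c \<circ> fst \<circ> chart_inv (graph_bundle_chart M c b)) y = fst y"
  using graph_bundle_fst(1)[OF M c b chart_inv_mem[OF y]] chart_inv_right[OF y] by simp

lemma smooth_map_fst_Gr2T:
  assumes M: "mfd M"
  shows "smooth_map (Gr2T M) M fst"
proof (rule smooth_mapI[OF mfd_Gr2T[OF M]])
  fix e assume e: "e \<in> carrier_of (Gr2T M)"
  obtain c b A where cb: "c \<in> charts_at M (fst e)" "frame UNIV b" "snd e = graph_plane (coord_frame M c b (fst e)) A"
    using e by (metis carrier_Gr2T_obtain[OF M] prod.collapse)
  have c: "c \<in> M" using cb by (simp add: charts_at_def)
  let ?G = "graph_bundle_chart M c b"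
  have eG: "e \<in> fst ?G" using graph_bundle_apply(2)[OF M cb(1,2), of A] cb(3) by (metis prod.collapse)
  have o: "open (snd ?G ` fst ?G)" by (rule valid_chart_open[OF valid_graph_bundle_chart[OF M c cb(2)]])
  have "smooth_on (snd ?G ` fst ?G) (snd c \<circ> fst \<circ> chart_inv ?G)"
    by (rule smooth_on_cong[OF o _ smooth_on_fst[OF o smooth_on_ident]]) (rule fst_graph_bundle_rep[OF M c cb(2), symmetric])
  then show "\<exists>c\<in>Gr2T M. \<exists>d\<in>M. \<exists>T. e \<in> T \<and> T \<subseteq> fst c \<and> open (snd c ` T) \<and> fst ` T \<subseteq> fst d \<and> smooth_on (snd c ` T) (snd d \<circ> fst \<circ> chart_inv c)"
    using graph_bundle_chart_mem[OF M c cb(2)] eG o graph_bundle_fst(2)[OF M c cb(2)] c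
    by (intro bexI[of _ ?G] bexI[of _ c] exI[of _ "fst ?G"]) auto
qed

lemma graph_bundle_at:
  assumes M: "mfd M" and c: "c \<in> charts_at M m" and b: "frame UNIV b" and P: "P = graph_plane (coord_frame M c b m) A"
  shows "graph_bundle_chart M c b \<in> charts_at (Gr2T M) (m, P)"
  using graph_bundle_apply(2)[OF M c b, of A] graph_bundle_chart_mem[OF M _ b] c P by (simp add: charts_at_def)

lemma tmap_fst_Gr2T:
  assumes M: "mfd M" and c: "c \<in> charts_at M (fst e)" and b: "frame UNIV b" and G: "graph_bundle_chart M c b \<in> charts_at (Gr2T M) e"
    and xi: "\<xi> \<in> tangent_space (Gr2T M) e"
  shows "tmap (Gr2T M) M fst e \<xi> c = fst (\<xi> (graph_bundle_chart M c b))"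
proof -
  let ?G = "graph_bundle_chart M c b"
  have cM: "c \<in> M" using c by (simp add: charts_at_def)
  have o: "open (snd ?G ` fst ?G)" by (rule valid_chart_open[OF valid_graph_bundle_chart[OF M cM b]])
  have m: "snd ?G e \<in> snd ?G ` fst ?G" using G by (simp add: charts_at_def)
  have "(snd c \<circ> fst \<circ> chart_inv ?G has_derivative fst) (at (snd ?G e))"
    by (rule has_derivative_transform_within_open[OF has_derivative_fst[OF has_derivative_ident] o m])
      (rule fst_graph_bundle_rep[OF M cM b, symmetric])
  then have "frechet_derivative (snd c \<circ> fst \<circ> chart_inv ?G) (at (snd ?G e)) = fst"
    by (rule frechet_derivative_eq)
  then show ?thesis using tmap_apply[OF mfd_Gr2T[OF M] M smooth_map_fst_Gr2T[OF M] xi G c] by simp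
qed

text \<open>Every frame of a tangent space comes from constant vectors in the chart
  \<open>c\<close>, so each graph chart of a fibre Grassmannian is matched by a bundle
  chart.\<close>

lemma coord_frame_obtain:
  assumes M: "mfd M" and c: "c \<in> charts_at M m" and g: "frame (tangent_space M m) g"
  obtains b where "frame UNIV b" "coord_frame M c b m = g"
proof -
  define b where "b = (\<lambda>i. g i c)"
  have gT: "g i \<in> tangent_space M m" for i using frame_mem[OF g, of "axis i 1"] by (simp add: lc_axis)
  have e: "coord_frame M c b m = g" by (rule ext) (simp add: coord_frame_def b_def tangent_coord[OF c gT])
  note l = lc_coord_frame[OF mfd_atlas[OF M] c, of b, unfolded e]
  have "inj (lc b)" using frame_lc_eq[OF g] l by (metis injI)
  moreover have "range (lc b) = UNIV"
    using linear_injective_imp_surjective[OF linear_lc \<open>inj (lc b)\<close>] by simp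
  ultimately show thesis using that e by (simp add: frame_iff)
qed

lemma Pair_Gr2_rep:
  assumes M: "mfd M" and c: "c \<in> charts_at M m" and b: "frame UNIV b"
  shows "(snd (graph_bundle_chart M c b) \<circ> Pair m \<circ> chart_inv (graph_chart (coord_frame M c b m))) A = (snd c m, A)"
  by (simp add: graph_chart_inv[OF frame_coord_frame[OF M c b]] graph_bundle_apply(1)[OF M c b])

lemma smooth_map_Pair_Gr2T:
  assumes M: "mfd M" and m: "m \<in> carrier_of M"
  shows "smooth_map (Gr2 (tangent_space M m)) (Gr2T M) (Pair m)"
proof (rule smooth_mapI[OF mfd_Gr2])
  fix P assume "P \<in> carrier_of (Gr2 (tangent_space M m))"
  then obtain g A where g: "frame (tangent_space M m) g" "P = graph_plane g A" by (auto simp: carrier_Gr2)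
  obtain c where c: "c \<in> charts_at M m" using carrier_charts_at[OF m] by blast
  obtain b where b: "frame UNIV b" "coord_frame M c b m = g" using coord_frame_obtain[OF M c g(1)] by blast
  let ?G = "graph_bundle_chart M c b"
  have cM: "c \<in> M" using c by (simp add: charts_at_def)
  have o: "open (snd (graph_chart g) ` fst (graph_chart g))" by (rule valid_chart_open[OF valid_graph_chart[OF g(1)]])
  have "smooth_on (snd (graph_chart g) ` fst (graph_chart g)) (snd ?G \<circ> Pair m \<circ> chart_inv (graph_chart g))"
    by (rule smooth_on_cong[OF o, of "\<lambda>A. (snd c m, A)"])
      (simp_all only: Pair_Gr2_rep[OF M c b(1), unfolded b(2)] smooth_on_Pair[OF o smooth_on_const smooth_on_ident])
  moreover have "Pair m ` fst (graph_chart g) \<subseteq> fst ?G"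
    using graph_bundle_apply(2)[OF M c b(1)] by (auto simp: graph_chart_dom b(2))
  ultimately show "\<exists>c\<in>Gr2 (tangent_space M m). \<exists>d\<in>Gr2T M. \<exists>T. P \<in> T \<and> T \<subseteq> fst c \<and> open (snd c ` T) \<and> Pair m ` T \<subseteq> fst d \<and>
      smooth_on (snd c ` T) (snd d \<circ> Pair m \<circ> chart_inv c)"
    using graph_chart_mem[OF g(1)] graph_bundle_chart_mem[OF M cM b(1)] g o
    by (intro bexI[of _ "graph_chart g"] bexI[of _ ?G] exI[of _ "fst (graph_chart g)"]) (auto simp: graph_chart_dom)
qed

text \<open>In matching charts the inclusion of a fibre is
  \<open>A \<mapsto> (snd c m, A)\<close>.\<close>

lemma tmap_Pair_Gr2T:
  assumes M: "mfd M" and c: "c \<in> charts_at M m" and b: "frame UNIV b" and P: "P = graph_plane (coord_frame M c b m) A"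
    and xi: "\<xi> \<in> tangent_space (Gr2 (tangent_space M m)) P"
  shows "tmap (Gr2 (tangent_space M m)) (Gr2T M) (Pair m) P \<xi> (graph_bundle_chart M c b) = (0, \<xi> (graph_chart (coord_frame M c b m)))"
proof -
  let ?G = "graph_bundle_chart M c b" and ?g = "coord_frame M c b m"
  have m: "m \<in> carrier_of M" using charts_at_carrier[OF c] .
  note g = frame_coord_frame[OF M c b]
  have "(snd ?G \<circ> Pair m \<circ> chart_inv (graph_chart ?g)) = (\<lambda>A. (snd c m, A))"
    by (rule ext) (rule Pair_Gr2_rep[OF M c b])
  moreover have "((\<lambda>A::real^2^2. (snd c m, A)) has_derivative (\<lambda>H. (0, H))) (at a)" for a
    by (auto intro!: derivative_eq_intros)
  ultimately have "frechet_derivative (snd ?G \<circ> Pair m \<circ> chart_inv (graph_chart ?g)) (at (snd (graph_chart ?g) P)) = (\<lambda>H. (0, H))"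
    by (simp only: frechet_derivative_eq)
  then show ?thesis
    using tmap_apply[OF mfd_Gr2 mfd_Gr2T[OF M] smooth_map_Pair_Gr2T[OF M m] xi graph_chart_at[OF g P[symmetric]] graph_bundle_at[OF M c b P]] by simp
qed

text \<open>Passing to the shifted frame translates the graph coordinate by \<open>A\<close>, which
  leaves the matrix of the tangent vector unchanged.\<close>

lemma Gr2_hom_graph:
  assumes g: "frame V g" and P: "P = graph_plane g A" and xi: "\<xi> \<in> tangent_space (Gr2 V) P"
  shows "Gr2_hom V P \<xi> = frame_hom (shift_frame g A) (\<xi> (graph_chart g))"
proof -
  let ?h = "shift_frame g A"
  have h: "frame V ?h" by (rule frame_shift[OF g])
  have hP: "graph_plane ?h 0 = P" by (simp add: graph_plane_shift P)
  have "(snd (graph_chart ?h) \<circ> chart_inv (graph_chart g)) B = B - A" for B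
    using graph_plane_shift[of g A "B - A"] graph_chart_apply[OF h, of "B - A"] by (simp add: graph_chart_inv[OF g])
  then have "snd (graph_chart ?h) \<circ> chart_inv (graph_chart g) = (\<lambda>B. B - A)" by (rule ext)
  moreover have "((\<lambda>B. B - A) has_derivative (\<lambda>H. H)) (at a)" for a by (auto intro!: derivative_eq_intros)
  ultimately have "frechet_derivative (snd (graph_chart ?h) \<circ> chart_inv (graph_chart g)) (at (snd (graph_chart g) P)) = (\<lambda>H. H)"
    by (simp only: frechet_derivative_eq)
  then have "\<xi> (graph_chart ?h) = \<xi> (graph_chart g)"
    using tangent_law(1)[OF xi graph_chart_at[OF g P[symmetric]] graph_chart_at[OF h hP]] by simp
  then show ?thesis using Gr2_hom_eq[OF h hP xi] by simp
qed

lemma plane_graph_plane: "plane (graph_plane b A) = {lc b y | y. proj2 y = proj1 y v* A}"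
proof -
  have "plane (graph_plane b A) = {s *\<^sub>R lc b (grow1 A) + t *\<^sub>R lc b (grow2 A) | s t. True}"
    by (simp only: graph_plane_lc plane_oplane span_pair)
  also have "\<dots> = {lc b (s *\<^sub>R grow1 A + t *\<^sub>R grow2 A) | s t. True}"
    by (simp add: linear_add[OF linear_lc] linear_scale[OF linear_lc])
  also have "\<dots> = {lc b y | y. proj2 y = proj1 y v* A}"
  proof (intro equalityI subsetI)
    fix v assume "v \<in> {lc b (s *\<^sub>R grow1 A + t *\<^sub>R grow2 A) | s t. True}"
    then obtain s t where "v = lc b (s *\<^sub>R grow1 A + t *\<^sub>R grow2 A)" by blast
    moreover have "proj2 (s *\<^sub>R grow1 A + t *\<^sub>R grow2 A) = proj1 (s *\<^sub>R grow1 A + t *\<^sub>R grow2 A) v* A"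
      by (rule vec2_eqI) (simp_all add: vm_nth)
    ultimately show "v \<in> {lc b y | y. proj2 y = proj1 y v* A}" by blast
  next
    fix v assume "v \<in> {lc b y | y. proj2 y = proj1 y v* A}"
    then obtain y where y: "v = lc b y" "proj2 y = proj1 y v* A" by blast
    have e: "y = y$1 *\<^sub>R grow1 A + y$2 *\<^sub>R grow2 A"
      using arg_cong[OF y(2), of "\<lambda>z. z$1"] arg_cong[OF y(2), of "\<lambda>z. z$2"]
      by (intro vec4_eqI) (simp_all add: vm_nth)
    have "v = lc b (y$1 *\<^sub>R grow1 A + y$2 *\<^sub>R grow2 A)" unfolding y(1) by (rule arg_cong[OF e])
    then show "v \<in> {lc b (s *\<^sub>R grow1 A + t *\<^sub>R grow2 A) | s t. True}" by blast
  qed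
  finally show ?thesis .
qed

lemma tmap_const: "tmap M N (\<lambda>_. q) p v = 0"
  by (auto simp: tmap_def Let_def fun_eq_iff o_def)

text \<open>A trivialization provides a local section \<open>s\<close> of \<open>p\<close> through
  \<open>e\<close>; differentiating \<open>p \<circ> s = id\<close> shows that the differential of
  \<open>p\<close> is onto.\<close>

lemma trivialized_submersion:
  assumes E: "mfd E" and M: "mfd M" and F: "mfd F" and p: "smooth_map E M p" and W: "openin (mtop M) W"
    and tr: "trivialized_over E M p W F" and e: "e \<in> carrier_of E" "p e \<in> W"
  shows "tmap E M p e ` tangent_space E e = tangent_space M (p e)"
proof -
  define V where "V = {e \<in> carrier_of E. p e \<in> W}"
  have V: "openin (mtop E) V" unfolding V_def by (rule smooth_map_openin_preimage[OF E M p W])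
  note mE' = mfd_open_sub[OF E V] and mM' = mfd_open_sub[OF M W]
  note cE' = carrier_open_sub[OF E V] and cM' = carrier_open_sub[OF M W]
  obtain \<Psi> where d: "diffeo (open_sub E V) (prod_manifold (open_sub M W) F) \<Psi>" and fst\<Psi>: "\<And>e. e \<in> V \<Longrightarrow> fst (\<Psi> e) = p e"
    using tr unfolding trivialized_over_def V_def by blast
  have cP: "carrier_of (prod_manifold (open_sub M W) F) = W \<times> carrier_of F"
    using carrier_prod_manifold[OF mfd_atlas[OF mM'] mfd_atlas[OF F]] cM' by simp
  have mP: "mfd (prod_manifold (open_sub M W) F)" by (rule mfd_prod_manifold[OF mfd_atlas[OF mM'] mfd_atlas[OF F]])
  have bij: "bij_betw \<Psi> V (W \<times> carrier_of F)" and inv: "smooth_map (prod_manifold (open_sub M W) F) (open_sub E V) (inv_into V \<Psi>)"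
    using d by (auto simp: diffeo_def cE' cP)
  have eV: "e \<in> V" using e by (simp add: V_def)
  define f where "f = snd (\<Psi> e)"
  have \<Psi>e: "\<Psi> e = (p e, f)" using fst\<Psi>[OF eV] by (simp add: f_def prod_eq_iff)
  have "\<Psi> e \<in> W \<times> carrier_of F" using bij eV by (auto simp: bij_betw_def)
  then have f: "f \<in> carrier_of F" using \<Psi>e by simp
  define s where "s = inv_into V \<Psi> \<circ> (\<lambda>x. (x, f))"
  have "smooth_map (open_sub M W) (open_sub E V) s"
    unfolding s_def by (rule smooth_map_comp[OF mM' mP mE' smooth_map_Pair_const[OF mM' F f] inv])
  then have s: "smooth_map (open_sub M W) E s" by (rule smooth_map_into_open_sub[OF mM' E V])
  have se: "s (p e) = e" using bij eV by (simp add: s_def \<Psi>e[symmetric] bij_betw_def)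
  have ps: "p (s x) = x" if "x \<in> W" for x
  proof -
    have "(x, f) \<in> \<Psi> ` V" using that f bij by (simp add: bij_betw_def)
    then have "s x \<in> V" "\<Psi> (s x) = (x, f)" by (simp_all add: s_def inv_into_into f_inv_into_f)
    then show ?thesis using fst\<Psi> by (metis fst_conv)
  qed
  have peW: "p e \<in> carrier_of (open_sub M W)" using e cM' by simp
  have "tangent_space M (p e) \<subseteq> tmap E M p e ` tangent_space E e"
  proof
    fix v assume "v \<in> tangent_space M (p e)"
    then obtain u where u: "u \<in> tangent_space (open_sub M W) (p e)" "v = tmap (open_sub M W) M id (p e) u"
      using tmap_open_sub_incl_bij[OF M W e(2)] by (auto simp: bij_betw_def)
    have "tmap (open_sub M W) M (p \<circ> s) (p e) u = tmap (open_sub M W) M id (p e) u"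
      by (rule tmap_cong[OF mM' M smooth_map_open_sub_incl[OF M W] _ u(1) peW]) (use cM' ps in auto)
    moreover have "tmap (open_sub M W) M (p \<circ> s) (p e) u = tmap E M p e (tmap (open_sub M W) E s (p e) u)"
      using tmap_comp[OF mM' E M s p u(1) peW] se by simp
    moreover have "tmap (open_sub M W) E s (p e) u \<in> tangent_space E e"
      using tmap_tangent[OF mM' E s u(1) peW] se by simp
    ultimately show "v \<in> tmap E M p e ` tangent_space E e" using u(2) by (metis imageI)
  qed
  then show ?thesis using tmap_tangent[OF E M p _ e(1)] by blast
qed

lemma tangent_space_range:
  "mfd M \<Longrightarrow> c \<in> charts_at M p \<Longrightarrow> tangent_space M p = range (coord_vec M c p)"
  using coord_vec_tangent[of M c p] by (auto simp: image_iff intro!: exI[of _ "_ c"] dest: tangent_coord[of c M p, symmetric])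

text \<open>\<open>r\<close> is the differential from coordinates to coordinates. Dimension counts
  are made for \<open>r\<close>, between Euclidean spaces, and carried back to the tangent
  spaces.\<close>

lemma tmap_coords:
  assumes M: "mfd M" and N: "mfd N" and f: "smooth_map M N f" and k: "k \<in> charts_at M p" and d: "d \<in> charts_at N (f p)"
  defines "r \<equiv> \<lambda>w. tmap M N f p (coord_vec M k p w) d"
  shows "linear r" "r w = 0 \<longleftrightarrow> coord_vec M k p w \<in> ker_tmap M N f p"
    "ker_tmap M N f p = coord_vec M k p ` {w. r w = 0}"
    "tmap M N f p ` tangent_space M p = tangent_space N (f p) \<Longrightarrow> surj r"
    "r = frechet_derivative (snd d \<circ> f \<circ> chart_inv k) (at (snd k p))"
proof -
  have p: "p \<in> carrier_of M" by (rule charts_at_carrier[OF k])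
  have fp: "f p \<in> carrier_of N" by (rule charts_at_carrier[OF d])
  show "linear r"
    using linear_compose[OF linear_compose[OF linear_coord_vec[OF mfd_atlas[OF M] k] linear_tmap[OF M N f p]] linear_fun_apply, of d]
    by (simp add: r_def o_def)
  have v: "coord_vec M k p w \<in> tangent_space M p" for w by (rule coord_vec_tangent[OF M k])
  have *: "r w = 0 \<longleftrightarrow> coord_vec M k p w \<in> ker_tmap M N f p" for w
  proof -
    have "tmap M N f p (coord_vec M k p w) \<in> tangent_space N (f p)" by (rule tmap_tangent[OF M N f v p])
    moreover have "0 \<in> tangent_space N (f p)" by (rule subspace_0[OF subspace_tangent_space[OF N fp]])
    ultimately have "r w = 0 \<longleftrightarrow> tmap M N f p (coord_vec M k p w) = 0"
      using tangent_eqI[OF d] by (auto simp: r_def)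
    then show ?thesis using v by (simp add: ker_tmap_def)
  qed
  then show "r w = 0 \<longleftrightarrow> coord_vec M k p w \<in> ker_tmap M N f p" .
  show "ker_tmap M N f p = coord_vec M k p ` {w. r w = 0}"
  proof (intro equalityI subsetI)
    fix u assume u: "u \<in> ker_tmap M N f p"
    then have "u = coord_vec M k p (u k)" using tangent_coord[OF k, of u] by (simp add: ker_tmap_def)
    moreover from this have "r (u k) = 0" using *[of "u k"] u by simp
    ultimately show "u \<in> coord_vec M k p ` {w. r w = 0}" by blast
  qed (use * in auto)
  show "surj r" if s: "tmap M N f p ` tangent_space M p = tangent_space N (f p)"
  proof -
    have "y \<in> range r" for y
    proof -
      have "coord_vec N d (f p) y \<in> tmap M N f p ` tangent_space M p" using coord_vec_tangent[OF N d] s by simp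
      then obtain u where u: "u \<in> tangent_space M p" "coord_vec N d (f p) y = tmap M N f p u" by blast
      then have "r (u k) = y" using tangent_coord[OF k u(1)] coord_vec_same[OF mfd_atlas[OF N] d, of y] by (simp add: r_def)
      then show ?thesis by blast
    qed
    then show ?thesis by blast
  qed
  show "r = frechet_derivative (snd d \<circ> f \<circ> chart_inv k) (at (snd k p))"
    unfolding r_def by (rule ext) (simp add: tmap_apply[OF M N f v k d] coord_vec_same[OF mfd_atlas[OF M] k])
qed

lemma surface_hom_frame_hom:
  assumes F: "mfd F" and i: "smooth_map F (Gr2 V) id" and P: "P \<in> carrier_of F" "P = graph_plane g A" and g: "frame V g"
    and \<zeta>: "\<zeta> \<in> tangent_space F P"
  shows "surface_hom V F P \<zeta> = frame_hom (shift_frame g A) (tmap F (Gr2 V) id P \<zeta> (graph_chart g))"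
  unfolding surface_hom_def using Gr2_hom_graph[OF g P(2)] tmap_tangent[OF F mfd_Gr2 i \<zeta> P(1)] by simp

section \<open>The double fibration: kernels of \<lambda>' and \<rho>' and their matrix form\<close>

section \<open>The family of curves\<close>

locale curve_family =
  fixes X :: "('x, real^4) manifold"
    and E :: "('x \<times> ('x, real^4) tvec oplane) set"
    and Y :: "('x osurface, real^4) manifold"
    and Z :: "('x \<times> 'x osurface, real^6) manifold"
  assumes X: "smooth_manifold X"
    and pseudo: "pseudocomplex X (carrier_of X) E"
    and family: "smooth_family X E Y Z"
    and tau_local_diffeo: "local_diffeo Z (total_space X E) (tau X)"
begin

lemma mX: "mfd X" and mY: "mfd Y" and mZ: "mfd Z"
  using X family smooth_manifold_mfd by (auto simp: smooth_family_def)

lemma mG: "mfd (Gr2T X)"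
  by (rule mfd_Gr2T[OF mX])

lemma sub6: "submanifold DIM(real^6) (Gr2T X) E"
  using pseudo by (simp add: pseudocomplex_def)

lemma mE: "mfd (total_space X E)"
  unfolding total_space_def by (rule mfd_sub_structure[OF mfd_atlas[OF mG]])

lemma carrier_E: "carrier_of (total_space X E) = E"
  unfolding total_space_def by (rule carrier_sub_structure[OF mfd_atlas[OF mG] sub6])

lemma immersion_E: "immersion (total_space X E) (Gr2T X) id"
  unfolding total_space_def by (rule immersion_sub_incl[OF mG sub6])

lemma smooth_E: "smooth_map (total_space X E) (Gr2T X) id"
  using immersion_E by (simp add: immersion_def)

lemma smooth_tau: "smooth_map Z (total_space X E) (tau X)"
  by (rule local_diffeo_smooth_map[OF mZ mE tau_local_diffeo])

lemma smooth_tau_G: "smooth_map Z (Gr2T X) (tau X)"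
  using smooth_map_comp[OF mZ mE mG smooth_tau smooth_E] by simp

lemma smooth_lambda: "smooth_map Z X fst" and smooth_rho: "smooth_map Z Y snd"
  using family by (auto simp: smooth_family_def submersion_def)

lemma fst_tau: "fst (tau X z) = fst z" and fst_comp_tau: "fst \<circ> tau X = fst"
  by (auto simp: tau_def fun_eq_iff split: prod.splits)

lemma tau_E: "z \<in> carrier_of Z \<Longrightarrow> tau X z \<in> E"
  using smooth_map_carrier[OF smooth_tau] carrier_E by blast

lemma smooth_fst_E: "smooth_map (total_space X E) X fst"
  using smooth_map_comp[OF mE mG mX smooth_E smooth_map_fst_Gr2T[OF mX]] by simp

lemma carrier_Z_X: "z \<in> carrier_of Z \<Longrightarrow> fst z \<in> carrier_of X"
  by (rule smooth_map_carrier[OF smooth_lambda])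

lemma carrier_Z_Y: "z \<in> carrier_of Z \<Longrightarrow> snd z \<in> carrier_of Y"
  by (rule smooth_map_carrier[OF smooth_rho])

lemma tmap_tau_bij: "z \<in> carrier_of Z \<Longrightarrow>
    bij_betw (tmap Z (total_space X E) (tau X) z) (tangent_space Z z) (tangent_space (total_space X E) (tau X z))"
  by (rule local_diffeo_tmap_bij[OF mZ mE tau_local_diffeo])

lemma tmap_tau_G: "z \<in> carrier_of Z \<Longrightarrow> v \<in> tangent_space Z z \<Longrightarrow>
    tmap Z (Gr2T X) (tau X) z v = tmap (total_space X E) (Gr2T X) id (tau X z) (tmap Z (total_space X E) (tau X) z v)"
  using tmap_comp[OF mZ mE mG smooth_tau smooth_E] by simp

text \<open>\<lambda> is the bundle projection after \<tau>; \<tau>' is bijective and the projection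
  is a submersion by local triviality.\<close>

lemma lambda_surj:
  assumes z: "z \<in> carrier_of Z"
  shows "tmap Z X fst z ` tangent_space Z z = tangent_space X (fst z)"
proof -
  have eE: "tau X z \<in> carrier_of (total_space X E)" using tau_E[OF z] carrier_E by simp
  have "fst z \<in> carrier_of X" by (rule carrier_Z_X[OF z])
  then obtain W and F :: "(('x, real^4) tvec oplane, real^2) manifold" where W: "openin (mtop X) W" "fst z \<in> W" and F: "smooth_manifold F"
    and tr: "trivialized_over (total_space X E) X fst W F"
    using pseudo unfolding pseudocomplex_def by blast
  have s: "tmap (total_space X E) X fst (tau X z) ` tangent_space (total_space X E) (tau X z) = tangent_space X (fst z)"
    using trivialized_submersion[OF mE mX smooth_manifold_mfd[OF F] smooth_fst_E W(1) tr eE] W(2) by (simp add: fst_tau)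
  have "tmap Z X fst z v = tmap (total_space X E) X fst (tau X z) (tmap Z (total_space X E) (tau X) z v)" if "v \<in> tangent_space Z z" for v
    using tmap_comp[OF mZ mE mX smooth_tau smooth_fst_E that z] by (simp add: fst_comp_tau)
  then have "tmap Z X fst z ` tangent_space Z z =
      tmap (total_space X E) X fst (tau X z) ` (tmap Z (total_space X E) (tau X) z ` tangent_space Z z)"
    unfolding image_image by (intro image_cong refl) simp
  also have "\<dots> = tangent_space X (fst z)"
    using tmap_tau_bij[OF z] s by (simp add: bij_betw_def)
  finally show ?thesis .
qed

lemma rho_surj: "z \<in> carrier_of Z \<Longrightarrow> tmap Z Y snd z ` tangent_space Z z = tangent_space Y (snd z)"
  using family by (auto simp: smooth_family_def submersion_def)

text \<open>The kernel of \<open>\<rho>'\<close> is the tangent space of the curve, lifted to \<open>Z\<close>.\<close>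
lemma rho_kernel:
  assumes z: "z \<in> carrier_of Z"
  shows "bij_betw (tmap Z X fst z) (ker_tmap Z Y snd z) (plane (snd (tau X z)))"
proof -
  obtain x C where zC: "z = (x, C)" by (cases z)
  have "C \<in> carrier_of Y" "x \<in> points C" using z family by (auto simp: zC smooth_family_def)
  then have Ec: "E_curve X E C" and C: "C \<in> carrier_of Y" and j: "smooth_map (fst C) Z (\<lambda>x. (x, C))" and x: "x \<in> carrier_of (fst C)"
    using family by (auto simp: smooth_family_def points_def)
  define S where "S = fst C"
  define j' where "j' = tmap S Z (\<lambda>x. (x, C)) x"
  have smS: "smooth_manifold S" and im: "immersion S X id" and orS: "orientation S (snd C)"
    using Ec by (auto simp: E_curve_def surface_in_def S_def)
  have mS: "mfd S" by (rule smooth_manifold_mfd[OF smS])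
  have xS: "x \<in> carrier_of S" and jS: "smooth_map S Z (\<lambda>x. (x, C))" using x j by (auto simp: S_def)
  have iS: "smooth_map S X id" and inj: "inj_on (tmap S X id x) (tangent_space S x)" using im xS by (auto simp: immersion_def)
  have lj: "tmap Z X fst z (j' u) = tmap S X id x u" if u: "u \<in> tangent_space S x" for u
    using tmap_comp[OF mS mZ mX jS smooth_lambda u xS] by (simp add: j'_def zC o_def id_def)
  have rj: "tmap Z Y snd z (j' u) = 0" if u: "u \<in> tangent_space S x" for u
    using tmap_comp[OF mS mZ mY jS smooth_rho u xS] by (simp add: j'_def zC o_def tmap_const)
  have jT: "j' u \<in> tangent_space Z z" if u: "u \<in> tangent_space S x" for u
    using tmap_tangent[OF mS mZ jS u xS] by (simp add: j'_def zC)
  obtain s where s: "s \<in> charts_at S x" using carrier_charts_at[OF xS] by blast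
  obtain k where k: "k \<in> charts_at Z z" using carrier_charts_at[OF z] by blast
  obtain d where d: "d \<in> charts_at Y (snd z)" using carrier_charts_at[OF carrier_Z_Y[OF z]] by blast
  define r where "r = (\<lambda>w. tmap Z Y snd z (coord_vec Z k z w) d)"
  define i where "i = (\<lambda>w. j' (coord_vec S s x w) k)"
  note r_coords = tmap_coords[OF mZ mY smooth_rho k d]
  have linr: "linear r" and surjr: "surj r" and kerr: "r w = 0 \<longleftrightarrow> coord_vec Z k z w \<in> ker_tmap Z Y snd z" for w
    using r_coords(1,2) r_coords(4)[OF rho_surj[OF z]] unfolding r_def by blast+
  have lini: "linear i"
    using linear_compose[OF linear_compose[OF linear_coord_vec[OF mfd_atlas[OF mS] s] linear_tmap[OF mS mZ jS xS]] linear_fun_apply, of k]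
    by (simp add: i_def j'_def o_def)
  have dimr: "dim {w. r w = 0} = 2" using dim_kernel_surj[OF linr surjr] by simp
  have inji: "inj i"
  proof (rule injI)
    fix u u' assume e: "i u = i u'"
    let ?u = "coord_vec S s x u" and ?u' = "coord_vec S s x u'"
    have T: "?u \<in> tangent_space S x" "?u' \<in> tangent_space S x" using coord_vec_tangent[OF mS s] by auto
    have "j' ?u = j' ?u'" by (rule tangent_eqI[OF k jT[OF T(1)] jT[OF T(2)]]) (use e in \<open>simp add: i_def\<close>)
    then have "tmap S X id x ?u = tmap S X id x ?u'" using lj[OF T(1)] lj[OF T(2)] by simp
    then have "?u = ?u'" using inj T by (meson inj_onD)
    then show "u = u'" using coord_vec_same[OF mfd_atlas[OF mS] s] by metis
  qed
  have sub: "range i \<subseteq> {w. r w = 0}"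
  proof
    fix w assume "w \<in> range i"
    then obtain u where u: "w = j' (coord_vec S s x u) k" by (auto simp: i_def)
    have T: "coord_vec S s x u \<in> tangent_space S x" by (rule coord_vec_tangent[OF mS s])
    then have "coord_vec Z k z w = j' (coord_vec S s x u)" using tangent_coord[OF k jT[OF T]] u by simp
    then have "r w = 0" using rj[OF T] by (simp add: r_def)
    then show "w \<in> {w. r w = 0}" by simp
  qed
  have "dim (range i) = 2"
    using dim_image_eq[OF lini, of UNIV] inji by simp
  moreover have "subspace (range i)" by (rule linear_subspace_image[OF lini subspace_UNIV])
  moreover have "subspace {w. r w = 0}" using linear_subspace_vimage[OF linr subspace_single_0] by (simp add: vimage_def)
  \<comment> \<open>The lift is an immersion into the fibre of \<rho>, so its tangent space fills
    the kernel, both being 2-dimensional.\<close>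
  ultimately have eqr: "range i = {w. r w = 0}" using sub dimr by (intro subspace_dim_equal) auto
  have ker: "ker_tmap Z Y snd z = j' ` tangent_space S x"
  proof (intro equalityI subsetI)
    fix v assume v: "v \<in> ker_tmap Z Y snd z"
    then have vT: "v \<in> tangent_space Z z" by (simp add: ker_tmap_def)
    then have "r (v k) = 0" using v tangent_coord[OF k vT] kerr[of "v k"] by simp
    then obtain u where u: "v k = j' (coord_vec S s x u) k" using eqr by (auto simp: i_def)
    have T: "coord_vec S s x u \<in> tangent_space S x" by (rule coord_vec_tangent[OF mS s])
    have "v = j' (coord_vec S s x u)" by (rule tangent_eqI[OF k vT jT[OF T] u])
    then show "v \<in> j' ` tangent_space S x" using T by blast
  next
    fix v assume "v \<in> j' ` tangent_space S x"
    then show "v \<in> ker_tmap Z Y snd z" using jT rj by (auto simp: ker_tmap_def)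
  qed
  have "snd C x \<in> oplanes (tangent_space S x)" using orS xS by (simp add: orientation_def)
  then obtain u1 u2 where u: "u1 \<in> tangent_space S x" "u2 \<in> tangent_space S x" "snd C x = oplane u1 u2" "u1 \<noteq> u2" "independent {u1, u2}"
    unfolding oplanes_def by blast
  have linS: "linear (tmap S X id x)" by (rule linear_tmap[OF mS mX iS xS])
  have "snd (tau X z) = oplane (tmap S X id x u1) (tmap S X id x u2)"
    using oplane_linear_image[OF linS, of u1 u2] u(3) by (simp add: zC tau_def tangent_oplane_def S_def)
  then have pl: "plane (snd (tau X z)) = tmap S X id x ` span {u1, u2}"
    using linear_span_image[OF linS, of "{u1, u2}"] by (simp add: plane_oplane)
  have "span {u1, u2} = tangent_space S x"
  proof
    show "span {u1, u2} \<subseteq> tangent_space S x"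
      using u subspace_tangent_space[OF mS xS] by (intro span_minimal) auto
    show "tangent_space S x \<subseteq> span {u1, u2}"
    proof
      fix v assume v: "v \<in> tangent_space S x"
      have ind: "x' = 0 \<and> y' = 0" if "x' *\<^sub>R u1 s + y' *\<^sub>R u2 s = 0" for x' y' :: real
      proof -
        have T: "x' *\<^sub>R u1 + y' *\<^sub>R u2 \<in> tangent_space S x" "0 \<in> tangent_space S x"
          using u subspace_tangent_space[OF mS xS] by (auto simp: subspace_add subspace_scale subspace_0)
        have "x' *\<^sub>R u1 + y' *\<^sub>R u2 = 0"
          by (rule tangent_eqI[OF s T]) (use that in \<open>simp add: scaleR_fun_def\<close>)
        then have "(\<Sum>w\<in>{u1, u2}. (if w = u1 then x' else y') *\<^sub>R w) = 0" using u(4) by simp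
        moreover have nd: "\<forall>w\<in>{u1, u2}. a w = 0" if "(\<Sum>w\<in>{u1, u2}. a w *\<^sub>R w) = 0" for a
        proof -
          have "finite {u1, u2}" by simp
          from dependent_finite[OF this] show ?thesis using u(5) that by blast
        qed
        ultimately show ?thesis using nd[of "\<lambda>w. if w = u1 then x' else y'"] u(4) by auto
      qed
      \<comment> \<open>Reading \<open>u1\<close> and \<open>u2\<close> in the chart
        \<open>s\<close> turns the spanning property into a 2 by 2 linear system, where injectivity
        gives surjectivity.\<close>
      define M where "M = (\<lambda>w :: real^2. w$1 *\<^sub>R u1 s + w$2 *\<^sub>R u2 s)"
      have "linear M" by (rule linearI) (simp_all add: M_def algebra_simps)
      moreover have "inj M"
        unfolding linear_injective_0[OF \<open>linear M\<close>]
      proof (intro allI impI)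
        fix w assume "M w = 0"
        then have "w$1 = 0 \<and> w$2 = 0" using ind[of "w$1" "w$2"] by (simp only: M_def)
        then show "w = 0" by (simp add: vec_eq_iff forall_2)
      qed
      ultimately have "surj M" using linear_injective_imp_surjective[of M] by simp
      then obtain w where "v s = M w" by (metis surjD)
      then have "v s = (w$1 *\<^sub>R u1 + w$2 *\<^sub>R u2) s" by (simp add: M_def scaleR_fun_def)
      moreover have "w$1 *\<^sub>R u1 + w$2 *\<^sub>R u2 \<in> tangent_space S x"
        using u subspace_tangent_space[OF mS xS] by (auto simp: subspace_add subspace_scale)
      ultimately have "v = w$1 *\<^sub>R u1 + w$2 *\<^sub>R u2" using tangent_eqI[OF s v] by blast
      then show "v \<in> span {u1, u2}" unfolding span_pair by blast
    qed
  qed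
  then have pl': "plane (snd (tau X z)) = tmap Z X fst z ` ker_tmap Z Y snd z"
    unfolding pl ker image_image using lj by (intro image_cong) auto
  moreover have "inj_on (tmap Z X fst z) (ker_tmap Z Y snd z)"
    unfolding ker
  proof (rule inj_onI)
    fix v v' assume "v \<in> j' ` tangent_space S x" "v' \<in> j' ` tangent_space S x" and e: "tmap Z X fst z v = tmap Z X fst z v'"
    then obtain u u' where u: "u \<in> tangent_space S x" "v = j' u" "u' \<in> tangent_space S x" "v' = j' u'" by blast
    then have "tmap S X id x u = tmap S X id x u'" using e lj by simp
    then have "u = u'" using inj u by (meson inj_onD)
    then show "v = v'" using u by simp
  qed
  ultimately show ?thesis by (simp add: bij_betw_def)
qed

text \<open>The matrix component of \<tau>' in a bundle chart. For \<open>v\<close> in ker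
  \<lambda>' it is the matrix of the homomorphism from the plane \<tau>(z) to its quotient that
  \<tau>'v represents.\<close>

definition alpha :: "('x, real^4) chart \<Rightarrow> (4 \<Rightarrow> real^4) \<Rightarrow> 'x \<times> 'x osurface \<Rightarrow> ('x \<times> 'x osurface, real^6) tvec \<Rightarrow> real^2^2" where
  "alpha c b z v = snd (tmap Z (Gr2T X) (tau X) z v (graph_bundle_chart X c b))"

text \<open>Coordinates in which the plane \<tau>(z) is a graph, so that the bundle chart used by
  \<open>alpha\<close> is a chart at \<tau>(z).\<close>

definition adapted :: "('x, real^4) chart \<Rightarrow> (4 \<Rightarrow> real^4) \<Rightarrow> 'x \<times> 'x osurface \<Rightarrow> bool" where
  "adapted c b z \<longleftrightarrow> z \<in> carrier_of Z \<and> c \<in> charts_at X (fst z) \<and> frame UNIV b \<and>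
     (\<exists>A. snd (tau X z) = graph_plane (coord_frame X c b (fst z)) A)"

lemma adapted_exists:
  assumes z: "z \<in> carrier_of Z"
  obtains c b where "adapted c b z"
proof -
  have "tau X z \<in> carrier_of (Gr2T X)" by (rule smooth_map_carrier[OF smooth_tau_G z])
  then have "(fst z, snd (tau X z)) \<in> carrier_of (Gr2T X)" using fst_tau by (metis prod.collapse)
  then show thesis using carrier_Gr2T_obtain[OF mX] that z unfolding adapted_def by metis
qed

lemma adapted_chart:
  assumes "adapted c b z"
  shows "graph_bundle_chart X c b \<in> charts_at (Gr2T X) (tau X z)"
  using assms graph_bundle_at[OF mX, of c "fst z" b] fst_tau unfolding adapted_def by (metis prod.collapse)

lemma tau_G_coords:
  assumes a: "adapted c b z" and v: "v \<in> tangent_space Z z"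
  shows "tmap Z (Gr2T X) (tau X) z v (graph_bundle_chart X c b) = (tmap Z X fst z v c, alpha c b z v)"
proof -
  have z: "z \<in> carrier_of Z" and c: "c \<in> charts_at X (fst (tau X z))" and b: "frame UNIV b"
    using a by (auto simp: adapted_def fst_tau)
  have "tmap Z X fst z v = tmap (Gr2T X) X fst (tau X z) (tmap Z (Gr2T X) (tau X) z v)"
    using tmap_comp[OF mZ mG mX smooth_tau_G smooth_map_fst_Gr2T[OF mX] v z] by (simp add: fst_comp_tau)
  then have "tmap Z X fst z v c = fst (tmap Z (Gr2T X) (tau X) z v (graph_bundle_chart X c b))"
    using tmap_fst_Gr2T[OF mX c b adapted_chart[OF a] tmap_tangent[OF mZ mG smooth_tau_G v z]] by simp
  then show ?thesis by (simp add: alpha_def)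
qed

lemma linear_alpha: "z \<in> carrier_of Z \<Longrightarrow> linear (alpha c b z)"
  using linear_compose[OF linear_compose[OF linear_tmap[OF mZ mG smooth_tau_G] linear_fun_apply] linear_snd]
  by (simp add: alpha_def[abs_def] o_def)

text \<open>\<tau>' is an isomorphism onto the tangent space of \<open>E\<close>, and
  \<open>E\<close> is immersed in the Grassmann bundle.\<close>

lemma tmap_tau_G_inj:
  assumes z: "z \<in> carrier_of Z"
  shows "inj_on (tmap Z (Gr2T X) (tau X) z) (tangent_space Z z)"
proof (rule inj_onI)
  fix v w assume v: "v \<in> tangent_space Z z" "w \<in> tangent_space Z z" "tmap Z (Gr2T X) (tau X) z v = tmap Z (Gr2T X) (tau X) z w"
  have "inj_on (tmap (total_space X E) (Gr2T X) id (tau X z)) (tangent_space (total_space X E) (tau X z))"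
    using immersion_E tau_E[OF z] carrier_E by (simp add: immersion_def)
  moreover have "tmap Z (total_space X E) (tau X) z v \<in> tangent_space (total_space X E) (tau X z)"
    "tmap Z (total_space X E) (tau X) z w \<in> tangent_space (total_space X E) (tau X z)"
    using tmap_tangent[OF mZ mE smooth_tau _ z] v by auto
  ultimately have "tmap Z (total_space X E) (tau X) z v = tmap Z (total_space X E) (tau X) z w"
    using v by (simp add: tmap_tau_G[OF z] inj_on_def)
  then show "v = w" using tmap_tau_bij[OF z] v by (simp add: bij_betw_def inj_on_def)
qed

text \<open>On ker \<lambda>' the base component of \<tau>' vanishes, so the matrix component
  carries all of the injective map \<tau>'.\<close>

lemma alpha_inj:
  assumes a: "adapted c b z"
  shows "inj_on (alpha c b z) (ker_tmap Z X fst z)"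
proof (rule inj_onI)
  fix v w assume v: "v \<in> ker_tmap Z X fst z" "w \<in> ker_tmap Z X fst z" "alpha c b z v = alpha c b z w"
  have z: "z \<in> carrier_of Z" using a by (simp add: adapted_def)
  have T: "v \<in> tangent_space Z z" "w \<in> tangent_space Z z" using v by (auto simp: ker_tmap_def)
  have "tmap Z (Gr2T X) (tau X) z v = tmap Z (Gr2T X) (tau X) z w"
    by (rule tangent_eqI[OF adapted_chart[OF a] tmap_tangent[OF mZ mG smooth_tau_G T(1) z] tmap_tangent[OF mZ mG smooth_tau_G T(2) z]])
      (use v in \<open>simp add: tau_G_coords[OF a T(1)] tau_G_coords[OF a T(2)] ker_tmap_def\<close>)
  then show "v = w" using tmap_tau_G_inj[OF z] T by (meson inj_onD)
qed

lemma subspace_kernel: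
  assumes z: "z \<in> carrier_of Z"
  shows "subspace (ker_tmap Z X fst z)"
proof -
  have l: "linear (tmap Z X fst z)" by (rule linear_tmap[OF mZ mX smooth_lambda z])
  have T: "subspace (tangent_space Z z)" by (rule subspace_tangent_space[OF mZ z])
  show ?thesis
    using subspace_inter[OF T linear_subspace_vimage[OF l subspace_single_0]]
    by (simp add: ker_tmap_def Int_def vimage_def)
qed

text \<open>The plane of matrices obtained here is the coordinate form of T_P E_x; its dimension is
  6 - 4, since \<lambda>' is onto and \<open>alpha\<close> is injective on the kernel.\<close>

lemma alpha_kernel_dim:
  assumes a: "adapted c b z"
  shows "subspace (alpha c b z ` ker_tmap Z X fst z)" "dim (alpha c b z ` ker_tmap Z X fst z) = 2"
proof -
  have z: "z \<in> carrier_of Z" and c: "c \<in> charts_at X (fst z)" using a by (auto simp: adapted_def)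
  obtain k where k: "k \<in> charts_at Z z" using carrier_charts_at[OF z] by blast
  note co = tmap_coords[OF mZ mX smooth_lambda k c]
  define l where "l = (\<lambda>w. tmap Z X fst z (coord_vec Z k z w) c)"
  note lin = linear_compose[OF linear_coord_vec[OF mfd_atlas[OF mZ] k] linear_alpha[OF z, of c b], unfolded o_def]
  have K: "ker_tmap Z X fst z = coord_vec Z k z ` {w. l w = 0}" using co(3) by (simp add: l_def)
  have sub: "subspace {w. l w = 0}" using linear_subspace_vimage[OF co(1) subspace_single_0] by (simp add: vimage_def l_def)
  have im: "alpha c b z ` ker_tmap Z X fst z = (\<lambda>w. alpha c b z (coord_vec Z k z w)) ` {w. l w = 0}"
    by (simp add: K image_image)
  show "subspace (alpha c b z ` ker_tmap Z X fst z)"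
    unfolding im by (rule linear_subspace_image[OF lin sub])
  have "inj_on (\<lambda>w. alpha c b z (coord_vec Z k z w)) (span {w. l w = 0})"
    unfolding span_eq_iff[THEN iffD2, OF sub]
  proof (rule inj_onI)
    fix w w' assume "w \<in> {w. l w = 0}" "w' \<in> {w. l w = 0}" "alpha c b z (coord_vec Z k z w) = alpha c b z (coord_vec Z k z w')"
    then have "coord_vec Z k z w = coord_vec Z k z w'" by (intro inj_onD[OF alpha_inj[OF a]]) (auto simp: K)
    then show "w = w'" using coord_vec_same[OF mfd_atlas[OF mZ] k] by metis
  qed
  then have "dim (alpha c b z ` ker_tmap Z X fst z) = dim {w. l w = 0}"
    unfolding im by (rule dim_image_eq[OF lin])
  also have "\<dots> = 2" using dim_kernel_surj[OF co(1) co(4)[OF lambda_surj[OF z]]] by (simp add: l_def)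
  finally show "dim (alpha c b z ` ker_tmap Z X fst z) = 2" .
qed

lemma fibre_facts:
  assumes "x \<in> carrier_of X"
  shows "submanifold DIM(real^2) (Gr2 (tangent_space X x)) (fibre_set E x)"
    "elliptic_line_congruence (tangent_space X x) (fibre X E x)"
  using pseudo assms by (auto simp: pseudocomplex_def)

text \<open>T_P E_x and ker \<lambda>' both map injectively to vertical tangent vectors of the
  Grassmann bundle, where their matrices can be compared. Surjectivity of \<tau>' gives one
  inclusion of images, and equality follows since both have dimension 2.\<close>

lemma fibre_kernel:
  assumes a: "adapted c b z"
  defines "x \<equiv> fst z" and "P \<equiv> snd (tau X z)" and "V \<equiv> tangent_space X (fst z)" and "F \<equiv> fibre X E (fst z)"
    and "n \<equiv> \<lambda>\<zeta>. tmap (fibre X E (fst z)) (Gr2 (tangent_space X (fst z))) id (snd (tau X z)) \<zeta> (graph_chart (coord_frame X c b (fst z)))"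
  shows "\<And>\<zeta> v. \<zeta> \<in> tangent_space F P \<Longrightarrow> v \<in> ker_tmap Z X fst z \<Longrightarrow>
      tmap F (total_space X E) (Pair x) P \<zeta> = tmap Z (total_space X E) (tau X) z v \<longleftrightarrow> n \<zeta> = alpha c b z v"
    and "n ` tangent_space F P = alpha c b z ` ker_tmap Z X fst z"
    and "mfd F" "smooth_map F (Gr2 V) id" "P \<in> carrier_of F"
proof -
  define g where "g = coord_frame X c b x"
  define G where "G = graph_bundle_chart X c b"
  have z: "z \<in> carrier_of Z" and c: "c \<in> charts_at X x" and b: "frame UNIV b" using a by (auto simp: adapted_def x_def)
  obtain A where P: "P = graph_plane g A" using a by (auto simp: adapted_def x_def P_def g_def)
  have x: "x \<in> carrier_of X" unfolding x_def by (rule carrier_Z_X[OF z])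
  have tz: "tau X z = (x, P)" by (simp add: x_def P_def fst_tau[symmetric])
  note sub2 = fibre_facts(1)[OF x]
  have Fe: "F = sub_structure (Gr2 V) (fibre_set E x)" by (simp add: F_def V_def x_def fibre_def)
  show mF: "mfd F" unfolding Fe by (rule mfd_sub_structure[OF mfd_atlas[OF mfd_Gr2]])
  have cF: "carrier_of F = fibre_set E x" unfolding Fe by (rule carrier_sub_structure[OF mfd_atlas[OF mfd_Gr2] sub2[folded x_def V_def, unfolded x_def, folded V_def, folded x_def]])
  have im: "immersion F (Gr2 V) id" unfolding Fe V_def x_def by (rule immersion_sub_incl[OF mfd_Gr2 fibre_facts(1)[OF x[unfolded x_def]]])
  then show iF: "smooth_map F (Gr2 V) id" by (simp add: immersion_def)
  have "(x, P) \<in> E" using tau_E[OF z] tz by simp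
  then show PF: "P \<in> carrier_of F" using cF by (simp add: fibre_set_def)
  have frg: "frame V g" unfolding V_def g_def x_def by (rule frame_coord_frame[OF mX c[unfolded x_def] b])
  have n: "n = (\<lambda>\<zeta>. tmap F (Gr2 V) id P \<zeta> (graph_chart g))" by (simp add: n_def F_def V_def P_def g_def x_def)
  have jV: "smooth_map (Gr2 V) (Gr2T X) (Pair x)" unfolding V_def x_def by (rule smooth_map_Pair_Gr2T[OF mX x[unfolded x_def]])
  have jG: "smooth_map F (Gr2T X) (Pair x)" using smooth_map_comp[OF mF mfd_Gr2 mG iF jV] by simp
  have jE: "smooth_map F (total_space X E) (Pair x)"
    unfolding total_space_def by (rule smooth_map_into_sub[OF mF mG sub6 jG]) (auto simp: cF fibre_set_def)
  have a1: "tmap F (Gr2T X) (Pair x) P \<zeta> G = (0, n \<zeta>)" if \<zeta>: "\<zeta> \<in> tangent_space F P" for \<zeta>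
  proof -
    have "tmap F (Gr2T X) (Pair x) P \<zeta> = tmap (Gr2 V) (Gr2T X) (Pair x) P (tmap F (Gr2 V) id P \<zeta>)"
      using tmap_comp[OF mF mfd_Gr2 mG iF jV \<zeta> PF] by simp
    moreover have "tmap F (Gr2 V) id P \<zeta> \<in> tangent_space (Gr2 V) P" using tmap_tangent[OF mF mfd_Gr2 iF \<zeta> PF] by simp
    ultimately show ?thesis
      using tmap_Pair_Gr2T[OF mX c b P[unfolded g_def], of "tmap F (Gr2 V) id P \<zeta>"] by (simp add: n G_def g_def V_def x_def)
  qed
  have a2: "tmap F (Gr2T X) (Pair x) P \<zeta> = tmap (total_space X E) (Gr2T X) id (tau X z) (tmap F (total_space X E) (Pair x) P \<zeta>)"
    if \<zeta>: "\<zeta> \<in> tangent_space F P" for \<zeta>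
    using tmap_comp[OF mF mE mG jE smooth_E \<zeta> PF] by (simp add: tz)
  have jT: "tmap F (total_space X E) (Pair x) P \<zeta> \<in> tangent_space (total_space X E) (tau X z)" if \<zeta>: "\<zeta> \<in> tangent_space F P" for \<zeta>
    using tmap_tangent[OF mF mE jE \<zeta> PF] by (simp add: tz)
  have jGT: "tmap F (Gr2T X) (Pair x) P \<zeta> \<in> tangent_space (Gr2T X) (tau X z)" if \<zeta>: "\<zeta> \<in> tangent_space F P" for \<zeta>
    using tmap_tangent[OF mF mG jG \<zeta> PF] by (simp add: tz)
  have injE: "inj_on (tmap (total_space X E) (Gr2T X) id (tau X z)) (tangent_space (total_space X E) (tau X z))"
    using immersion_E tau_E[OF z] carrier_E by (simp add: immersion_def)
  have eqv: "tmap F (total_space X E) (Pair x) P \<zeta> = tmap Z (total_space X E) (tau X) z v \<longleftrightarrow> (0, n \<zeta>) = (tmap Z X fst z v c, alpha c b z v)"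
    if \<zeta>: "\<zeta> \<in> tangent_space F P" and v: "v \<in> tangent_space Z z" for \<zeta> v
  proof -
    have "tmap F (total_space X E) (Pair x) P \<zeta> = tmap Z (total_space X E) (tau X) z v \<longleftrightarrow>
        tmap F (Gr2T X) (Pair x) P \<zeta> = tmap Z (Gr2T X) (tau X) z v"
      unfolding a2[OF \<zeta>] tmap_tau_G[OF z v]
      by (rule inj_on_eq_iff[OF injE jT[OF \<zeta>] tmap_tangent[OF mZ mE smooth_tau v z], symmetric])
    also have "\<dots> \<longleftrightarrow> tmap F (Gr2T X) (Pair x) P \<zeta> G = tmap Z (Gr2T X) (tau X) z v G"
      unfolding G_def using tangent_eqI[OF adapted_chart[OF a] jGT[OF \<zeta>] tmap_tangent[OF mZ mG smooth_tau_G v z]] by auto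
    finally show ?thesis unfolding a1[OF \<zeta>] tau_G_coords[OF a v, folded G_def] .
  qed
  then show eqv': "tmap F (total_space X E) (Pair x) P \<zeta> = tmap Z (total_space X E) (tau X) z v \<longleftrightarrow> n \<zeta> = alpha c b z v"
    if "\<zeta> \<in> tangent_space F P" "v \<in> ker_tmap Z X fst z" for \<zeta> v
    using that by (simp add: ker_tmap_def)
  have sub: "n ` tangent_space F P \<subseteq> alpha c b z ` ker_tmap Z X fst z"
  proof
    fix N assume "N \<in> n ` tangent_space F P"
    then obtain \<zeta> where \<zeta>: "\<zeta> \<in> tangent_space F P" "N = n \<zeta>" by blast
    obtain v where v: "v \<in> tangent_space Z z" "tmap F (total_space X E) (Pair x) P \<zeta> = tmap Z (total_space X E) (tau X) z v"
      using tmap_tau_bij[OF z] jT[OF \<zeta>(1)] unfolding bij_betw_def by blast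
    then have e: "0 = tmap Z X fst z v c" "n \<zeta> = alpha c b z v" using eqv[OF \<zeta>(1) v(1)] by auto
    have "tmap Z X fst z v = 0"
      using tangent_eqI[OF c[unfolded x_def] tmap_tangent[OF mZ mX smooth_lambda v(1) z] subspace_0[OF subspace_tangent_space[OF mX x[unfolded x_def]]]] e(1) by simp
    then have "v \<in> ker_tmap Z X fst z" using v by (simp add: ker_tmap_def)
    then show "N \<in> alpha c b z ` ker_tmap Z X fst z" using e(2) \<zeta>(2) by blast
  qed
  obtain s where s: "s \<in> charts_at F P" using carrier_charts_at[OF PF] by blast
  define n' where "n' = (\<lambda>u. n (coord_vec F s P u))"
  have r: "n ` tangent_space F P = range n'"
  proof -
    show ?thesis unfolding tangent_space_range[OF mF s] by (simp add: n'_def image_image)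
  qed
  have lin: "linear n'"
    using linear_compose[OF linear_compose[OF linear_coord_vec[OF mfd_atlas[OF mF] s] linear_tmap[OF mF mfd_Gr2 iF PF]] linear_fun_apply, of "graph_chart g"]
    by (simp add: n'_def n o_def)
  have inj: "inj n'"
  proof (rule injI)
    fix u u' assume e: "n' u = n' u'"
    have T: "coord_vec F s P u \<in> tangent_space F P" "coord_vec F s P u' \<in> tangent_space F P" using coord_vec_tangent[OF mF s] by auto
    have T': "tmap F (Gr2 V) id P (coord_vec F s P w) \<in> tangent_space (Gr2 V) P" for w
      using tmap_tangent[OF mF mfd_Gr2 iF coord_vec_tangent[OF mF s] PF] by simp
    have "tmap F (Gr2 V) id P (coord_vec F s P u) = tmap F (Gr2 V) id P (coord_vec F s P u')"
      by (rule tangent_eqI[OF graph_chart_at[OF frg P[symmetric]] T' T']) (use e in \<open>simp add: n'_def n\<close>)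
    then have "coord_vec F s P u = coord_vec F s P u'" using im PF T by (meson immersion_def inj_onD)
    then show "u = u'" using coord_vec_same[OF mfd_atlas[OF mF] s] by metis
  qed
  have d2: "dim (range n') = 2" using dim_image_eq[OF lin, of UNIV] inj by simp
  have "range n' = alpha c b z ` ker_tmap Z X fst z"
    by (rule subspace_dim_equal[OF linear_subspace_image[OF lin subspace_UNIV] alpha_kernel_dim(1)[OF a]])
      (use sub r d2 alpha_kernel_dim(2)[OF a] in simp_all)
  then show "n ` tangent_space F P = alpha c b z ` ker_tmap Z X fst z" using r by simp
qed

text \<open>Ellipticity of \<open>E\<close> excludes rank one in T_P E_x, and
  \<open>fibre_kernel\<close> identifies its elements with these matrices.\<close>

lemma alpha_kernel_definite:
  assumes a: "adapted c b z" and N: "N \<in> alpha c b z ` ker_tmap Z X fst z" "N \<noteq> 0"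
  shows "det N \<noteq> 0"
proof -
  have z: "z \<in> carrier_of Z" and c: "c \<in> charts_at X (fst z)" and b: "frame UNIV b" using a by (auto simp: adapted_def)
  define P where "P = snd (tau X z)"
  define V where "V = tangent_space X (fst z)"
  define F where "F = fibre X E (fst z)"
  define g where "g = coord_frame X c b (fst z)"
  note fk = fibre_kernel[OF a, folded P_def V_def F_def g_def]
  obtain A where P: "P = graph_plane g A" using a by (auto simp: adapted_def P_def g_def)
  have frg: "frame V g" unfolding V_def g_def by (rule frame_coord_frame[OF mX c b])
  obtain \<zeta> where \<zeta>: "\<zeta> \<in> tangent_space F P" "N = tmap F (Gr2 V) id P \<zeta> (graph_chart g)"
    using N fk(2) by blast
  have "elliptic_line_congruence V F" unfolding V_def F_def by (rule fibre_facts(2)[OF carrier_Z_X[OF z]])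
  then have "quot_rank P (surface_hom V F P \<zeta>) \<noteq> 1" using fk(5) \<zeta>(1) by (auto simp: elliptic_line_congruence_def)
  moreover have "surface_hom V F P \<zeta> = frame_hom (shift_frame g A) N"
    unfolding \<zeta>(2) by (rule surface_hom_frame_hom[OF fk(3,4,5) P frg \<zeta>(1)])
  moreover have "graph_plane (shift_frame g A) 0 = P" by (simp add: graph_plane_shift P)
  ultimately show ?thesis using quot_rank_frame_hom[OF frame_shift[OF frg], of A N] N(2) by metis
qed

text \<open>Eliminates the existential complex structures from the orientation; what remains, the
  sign of \<open>posdet\<close>, is an open condition that can be followed along smooth
  families.\<close>

lemma positive_kernel_basis_iff:
  assumes a: "adapted c b z"
  shows "positive_kernel_basis X E Z z v w \<longleftrightarrow>
     v \<in> ker_tmap Z X fst z \<and> w \<in> ker_tmap Z X fst z \<and> posdet (alpha c b z v) (alpha c b z w) > 0"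
proof -
  have z: "z \<in> carrier_of Z" and c: "c \<in> charts_at X (fst z)" and b: "frame UNIV b" using a by (auto simp: adapted_def)
  define P where "P = snd (tau X z)"
  define V where "V = tangent_space X (fst z)"
  define F where "F = fibre X E (fst z)"
  define g where "g = coord_frame X c b (fst z)"
  define n where "n = (\<lambda>\<zeta>. tmap F (Gr2 V) id P \<zeta> (graph_chart g))"
  define K where "K = ker_tmap Z X fst z"
  note fk = fibre_kernel[OF a, folded P_def V_def F_def g_def K_def, folded n_def]
  have fk1: "tmap F (total_space X E) (Pair (fst z)) P \<zeta> = tmap Z (total_space X E) (tau X) z v \<longleftrightarrow> n \<zeta> = alpha c b z v"
    if "\<zeta> \<in> tangent_space F P" "v \<in> K" for \<zeta> v unfolding n_def by (rule fk(1)[OF that])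
  obtain A where P: "P = graph_plane g A" using a by (auto simp: adapted_def P_def g_def)
  define h where "h = shift_frame g A"
  have frg: "frame V g" unfolding V_def g_def by (rule frame_coord_frame[OF mX c b])
  have frh: "frame V h" unfolding h_def by (rule frame_shift[OF frg])
  have hP: "graph_plane h 0 = P" by (simp add: graph_plane_shift P h_def)
  have sh: "surface_hom V F P \<zeta> = frame_hom h (n \<zeta>)" if "\<zeta> \<in> tangent_space F P" for \<zeta>
    unfolding n_def h_def by (rule surface_hom_frame_hom[OF fk(3,4,5) P frg that])
  have T: "surface_hom V F P ` tangent_space F P = frame_hom h ` (alpha c b z ` K)"
    unfolding fk(2)[symmetric] image_image using sh by (intro image_cong) auto
  have "positive_kernel_basis X E Z z v w \<longleftrightarrow> v \<in> K \<and> w \<in> K \<and>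
      (\<exists>\<zeta>\<in>tangent_space F P. \<exists>\<eta>\<in>tangent_space F P.
         tmap F (total_space X E) (Pair (fst z)) P \<zeta> = tmap Z (total_space X E) (tau X) z v \<and>
         tmap F (total_space X E) (Pair (fst z)) P \<eta> = tmap Z (total_space X E) (tau X) z w \<and>
         positive_basis V P (frame_hom h ` (alpha c b z ` K)) (surface_hom V F P \<zeta>) (surface_hom V F P \<eta>))"
    unfolding positive_kernel_basis_def Let_def fst_tau P_def[symmetric] V_def[symmetric] F_def[symmetric] K_def[symmetric] T ..
  also have "\<dots> \<longleftrightarrow> v \<in> K \<and> w \<in> K \<and> positive_basis V P (frame_hom h ` (alpha c b z ` K)) (frame_hom h (alpha c b z v)) (frame_hom h (alpha c b z w))"
  proof (intro conj_cong refl iffI)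
    assume v: "v \<in> K" and w: "w \<in> K"
    assume "\<exists>\<zeta>\<in>tangent_space F P. \<exists>\<eta>\<in>tangent_space F P.
         tmap F (total_space X E) (Pair (fst z)) P \<zeta> = tmap Z (total_space X E) (tau X) z v \<and>
         tmap F (total_space X E) (Pair (fst z)) P \<eta> = tmap Z (total_space X E) (tau X) z w \<and>
         positive_basis V P (frame_hom h ` (alpha c b z ` K)) (surface_hom V F P \<zeta>) (surface_hom V F P \<eta>)"
    then obtain \<zeta> \<eta> where 1: "\<zeta> \<in> tangent_space F P" "\<eta> \<in> tangent_space F P"
         "tmap F (total_space X E) (Pair (fst z)) P \<zeta> = tmap Z (total_space X E) (tau X) z v"
         "tmap F (total_space X E) (Pair (fst z)) P \<eta> = tmap Z (total_space X E) (tau X) z w"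
         "positive_basis V P (frame_hom h ` (alpha c b z ` K)) (surface_hom V F P \<zeta>) (surface_hom V F P \<eta>)" by blast
    then have "n \<zeta> = alpha c b z v" "n \<eta> = alpha c b z w" using fk1[OF 1(1) v] fk1[OF 1(2) w] by auto
    then show "positive_basis V P (frame_hom h ` (alpha c b z ` K)) (frame_hom h (alpha c b z v)) (frame_hom h (alpha c b z w))"
      using 1(5) sh[OF 1(1)] sh[OF 1(2)] by simp
  next
    assume v: "v \<in> K" and w: "w \<in> K"
      and pb: "positive_basis V P (frame_hom h ` (alpha c b z ` K)) (frame_hom h (alpha c b z v)) (frame_hom h (alpha c b z w))"
    have im: "alpha c b z v \<in> n ` tangent_space F P" "alpha c b z w \<in> n ` tangent_space F P" unfolding fk(2) using v w by auto
    obtain \<zeta> where \<zeta>: "\<zeta> \<in> tangent_space F P" "alpha c b z v = n \<zeta>" using im(1) by (rule imageE)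
    obtain \<eta> where \<eta>: "\<eta> \<in> tangent_space F P" "alpha c b z w = n \<eta>" using im(2) by (rule imageE)
    note 1 = \<zeta>(1) \<eta>(1) \<zeta>(2)[symmetric] \<eta>(2)[symmetric]
    show "\<exists>\<zeta>\<in>tangent_space F P. \<exists>\<eta>\<in>tangent_space F P.
         tmap F (total_space X E) (Pair (fst z)) P \<zeta> = tmap Z (total_space X E) (tau X) z v \<and>
         tmap F (total_space X E) (Pair (fst z)) P \<eta> = tmap Z (total_space X E) (tau X) z w \<and>
         positive_basis V P (frame_hom h ` (alpha c b z ` K)) (surface_hom V F P \<zeta>) (surface_hom V F P \<eta>)"
      using fk1[OF 1(1) v] fk1[OF 1(2) w] pb sh[OF 1(1)] sh[OF 1(2)] 1
      by (intro bexI[of _ \<zeta>] bexI[of _ \<eta>] conjI) simp_all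
  qed
  also have "\<dots> \<longleftrightarrow> v \<in> K \<and> w \<in> K \<and> posdet (alpha c b z v) (alpha c b z w) > 0"
  proof (intro conj_cong refl iffI)
    assume v: "v \<in> K" and w: "w \<in> K"
    have d: "\<And>N. N \<in> alpha c b z ` K \<Longrightarrow> N \<noteq> 0 \<Longrightarrow> det N \<noteq> 0"
      using alpha_kernel_definite[OF a] by (simp add: K_def)
    note ad = alpha_kernel_dim[OF a, folded K_def]
    show "posdet (alpha c b z v) (alpha c b z w) > 0"
      if "positive_basis V P (frame_hom h ` (alpha c b z ` K)) (frame_hom h (alpha c b z v)) (frame_hom h (alpha c b z w))"
      by (rule positive_basis_posdet[OF frh d imageI[OF v] imageI[OF w]]) (use that in \<open>simp_all add: hP\<close>)
    show "positive_basis V P (frame_hom h ` (alpha c b z ` K)) (frame_hom h (alpha c b z v)) (frame_hom h (alpha c b z w))"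
      if "posdet (alpha c b z v) (alpha c b z w) > 0"
      using posdet_positive_basis[OF frh d ad imageI[OF v] imageI[OF w] that] by (simp add: hP)
  qed
  finally show ?thesis by (simp add: K_def)
qed

section \<open>The dual planes and the plane field they define\<close>

lemma kernel_span:
  assumes a: "adapted c b z" and w: "w1 \<in> ker_tmap Z X fst z" "w2 \<in> ker_tmap Z X fst z"
    and pos: "posdet (alpha c b z w1) (alpha c b z w2) > 0" and v: "v \<in> ker_tmap Z X fst z"
  shows "\<exists>x y. v = x *\<^sub>R w1 + y *\<^sub>R w2"
proof -
  have z: "z \<in> carrier_of Z" using a by (simp add: adapted_def)
  note l = linear_alpha[OF z, of c b]
  let ?N1 = "alpha c b z w1" and ?N2 = "alpha c b z w2"
  have pi: "x = 0 \<and> y = 0" if "x *\<^sub>R ?N1 + y *\<^sub>R ?N2 = 0" for x y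
    by (rule posdet_independent[OF _ that]) (use pos in simp)
  have ne: "?N1 \<noteq> ?N2" using pi[of 1 "-1"] by auto
  have "?N2 \<notin> span {?N1}"
  proof
    assume "?N2 \<in> span {?N1}"
    then obtain k where "?N2 = k *\<^sub>R ?N1" by (auto simp: span_singleton)
    then show False using pi[of k "-1"] by simp
  qed
  moreover have "?N1 \<noteq> 0" using pi[of 1 0] by auto
  ultimately have ind: "independent {?N2, ?N1}" using independent_insertI[of ?N2 "{?N1}"] by simp
  have "alpha c b z ` ker_tmap Z X fst z \<subseteq> span {?N2, ?N1}"
    by (rule card_ge_dim_independent[OF _ ind]) (use w ne alpha_kernel_dim(2)[OF a] in auto)
  then have "alpha c b z v \<in> {s *\<^sub>R ?N2 + t *\<^sub>R ?N1 | s t. True}" using v unfolding span_pair by blast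
  then obtain s t where "alpha c b z v = s *\<^sub>R ?N2 + t *\<^sub>R ?N1" by blast
  then have "alpha c b z v = alpha c b z (t *\<^sub>R w1 + s *\<^sub>R w2)" by (simp add: linear_add[OF l] linear_scale[OF l])
  moreover have "t *\<^sub>R w1 + s *\<^sub>R w2 \<in> ker_tmap Z X fst z"
    using w subspace_kernel[OF z] by (simp add: subspace_add subspace_scale)
  ultimately have "v = t *\<^sub>R w1 + s *\<^sub>R w2" using alpha_inj[OF a] v by (meson inj_onD)
  then show ?thesis by blast
qed

text \<open>By \<open>posdet_combination\<close> the positive bases of ker \<lambda>' are the base
  changes of positive determinant of a single one, so their images under \<rho>' make up exactly one
  \<open>oplane\<close>.\<close>

lemma dual_map_oplane:
  assumes a: "adapted c b z" and w: "w1 \<in> ker_tmap Z X fst z" "w2 \<in> ker_tmap Z X fst z"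
    and pos: "posdet (alpha c b z w1) (alpha c b z w2) > 0"
  shows "dual_map X E Y Z z = (snd z, oplane (tmap Z Y snd z w1) (tmap Z Y snd z w2))"
proof -
  have z: "z \<in> carrier_of Z" using a by (simp add: adapted_def)
  note l = linear_alpha[OF z, of c b] and lr = linear_tmap[OF mZ mY smooth_rho z]
  have K: "p *\<^sub>R w1 + q *\<^sub>R w2 \<in> ker_tmap Z X fst z" for p q
    using w subspace_kernel[OF z] by (simp add: subspace_add subspace_scale)
  have d: "det (x *\<^sub>R alpha c b z w1 + y *\<^sub>R alpha c b z w2) \<noteq> 0" if "x \<noteq> 0 \<or> y \<noteq> 0" for x y
  proof (rule alpha_kernel_definite[OF a])
    show "x *\<^sub>R alpha c b z w1 + y *\<^sub>R alpha c b z w2 \<in> alpha c b z ` ker_tmap Z X fst z"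
      using K[of x y] by (auto simp: linear_add[OF l] linear_scale[OF l] intro!: image_eqI[of _ _ "x *\<^sub>R w1 + y *\<^sub>R w2"])
    show "x *\<^sub>R alpha c b z w1 + y *\<^sub>R alpha c b z w2 \<noteq> 0"
      using posdet_independent[of "alpha c b z w1" "alpha c b z w2" x y] pos that by auto
  qed
  have pd: "posdet (alpha c b z (p *\<^sub>R w1 + q *\<^sub>R w2)) (alpha c b z (r *\<^sub>R w1 + s *\<^sub>R w2)) > 0 \<longleftrightarrow> p * s - q * r > 0" for p q r s
    using posdet_combination[OF d pos] by (simp add: linear_add[OF l] linear_scale[OF l])
  have "{(tmap Z Y snd z v, tmap Z Y snd z w) | v w. positive_kernel_basis X E Z z v w} = oplane (tmap Z Y snd z w1) (tmap Z Y snd z w2)"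
  proof (intro equalityI subsetI)
    fix e assume "e \<in> {(tmap Z Y snd z v, tmap Z Y snd z w) | v w. positive_kernel_basis X E Z z v w}"
    then obtain v w where e: "e = (tmap Z Y snd z v, tmap Z Y snd z w)" "v \<in> ker_tmap Z X fst z" "w \<in> ker_tmap Z X fst z"
      "posdet (alpha c b z v) (alpha c b z w) > 0" unfolding positive_kernel_basis_iff[OF a] by blast
    obtain p q where v: "v = p *\<^sub>R w1 + q *\<^sub>R w2" using kernel_span[OF a w pos e(2)] by blast
    obtain r s where w': "w = r *\<^sub>R w1 + s *\<^sub>R w2" using kernel_span[OF a w pos e(3)] by blast
    have "p * s - q * r > 0" using e(4) pd unfolding v w' by blast
    then show "e \<in> oplane (tmap Z Y snd z w1) (tmap Z Y snd z w2)"
      unfolding e(1) v w' by (simp add: linear_add[OF lr] linear_scale[OF lr] oplane_memI)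
  next
    fix e assume "e \<in> oplane (tmap Z Y snd z w1) (tmap Z Y snd z w2)"
    then obtain p q r s where e: "e = (p *\<^sub>R tmap Z Y snd z w1 + q *\<^sub>R tmap Z Y snd z w2, r *\<^sub>R tmap Z Y snd z w1 + s *\<^sub>R tmap Z Y snd z w2)"
      "p * s - q * r > 0" unfolding oplane_def by blast
    have "positive_kernel_basis X E Z z (p *\<^sub>R w1 + q *\<^sub>R w2) (r *\<^sub>R w1 + s *\<^sub>R w2)"
      unfolding positive_kernel_basis_iff[OF a] using K pd e(2) by blast
    moreover have "e = (tmap Z Y snd z (p *\<^sub>R w1 + q *\<^sub>R w2), tmap Z Y snd z (r *\<^sub>R w1 + s *\<^sub>R w2))"
      by (simp add: e(1) linear_add[OF lr] linear_scale[OF lr])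
    ultimately show "e \<in> {(tmap Z Y snd z v, tmap Z Y snd z w) | v w. positive_kernel_basis X E Z z v w}" by blast
  qed
  then show ?thesis by (simp add: dual_map_def)
qed

lemma positive_kernel_basis_exists:
  assumes a: "adapted c b z"
  obtains w1 w2 where "w1 \<in> ker_tmap Z X fst z" "w2 \<in> ker_tmap Z X fst z" "posdet (alpha c b z w1) (alpha c b z w2) > 0"
proof -
  have lid: "linear (\<lambda>x::real^2^2. x)" by (rule linear_ident)
  obtain N1 N2 where N: "N1 \<in> alpha c b z ` ker_tmap Z X fst z" "N2 \<in> alpha c b z ` ker_tmap Z X fst z" "posdet N1 N2 > 0"
    by (rule definite_kernel_basis[OF alpha_kernel_dim[OF a] lid alpha_kernel_definite[OF a]])
  then show thesis using that by blast
qed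

text \<open>\<Theta> is the sum of ker \<lambda>' and ker \<rho>', and \<rho>' forgets the second
  summand.\<close>

lemma dual_plane:
  assumes z: "z \<in> carrier_of Z"
  shows "plane (snd (dual_map X E Y Z z)) = tmap Z Y snd z ` plane_field Z X (tau X) z"
proof -
  obtain c b where a: "adapted c b z" using adapted_exists[OF z] by blast
  obtain w1 w2 where w: "w1 \<in> ker_tmap Z X fst z" "w2 \<in> ker_tmap Z X fst z" "posdet (alpha c b z w1) (alpha c b z w2) > 0"
    using positive_kernel_basis_exists[OF a] by blast
  note lr = linear_tmap[OF mZ mY smooth_rho z] and ll = linear_tmap[OF mZ mX smooth_lambda z]
  have "plane (snd (dual_map X E Y Z z)) = {s *\<^sub>R tmap Z Y snd z w1 + t *\<^sub>R tmap Z Y snd z w2 | s t. True}"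
    by (simp only: dual_map_oplane[OF a w] snd_conv plane_oplane span_pair)
  also have "\<dots> = tmap Z Y snd z ` ker_tmap Z X fst z"
  proof (intro equalityI subsetI)
    fix u assume "u \<in> {s *\<^sub>R tmap Z Y snd z w1 + t *\<^sub>R tmap Z Y snd z w2 | s t. True}"
    then obtain s t where "u = tmap Z Y snd z (s *\<^sub>R w1 + t *\<^sub>R w2)" by (auto simp: linear_add[OF lr] linear_scale[OF lr])
    moreover have "s *\<^sub>R w1 + t *\<^sub>R w2 \<in> ker_tmap Z X fst z"
      using w subspace_kernel[OF z] by (simp add: subspace_add subspace_scale)
    ultimately show "u \<in> tmap Z Y snd z ` ker_tmap Z X fst z" by blast
  next
    fix u assume "u \<in> tmap Z Y snd z ` ker_tmap Z X fst z"
    then obtain v where v: "v \<in> ker_tmap Z X fst z" "u = tmap Z Y snd z v" by blast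
    obtain s t where "v = s *\<^sub>R w1 + t *\<^sub>R w2" using kernel_span[OF a w v(1)] by blast
    then have "u = s *\<^sub>R tmap Z Y snd z w1 + t *\<^sub>R tmap Z Y snd z w2"
      using v(2) by (simp add: linear_add[OF lr] linear_scale[OF lr])
    then show "u \<in> {s *\<^sub>R tmap Z Y snd z w1 + t *\<^sub>R tmap Z Y snd z w2 | s t. True}" by blast
  qed
  also have "\<dots> = tmap Z Y snd z ` plane_field Z X (tau X) z"
  proof (intro equalityI subsetI)
    fix u assume "u \<in> tmap Z Y snd z ` ker_tmap Z X fst z"
    moreover have "ker_tmap Z X fst z \<subseteq> plane_field Z X (tau X) z"
      using subspace_0[OF subspace_plane] by (auto simp: ker_tmap_def plane_field_def fst_comp_tau)
    ultimately show "u \<in> tmap Z Y snd z ` plane_field Z X (tau X) z" by blast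
  next
    fix u assume "u \<in> tmap Z Y snd z ` plane_field Z X (tau X) z"
    then obtain v where v: "v \<in> tangent_space Z z" "tmap Z X fst z v \<in> plane (snd (tau X z))" "u = tmap Z Y snd z v"
      by (auto simp: plane_field_def fst_comp_tau)
    \<comment> \<open>\<open>rho_kernel\<close> yields a vector \<open>k\<close> of ker \<rho>' with
      the same image under \<lambda>'; subtracting it moves \<open>v\<close> into ker \<lambda>'
      without changing its image under \<rho>'.\<close>
    have "tmap Z X fst z v \<in> tmap Z X fst z ` ker_tmap Z Y snd z"
      using v(2) unfolding bij_betw_imp_surj_on[OF rho_kernel[OF z]] .
    then obtain k where k: "k \<in> ker_tmap Z Y snd z" "tmap Z X fst z v = tmap Z X fst z k" by blast
    then have kT: "k \<in> tangent_space Z z" "tmap Z Y snd z k = 0" by (auto simp: ker_tmap_def)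
    have "v - k \<in> ker_tmap Z X fst z"
      using v(1) kT(1) k(2) subspace_tangent_space[OF mZ z] by (simp add: ker_tmap_def linear_diff[OF ll] subspace_diff)
    moreover have "u = tmap Z Y snd z (v - k)" using v(3) kT(2) by (simp add: linear_diff[OF lr])
    ultimately show "u \<in> tmap Z Y snd z ` ker_tmap Z X fst z" by blast
  qed
  finally show ?thesis .
qed

lemma fst_dual: "fst \<circ> dual_map X E Y Z = snd"
  by (auto simp: dual_map_def)

text \<open>\<Theta> contains ker \<rho>', hence it is the full preimage of its image under \<rho>',
  and by \<open>dual_plane\<close> this image is the dual plane.\<close>

lemma plane_field_dual:
  assumes z: "z \<in> carrier_of Z"
  shows "plane_field Z Y (dual_map X E Y Z) z = plane_field Z X (tau X) z"
proof (intro equalityI subsetI)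
  note lr = linear_tmap[OF mZ mY smooth_rho z] and ll = linear_tmap[OF mZ mX smooth_lambda z]
  fix v assume "v \<in> plane_field Z Y (dual_map X E Y Z) z"
  then have v: "v \<in> tangent_space Z z" "tmap Z Y snd z v \<in> tmap Z Y snd z ` plane_field Z X (tau X) z"
    by (auto simp: plane_field_def fst_dual dual_plane[OF z, unfolded plane_field_def])
  then obtain u where u: "u \<in> plane_field Z X (tau X) z" "tmap Z Y snd z v = tmap Z Y snd z u" by blast
  have uT: "u \<in> tangent_space Z z" "tmap Z X fst z u \<in> plane (snd (tau X z))" using u by (auto simp: plane_field_def fst_comp_tau)
  have "v - u \<in> ker_tmap Z Y snd z"
    using v(1) uT(1) u(2) subspace_tangent_space[OF mZ z] by (simp add: ker_tmap_def linear_diff[OF lr] subspace_diff)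
  then have "tmap Z X fst z (v - u) \<in> plane (snd (tau X z))" using rho_kernel[OF z] by (auto simp: bij_betw_def)
  then have "tmap Z X fst z (v - u) + tmap Z X fst z u \<in> plane (snd (tau X z))"
    using uT(2) subspace_add[OF subspace_plane] by blast
  then have "tmap Z X fst z v \<in> plane (snd (tau X z))" by (simp add: linear_diff[OF ll])
  then show "v \<in> plane_field Z X (tau X) z" using v(1) by (simp add: plane_field_def fst_comp_tau)
next
  fix v assume v: "v \<in> plane_field Z X (tau X) z"
  then show "v \<in> plane_field Z Y (dual_map X E Y Z) z"
    unfolding plane_field_def[of Z Y] fst_dual dual_plane[OF z] using v by (simp add: plane_field_def[of Z X])
qed

lemma E_curves_dual: "E_curves_in Z Y (dual_map X E Y Z) = E_curves_in Z X (tau X)"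
proof -
  have "plane_field Z Y (dual_map X E Y Z) z = plane_field Z X (tau X) z" if "surface_in S Z" "z \<in> carrier_of S" for S z
    using that smooth_map_carrier[of S Z id z] plane_field_dual by (simp add: surface_in_def immersion_def)
  then show ?thesis unfolding E_curves_in_def by blast
qed

end

section \<open>Embedded elliptic bundles from smooth families of graphs\<close>

section \<open>Pseudocomplex structures from families of graphs\<close>

lemma linear_inv:
  assumes f: "linear f" "bij f"
  shows "linear (inv f)"
proof -
  have fi: "inv f (f p) = p" "f (inv f q) = q" for p q using f(2) by (simp_all add: bij_def surj_f_inv_f)
  show ?thesis
  proof (rule linearI)
    fix x y r
    show "inv f (x + y) = inv f x + inv f y" using fi linear_add[OF f(1), of "inv f x" "inv f y"] by metis
    show "inv f (r *\<^sub>R x) = r *\<^sub>R inv f x" using fi linear_scale[OF f(1), of r "inv f x"] by metis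
  qed
qed

text \<open>With one global chart on each side, \<open>T\<close> and \<open>T'\<close> are the
  coordinate forms of \<open>f\<close> and of its inverse.\<close>

lemma global_chart_diffeo:
  assumes c: "valid_chart c" "c \<in> M" "fst c = carrier_of M" and d: "valid_chart d" "d \<in> N" "fst d = carrier_of N"
    and f: "bij_betw f (carrier_of M) (carrier_of N)"
    and T: "\<And>p. p \<in> carrier_of M \<Longrightarrow> snd d (f p) = T (snd c p)" "smooth_on (snd c ` fst c) T"
    and T': "\<And>p. p \<in> carrier_of M \<Longrightarrow> snd c p = T' (snd d (f p))" "smooth_on (snd d ` fst d) T'"
  shows "diffeo M N f"
  unfolding diffeo_def
proof (intro conjI f)
  have "smooth_on (snd c ` fst c) (snd d \<circ> f \<circ> chart_inv c)"
    by (rule smooth_on_cong[OF valid_chart_open[OF c(1)] _ T(2)]) (use T(1) c in \<open>auto simp: chart_inv_left\<close>)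
  moreover have "f ` fst c \<subseteq> fst d" using f c d by (auto simp: bij_betw_def)
  ultimately show "smooth_map M N f"
    unfolding smooth_map_def
    by (intro conjI ballI bexI[of _ c] bexI[of _ d]) (use c d f in \<open>simp_all add: bij_betw_def\<close>)
  let ?g = "inv_into (carrier_of M) f"
  have g: "bij_betw ?g (carrier_of N) (carrier_of M)" by (rule bij_betw_inv_into[OF f])
  have fg: "f (?g q) = q" if "q \<in> carrier_of N" for q using f that by (simp add: bij_betw_def f_inv_into_f)
  have gq: "?g q \<in> carrier_of M" if "q \<in> carrier_of N" for q using g that by (auto simp: bij_betw_def)
  have "smooth_on (snd d ` fst d) (snd c \<circ> ?g \<circ> chart_inv d)"
  proof (rule smooth_on_cong[OF valid_chart_open[OF d(1)] _ T'(2)])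
    fix x assume "x \<in> snd d ` fst d"
    then obtain q where q: "q \<in> carrier_of N" "x = snd d q" using d(3) by blast
    then have "chart_inv d x = q" using chart_inv_left[OF d(1)] d(3) by simp
    then show "T' x = (snd c \<circ> ?g \<circ> chart_inv d) x" using T'(1)[OF gq[OF q(1)]] fg[OF q(1)] q by simp
  qed
  moreover have "?g ` fst d \<subseteq> fst c" using g c d by (auto simp: bij_betw_def)
  ultimately show "smooth_map N M ?g"
    unfolding smooth_map_def
    by (intro conjI ballI bexI[of _ d] bexI[of _ c]) (use c d g in \<open>simp_all add: bij_betw_def\<close>)
qed

lemma submanifold_single_slice:
  assumes sl: "slice_chart N S c W" and S: "S \<subseteq> fst c" and W: "dim W = k"
  shows "submanifold k N S"
  unfolding submanifold_def
proof (intro conjI ballI)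
  have "c \<in> N" using sl by (simp add: slice_chart_def)
  then show "S \<subseteq> carrier_of N" using S unfolding carrier_of_def by blast
  show "\<exists>c W. p \<in> fst c \<and> slice_chart N S c W \<and> dim W = k" if "p \<in> S" for p
    by (rule exI[of _ c], rule exI[of _ W]) (use that sl S W in blast)
qed

text \<open>Straightening a graph: \<open>(y, t) \<mapsto> (y, B (y, t))\<close> extends to a diffeomorphism of open subsets
  of \<open>\<real>\<^sup>4 \<times> \<real>\<^sup>2\<^sup>\<times>\<^sup>2\<close>, where \<open>t\<close> is embedded by the partial derivative \<open>N\<close> of \<open>B\<close>.\<close>
lemma straighten_graph:
  fixes B :: "(real^4) \<times> (real^2) \<Rightarrow> real^2^2"
  assumes Om: "open Om" "(y0, t0) \<in> Om" and sB: "smooth_on Om B"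
    and inj: "inj (\<lambda>u. frechet_derivative B (at (y0, t0)) (0, u))"
  obtains N \<pi> Uy Mo Q g where "linear N" "linear \<pi>" "\<And>t. \<pi> (N t) = t" "open Uy" "open Mo" "y0 \<in> Uy" "N t0 \<in> Mo"
    "\<And>y m. y \<in> Uy \<Longrightarrow> m \<in> Mo \<Longrightarrow> (y, \<pi> m) \<in> Om"
    "smooth_on (Uy \<times> Mo) (\<lambda>(y, m). (y, B (y, \<pi> m) + (m - N (\<pi> m))))" "open Q"
    "(\<lambda>(y, m). (y, B (y, \<pi> m) + (m - N (\<pi> m)))) ` (Uy \<times> Mo) = Q" "smooth_on Q g"
    "\<And>y m. y \<in> Uy \<Longrightarrow> m \<in> Mo \<Longrightarrow> g (y, B (y, \<pi> m) + (m - N (\<pi> m))) = (y, m)"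
proof -
  define DB where "DB = frechet_derivative B (at (y0, t0))"
  define N where "N = (\<lambda>u. DB (0, u))"
  have lDB: "linear DB" unfolding DB_def by (rule smooth_on_linear_derivative[OF sB Om(2)])
  have lN: "linear N" unfolding N_def by (rule linearI) (simp_all flip: linear_add[OF lDB] linear_scale[OF lDB])
  have iN: "inj N" using inj by (simp add: N_def DB_def)
  obtain \<pi> where \<pi>: "linear \<pi>" "\<pi> \<circ> N = id" using linear_injective_left_inverse[OF lN iN] by blast
  have \<pi>N: "\<pi> (N t) = t" for t using \<pi>(2) by (metis comp_apply id_apply)
  \<comment> \<open>On \<open>m = N t\<close> this is \<open>(y, B (y, t))\<close>. The term
    \<open>m - N (\<pi> m)\<close> ranges over the kernel of \<open>\<pi>\<close>, a complement of
    the range of \<open>N\<close>, and supplies the two missing directions.\<close>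
  define F where "F = (\<lambda>(y, m). (y, B (y, \<pi> m) + (m - N (\<pi> m))))"
  have lp: "linear (\<lambda>x :: (real^4) \<times> (real^2^2). (fst x, \<pi> (snd x)))"
    by (rule linearI) (simp_all add: linear_add[OF \<pi>(1)] linear_scale[OF \<pi>(1)])
  define Om2 where "Om2 = (\<lambda>x :: (real^4) \<times> (real^2^2). (fst x, \<pi> (snd x))) -` Om"
  have o2: "open Om2" unfolding Om2_def
    by (rule open_vimage[OF Om(1)]) (use lp in \<open>simp add: linear_continuous_on linear_linear\<close>)
  have lq: "linear (\<lambda>x :: (real^4) \<times> (real^2^2). snd x - N (\<pi> (snd x)))"
    by (rule linearI) (simp_all add: linear_add[OF \<pi>(1)] linear_scale[OF \<pi>(1)] linear_add[OF lN] linear_scale[OF lN] algebra_simps)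
  have F_eq: "F = (\<lambda>x. (fst x, B (fst x, \<pi> (snd x)) + (snd x - N (\<pi> (snd x)))))" by (simp add: F_def case_prod_unfold)
  have sF: "smooth_on Om2 F"
    unfolding F_eq
    by (intro smooth_on_Pair[OF o2] smooth_on_add[OF o2] smooth_on_compose[OF o2 Om(1) _ smooth_on_linear[OF lp] sB]
        smooth_on_linear[OF lq] smooth_on_fst[OF o2] smooth_on_ident) (auto simp: Om2_def)
  have x0: "(y0, N t0) \<in> Om2" using Om by (simp add: Om2_def \<pi>N)
  have "(B has_derivative DB) (at ((\<lambda>x. (fst x, \<pi> (snd x))) (y0, N t0)))"
    unfolding DB_def using smooth_on_has_derivative[OF sB Om(2)] by (simp add: \<pi>N)
  from has_derivative_compose[OF linear_imp_has_derivative[OF lp] this]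
  have "((\<lambda>x. B (fst x, \<pi> (snd x))) has_derivative (\<lambda>h. DB (fst h, \<pi> (snd h)))) (at (y0, N t0))" by simp
  then have "(F has_derivative (\<lambda>h. (fst h, DB (fst h, \<pi> (snd h)) + (snd h - N (\<pi> (snd h)))))) (at (y0, N t0))"
    unfolding F_eq
    by (intro has_derivative_Pair has_derivative_add linear_imp_has_derivative[OF lq] has_derivative_fst[OF has_derivative_ident])
  then have dF: "frechet_derivative F (at (y0, N t0)) = (\<lambda>h. (fst h, DB (fst h, \<pi> (snd h)) + (snd h - N (\<pi> (snd h)))))"
    by (rule frechet_derivative_eq)
  have "inj (frechet_derivative F (at (y0, N t0)))"
    unfolding linear_injective_0[OF smooth_on_linear_derivative[OF sF x0]]
  proof (intro allI impI)
    fix h assume "frechet_derivative F (at (y0, N t0)) h = 0"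
    then have h: "fst h = 0" "DB (fst h, \<pi> (snd h)) + (snd h - N (\<pi> (snd h))) = 0"
      unfolding dF zero_prod_def prod.inject by blast+
    \<comment> \<open>At the base point the two parts of the derivative in \<open>m\<close> add up
      to the identity.\<close>
    have "N (\<pi> (snd h)) + (snd h - N (\<pi> (snd h))) = 0" using h(2) unfolding h(1) N_def .
    then have "snd h = 0" by simp
    then show "h = 0" using h(1) by (simp add: prod_eq_iff)
  qed
  then show thesis
  proof (rule smooth_inverse_function[OF o2 x0 sF])
    fix U' V g
    assume U': "open U'" "U' \<subseteq> Om2" "(y0, N t0) \<in> U'" "open V" "F ` U' = V" "g ` V = U'"
      "\<And>x. x \<in> U' \<Longrightarrow> g (F x) = x" "\<And>y. y \<in> V \<Longrightarrow> F (g y) = y" "smooth_on V g"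
    obtain Uy Mo where box: "open Uy" "open Mo" "y0 \<in> Uy" "N t0 \<in> Mo" "Uy \<times> Mo \<subseteq> U'"
      using open_prod_elim[OF U'(1,3)] by (metis SigmaE2)
    have "F ` (Uy \<times> Mo) = V \<inter> g -` (Uy \<times> Mo)"
    proof (intro equalityI subsetI)
      fix x assume "x \<in> F ` (Uy \<times> Mo)"
      then obtain w where w: "w \<in> Uy \<times> Mo" "x = F w" by blast
      then have "w \<in> U'" using box(5) by blast
      then show "x \<in> V \<inter> g -` (Uy \<times> Mo)" using U'(5,7) w by auto
    next
      fix x assume "x \<in> V \<inter> g -` (Uy \<times> Mo)"
      then show "x \<in> F ` (Uy \<times> Mo)" using U'(8)[of x] by (metis IntE image_eqI vimageE)
    qed
    then have oQ: "open (F ` (Uy \<times> Mo))"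
      using continuous_open_preimage[OF smooth_on_continuous[OF U'(9)] U'(4)] box by (simp add: open_Times)
    have FV: "F ` (Uy \<times> Mo) \<subseteq> V" using U'(5) box(5) by blast
    show thesis
    proof (rule that[OF lN \<pi>(1) \<pi>N box(1-4) _ _ oQ])
      show "(y, \<pi> m) \<in> Om" if "y \<in> Uy" "m \<in> Mo" for y m
      proof -
        have "(y, m) \<in> Om2" using that box(5) U'(2) by blast
        then show ?thesis by (simp add: Om2_def)
      qed
      show "smooth_on (Uy \<times> Mo) (\<lambda>(y, m). (y, B (y, \<pi> m) + (m - N (\<pi> m))))"
        using smooth_on_subset[OF sF, of "Uy \<times> Mo"] box(5) U'(2) by (auto simp: F_def)
      show "(\<lambda>(y, m). (y, B (y, \<pi> m) + (m - N (\<pi> m)))) ` (Uy \<times> Mo) = F ` (Uy \<times> Mo)" by (simp add: F_def)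
      show "smooth_on (F ` (Uy \<times> Mo)) g" by (rule smooth_on_subset[OF U'(9) FV])
      show "g (y, B (y, \<pi> m) + (m - N (\<pi> m))) = (y, m)" if "y \<in> Uy" "m \<in> Mo" for y m
        using U'(7)[of "(y, m)"] that box(5) by (auto simp: F_def)
    qed
  qed
qed

text \<open>The inverse of the straightening map, applied after one bundle chart, is a slice chart
  for the whole image, and with \<open>y\<close> frozen it is one for each fibre. \<open>L\<close>
  identifies R^4 \<times> R^2 with the model space of \<open>total_space\<close>. The last
  conclusion exposes the resulting global chart, in which the dual map will be the identity.\<close>

lemma graph_family_pseudocomplex:
  fixes Y :: "('p, real^4) manifold" and B :: "(real^4) \<times> (real^2) \<Rightarrow> real^2^2" and L :: "(real^4) \<times> (real^2) \<Rightarrow> real^6"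
  assumes Y: "smooth_manifold Y" and d: "d \<in> Y" and a: "frame UNIV a"
    and Om: "open Om" "(y0, t0) \<in> Om" and sB: "smooth_on Om B"
    and dom: "\<And>p. p \<in> Om \<Longrightarrow> fst p \<in> snd d ` fst d"
    and ell: "\<And>p u. p \<in> Om \<Longrightarrow> u \<noteq> 0 \<Longrightarrow> det (frechet_derivative B (at p) (0, u)) \<noteq> 0"
    and L: "linear L" "bij L"
  obtains Uy Bt where "open Uy" "open Bt" "(y0, t0) \<in> Uy \<times> Bt" "Uy \<times> Bt \<subseteq> Om"
    "openin (mtop Y) (chart_inv d ` Uy)"
    "pseudocomplex Y (chart_inv d ` Uy) ((\<lambda>p. graph_param Y d a (fst p, B p)) ` (Uy \<times> Bt))"
    "carrier_of (total_space Y ((\<lambda>p. graph_param Y d a (fst p, B p)) ` (Uy \<times> Bt))) = (\<lambda>p. graph_param Y d a (fst p, B p)) ` (Uy \<times> Bt)"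
    "\<exists>s\<in>total_space Y ((\<lambda>p. graph_param Y d a (fst p, B p)) ` (Uy \<times> Bt)).
       fst s = (\<lambda>p. graph_param Y d a (fst p, B p)) ` (Uy \<times> Bt) \<and> valid_chart s \<and>
       (\<forall>p\<in>Uy \<times> Bt. snd s (graph_param Y d a (fst p, B p)) = L p)"
proof -
  have mY: "mfd Y" by (rule smooth_manifold_mfd[OF Y])
  note mG = mfd_Gr2T[OF mY]
  have vd: "valid_chart d" by (rule atlas_valid[OF mfd_atlas[OF mY] d])
  have lB: "linear (\<lambda>u. frechet_derivative B (at p) (0, u))" if "p \<in> Om" for p
    using smooth_on_linear_derivative[OF sB that]
    by (intro linearI) (simp_all flip: linear_add linear_scale)
  have injB: "inj (\<lambda>u. frechet_derivative B (at (y0, t0)) (0, u))"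
    unfolding linear_injective_0[OF lB[OF Om(2)]]
  proof (intro allI impI)
    fix u assume "frechet_derivative B (at (y0, t0)) (0, u) = 0"
    then show "u = 0" using ell[OF Om(2), of u] by (auto simp: det_2)
  qed
  show thesis
  proof (rule straighten_graph[OF Om sB injB])
  fix N \<pi> Uy Mo Q g
  assume lN: "linear N" and \<pi>: "linear \<pi>" and \<pi>N: "\<And>t. \<pi> (N t) = t" and oUy: "open Uy" and oMo: "open Mo" and y0: "y0 \<in> Uy" and t0: "N t0 \<in> Mo"
    and inOm: "\<And>y m. y \<in> Uy \<Longrightarrow> m \<in> Mo \<Longrightarrow> (y, \<pi> m) \<in> Om"
    and sF: "smooth_on (Uy \<times> Mo) (\<lambda>(y, m). (y, B (y, \<pi> m) + (m - N (\<pi> m))))" and oQ: "open Q"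
    and FQ: "(\<lambda>(y, m). (y, B (y, \<pi> m) + (m - N (\<pi> m)))) ` (Uy \<times> Mo) = Q" and sg: "smooth_on Q g"
    and gF: "\<And>y m. y \<in> Uy \<Longrightarrow> m \<in> Mo \<Longrightarrow> g (y, B (y, \<pi> m) + (m - N (\<pi> m))) = (y, m)"
  define F where "F = (\<lambda>(y, m). (y, B (y, \<pi> m) + (m - N (\<pi> m))))"
  \<comment> \<open>The box meets the range of \<open>N\<close>, where the straightening map
    restricts to the given family, exactly in the points \<open>N t\<close> with \<open>t\<close> in
    this set.\<close>
  define Bt where "Bt = N -` Mo"
  have oBt: "open Bt" unfolding Bt_def using lN by (intro open_vimage oMo) (simp add: linear_continuous_on linear_linear)
  have FN: "F (y, N t) = (y, B (y, t))" for y t by (simp add: F_def \<pi>N)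
  have gF': "g (F x) = x" if "x \<in> Uy \<times> Mo" for x using gF that by (auto simp: F_def)
  have FQ': "F ` (Uy \<times> Mo) = Q" using FQ by (simp add: F_def)
  have sF': "smooth_on (Uy \<times> Mo) F" using sF by (simp add: F_def)
  have gQ: "g ` Q = Uy \<times> Mo" unfolding FQ'[symmetric] image_image using gF' by simp
  have box: "Uy \<times> Bt \<subseteq> Om"
  proof
    fix p assume "p \<in> Uy \<times> Bt"
    then have "(fst p, \<pi> (N (snd p))) \<in> Om" by (intro inOm) (auto simp: Bt_def)
    then show "p \<in> Om" by (simp add: \<pi>N)
  qed
  have t0Bt: "t0 \<in> Bt" using t0 by (simp add: Bt_def)
  have Uyd: "Uy \<subseteq> snd d ` fst d"
  proof
    fix y assume "y \<in> Uy"
    then have "(y, t0) \<in> Om" using box t0Bt by blast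
    then show "y \<in> snd d ` fst d" using dom[of "(y, t0)"] by simp
  qed
  have fstQ: "fst x \<in> Uy" if "x \<in> Q" for x using that unfolding FQ'[symmetric] by (auto simp: F_def)
  have BQ: "(y, B (y, t)) \<in> Q" if "y \<in> Uy" "t \<in> Bt" for y t
    using that FN unfolding FQ'[symmetric] by (metis Bt_def SigmaI image_eqI vimageE)
  have gB: "g (y, B (y, t)) = (y, N t)" if "y \<in> Uy" "t \<in> Bt" for y t
    using gF'[of "(y, N t)"] that by (simp add: FN Bt_def)
  define D where "D = (\<lambda>p. graph_param Y d a (fst p, B p))"
  define S where "S = D ` (Uy \<times> Bt)"
  define gm where "gm = coord_frame Y d a"
  have D: "D (snd d m, t) = (m, graph_plane (gm m) (B (snd d m, t)))" if "m \<in> fst d" for m t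
    using chart_inv_left[OF vd that] by (simp add: D_def graph_param_eq gm_def)
  define U where "U = chart_inv d ` Uy"
  have U_eq: "U = fst d \<inter> snd d -` Uy"
  proof (intro equalityI subsetI)
    fix m assume "m \<in> U"
    then obtain y where y: "y \<in> Uy" "m = chart_inv d y" by (auto simp: U_def)
    then show "m \<in> fst d \<inter> snd d -` Uy" using Uyd chart_inv_mem[of y d] chart_inv_right[of y d] by auto
  next
    fix m assume "m \<in> fst d \<inter> snd d -` Uy"
    then show "m \<in> U" using chart_inv_left[OF vd, of m] unfolding U_def by (metis IntE image_eqI vimageE)
  qed
  have openU: "openin (mtop Y) U" unfolding U_eq by (rule openin_mtop_preimage[OF mfd_atlas[OF mY] d oUy])
  have S_iff: "e \<in> S \<longleftrightarrow> (\<exists>m t. m \<in> U \<and> t \<in> Bt \<and> e = D (snd d m, t))" for e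
  proof
    assume "e \<in> S"
    then obtain y t where y: "y \<in> Uy" "t \<in> Bt" "e = D (y, t)" by (auto simp: S_def)
    then have "y = snd d (chart_inv d y)" using Uyd chart_inv_right[of y d] by auto
    then show "\<exists>m t. m \<in> U \<and> t \<in> Bt \<and> e = D (snd d m, t)" using y unfolding U_def by (metis imageI)
  qed (auto simp: S_def U_eq)
  have cm: "d \<in> charts_at Y m" if "m \<in> U" for m using that d by (simp add: U_eq charts_at_def)
  have mU: "m \<in> fst d" "snd d m \<in> Uy" if "m \<in> U" for m using that by (auto simp: U_eq)
  have frm: "frame (tangent_space Y m) (gm m)" if "m \<in> U" for m
    unfolding gm_def by (rule frame_coord_frame[OF mY cm[OF that] a])
  define C0 where "C0 = graph_bundle_chart Y d a"
  have C0: "C0 \<in> Gr2T Y" unfolding C0_def by (rule graph_bundle_chart_mem[OF mY d a])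
  have C0im: "snd C0 ` fst C0 = snd d ` fst d \<times> UNIV" unfolding C0_def by (rule graph_bundle_image[OF mY d a])
  have C0D: "snd C0 (D (snd d m, t)) = (snd d m, B (snd d m, t))" "D (snd d m, t) \<in> fst C0" if "m \<in> U" for m t
    using graph_bundle_apply[OF mY cm[OF that] a] D[OF mU(1)[OF that]] by (simp_all add: C0_def gm_def)
  define E0 where "E0 = fst C0 \<inter> snd C0 -` Q"
  have C0E: "snd C0 ` E0 = Q"
  proof (intro equalityI subsetI)
    fix x assume x: "x \<in> Q"
    have "fst x \<in> snd d ` fst d" using fstQ[OF x] Uyd by blast
    then have "x \<in> snd C0 ` fst C0" unfolding C0im mem_Times_iff by simp
    then obtain e where "e \<in> fst C0" "x = snd C0 e" by blast
    then show "x \<in> snd C0 ` E0" using x unfolding E0_def by blast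
  qed (auto simp: E0_def)
  \<comment> \<open>In this chart the family is cut out by the linear condition that the second
    coordinate lies in the range of \<open>N\<close>.\<close>
  define sl where "sl = (E0, restrict (g \<circ> snd C0) E0)"
  have sl: "sl \<in> Gr2T Y" unfolding sl_def
  proof (rule new_chart[OF mG C0])
    show "open (g ` snd C0 ` E0)" unfolding C0E gQ using oUy oMo by (simp add: open_Times)
    show "smooth_on (g ` snd C0 ` E0) F" unfolding C0E gQ by (rule sF')
    show "F (g x) = x" if "x \<in> snd C0 ` E0" for x
      using that gF' unfolding C0E FQ'[symmetric] by auto
  qed (use oQ sg C0E in \<open>auto simp: E0_def\<close>)
  have SE: "D (snd d m, t) \<in> E0" "snd sl (D (snd d m, t)) = (snd d m, N t)" if "m \<in> U" "t \<in> Bt" for m t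
    using C0D[OF that(1)] BQ[OF mU(2)[OF that(1)] that(2)] gB[OF mU(2)[OF that(1)] that(2)] by (auto simp: E0_def sl_def)
  have SE0: "S \<subseteq> E0"
  proof
    fix e assume "e \<in> S"
    then obtain m t where "m \<in> U" "t \<in> Bt" "e = D (snd d m, t)" unfolding S_iff by blast
    then show "e \<in> E0" using SE(1) by simp
  qed
  let ?W = "(UNIV :: (real^4) set) \<times> range N"
  have subN: "subspace (range N)" by (rule linear_subspace_image[OF lN subspace_UNIV])
  have dimN: "dim (range N) = 2"
  proof -
    have "inj N" using \<pi>N by (metis injI)
    then show ?thesis using dim_image_eq[OF lN, of UNIV] by simp
  qed
  have slice: "slice_chart (Gr2T Y) S sl ?W"
    unfolding slice_chart_def
  proof (intro conjI sl subspace_Times subspace_UNIV subN)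
    have 1: "snd sl ` fst sl = Uy \<times> Mo" using gQ C0E by (auto simp: sl_def image_comp[symmetric])
    have 2: "fst sl \<inter> S = S" using SE0 by (auto simp: sl_def)
    show "snd sl ` (fst sl \<inter> S) = snd sl ` fst sl \<inter> ?W"
      unfolding 1 2
    proof (intro equalityI subsetI)
      fix x assume "x \<in> snd sl ` S"
      then obtain e where e: "e \<in> S" "x = snd sl e" by blast
      obtain m t where mt: "m \<in> U" "t \<in> Bt" "e = D (snd d m, t)" using e(1) unfolding S_iff by blast
      then have "x = (snd d m, N t)" using SE(2) e(2) by simp
      then show "x \<in> Uy \<times> Mo \<inter> ?W" using mU(2)[OF mt(1)] mt(2) by (simp add: Bt_def)
    next
      fix x assume "x \<in> Uy \<times> Mo \<inter> ?W"
      then obtain y t where x: "x = (y, N t)" "y \<in> Uy" "t \<in> Bt" by (auto simp: Bt_def)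
      then have m: "chart_inv d y \<in> U" "snd d (chart_inv d y) = y" using Uyd chart_inv_right[of y d] by (auto simp: U_def)
      have "D (y, t) \<in> S" using x by (auto simp: S_def)
      moreover have "snd sl (D (y, t)) = x" using SE(2)[OF m(1) x(3)] by (simp add: m x)
      ultimately show "x \<in> snd sl ` S" by blast
    qed
  qed
  have "dim ?W = 6" using dim_Times[OF subspace_UNIV subN, where 'a="real^4"] dimN by simp
  then have sub6: "submanifold DIM(real^6) (Gr2T Y) S"
    by (intro submanifold_single_slice[OF slice]) (use SE0 in \<open>simp_all add: sl_def\<close>)
  have mT: "mfd (total_space Y S)" unfolding total_space_def by (rule mfd_sub_structure[OF mfd_atlas[OF mG]])
  have cT: "carrier_of (total_space Y S) = S" unfolding total_space_def by (rule carrier_sub_structure[OF mfd_atlas[OF mG] sub6])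
  \<comment> \<open>On the slice \<open>\<pi>\<close> undoes \<open>N\<close>, so the induced chart
    reads off the parameters (y, t), up to \<open>L\<close>.\<close>
  define Lc where "Lc = (\<lambda>x :: (real^4) \<times> (real^2^2). L (fst x, \<pi> (snd x)))"
  have lLc: "linear Lc" unfolding Lc_def
    by (rule linearI) (simp_all add: linear_add[OF \<pi>] linear_scale[OF \<pi>] flip: linear_add[OF L(1)] linear_scale[OF L(1)])
  have bLc: "bij_betw Lc ?W UNIV"
  proof (rule bij_betwI')
    fix x y assume "x \<in> ?W" "y \<in> ?W"
    then obtain p q s t where "x = (p, N s)" "y = (q, N t)" by auto
    moreover have "N s = N t \<longleftrightarrow> s = t" using \<pi>N by metis
    ultimately show "(Lc x = Lc y) = (x = y)" using inj_eq[OF bij_is_inj[OF L(2)]] by (simp add: Lc_def \<pi>N)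
  next
    fix w :: "real^6"
    obtain p where "w = L p" using L(2) by (metis bij_pointE)
    then have "w = Lc (fst p, N (snd p))" by (simp add: Lc_def \<pi>N)
    then show "\<exists>x\<in>?W. w = Lc x" by blast
  qed simp
  define s where "s = slice_restr sl S Lc"
  have sT: "s \<in> total_space Y S" unfolding total_space_def s_def by (rule slice_restr_mem[OF mfd_atlas[OF mG] slice lLc bLc])
  have fs: "fst s = S" using SE0 by (auto simp: s_def slice_restr_def sl_def)
  have vs: "valid_chart s" by (rule atlas_valid[OF mfd_atlas[OF mT] sT])
  have sv: "snd s (D (snd d m, t)) = L (snd d m, t)" if "m \<in> U" "t \<in> Bt" for m t
  proof -
    have "D (snd d m, t) \<in> S" using S_iff that by blast
    then show ?thesis using SE(2)[OF that] SE0 by (auto simp: s_def slice_restr_def Lc_def \<pi>N sl_def)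
  qed
  have fib: "fibre_set S m = {graph_plane (gm m) (B (snd d m, t)) | t. t \<in> Bt}" if m: "m \<in> U" for m
  proof (intro equalityI subsetI)
    fix P assume "P \<in> fibre_set S m"
    then obtain m' t where "m' \<in> U" "t \<in> Bt" "(m, P) = D (snd d m', t)" using S_iff by (auto simp: fibre_set_def)
    then show "P \<in> {graph_plane (gm m) (B (snd d m, t)) | t. t \<in> Bt}" using D[OF mU(1)] by auto
  next
    fix P assume "P \<in> {graph_plane (gm m) (B (snd d m, t)) | t. t \<in> Bt}"
    then obtain t where "t \<in> Bt" "P = graph_plane (gm m) (B (snd d m, t))" by blast
    then have "(m, P) = D (snd d m, t)" using D[OF mU(1)[OF m], of t] by simp
    then have "(m, P) \<in> S" unfolding S_iff using m \<open>t \<in> Bt\<close> by blast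
    then show "P \<in> fibre_set S m" by (simp add: fibre_set_def)
  qed
  have fibre: "submanifold DIM(real^2) (Gr2 (tangent_space Y m)) (fibre_set S m) \<and> smooth_manifold (fibre Y S m) \<and>
      carrier_of (fibre Y S m) = fibre_set S m \<and>
      (\<exists>c\<in>fibre Y S m. fst c = fibre_set S m \<and> (\<forall>t\<in>Bt. snd c (graph_plane (gm m) (B (snd d m, t))) = t))"
    if m: "m \<in> U" for m
  proof -
    let ?V = "tangent_space Y m" and ?y = "snd d m"
    note fr = frm[OF m] and y = mU(2)[OF m]
    \<comment> \<open>The fibre over \<open>m\<close> is straightened by the same maps with first
      coordinate frozen at \<open>?y\<close>: \<open>\<phi>\<close> restricts \<open>g\<close> and
      \<open>\<psi>\<close> restricts \<open>F\<close>.\<close>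
    define Qy where "Qy = {A. (?y, A) \<in> Q}"
    have oQy: "open Qy"
      using open_vimage[OF oQ, of "\<lambda>A. (?y, A)"] by (simp add: Qy_def vimage_def continuous_on_Pair)
    define Dm where "Dm = graph_plane (gm m) ` Qy"
    have im: "snd (graph_chart (gm m)) ` Dm = Qy" by (simp add: Dm_def image_image graph_chart_apply[OF fr])
    have sub: "Dm \<subseteq> fst (graph_chart (gm m))" by (auto simp: Dm_def graph_chart_dom)
    define \<phi> where "\<phi> = (\<lambda>A. snd (g (?y, A)))"
    define \<psi> where "\<psi> = (\<lambda>q. snd (F (?y, q)))"
    have key: "\<exists>q\<in>Mo. F (?y, q) = (?y, A) \<and> \<phi> A = q" if "A \<in> Qy" for A
    proof -
      have "(?y, A) \<in> F ` (Uy \<times> Mo)" using that unfolding FQ' Qy_def by simp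
      then obtain x where x: "(?y, A) = F x" "x \<in> Uy \<times> Mo" by (rule imageE)
      obtain q where q: "x = (?y, q)" using x(1) by (cases x) (simp add: F_def)
      then show ?thesis using x gF'[OF x(2)] by (intro bexI[of _ q]) (simp_all add: \<phi>_def)
    qed
    have key2: "\<psi> q \<in> Qy" "\<phi> (\<psi> q) = q" if "q \<in> Mo" for q
    proof -
      have e: "F (?y, q) = (?y, \<psi> q)" by (simp add: F_def \<psi>_def)
      moreover have "F (?y, q) \<in> Q" using that y FQ' by blast
      ultimately show "\<psi> q \<in> Qy" by (simp add: Qy_def)
      show "\<phi> (\<psi> q) = q" using gF'[of "(?y, q)"] that y by (simp add: e \<phi>_def)
    qed
    have \<phi>im: "\<phi> ` Qy = Mo"
    proof (intro equalityI subsetI)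
      fix q assume "q \<in> \<phi> ` Qy" then show "q \<in> Mo" using key by force
    next
      fix q assume "q \<in> Mo" then show "q \<in> \<phi> ` Qy" using key2[of q] by (metis imageI)
    qed
    define slm where "slm = (Dm, restrict (\<phi> \<circ> snd (graph_chart (gm m))) Dm)"
    have slm: "slm \<in> Gr2 ?V" unfolding slm_def
    proof (rule new_chart[OF mfd_Gr2 graph_chart_mem[OF fr] sub])
      show "open (snd (graph_chart (gm m)) ` Dm)" unfolding im by (rule oQy)
      show "smooth_on (snd (graph_chart (gm m)) ` Dm) \<phi>" unfolding im \<phi>_def
        by (intro smooth_on_snd[OF oQy] smooth_on_compose[OF oQy oQ _ smooth_on_Pair[OF oQy smooth_on_const smooth_on_ident] sg]) (auto simp: Qy_def)
      show "open (\<phi> ` snd (graph_chart (gm m)) ` Dm)" unfolding im \<phi>im by (rule oMo)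
      show "smooth_on (\<phi> ` snd (graph_chart (gm m)) ` Dm) \<psi>" unfolding im \<phi>im \<psi>_def
        by (intro smooth_on_snd[OF oMo] smooth_on_compose[OF oMo _ _ smooth_on_Pair[OF oMo smooth_on_const smooth_on_ident] sF'])
          (use y oUy oMo in \<open>auto simp: open_Times\<close>)
      show "\<psi> (\<phi> x) = x" if "x \<in> snd (graph_chart (gm m)) ` Dm" for x
        using key[of x] that unfolding im by (auto simp: \<psi>_def)
    qed
    have Bq: "B (?y, t) \<in> Qy" "\<phi> (B (?y, t)) = N t" if "t \<in> Bt" for t
      using BQ[OF y that] gB[OF y that] by (simp_all add: Qy_def \<phi>_def)
    have slv: "graph_plane (gm m) (B (?y, t)) \<in> Dm" "snd slm (graph_plane (gm m) (B (?y, t))) = N t" if "t \<in> Bt" for t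
      using Bq[OF that] by (auto simp: slm_def Dm_def graph_chart_apply[OF fr])
    have FD: "fibre_set S m \<subseteq> Dm" using slv(1) by (auto simp: fib[OF m])
    have slicem: "slice_chart (Gr2 ?V) (fibre_set S m) slm (range N)"
      unfolding slice_chart_def
    proof (intro conjI slm subN)
      have 1: "snd slm ` fst slm = Mo" using im \<phi>im by (auto simp: slm_def image_comp[symmetric])
      have 2: "fst slm \<inter> fibre_set S m = fibre_set S m" using FD by (auto simp: slm_def)
      show "snd slm ` (fst slm \<inter> fibre_set S m) = snd slm ` fst slm \<inter> range N"
        unfolding 1 2
      proof (intro equalityI subsetI)
        fix x assume "x \<in> snd slm ` fibre_set S m"
        then obtain t where "t \<in> Bt" "x = N t" using slv(2) by (auto simp: fib[OF m])
        then show "x \<in> Mo \<inter> range N" by (auto simp: Bt_def)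
      next
        fix x assume "x \<in> Mo \<inter> range N"
        then obtain t where t: "t \<in> Bt" "x = N t" by (auto simp: Bt_def)
        then have "graph_plane (gm m) (B (?y, t)) \<in> fibre_set S m" by (auto simp: fib[OF m])
        then show "x \<in> snd slm ` fibre_set S m" using slv(2)[OF t(1)] t(2) by (metis imageI)
      qed
    qed
    have sub2: "submanifold DIM(real^2) (Gr2 ?V) (fibre_set S m)"
      by (intro submanifold_single_slice[OF slicem]) (use FD dimN in \<open>simp_all add: slm_def\<close>)
    have b\<pi>: "bij_betw \<pi> (range N) UNIV"
      using \<pi>N by (intro bij_betw_byWitness[where f'=N]) auto
    define c where "c = slice_restr slm (fibre_set S m) \<pi>"
    have c: "c \<in> fibre Y S m" unfolding fibre_def c_def by (rule slice_restr_mem[OF mfd_atlas[OF mfd_Gr2] slicem \<pi> b\<pi>])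
    have fc: "fst c = fibre_set S m" using FD by (auto simp: c_def slice_restr_def slm_def)
    have mF: "mfd (fibre Y S m)" unfolding fibre_def by (rule mfd_sub_structure[OF mfd_atlas[OF mfd_Gr2]])
    have cF: "carrier_of (fibre Y S m) = fibre_set S m" unfolding fibre_def by (rule carrier_sub_structure[OF mfd_atlas[OF mfd_Gr2] sub2])
    have sc: "snd c (graph_plane (gm m) (B (?y, t))) = t" if t: "t \<in> Bt" for t
    proof -
      have "graph_plane (gm m) (B (?y, t)) \<in> fibre_set S m" using t by (auto simp: fib[OF m])
      then show ?thesis using slv[OF t] by (auto simp: c_def slice_restr_def \<pi>N slm_def)
    qed
    show ?thesis
      using sub2 single_chart_smooth_manifold[OF mF c] fc cF c sc by (intro conjI bexI[of _ c]) auto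
  qed
  have elliptic: "elliptic_line_congruence (tangent_space Y m) (fibre Y S m)" if m: "m \<in> U" for m
  proof -
    let ?V = "tangent_space Y m" and ?y = "snd d m" and ?F = "fibre Y S m"
    note fr = frm[OF m] and y = mU(2)[OF m] and fb = fibre[OF m]
    obtain c where c: "c \<in> ?F" "fst c = fibre_set S m" "\<And>t. t \<in> Bt \<Longrightarrow> snd c (graph_plane (gm m) (B (?y, t))) = t" using fb by blast
    have im: "immersion ?F (Gr2 ?V) id" unfolding fibre_def by (rule immersion_sub_incl[OF mfd_Gr2]) (use fb in blast)
    then have iF: "smooth_map ?F (Gr2 ?V) id" by (simp add: immersion_def)
    have mF: "mfd ?F" using fb smooth_manifold_mfd by blast
    have vc: "valid_chart c" by (rule atlas_valid[OF mfd_atlas[OF mF] c(1)])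
    have "quot_rank P (surface_hom ?V ?F P \<zeta>) \<noteq> 1" if P: "P \<in> carrier_of ?F" and \<zeta>: "\<zeta> \<in> tangent_space ?F P" for P \<zeta>
    proof -
      have Pf: "P \<in> fibre_set S m" using P fb by simp
      then obtain t where t: "t \<in> Bt" "P = graph_plane (gm m) (B (?y, t))" by (auto simp: fib[OF m])
      define N' where "N' = tmap ?F (Gr2 ?V) id P \<zeta> (graph_chart (gm m))"
      have pO: "(?y, t) \<in> Om" using box y t by blast
      have cP: "c \<in> charts_at ?F P" using c Pf by (simp add: charts_at_def)
      have gP: "graph_chart (gm m) \<in> charts_at (Gr2 ?V) (id P)" using graph_chart_at[OF fr, of "B (?y, t)" P] t by simp
      have ct: "snd c P = t" using c(3)[OF t(1)] t(2) by simp
      have rep: "(snd (graph_chart (gm m)) \<circ> id \<circ> chart_inv c) t' = B (?y, t')" if "t' \<in> Bt" for t'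
      proof -
        have "graph_plane (gm m) (B (?y, t')) \<in> fst c" using that c(2) by (auto simp: fib[OF m])
        then have "chart_inv c t' = graph_plane (gm m) (B (?y, t'))" using chart_inv_left[OF vc] c(3)[OF that] by metis
        then show ?thesis by (simp add: graph_chart_apply[OF fr])
      qed
      have "((\<lambda>t'. (?y, t')) has_derivative (\<lambda>u. (0, u))) (at t)" by (auto intro!: derivative_eq_intros)
      from has_derivative_compose[OF this smooth_on_has_derivative[OF sB pO]]
      have "((\<lambda>t'. B (?y, t')) has_derivative (\<lambda>u. frechet_derivative B (at (?y, t)) (0, u))) (at t)" .
      then have "(snd (graph_chart (gm m)) \<circ> id \<circ> chart_inv c has_derivative (\<lambda>u. frechet_derivative B (at (?y, t)) (0, u))) (at t)"
        by (rule has_derivative_transform_within_open[OF _ oBt t(1)]) (rule rep[symmetric])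
      \<comment> \<open>The matrix of a tangent vector of the fibre is the partial derivative of
        \<open>B\<close> along \<open>t\<close>, so ellipticity of the fibre is the hypothesis
        \<open>ell\<close>.\<close>
      then have N': "N' = frechet_derivative B (at (?y, t)) (0, \<zeta> c)"
        using tmap_apply[where f=id, OF mF mfd_Gr2 iF \<zeta> cP gP] by (simp add: N'_def ct frechet_derivative_eq)
      have "N' = 0 \<or> det N' \<noteq> 0"
      proof (cases "\<zeta> c = 0")
        case True
        then show ?thesis using linear_0[OF lB[OF pO]] by (simp add: N')
      next
        case False
        then show ?thesis using ell[OF pO] by (simp add: N')
      qed
      moreover have "surface_hom ?V ?F P \<zeta> = frame_hom (shift_frame (gm m) (B (?y, t))) N'"
        unfolding N'_def by (rule surface_hom_frame_hom[OF mF iF P t(2) fr \<zeta>])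
      moreover have "graph_plane (shift_frame (gm m) (B (?y, t))) 0 = P" by (simp add: graph_plane_shift t)
      ultimately show ?thesis using quot_rank_frame_hom[OF frame_shift[OF fr], of "B (?y, t)" N'] by metis
    qed
    then show ?thesis using fb im by (auto simp: elliptic_line_congruence_def surface_in_def)
  qed
  define m0 where "m0 = chart_inv d y0"
  have m0: "m0 \<in> U" using y0 by (auto simp: m0_def U_def)
  have dm0: "snd d m0 = y0" using y0 Uyd chart_inv_right[of y0 d] by (auto simp: m0_def)
  have triv: "trivialized_over (total_space Y S) Y fst U (fibre Y S m0)"
  proof -
    note fb = fibre[OF m0]
    obtain c where c: "c \<in> fibre Y S m0" "fst c = fibre_set S m0" "\<And>t. t \<in> Bt \<Longrightarrow> snd c (graph_plane (gm m0) (B (y0, t))) = t"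
      using fb dm0 by auto
    have mF: "mfd (fibre Y S m0)" using fb smooth_manifold_mfd by blast
    have allS: "{e \<in> carrier_of (total_space Y S). fst e \<in> U} = S"
    proof (intro equalityI subsetI)
      fix e assume e: "e \<in> S"
      then obtain m t where mt: "m \<in> U" "t \<in> Bt" "e = D (snd d m, t)" unfolding S_iff by blast
      then have "fst e \<in> U" using D[OF mU(1)[OF mt(1)], of t] by simp
      then show "e \<in> {e \<in> carrier_of (total_space Y S). fst e \<in> U}" using e cT by simp
    qed (use cT in simp)
    have oS: "openin (mtop (total_space Y S)) S" using openin_chart_dom[OF mfd_atlas[OF mT] sT] fs by simp
    have sS: "s \<in> open_sub (total_space Y S) S" using sT fs by (simp add: open_sub_def)
    have cS: "carrier_of (open_sub (total_space Y S) S) = S" by (rule carrier_open_sub[OF mT oS])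
    note mU' = mfd_open_sub[OF mY openU] and cU = carrier_open_sub[OF mY openU]
    define dU where "dU = (fst d \<inter> U, restrict (snd d) (fst d \<inter> U))"
    have dU: "dU \<in> open_sub Y U" using restrict_chart_openin[OF mY d openU] by (auto simp: dU_def open_sub_def)
    have fdU: "fst dU = U" by (auto simp: dU_def U_eq)
    have vp: "valid_chart (prod_chart dU c)"
      by (rule valid_prod_chart[OF atlas_valid[OF mfd_atlas[OF mU'] dU] atlas_valid[OF mfd_atlas[OF mF] c(1)]])
    have pm: "prod_chart dU c \<in> prod_manifold (open_sub Y U) (fibre Y S m0)"
      by (rule prod_chart_mem[OF mfd_atlas[OF mU'] mfd_atlas[OF mF] dU c(1)])
    have cP: "carrier_of (prod_manifold (open_sub Y U) (fibre Y S m0)) = U \<times> fibre_set S m0"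
      using carrier_prod_manifold[OF mfd_atlas[OF mU'] mfd_atlas[OF mF]] cU fb by simp
    have fp: "fst (prod_chart dU c) = U \<times> fibre_set S m0" using c fdU by (simp add: prod_chart_def)
    \<comment> \<open>Keeps the parameter \<open>t\<close>, read off by
      \<open>inv L (snd s e)\<close>, and moves the plane to the fibre over the fixed point
      \<open>m0\<close>.\<close>
    define \<Psi> where "\<Psi> = (\<lambda>e. (fst e, graph_plane (gm m0) (B (y0, snd (inv L (snd s e))))))"
    have \<Psi>D: "\<Psi> (D (snd d m, t)) = (m, graph_plane (gm m0) (B (y0, t)))" if "m \<in> U" "t \<in> Bt" for m t
      using D[OF mU(1)[OF that(1)], of t] sv[OF that] L(2) by (simp add: \<Psi>_def bij_def inv_f_f)
    have pv: "snd (prod_chart dU c) (\<Psi> (D (snd d m, t))) = (snd d m, t)" if "m \<in> U" "t \<in> Bt" for m t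
    proof -
      have "graph_plane (gm m0) (B (y0, t)) \<in> fibre_set S m0" using that(2) by (auto simp: fib[OF m0] dm0)
      then show ?thesis using that c mU(1) by (simp add: \<Psi>D prod_chart_def fdU) (simp add: dU_def)
    qed
    have bij: "bij_betw \<Psi> S (U \<times> fibre_set S m0)"
    proof (rule bij_betwI')
      fix e e' assume "e \<in> S" "e' \<in> S"
      then obtain m t m' t' where e: "m \<in> U" "t \<in> Bt" "e = D (snd d m, t)" "m' \<in> U" "t' \<in> Bt" "e' = D (snd d m', t')"
        using S_iff by metis
      show "(\<Psi> e = \<Psi> e') = (e = e')"
      proof
        assume "\<Psi> e = \<Psi> e'"
        then have "snd (prod_chart dU c) (\<Psi> e) = snd (prod_chart dU c) (\<Psi> e')" by simp
        then have "(snd d m, t) = (snd d m', t')" unfolding e(3,6) pv[OF e(1,2)] pv[OF e(4,5)] .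
        then show "e = e'" by (simp add: e(3,6))
      qed simp
    next
      fix e assume "e \<in> S"
      then obtain m t where "m \<in> U" "t \<in> Bt" "e = D (snd d m, t)" using S_iff by metis
      then show "\<Psi> e \<in> U \<times> fibre_set S m0" using \<Psi>D by (auto simp: fib[OF m0] dm0)
    next
      fix q assume "q \<in> U \<times> fibre_set S m0"
      then obtain m t where mt: "m \<in> U" "t \<in> Bt" "q = (m, graph_plane (gm m0) (B (y0, t)))" by (auto simp: fib[OF m0] dm0)
      have "D (snd d m, t) \<in> S" unfolding S_iff using mt by blast
      then show "\<exists>e\<in>S. q = \<Psi> e" by (rule bexI[rotated]) (simp add: mt(3) \<Psi>D[OF mt(1,2)])
    qed
    note lL' = linear_inv[OF L]
    \<comment> \<open>Between the global charts \<open>s\<close> and \<open>prod_chart dU c\<close>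
      the map is \<open>inv L\<close>.\<close>
    have "diffeo (open_sub (total_space Y S) S) (prod_manifold (open_sub Y U) (fibre Y S m0)) \<Psi>"
    proof (rule global_chart_diffeo[OF vs sS _ vp pm])
      show "fst s = carrier_of (open_sub (total_space Y S) S)" using fs cS by simp
      show "fst (prod_chart dU c) = carrier_of (prod_manifold (open_sub Y U) (fibre Y S m0))" using fp cP by simp
      show "bij_betw \<Psi> (carrier_of (open_sub (total_space Y S) S)) (carrier_of (prod_manifold (open_sub Y U) (fibre Y S m0)))"
        using bij cS cP by simp
      show "snd (prod_chart dU c) (\<Psi> e) = inv L (snd s e)" if e: "e \<in> carrier_of (open_sub (total_space Y S) S)" for e
      proof -
        obtain m t where "m \<in> U" "t \<in> Bt" "e = D (snd d m, t)" using e S_iff by (metis cS)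
        then show ?thesis using pv sv L(2) by (simp add: bij_def inv_f_f)
      qed
      show "snd s e = L (snd (prod_chart dU c) (\<Psi> e))" if e: "e \<in> carrier_of (open_sub (total_space Y S) S)" for e
      proof -
        obtain m t where "m \<in> U" "t \<in> Bt" "e = D (snd d m, t)" using e S_iff by (metis cS)
        then show ?thesis using pv sv by simp
      qed
    qed (rule smooth_on_linear[OF lL'], rule smooth_on_linear[OF L(1)])
    then show ?thesis
      unfolding trivialized_over_def allS by (intro exI[of _ \<Psi>]) (simp add: \<Psi>_def)
  qed
  have fstS: "fst ` S = U"
  proof (intro equalityI subsetI)
    fix m assume "m \<in> fst ` S"
    then show "m \<in> U" using S_iff D[OF mU(1)] by auto
  next
    fix m assume m: "m \<in> U"
    then have "D (snd d m, t0) \<in> S" using S_iff t0Bt by blast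
    moreover have "fst (D (snd d m, t0)) = m" using D[OF mU(1)[OF m]] by simp
    ultimately show "m \<in> fst ` S" by (metis imageI)
  qed
  have "pseudocomplex Y U S"
    unfolding pseudocomplex_def
  proof (intro conjI ballI Y openU fstS)
    show "submanifold 6 (Gr2T Y) S" using sub6 by simp
    show "\<exists>W. openin (mtop Y) W \<and> m \<in> W \<and> W \<subseteq> U \<and>
        (\<exists>F :: (('p, real^4) tvec oplane, real^2) manifold. smooth_manifold F \<and> trivialized_over (total_space Y S) Y fst W F)" if "m \<in> U" for m
      using that openU triv fibre[OF m0] by (intro exI[of _ U]) blast
    show "submanifold 2 (Gr2 (tangent_space Y m)) (fibre_set S m)" if "m \<in> U" for m using fibre[OF that] by simp
    show "elliptic_line_congruence (tangent_space Y m) (fibre Y S m)" if "m \<in> U" for m by (rule elliptic[OF that])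
  qed
  moreover have "\<forall>p\<in>Uy \<times> Bt. snd s (D p) = L p"
  proof
    fix p assume "p \<in> Uy \<times> Bt"
    then obtain y t where p: "p = (y, t)" "y \<in> Uy" "t \<in> Bt" by auto
    then have "chart_inv d y \<in> U" "snd d (chart_inv d y) = y" using Uyd chart_inv_right[of y d] by (auto simp: U_def)
    then show "snd s (D p) = L p" using sv[of "chart_inv d y" t] p by simp
  qed
  ultimately show thesis
    using that[OF oUy oBt _ box] y0 t0Bt openU cT sT fs vs unfolding U_def[symmetric] S_def D_def by blast
  qed
qed

text \<open>Normal form of a submersion: the coordinates of \<open>f\<close> are completed by two
  linear functions to a local diffeomorphism. \<open>L\<close> reconciles R^4 \<times> R^2 with the
  model space \<open>real^6\<close>.\<close>

lemma submersion_chart: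
  fixes Z :: "('z, real^6) manifold" and Y :: "('p, real^4) manifold"
  assumes Z: "mfd Z" and Y: "mfd Y" and f: "smooth_map Z Y f" and z0: "z0 \<in> carrier_of Z"
    and surj: "tmap Z Y f z0 ` tangent_space Z z0 = tangent_space Y (f z0)"
    and d: "d \<in> charts_at Y (f z0)" and W: "openin (mtop Z) W" "z0 \<in> W"
  obtains k and L :: "(real^4) \<times> (real^2) \<Rightarrow> real^6" where "k \<in> charts_at Z z0" "linear L" "bij L"
    "fst k \<subseteq> W" "f ` fst k \<subseteq> fst d" "\<And>z. z \<in> fst k \<Longrightarrow> snd d (f z) = fst (inv L (snd k z))"
proof -
  obtain k0 where k0: "k0 \<in> charts_at Z z0" using carrier_charts_at[OF z0] by blast
  then have k0Z: "k0 \<in> Z" "z0 \<in> fst k0" by (auto simp: charts_at_def)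
  have dY: "d \<in> Y" "f z0 \<in> fst d" using d by (auto simp: charts_at_def)
  note vk0 = atlas_valid[OF mfd_atlas[OF Z] k0Z(1)]
  define r0 where "r0 = snd d \<circ> f \<circ> chart_inv k0"
  define O1 where "O1 = snd k0 ` (fst k0 \<inter> f -` fst d)"
  define O0 where "O0 = O1 \<inter> snd k0 ` (fst k0 \<inter> W)"
  have "open O1" "smooth_on O1 r0"
    using smooth_map_rep[OF mfd_atlas[OF Z] mfd_atlas[OF Y] f k0Z(1) dY(1)] by (simp_all add: O1_def r0_def)
  moreover have "open (snd k0 ` (fst k0 \<inter> W))" using W(1) k0Z(1) openin_mtop_iff[OF mfd_atlas[OF Z]] by blast
  ultimately have O0: "open O0" "smooth_on O0 r0" by (auto simp: O0_def intro: smooth_on_subset)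
  have O0_eq: "O0 = snd k0 ` (fst k0 \<inter> f -` fst d \<inter> (fst k0 \<inter> W))"
    unfolding O0_def O1_def by (rule chart_image_Int[OF vk0, symmetric]) auto
  have x0: "snd k0 z0 \<in> O0" unfolding O0_eq using k0Z dY W by blast
  define D0 where "D0 = frechet_derivative r0 (at (snd k0 z0))"
  have lD0: "linear D0" unfolding D0_def by (rule smooth_on_linear_derivative[OF O0(2) x0])
  have sD0: "surj D0" using tmap_coords(4)[OF Z Y f k0 d surj] unfolding tmap_coords(5)[OF Z Y f k0 d] D0_def r0_def .
  let ?K = "{w. D0 w = 0}"
  have "dim ?K = DIM(real^2)" using dim_kernel_surj[OF lD0 sD0] by simp
  \<comment> \<open>The two coordinates along the fibre: any linear map that is bijective on the
    kernel of \<open>D0\<close> makes the derivative of \<open>(r0, \<pi>)\<close>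
    invertible.\<close>
  then obtain \<pi> :: "real^6 \<Rightarrow> real^2" where \<pi>: "linear \<pi>" "bij_betw \<pi> ?K UNIV"
    using exists_slice_linear[OF linear_subspace_kernel[OF lD0]] by blast
  have "dim (UNIV :: ((real^4) \<times> (real^2)) set) = DIM(real^6)" by simp
  then obtain L :: "(real^4) \<times> (real^2) \<Rightarrow> real^6" where L: "linear L" "bij L"
    using exists_slice_linear[OF subspace_UNIV] by blast
  have Li: "inv L (L p) = p" for p using L(2) by (simp add: bij_def)
  define \<Phi> where "\<Phi> = (\<lambda>x. L (r0 x, \<pi> x))"
  have s\<Phi>: "smooth_on O0 \<Phi>" unfolding \<Phi>_def
    by (rule smooth_on_linear_compose[OF L(1) O0(1) smooth_on_Pair[OF O0 smooth_on_linear[OF \<pi>(1)]]])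
  have "(\<Phi> has_derivative (\<lambda>h. L (D0 h, \<pi> h))) (at (snd k0 z0))"
    unfolding \<Phi>_def D0_def
    by (rule has_derivative_compose[OF has_derivative_Pair[OF smooth_on_has_derivative[OF O0(2) x0] linear_imp_has_derivative[OF \<pi>(1)]]
          linear_imp_has_derivative[OF L(1)]])
  then have d\<Phi>: "frechet_derivative \<Phi> (at (snd k0 z0)) = (\<lambda>h. L (D0 h, \<pi> h))" by (rule frechet_derivative_eq)
  have "inj (frechet_derivative \<Phi> (at (snd k0 z0)))"
    unfolding linear_injective_0[OF smooth_on_linear_derivative[OF s\<Phi> x0]]
  proof (intro allI impI)
    fix h assume "frechet_derivative \<Phi> (at (snd k0 z0)) h = 0"
    then have "L (D0 h, \<pi> h) = 0" by (simp add: d\<Phi>)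
    then have "L (D0 h, \<pi> h) = L (0, 0)" using linear_0[OF L(1)] by (simp add: zero_prod_def)
    then have h: "D0 h = 0" "\<pi> h = \<pi> 0" using inj_eq[OF bij_is_inj[OF L(2)]] linear_0[OF \<pi>(1)] by simp_all
    have "0 \<in> ?K" using linear_0[OF lD0] by simp
    then show "h = 0" using h \<pi>(2) by (metis (mono_tags) bij_betw_def inj_onD mem_Collect_eq)
  qed
  then show thesis
  proof (rule smooth_inverse_function[OF O0(1) x0 s\<Phi>])
    fix U' V g
    assume U': "open U'" "U' \<subseteq> O0" "snd k0 z0 \<in> U'" "open V" "\<Phi> ` U' = V" "g ` V = U'"
      "\<And>x. x \<in> U' \<Longrightarrow> g (\<Phi> x) = x" "\<And>y. y \<in> V \<Longrightarrow> \<Phi> (g y) = y" "smooth_on V g"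
    define D where "D = fst k0 \<inter> snd k0 -` U'"
    have im: "snd k0 ` D = U'" using U'(2) unfolding D_def O0_eq by blast
    define k where "k = (D, restrict (\<Phi> \<circ> snd k0) D)"
    have kZ: "k \<in> Z" unfolding k_def
    proof (rule new_chart[OF Z k0Z(1)])
      show "D \<subseteq> fst k0" by (auto simp: D_def)
      show "open (snd k0 ` D)" "smooth_on (snd k0 ` D) \<Phi>" "open (\<Phi> ` snd k0 ` D)" "smooth_on (\<Phi> ` snd k0 ` D) g"
        unfolding im U'(5) using U' smooth_on_subset[OF s\<Phi> U'(2)] by auto
      show "g (\<Phi> x) = x" if "x \<in> snd k0 ` D" for x using that U'(7) im by simp
    qed
    have D: "z \<in> W" "f z \<in> fst d" if z: "z \<in> D" for z
    proof -
      have "snd k0 z \<in> O0" "z \<in> fst k0" using z U'(2) by (auto simp: D_def)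
      then obtain z' where z': "z' \<in> fst k0" "f z' \<in> fst d" "z' \<in> W" "snd k0 z = snd k0 z'" unfolding O0_eq by blast
      then have "z = z'" using chart_inj[OF vk0 \<open>z \<in> fst k0\<close>] by blast
      then show "z \<in> W" "f z \<in> fst d" using z' by auto
    qed
    show thesis
    proof (rule that[OF _ L])
      show "k \<in> charts_at Z z0" using kZ k0Z U'(3) by (simp add: charts_at_def k_def D_def)
      show "fst k \<subseteq> W" "f ` fst k \<subseteq> fst d" using D by (auto simp: k_def)
      show "snd d (f z) = fst (inv L (snd k z))" if "z \<in> fst k" for z
      proof -
        have z: "z \<in> D" "z \<in> fst k0" using that by (auto simp: k_def D_def)
        then show ?thesis using chart_inv_left[OF vk0 z(2)] by (simp add: k_def \<Phi>_def Li r0_def)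
      qed
    qed
  qed
qed

section \<open>The dual family in coordinates adapted to \<rho>\<close>

section \<open>The dual structure\<close>

context curve_family
begin

text \<open>The hypotheses of \<open>dual_graph_local\<close> are geometric facts in coordinates:
  \<open>surj\<close> says that \<lambda> is a submersion, \<open>ell\<close> that \<open>E\<close>
  is elliptic, \<open>pl\<close> that \<tau>(z) is tangent to the curve through z,
  \<open>imm\<close> that the curve is immersed.\<close>

lemma local_structure:
  assumes z0: "z0 \<in> carrier_of Z"
  shows "dual_map X E Y Z z0 \<in> carrier_of (Gr2T Y)"
    and "\<exists>W U. openin (mtop Z) W \<and> z0 \<in> W \<and> openin (mtop Y) U \<and>
       pseudocomplex Y U (dual_map X E Y Z ` W) \<and>
       diffeo (open_sub Z W) (total_space Y (dual_map X E Y Z ` W)) (dual_map X E Y Z)"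
proof -
  let ?dual = "dual_map X E Y Z"
  obtain c b where ad0: "adapted c b z0" by (rule adapted_exists[OF z0])
  then have c: "c \<in> X" and b: "frame UNIV b" by (auto simp: adapted_def charts_at_def)
  note aX = mfd_atlas[OF mX] and aY = mfd_atlas[OF mY] and aZ = mfd_atlas[OF mZ]
  have vc: "valid_chart c" by (rule atlas_valid[OF aX c])
  define Gc where "Gc = graph_bundle_chart X c b"
  have Gc: "Gc \<in> Gr2T X" unfolding Gc_def by (rule graph_bundle_chart_mem[OF mX c b])
  obtain d where d: "d \<in> charts_at Y (snd z0)" using carrier_charts_at[OF carrier_Z_Y[OF z0]] by blast
  then have dY: "d \<in> Y" by (simp add: charts_at_def)
  have vd: "valid_chart d" by (rule atlas_valid[OF aY dY])
  \<comment> \<open>Here the planes \<tau>(z) stay graphs in the bundle chart of \<open>c\<close>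
    and \<open>b\<close>, so a single pair is adapted throughout.\<close>
  define W0 where "W0 = {z \<in> carrier_of Z. tau X z \<in> fst Gc}"
  have W0: "openin (mtop Z) W0"
    unfolding W0_def by (rule smooth_map_openin_preimage[OF mZ mG smooth_tau_G openin_chart_dom[OF mfd_atlas[OF mG] Gc]])
  have z0W0: "z0 \<in> W0" using adapted_chart[OF ad0] z0 by (simp add: W0_def Gc_def charts_at_def)
  obtain k and L :: "(real^4) \<times> (real^2) \<Rightarrow> real^6" where k0: "k \<in> charts_at Z z0" and L: "linear L" "bij L"
    and kW0: "fst k \<subseteq> W0" and kd: "snd ` fst k \<subseteq> fst d" and dk: "\<And>z. z \<in> fst k \<Longrightarrow> snd d (snd z) = fst (inv L (snd k z))"
    by (rule submersion_chart[OF mZ mY smooth_rho z0 rho_surj[OF z0] d W0 z0W0]) (rule that)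
  have Li: "inv L (L p) = p" "L (inv L w) = w" for p w using L(2) by (simp_all add: bij_def surj_f_inv_f)
  note lLi = linear_inv[OF L]
  have kZ: "k \<in> Z" using k0 by (simp add: charts_at_def)
  have vk: "valid_chart k" by (rule atlas_valid[OF aZ kZ])
  \<comment> \<open>Parametrizes a neighbourhood in \<open>Z\<close> by (y, t) in such a way that
    \<rho> is the projection to y.\<close>
  define h where "h = (\<lambda>p. chart_inv k (L p))"
  define Om where "Om = L -` (snd k ` fst k)"
  have oOm: "open Om" unfolding Om_def
    using L(1) by (intro open_vimage valid_chart_open[OF vk]) (simp add: linear_continuous_on linear_linear)
  have hk: "h p \<in> fst k" "snd k (h p) = L p" if "p \<in> Om" for p
    using that chart_inv_mem[of "L p" k] chart_inv_right[of "L p" k] by (simp_all add: Om_def h_def)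
  have kh: "h (inv L (snd k z)) = z" "inv L (snd k z) \<in> Om" if "z \<in> fst k" for z
    using that chart_inv_left[OF vk that] by (auto simp: h_def Om_def Li)
  have hat: "k \<in> charts_at Z (h p)" if "p \<in> Om" for p using hk(1)[OF that] kZ by (simp add: charts_at_def)
  have hd: "d \<in> charts_at Y (snd (h p))" "snd d (snd (h p)) = fst p" if "p \<in> Om" for p
    using hk[OF that] kd dY dk[OF hk(1)[OF that]] by (auto simp: charts_at_def Li)
  have ad: "adapted c b z" "z \<in> carrier_of Z" if "z \<in> fst k" for z
  proof -
    have z: "z \<in> carrier_of Z" "tau X z \<in> fst Gc" using that kW0 by (auto simp: W0_def)
    then obtain m A where "tau X z = (m, graph_plane (coord_frame X c b m) A)" "m \<in> fst c"
      unfolding Gc_def graph_bundle_dom[OF vc] by blast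
    then show "adapted c b z" using z(1) c b fst_tau[of z] by (auto simp: adapted_def charts_at_def)
  qed (use that kW0 in \<open>auto simp: W0_def\<close>)
  have lcb: "linear (lc b)" "bij (lc b)" using b linear_lc by (auto simp: frame_iff bij_def)
  have ilc: "inv (lc b) (lc b y) = y" "lc b (inv (lc b) w) = w" for y w using lcb(2) by (simp_all add: bij_def surj_f_inv_f)
  note lilc = linear_inv[OF lcb]
  define cv where "cv = (\<lambda>p w. coord_vec Z k (h p) (L w))"
  define q where "q = (\<lambda>p. snd Gc (tau X (h p)))"
  \<comment> \<open>\<open>inv (lc b)\<close> passes to components in the frame \<open>b\<close>, so
    that the splitting by \<open>proj1\<close> and \<open>proj2\<close> matches the graph matrix
    \<open>A\<close>.\<close>
  define l where "l = (\<lambda>p. inv (lc b) (fst (q p)))"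
  define A where "A = (\<lambda>p. snd (q p))"
  have cvT: "cv p w \<in> tangent_space Z (h p)" if "p \<in> Om" for p w
    unfolding cv_def by (rule coord_vec_tangent[OF mZ hat[OF that]])
  have sk: "smooth_on (snd k ` fst k) (snd Gc \<circ> tau X \<circ> chart_inv k)"
  proof -
    have "fst k \<inter> tau X -` fst Gc = fst k" using kW0 by (auto simp: W0_def)
    then show ?thesis using smooth_map_rep(2)[OF aZ mfd_atlas[OF mG] smooth_tau_G kZ Gc] by simp
  qed
  have q_eq: "q = (\<lambda>p. (snd Gc \<circ> tau X \<circ> chart_inv k) (L p))" by (simp add: q_def h_def)
  have sq: "smooth_on Om q"
    unfolding q_eq by (rule smooth_on_compose[OF oOm valid_chart_open[OF vk] _ smooth_on_linear[OF L(1)] sk]) (auto simp: Om_def)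
  have dq: "(q has_derivative (\<lambda>w. (tmap Z X fst (h p) (cv p w) c, alpha c b (h p) (cv p w)))) (at p)" if p: "p \<in> Om" for p
  proof -
    note a = ad[OF hk(1)[OF p]]
    have "(snd Gc \<circ> tau X \<circ> chart_inv k has_derivative frechet_derivative (snd Gc \<circ> tau X \<circ> chart_inv k) (at (L p))) (at (L p))"
      using smooth_on_has_derivative[OF sk] p by (simp add: Om_def)
    from has_derivative_compose[OF linear_imp_has_derivative[OF L(1)] this]
    have "(q has_derivative (\<lambda>w. frechet_derivative (snd Gc \<circ> tau X \<circ> chart_inv k) (at (L p)) (L w))) (at p)" unfolding q_eq .
    moreover have "frechet_derivative (snd Gc \<circ> tau X \<circ> chart_inv k) (at (L p)) (L w) =
        (tmap Z X fst (h p) (cv p w) c, alpha c b (h p) (cv p w))" for w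
      unfolding tau_G_coords[OF a(1) cvT[OF p], symmetric]
      using tmap_coords(5)[OF mZ mG smooth_tau_G hat[OF p] adapted_chart[OF a(1)]] hk(2)[OF p]
      unfolding cv_def Gc_def by metis
    ultimately show ?thesis by simp
  qed
  have sl: "smooth_on Om l" unfolding l_def by (rule smooth_on_linear_compose[OF lilc oOm smooth_on_fst[OF oOm sq]])
  have sA: "smooth_on Om A" unfolding A_def by (rule smooth_on_snd[OF oOm sq])
  have dl: "frechet_derivative l (at p) = (\<lambda>w. inv (lc b) (tmap Z X fst (h p) (cv p w) c))" if "p \<in> Om" for p
    using has_derivative_compose[OF has_derivative_fst[OF dq[OF that]] linear_imp_has_derivative[OF lilc]]
    by (intro frechet_derivative_eq) (simp add: l_def)
  have dA: "frechet_derivative A (at p) = (\<lambda>w. alpha c b (h p) (cv p w))" if "p \<in> Om" for p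
    using has_derivative_snd[OF dq[OF that]] by (intro frechet_derivative_eq) (simp add: A_def)
  have hc: "c \<in> charts_at X (fst (h p))" if "p \<in> Om" for p using ad(1)[OF hk(1)[OF that]] by (simp add: adapted_def)
  have rep: "frechet_derivative (snd d \<circ> snd \<circ> chart_inv k) (at (L p)) (L w) = fst w" if p: "p \<in> Om" for p w
  proof -
    have lf: "linear (\<lambda>x. fst (inv L x))" using linear_compose[OF lLi linear_fst] by (simp add: o_def)
    have "(snd d \<circ> snd \<circ> chart_inv k has_derivative (\<lambda>x. fst (inv L x))) (at (L p))"
    proof (rule has_derivative_transform_within_open[OF linear_imp_has_derivative[OF lf] valid_chart_open[OF vk]])
      show "L p \<in> snd k ` fst k" using p by (simp add: Om_def)
      show "fst (inv L x) = (snd d \<circ> snd \<circ> chart_inv k) x" if "x \<in> snd k ` fst k" for x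
        using dk[OF chart_inv_mem[OF that]] chart_inv_right[OF that] by simp
    qed
    then show ?thesis by (simp add: frechet_derivative_eq Li)
  qed
  have rho: "tmap Z Y snd (h p) (cv p w) = coord_vec Y d (snd (h p)) (fst w)" if p: "p \<in> Om" for p w
    unfolding cv_def tmap_coord_vec[OF mZ mY smooth_rho hat[OF p] hd(1)[OF p]] hk(2)[OF p] rep[OF p] ..
  have vertical: "cv p (0, u) \<in> ker_tmap Z Y snd (h p)" if p: "p \<in> Om" for p u
    using rho[OF p, of "(0, u)"] cvT[OF p] linear_0[OF linear_coord_vec[OF aY hd(1)[OF p]]] by (simp add: ker_tmap_def)
  have cv0: "cv p w = 0 \<longleftrightarrow> w = 0" if p: "p \<in> Om" for p w
  proof -
    have "cv p w = 0 \<longleftrightarrow> L w = 0"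
      using inj_coord_vec[OF aZ hat[OF p], of "L w" 0] linear_0[OF linear_coord_vec[OF aZ hat[OF p]]] by (simp add: cv_def)
    then show ?thesis using linear_0[OF L(1)] inj_eq[OF bij_is_inj[OF L(2)], of w 0] by simp
  qed
  have ker: "frechet_derivative l (at p) w = 0 \<longleftrightarrow> cv p w \<in> ker_tmap Z X fst (h p)" if p: "p \<in> Om" for p w
  proof -
    have "inv (lc b) x = 0 \<longleftrightarrow> x = 0" for x using ilc linear_0[OF lilc] linear_0[OF lcb(1)] by metis
    then show ?thesis using tmap_coords(2)[OF mZ mX smooth_lambda hat[OF p] hc[OF p], of "L w"]
      by (simp add: dl[OF p] cv_def)
  qed
  have zero: "0 \<in> ker_tmap Z X fst (h p)" "0 \<in> ker_tmap Z Y snd (h p)" if p: "p \<in> Om" for p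
    using ker[OF p, of 0] cv0[OF p, of 0] linear_0[OF smooth_on_linear_derivative[OF sl p]] vertical[OF p, of 0]
    by (simp_all add: zero_prod_def)
  have surj: "surj (frechet_derivative l (at p))" if p: "p \<in> Om" for p
  proof -
    have "surj (\<lambda>w. tmap Z X fst (h p) (coord_vec Z k (h p) w) c)"
      by (rule tmap_coords(4)[OF mZ mX smooth_lambda hat[OF p] hc[OF p] lambda_surj[OF ad(2)[OF hk(1)[OF p]]]])
    then have "surj (inv (lc b) \<circ> (\<lambda>w. tmap Z X fst (h p) (coord_vec Z k (h p) w) c) \<circ> L)"
      using lcb(2) L(2) by (intro comp_surj) (auto simp: bij_is_surj bij_imp_bij_inv)
    then show ?thesis unfolding dl[OF p] by (simp add: cv_def o_def)
  qed
  have ell: "det (frechet_derivative A (at p) w) \<noteq> 0" if p: "p \<in> Om" and w: "frechet_derivative l (at p) w = 0" "w \<noteq> 0" for p w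
  proof -
    note a = ad[OF hk(1)[OF p]]
    have v: "cv p w \<in> ker_tmap Z X fst (h p)" using w ker[OF p] by simp
    have "alpha c b (h p) (cv p w) \<noteq> alpha c b (h p) 0"
      using inj_onD[OF alpha_inj[OF a(1)] _ v zero(1)[OF p]] cv0[OF p] w(2) by blast
    then have "alpha c b (h p) (cv p w) \<noteq> 0" using linear_0[OF linear_alpha[OF a(2)]] by simp
    then show ?thesis using alpha_kernel_definite[OF a(1) imageI[OF v]] by (simp add: dA[OF p])
  qed
  have pl: "proj2 (frechet_derivative l (at p) (0, u)) = proj1 (frechet_derivative l (at p) (0, u)) v* A p" if p: "p \<in> Om" for p u
  proof -
    note a = ad[OF hk(1)[OF p]]
    obtain A' where A': "snd (tau X (h p)) = graph_plane (coord_frame X c b (fst (h p))) A'" using a(1) by (auto simp: adapted_def)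
    then have "tau X (h p) = (fst (h p), graph_plane (coord_frame X c b (fst (h p))) A')" using fst_tau by (metis prod.collapse)
    then have "A p = A'" using graph_bundle_apply(1)[OF mX hc[OF p] b] by (simp add: A_def q_def Gc_def)
    moreover have "tmap Z X fst (h p) (cv p (0, u)) \<in> plane (snd (tau X (h p)))"
      using rho_kernel[OF a(2)] vertical[OF p] by (auto simp: bij_betw_def)
    ultimately obtain y where y: "tmap Z X fst (h p) (cv p (0, u)) = lc (coord_frame X c b (fst (h p))) y" "proj2 y = proj1 y v* A p"
      unfolding A' plane_graph_plane by blast
    then have "tmap Z X fst (h p) (cv p (0, u)) c = lc b y"
      by (simp add: lc_coord_frame[OF aX hc[OF p]] coord_vec_same[OF aX hc[OF p]])
    then show ?thesis using y(2) by (simp add: dl[OF p] ilc)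
  qed
  have imm: "u = 0" if p: "p \<in> Om" and u: "frechet_derivative l (at p) (0, u) = 0" for p u
  proof -
    have "tmap Z X fst (h p) (cv p (0, u)) = tmap Z X fst (h p) 0"
      using u zero(1)[OF p] unfolding ker[OF p] ker_tmap_def by simp
    then have "cv p (0, u) = 0"
      using rho_kernel[OF ad(2)[OF hk(1)[OF p]]] vertical[OF p] zero(2)[OF p] by (simp add: bij_betw_def inj_on_def)
    then show "u = 0" using cv0[OF p] by (simp add: zero_prod_def)
  qed
  define p0 where "p0 = inv L (snd k z0)"
  have z0k: "z0 \<in> fst k" using k0 by (simp add: charts_at_def)
  have p0: "p0 \<in> Om" "h p0 = z0" using kh[OF z0k] by (simp_all add: p0_def)
  obtain O' a B where O': "open O'" "p0 \<in> O'" "O' \<subseteq> Om" and a: "frame UNIV a" and sB: "smooth_on O' B"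
    and B: "\<And>p. p \<in> O' \<Longrightarrow> \<exists>w1 w2. fst w1 = lc a (grow1 (B p)) \<and> fst w2 = lc a (grow2 (B p)) \<and>
       frechet_derivative l (at p) w1 = 0 \<and> frechet_derivative l (at p) w2 = 0 \<and>
       posdet (frechet_derivative A (at p) w1) (frechet_derivative A (at p) w2) > 0"
    and ellB: "\<And>p u. p \<in> O' \<Longrightarrow> u \<noteq> 0 \<Longrightarrow> det (frechet_derivative B (at p) (0, u)) \<noteq> 0"
  proof (rule dual_graph_local[OF oOm p0(1) sl sA])
    show "surj (frechet_derivative l (at p))" if "p \<in> Om" for p by (rule surj[OF that])
    show "det (frechet_derivative A (at p) w) \<noteq> 0" if "p \<in> Om" "frechet_derivative l (at p) w = 0" "w \<noteq> 0" for p w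
      by (rule ell[OF that])
    show "proj2 (frechet_derivative l (at p) (0, u)) = proj1 (frechet_derivative l (at p) (0, u)) v* A p" if "p \<in> Om" for p u
      by (rule pl[OF that])
    show "u = 0" if "p \<in> Om" "frechet_derivative l (at p) (0, u) = 0" for p u by (rule imm[OF that])
  qed (rule that)
  define D where "D = (\<lambda>p. graph_param Y d a (fst p, B p))"
  have Dp: "graph_param Y d a (fst p, B p) = D p" for p by (simp add: D_def)
  have chd: "chart_inv d (fst p) = snd (h p)" if "p \<in> Om" for p
    using chart_inv_left[OF vd, of "snd (h p)"] hd[OF that] by (simp add: charts_at_def)
  \<comment> \<open>\<open>w1\<close> and \<open>w2\<close> represent a positive basis of ker
    \<lambda>', and \<rho>' keeps their first components, which are the graph rows of
    \<open>B p\<close>.\<close>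
  have dual: "?dual (h p) = D p" if p: "p \<in> O'" for p
  proof -
    have pO: "p \<in> Om" using p O' by blast
    obtain w1 w2 where w: "fst w1 = lc a (grow1 (B p))" "fst w2 = lc a (grow2 (B p))"
       "frechet_derivative l (at p) w1 = 0" "frechet_derivative l (at p) w2 = 0"
       "posdet (frechet_derivative A (at p) w1) (frechet_derivative A (at p) w2) > 0" using B[OF p] by blast
    have "?dual (h p) = (snd (h p), oplane (tmap Z Y snd (h p) (cv p w1)) (tmap Z Y snd (h p) (cv p w2)))"
      by (rule dual_map_oplane[OF ad(1)[OF hk(1)[OF pO]]]) (use w in \<open>simp_all add: ker[OF pO] dA[OF pO]\<close>)
    then show ?thesis
      by (simp add: D_def graph_param_eq chd[OF pO] graph_plane_lc lc_coord_frame[OF aY hd(1)[OF pO]] rho[OF pO] w)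
  qed
  show "?dual z0 \<in> carrier_of (Gr2T Y)"
  proof -
    have "?dual z0 \<in> fst (graph_bundle_chart Y d a)"
      using dual[OF O'(2)] graph_bundle_apply(2)[OF mY d a] by (simp add: p0 D_def graph_param_eq chd)
    then show ?thesis using graph_bundle_chart_mem[OF mY dY a] unfolding carrier_of_def by blast
  qed
  obtain y0 t0 where yt: "p0 = (y0, t0)" by (cases p0)
  have dom: "fst p \<in> snd d ` fst d" if "p \<in> O'" for p
  proof -
    have "p \<in> Om" using that O' by blast
    then show ?thesis using hd[of p] by (metis (no_types, lifting) charts_at_def imageI mem_Collect_eq)
  qed
  obtain Uy Bt s where box: "open Uy" "open Bt" "p0 \<in> Uy \<times> Bt" "Uy \<times> Bt \<subseteq> O'"
    and U: "openin (mtop Y) (chart_inv d ` Uy)"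
    and pc: "pseudocomplex Y (chart_inv d ` Uy) (D ` (Uy \<times> Bt))"
    and cT: "carrier_of (total_space Y (D ` (Uy \<times> Bt))) = D ` (Uy \<times> Bt)"
    and s: "s \<in> total_space Y (D ` (Uy \<times> Bt))" "fst s = D ` (Uy \<times> Bt)" "valid_chart s"
      "\<forall>p\<in>Uy \<times> Bt. snd s (D p) = L p"
  proof (rule graph_family_pseudocomplex[OF _ dY a O'(1) O'(2)[unfolded yt] sB dom ellB L])
    show "smooth_manifold Y" using family by (simp add: smooth_family_def)
  next
    fix Uy Bt
    assume *: "open Uy" "open Bt" "(y0, t0) \<in> Uy \<times> Bt" "Uy \<times> Bt \<subseteq> O'" "openin (mtop Y) (chart_inv d ` Uy)"
      "pseudocomplex Y (chart_inv d ` Uy) ((\<lambda>p. graph_param Y d a (fst p, B p)) ` (Uy \<times> Bt))"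
      "carrier_of (total_space Y ((\<lambda>p. graph_param Y d a (fst p, B p)) ` (Uy \<times> Bt))) = (\<lambda>p. graph_param Y d a (fst p, B p)) ` (Uy \<times> Bt)"
      "\<exists>s\<in>total_space Y ((\<lambda>p. graph_param Y d a (fst p, B p)) ` (Uy \<times> Bt)).
         fst s = (\<lambda>p. graph_param Y d a (fst p, B p)) ` (Uy \<times> Bt) \<and> valid_chart s \<and>
         (\<forall>p\<in>Uy \<times> Bt. snd s (graph_param Y d a (fst p, B p)) = L p)"
    obtain s where "s \<in> total_space Y (D ` (Uy \<times> Bt))" "fst s = D ` (Uy \<times> Bt)" "valid_chart s"
      "\<forall>p\<in>Uy \<times> Bt. snd s (D p) = L p" using *(8) unfolding Dp by blast
    with * show thesis unfolding yt[symmetric] Dp by (intro that)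
  qed
  define S where "S = D ` (Uy \<times> Bt)"
  have boxOm: "p \<in> O'" "p \<in> Om" if "p \<in> Uy \<times> Bt" for p using that box(4) O'(3) by auto
  define W where "W = h ` (Uy \<times> Bt)"
  have WS: "?dual ` W = S" unfolding W_def S_def image_image by (rule image_cong[OF refl]) (use boxOm dual in blast)
  have Wk: "W \<subseteq> fst k" using hk boxOm by (auto simp: W_def)
  have W_eq: "W = fst k \<inter> snd k -` (inv L -` (Uy \<times> Bt))"
  proof (intro equalityI subsetI)
    fix z assume "z \<in> W"
    then obtain p where "p \<in> Uy \<times> Bt" "z = h p" by (auto simp: W_def)
    then show "z \<in> fst k \<inter> snd k -` (inv L -` (Uy \<times> Bt))" using hk[OF boxOm(2)] by (simp add: Li)
  next
    fix z assume "z \<in> fst k \<inter> snd k -` (inv L -` (Uy \<times> Bt))"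
    then have "z = h (inv L (snd k z))" "inv L (snd k z) \<in> Uy \<times> Bt" using kh by auto
    then show "z \<in> W" unfolding W_def by (rule image_eqI)
  qed
  have oW: "openin (mtop Z) W"
    unfolding W_eq
    by (intro openin_mtop_preimage[OF aZ kZ] open_vimage)
      (use box lLi in \<open>simp_all add: open_Times linear_continuous_on linear_linear\<close>)
  have z0W: "z0 \<in> W" using box(3) p0(2) unfolding W_def by blast
  \<comment> \<open>The chart \<open>s\<close> of the dual structure and the chart \<open>k\<close>
    of \<open>Z\<close> both read the parameter p as \<open>L p\<close>, so the dual map is the
    identity in coordinates.\<close>
  have sd: "snd s (?dual z) = snd k z" if "z \<in> W" for z
  proof -
    from that obtain p where p: "z = h p" "p \<in> Uy \<times> Bt" unfolding W_def by (rule imageE)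
    then show ?thesis using bspec[OF s(4) p(2)] hk(2)[OF boxOm(2)[OF p(2)]] dual[OF boxOm(1)[OF p(2)]] by simp
  qed
  define kW where "kW = (fst k \<inter> W, restrict (snd k) (fst k \<inter> W))"
  have kWZ: "kW \<in> Z" unfolding kW_def by (rule restrict_chart_openin[OF mZ kZ oW])
  have fkW: "fst kW = W" using Wk by (auto simp: kW_def)
  have skW: "snd kW z = snd k z" if "z \<in> W" for z using that Wk by (auto simp: kW_def)
  have cW: "carrier_of (open_sub Z W) = W" by (rule carrier_open_sub[OF mZ oW])
  have diff: "diffeo (open_sub Z W) (total_space Y S) ?dual"
  proof (rule global_chart_diffeo[where c=kW and d=s and T="\<lambda>x. x" and T'="\<lambda>x. x"])
    show "valid_chart kW" by (rule atlas_valid[OF aZ kWZ])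
    show "kW \<in> open_sub Z W" using kWZ fkW by (simp add: open_sub_def)
    show "bij_betw ?dual (carrier_of (open_sub Z W)) (carrier_of (total_space Y S))"
      unfolding cW cT[folded S_def] bij_betw_def
    proof (intro conjI inj_onI WS)
      fix z z' assume z: "z \<in> W" "z' \<in> W" "?dual z = ?dual z'"
      then have "snd k z = snd k z'" using sd by metis
      then show "z = z'" using chart_inj[OF vk] z Wk by blast
    qed
  qed (use s cT fkW cW sd skW in \<open>simp_all add: S_def smooth_on_ident\<close>)
  show "\<exists>W U. openin (mtop Z) W \<and> z0 \<in> W \<and> openin (mtop Y) U \<and>
       pseudocomplex Y U (?dual ` W) \<and> diffeo (open_sub Z W) (total_space Y (?dual ` W)) ?dual"
    using oW z0W U pc diff unfolding WS[symmetric] S_def[symmetric] by blast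
qed

end

text \<open>The first conjunct ties \<open>dual_map\<close>, which is assembled from positive bases
  of ker \<lambda>', to the planes \<rho>'\<Theta>; the other two are the pseudocomplex property and
  the equality of curves.\<close>

theorem mainTheorem1:
  fixes X :: "('x, real^4) manifold"
    and E :: "('x \<times> ('x, real^4) tvec oplane) set"
    and Y :: "('x osurface, real^4) manifold"
    and Z :: "('x \<times> 'x osurface, real^6) manifold"
  assumes "smooth_manifold X"
    and "pseudocomplex X (carrier_of X) E"
    and "smooth_family X E Y Z"
    and "local_diffeo Z (total_space X E) (tau X)"
  shows "(\<forall>z\<in>carrier_of Z.
            dual_map X E Y Z z \<in> carrier_of (Gr2T Y) \<and>
            plane (snd (dual_map X E Y Z z)) = tmap Z Y snd z ` plane_field Z X (tau X) z)
       \<and> (\<forall>z\<in>carrier_of Z. \<exists>W U. openin (mtop Z) W \<and> z \<in> W \<and> openin (mtop Y) U \<and>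
            pseudocomplex Y U (dual_map X E Y Z ` W) \<and>
            diffeo (open_sub Z W) (total_space Y (dual_map X E Y Z ` W)) (dual_map X E Y Z))
       \<and> E_curves_in Z Y (dual_map X E Y Z) = E_curves_in Z X (tau X)"
proof -
  interpret curve_family X E Y Z using assms by unfold_locales
  show ?thesis using local_structure dual_plane E_curves_dual by blast
qed

end
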